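(* Let $N\ge 1$, let $0<m<1$ and $a\in\mathbb{C}$ satisfy $2\sqrt m\,\mathrm{Im}(a)\ge(1-m)|\mathrm{Re}(a)|$ and, if $\mathrm{Re}(a)\ge0$, assume further that $2\sqrt m\,\mathrm{Im}(a)>(1-m)\mathrm{Re}(a)$. Let $f\in L^1_{\mathrm{loc}}\big([0,\infty);L^2(\mathbb{R}^N)\big)$, let $u_0\in L^2(\mathbb{R}^N)$ and let $u$ be the unique weak solution of $$\mathrm{i}u_t+\Delta u+a|u|^{-(1-m)}u=f \ \text{ in } (0,\infty)\times\mathbb{R}^N,\qquad u(0)=u_0 .$$ If $f\in L^1\big((0,\infty);L^2(\mathbb{R}^N)\big)$, then $$\lim_{t\nearrow\infty}\|u(t)\|_{L^2(\mathbb{R}^N)}=0.$$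
   Context: All functions are complex-valued. For a Banach space $X$ and $1\le p\le\infty$, $u\in L^p_{\mathrm{loc}}([0,\infty);X)$ means $u_{|(0,T)}\in L^p((0,T);X)$ for every $T>0$; similarly for $W^{1,p}_{\mathrm{loc}}([0,\infty);X)$. The expression $|z|^{-(1-m)}z$ is taken to be $0$ at $z=0$. $H^2$-solution: given $f\in L^1_{\mathrm{loc}}([0,\infty);L^2(\mathbb{R}^N))$, $u$ is an $H^2$-solution of $\mathrm{i}u_t+\Delta u+a|u|^{-(1-m)}u=f$, $u(0)=u_0$, if (1) $u\in L^{m+1}_{\mathrm{loc}}\big([0,\infty);H^1(\mathbb{R}^N)\cap L^{m+1}(\mathbb{R}^N)\big)\cap W^{1,\frac{m+1}{m}}_{\mathrm{loc}}\big([0,\infty);L^2(\mathbb{R}^N)+L^{\frac{m+1}{m}}(\mathbb{R}^N)\big)$ (this space embeds into $C([0,\infty);L^2(\mathbb{R}^N))$); (2) $\Delta u(t)\in L^2(\mathbb{R}^N)$ for almost every $t>0$; (3) $u$ satisfies the equation in $\mathscr{D}'\big((0,\infty)\times\mathbb{R}^N\big)$; (4) $u(0)=u_0$. Weak solution: $u$ is a weak solution of the problem with data $(f,u_0)$ if there exists $(f_n,u_n)_{n\in\mathbb{N}}\subset L^1_{\mathrm{loc}}([0,\infty);L^2(\mathbb{R}^N))\times C([0,\infty);L^2(\mathbb{R}^N))$ such that for every $n$, $u_n$ is an $H^2$-solution of the equation with right-hand side $f_n$ instead of $f$ (with its own initial value $u_n(0)$), such that for every $T>0$, $f_n\to f$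 in $L^1((0,T);L^2(\mathbb{R}^N))$ and $u_n\to u$ in $C([0,T];L^2(\mathbb{R}^N))$, and such that $u(0)=u_0$. Under the hypotheses of the theorem on $m$ and $a$, for every $f\in L^1_{\mathrm{loc}}([0,\infty);L^2(\mathbb{R}^N))$ and $u_0\in L^2(\mathbb{R}^N)$ there exists a unique weak solution. *)

theory Defs
  imports "HOL-Analysis.Analysis"
begin

text \<open>
  Elements of function spaces over a Euclidean space are represented by functions, not by
  almost-everywhere classes; all notions below are invariant under modification on null sets.
  A function space is a record of its carrier and its (semi)norm. The value of the norm outside
  the carrier is irrelevant.
\<close>

record 'a fspace =
  elems :: "('a \<Rightarrow> complex) set"
  nrm :: "('a \<Rightarrow> complex) \<Rightarrow> real"


subsection \<open>Test functions\<close>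

definition dir_deriv :: "('a::real_normed_vector \<Rightarrow> complex) \<Rightarrow> 'a \<Rightarrow> 'a \<Rightarrow> complex" where
  "dir_deriv \<phi> v = (\<lambda>x. frechet_derivative \<phi> (at x) v)"

primrec Ck :: "nat \<Rightarrow> ('a::euclidean_space \<Rightarrow> complex) \<Rightarrow> bool" where
  "Ck 0 \<phi> \<longleftrightarrow> continuous_on UNIV \<phi>"
| "Ck (Suc k) \<phi> \<longleftrightarrow> (\<forall>x. \<phi> differentiable (at x)) \<and> (\<forall>v. Ck k (dir_deriv \<phi> v))"

text \<open>\<open>C\<^sub>c\<^sup>\<infinity>(\<Omega>)\<close>; its elements are regarded as functions on the whole space, extended by \<open>0\<close>.\<close>

definition test_fun :: "'a::euclidean_space set \<Rightarrow> ('a \<Rightarrow> complex) set" where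
  "test_fun \<Omega> = {\<phi>. (\<forall>k. Ck k \<phi>) \<and> compact (closure {x. \<phi> x \<noteq> 0}) \<and> closure {x. \<phi> x \<noteq> 0} \<subseteq> \<Omega>}"


subsection \<open>Function spaces over \<open>\<real>\<^sup>N\<close>\<close>

definition Lp :: "real \<Rightarrow> 'a::euclidean_space fspace" where
  "Lp p = \<lparr> elems = {g \<in> borel_measurable lebesgue. integrable lebesgue (\<lambda>x. cmod (g x) powr p)},
           nrm = (\<lambda>g. (\<integral>x. cmod (g x) powr p \<partial>lebesgue) powr (1 / p)) \<rparr>"

abbreviation L2 :: "'a::euclidean_space fspace" where
  "L2 \<equiv> Lp 2"

text \<open>\<open>h = \<partial>\<^sub>v g\<close> in the sense of distributions, with \<open>h \<in> L\<^sup>2\<close>.\<close>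

definition weak_deriv_L2 ::
  "('a::euclidean_space \<Rightarrow> complex) \<Rightarrow> 'a \<Rightarrow> ('a \<Rightarrow> complex) \<Rightarrow> bool" where
  "weak_deriv_L2 g v h \<longleftrightarrow> h \<in> elems L2 \<and>
     (\<forall>\<psi> \<in> test_fun UNIV.
        (\<integral>x. g x * dir_deriv \<psi> v x \<partial>lebesgue) = - (\<integral>x. h x * \<psi> x \<partial>lebesgue))"

definition H1 :: "'a::euclidean_space fspace" where
  "H1 = \<lparr> elems = {g \<in> elems L2. \<forall>i\<in>Basis. \<exists>h. weak_deriv_L2 g i h},
         nrm = (\<lambda>g. sqrt ((nrm L2 g)\<^sup>2 + (\<Sum>i\<in>Basis. (nrm L2 (SOME h. weak_deriv_L2 g i h))\<^sup>2))) \<rparr>"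

definition inter_space :: "'a fspace \<Rightarrow> 'a fspace \<Rightarrow> 'a fspace" where
  "inter_space X Y = \<lparr> elems = elems X \<inter> elems Y, nrm = (\<lambda>g. nrm X g + nrm Y g) \<rparr>"

definition sum_space :: "'a fspace \<Rightarrow> 'a fspace \<Rightarrow> 'a::euclidean_space fspace" where
  "sum_space X Y =
    \<lparr> elems = {g. \<exists>g1\<in>elems X. \<exists>g2\<in>elems Y. AE x in lebesgue. g x = g1 x + g2 x},
      nrm = (\<lambda>g. Inf {nrm X g1 + nrm Y g2 | g1 g2.
                      g1 \<in> elems X \<and> g2 \<in> elems Y \<and> (AE x in lebesgue. g x = g1 x + g2 x)}) \<rparr>"

definition laplacian :: "('a::euclidean_space \<Rightarrow> complex) \<Rightarrow> 'a \<Rightarrow> complex" where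
  "laplacian \<psi> = (\<lambda>x. \<Sum>i\<in>Basis. dir_deriv (dir_deriv \<psi> i) i x)"

text \<open>The distribution \<open>\<Delta>g\<close> belongs to \<open>L\<^sup>2\<close>.\<close>

definition laplacian_in_L2 :: "('a::euclidean_space \<Rightarrow> complex) \<Rightarrow> bool" where
  "laplacian_in_L2 g \<longleftrightarrow>
     (\<exists>h \<in> elems L2. \<forall>\<psi> \<in> test_fun UNIV.
        (\<integral>x. g x * laplacian \<psi> x \<partial>lebesgue) = (\<integral>x. h x * \<psi> x \<partial>lebesgue))"


subsection \<open>Functions of time with values in a function space\<close>

text \<open>
  Bochner's notions are spelled out because the spaces above are not types. \<open>I\<close> is a time interval
  with Lebesgue measure.
\<close>

definition strongly_measurable_on ::
  "real set \<Rightarrow> 'a fspace \<Rightarrow> (real \<Rightarrow> 'a \<Rightarrow> complex) \<Rightarrow> bool" where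
  "strongly_measurable_on I X w \<longleftrightarrow>
     (\<exists>s. (\<forall>n. simple_function (lebesgue_on I) (s n) \<and> s n ` I \<subseteq> elems X) \<and>
          (AE t in lebesgue_on I. w t \<in> elems X \<and>
             (\<lambda>n. nrm X (\<lambda>x. s n t x - w t x)) \<longlonglongrightarrow> 0))"

definition bochner_Lp ::
  "real \<Rightarrow> real set \<Rightarrow> 'a fspace \<Rightarrow> (real \<Rightarrow> 'a \<Rightarrow> complex) set" where
  "bochner_Lp p I X =
     {w. strongly_measurable_on I X w \<and> integrable (lebesgue_on I) (\<lambda>t. nrm X (w t) powr p)}"

definition bochner_Lp_loc ::
  "real \<Rightarrow> 'a fspace \<Rightarrow> (real \<Rightarrow> 'a \<Rightarrow> complex) set" where
  "bochner_Lp_loc p X = {w. \<forall>T>0. w \<in> bochner_Lp p {0<..<T} X}"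

definition simple_integral_on ::
  "real set \<Rightarrow> (real \<Rightarrow> 'a \<Rightarrow> complex) \<Rightarrow> 'a \<Rightarrow> complex" where
  "simple_integral_on I s =
     (\<lambda>x. \<Sum>c \<in> s ` I. of_real (measure lebesgue {t \<in> I. s t = c}) * c x)"

text \<open>\<open>J\<close> is the Bochner integral of \<open>w\<close> over \<open>I\<close>, in the space \<open>X\<close>.\<close>

definition has_bochner_integral_on ::
  "real set \<Rightarrow> 'a fspace \<Rightarrow> (real \<Rightarrow> 'a \<Rightarrow> complex) \<Rightarrow> ('a \<Rightarrow> complex) \<Rightarrow> bool" where
  "has_bochner_integral_on I X w J \<longleftrightarrow>
     strongly_measurable_on I X w \<and> J \<in> elems X \<and>
     (\<exists>s. (\<forall>n. simple_function (lebesgue_on I) (s n) \<and> s n ` I \<subseteq> elems X \<and>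
               emeasure lebesgue {t \<in> I. s n t \<noteq> (\<lambda>x. 0)} < \<infinity>) \<and>
          (\<lambda>n. \<integral>\<^sup>+t. ennreal (nrm X (\<lambda>x. s n t x - w t x)) \<partial>lebesgue_on I) \<longlonglongrightarrow> 0 \<and>
          (\<lambda>n. nrm X (\<lambda>x. simple_integral_on I (s n) x - J x)) \<longlonglongrightarrow> 0)"

text \<open>\<open>w' = v\<close> in \<open>\<D>'(I; X)\<close>: \<open>\<integral> \<phi>' w = - \<integral> \<phi> v\<close> in \<open>X\<close> for all scalar test functions \<open>\<phi>\<close>.\<close>

definition vector_weak_deriv ::
  "real set \<Rightarrow> 'a fspace \<Rightarrow> (real \<Rightarrow> 'a \<Rightarrow> complex) \<Rightarrow> (real \<Rightarrow> 'a \<Rightarrow> complex) \<Rightarrow> bool" where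
  "vector_weak_deriv I X w v \<longleftrightarrow>
     (\<forall>\<phi> \<in> test_fun I. \<exists>J.
        has_bochner_integral_on I X (\<lambda>t x. dir_deriv \<phi> 1 t * w t x) J \<and>
        has_bochner_integral_on I X (\<lambda>t x. \<phi> t * v t x) (\<lambda>x. - J x))"

definition bochner_W1p ::
  "real \<Rightarrow> real set \<Rightarrow> 'a fspace \<Rightarrow> (real \<Rightarrow> 'a \<Rightarrow> complex) set" where
  "bochner_W1p p I X =
     {w \<in> bochner_Lp p I X. \<exists>v \<in> bochner_Lp p I X. vector_weak_deriv I X w v}"

definition bochner_W1p_loc ::
  "real \<Rightarrow> 'a fspace \<Rightarrow> (real \<Rightarrow> 'a \<Rightarrow> complex) set" where
  "bochner_W1p_loc p X = {w. \<forall>T>0. w \<in> bochner_W1p p {0<..<T} X}"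

text \<open>\<open>C([0,\<infinity>); X)\<close>\<close>

definition cont_space :: "'a fspace \<Rightarrow> (real \<Rightarrow> 'a \<Rightarrow> complex) set" where
  "cont_space X =
     {w. \<forall>t\<ge>0. w t \<in> elems X \<and>
          ((\<lambda>s. nrm X (\<lambda>x. w s x - w t x)) \<longlongrightarrow> 0) (at t within {0..})}"


subsection \<open>The equation\<close>

definition nonlin :: "real \<Rightarrow> complex \<Rightarrow> complex" where
  "nonlin m z = (if z = 0 then 0 else of_real (cmod z powr (- (1 - m))) * z)"

text \<open>
  The distribution on \<open>(0,\<infinity>) \<times> \<real>\<^sup>N\<close> defined by \<open>w\<close>. The integral is iterated since a strongly
  measurable \<open>w\<close> need not be jointly measurable when each \<open>w t\<close> is an arbitrary representative of
  its class; the iterated integral does not depend on these choices.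
\<close>

definition dist_pairing ::
  "(real \<Rightarrow> 'a::euclidean_space \<Rightarrow> complex) \<Rightarrow> (real \<times> 'a \<Rightarrow> complex) \<Rightarrow> complex" where
  "dist_pairing w \<phi> = (\<integral>t. (\<integral>x. w t x * \<phi> (t, x) \<partial>lebesgue) \<partial>lebesgue_on {0<..})"

definition time_deriv ::
  "(real \<times> 'a::euclidean_space \<Rightarrow> complex) \<Rightarrow> real \<times> 'a \<Rightarrow> complex" where
  "time_deriv \<phi> = dir_deriv \<phi> (1, 0)"

definition space_laplacian ::
  "(real \<times> 'a::euclidean_space \<Rightarrow> complex) \<Rightarrow> real \<times> 'a \<Rightarrow> complex" where
  "space_laplacian \<phi> = (\<lambda>z. \<Sum>i\<in>Basis. dir_deriv (dir_deriv \<phi> (0, i)) (0, i) z)"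

definition solves_in_distributions ::
  "complex \<Rightarrow> real \<Rightarrow> (real \<Rightarrow> 'a::euclidean_space \<Rightarrow> complex) \<Rightarrow>
   (real \<Rightarrow> 'a \<Rightarrow> complex) \<Rightarrow> bool" where
  "solves_in_distributions a m f u \<longleftrightarrow>
     (\<forall>\<phi> \<in> test_fun ({0<..} \<times> UNIV).
        - \<i> * dist_pairing u (time_deriv \<phi>) + dist_pairing u (space_laplacian \<phi>)
          + a * dist_pairing (\<lambda>t x. nonlin m (u t x)) \<phi>
        = dist_pairing f \<phi>)"

text \<open>
  The initial condition refers to the representative of \<open>u\<close> in \<open>C([0,\<infinity>); L\<^sup>2)\<close>.
\<close>

definition H2_solution ::
  "complex \<Rightarrow> real \<Rightarrow> (real \<Rightarrow> 'a::euclidean_space \<Rightarrow> complex) \<Rightarrow> ('a \<Rightarrow> complex) \<Rightarrow>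
   (real \<Rightarrow> 'a \<Rightarrow> complex) \<Rightarrow> bool" where
  "H2_solution a m f u0 u \<longleftrightarrow>
     u \<in> bochner_Lp_loc (m + 1) (inter_space H1 (Lp (m + 1))) \<and>
     u \<in> bochner_W1p_loc ((m + 1) / m) (sum_space L2 (Lp ((m + 1) / m))) \<and>
     (AE t in lebesgue_on {0<..}. laplacian_in_L2 (u t)) \<and>
     solves_in_distributions a m f u \<and>
     (\<exists>w \<in> cont_space L2.
        (AE t in lebesgue_on {0<..}. AE x in lebesgue. w t x = u t x) \<and>
        (AE x in lebesgue. w 0 x = u0 x))"

definition weak_solution ::
  "complex \<Rightarrow> real \<Rightarrow> (real \<Rightarrow> 'a::euclidean_space \<Rightarrow> complex) \<Rightarrow> ('a \<Rightarrow> complex) \<Rightarrow>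
   (real \<Rightarrow> 'a \<Rightarrow> complex) \<Rightarrow> bool" where
  "weak_solution a m f u0 u \<longleftrightarrow>
     u \<in> cont_space L2 \<and>
     (\<exists>fs us.
        (\<forall>n. fs n \<in> bochner_Lp_loc 1 L2 \<and> us n \<in> cont_space L2 \<and>
             H2_solution a m (fs n) (us n 0) (us n)) \<and>
        (\<forall>T>0.
           (\<lambda>n. \<integral>t. nrm L2 (\<lambda>x. fs n t x - f t x) \<partial>lebesgue_on {0<..<T}) \<longlonglongrightarrow> 0 \<and>
           uniform_limit {0..T} (\<lambda>n t. nrm L2 (\<lambda>x. us n t x - u t x)) (\<lambda>t. 0) sequentially)) \<and>
     (AE x in lebesgue. u 0 x = u0 x)"

end

theory Submission
  imports Defs
begin

text \<open>
  The nonlinearity is dissipative under the condition on \<open>a\<close>, so the difference of two solutions has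
  essentially nonincreasing \<open>L\<^sup>2\<close> norm. Compared with the zero solution this bounds
  \<open>\<integral>\<integral> |u|\<^bsup>m+1\<^esup>\<close>; hence \<open>u\<close> is small in \<open>L\<^bsup>m+1\<^esup>\<close> at some arbitrarily late times. Compared with its own
  translates in space it shows that the family \<open>u(t)\<close>, \<open>t \<ge> 1\<close>, is equicontinuous in \<open>L\<^sup>2\<close>, uniformly
  in time. A function that is equicontinuous in \<open>L\<^sup>2\<close> and small in \<open>L\<^bsup>m+1\<^esup>\<close> is small in \<open>L\<^sup>2\<close>, and
  since \<open>f\<close> is integrable in time the norm stays small afterwards. Neither existence theory nor
  \<open>H\<^sup>1\<close> bounds enter. The energy identity behind the contraction comes from convolving the
  equation in space with a smooth even kernel: for every point this gives an absolutely continuous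
  function of time, and the Laplacian contributes nothing to the integral of its squared modulus.
\<close>

subsection \<open>Lebesgue measure under translation and reflection\<close>

text \<open>The obstacle is that the equation cannot simply be multiplied by the conjugate of a
  solution: it holds only in distributions, and \<open>nonlin m\<close> does not map L^2 into
  itself, so its increments pair with a difference \<open>w\<close> of solutions only through
  L^(m+1) and its dual. All mollified pairings are therefore written through correlations: the
  pairing of the convolutions of \<open>u\<close> with \<open>k1\<close> and of \<open>v\<close>
  with \<open>k2\<close> is the integral of \<open>k1 y * cnj (k2 z) * corr u v (y - z)\<close>.
  This one formula yields integrability from a bound on absolute correlations, the limit of
  shrinking kernels from continuity of the correlation at 0, and the reality of the Laplacian term
  from a reflection symmetry. The hypothesis on \<open>a\<close> enters through the sector
  inequality \<open>2 * sqrt m * \<bar>Im Q\<bar> \<le> (1 - m) * Re Q\<close> for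
  \<open>Q = (nonlin m z - nonlin m w) * cnj (z - w)\<close>; together with its strict part it also
  forces \<open>0 < Im a\<close>. Estimates start at positive times, since the equation lives on the
  open half-line. The L^(m+1) integral is not continuous on L^2, so a truncated version of it is
  what is carried over to weak solutions.\<close>

lemma lebesgue_isometry:
  fixes t :: "'a::euclidean_space"
  assumes "\<bar>c\<bar> = 1"
  shows measurable_lebesgue_isometry: "(\<lambda>x. t + c *\<^sub>R x) \<in> lebesgue \<rightarrow>\<^sub>M lebesgue"
    and distr_lebesgue_isometry: "distr lebesgue lebesgue (\<lambda>x. t + c *\<^sub>R x) = lebesgue"
proof -
  have c: "c \<noteq> 0" using assms by auto
  have T: "(\<lambda>x. t + (\<Sum>j\<in>Basis. (c * (x \<bullet> j)) *\<^sub>R j)) = (\<lambda>x. t + c *\<^sub>R x)"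
    unfolding scaleR_scaleR[symmetric] scaleR_sum_right[symmetric] euclidean_representation ..
  show "(\<lambda>x. t + c *\<^sub>R x) \<in> lebesgue \<rightarrow>\<^sub>M lebesgue"
    using lebesgue_affine_measurable[of "\<lambda>_. c" t] c unfolding T by auto
  have "lebesgue = density (distr lebesgue lebesgue (\<lambda>x. t + c *\<^sub>R x)) (\<lambda>_. 1)"
    using lebesgue_affine_euclidean[of "\<lambda>_. c" t] c assms unfolding T by simp
  then show "distr lebesgue lebesgue (\<lambda>x. t + c *\<^sub>R x) = lebesgue"
    by (simp add: density_1)
qed

lemma measurable_lebesgue_shift [measurable]:
  "(\<lambda>x. x + h) \<in> lebesgue \<rightarrow>\<^sub>M (lebesgue :: 'a::euclidean_space measure)"
  using measurable_lebesgue_isometry[of 1 h] by (simp add: add.commute)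

lemma measurable_lebesgue_reflect [measurable]:
  "(\<lambda>x. h - x) \<in> lebesgue \<rightarrow>\<^sub>M (lebesgue :: 'a::euclidean_space measure)"
  using measurable_lebesgue_isometry[of "-1" h] by simp

lemma distr_lebesgue_shift: "distr lebesgue lebesgue (\<lambda>x. x + h) = (lebesgue :: 'a::euclidean_space measure)"
  using distr_lebesgue_isometry[of 1 h] by (simp add: add.commute)

lemma distr_lebesgue_reflect: "distr lebesgue lebesgue (\<lambda>x. h - x) = (lebesgue :: 'a::euclidean_space measure)"
  using distr_lebesgue_isometry[of "-1" h] by simp

lemma borel_measurable_lebesgue_shift:
  fixes f :: "'a::euclidean_space \<Rightarrow> 'b::topological_space"
  assumes "f \<in> borel_measurable lebesgue"
  shows "(\<lambda>x. f (x + h)) \<in> borel_measurable lebesgue"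
  by (rule measurable_compose[OF measurable_lebesgue_shift assms])

lemma borel_measurable_lebesgue_reflect:
  fixes f :: "'a::euclidean_space \<Rightarrow> 'b::topological_space"
  assumes "f \<in> borel_measurable lebesgue"
  shows "(\<lambda>x. f (h - x)) \<in> borel_measurable lebesgue"
  by (rule measurable_compose[OF measurable_lebesgue_reflect assms])

lemma integral_lebesgue_shift:
  fixes f :: "'a::euclidean_space \<Rightarrow> 'b::{banach, second_countable_topology}"
  assumes "f \<in> borel_measurable lebesgue"
  shows "(\<integral>x. f (x + h) \<partial>lebesgue) = (\<integral>x. f x \<partial>lebesgue)"
  using integral_distr[OF measurable_lebesgue_shift assms, of h] by (simp add: distr_lebesgue_shift)

lemma integral_lebesgue_reflect:
  fixes f :: "'a::euclidean_space \<Rightarrow> 'b::{banach, second_countable_topology}"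
  assumes "f \<in> borel_measurable lebesgue"
  shows "(\<integral>x. f (h - x) \<partial>lebesgue) = (\<integral>x. f x \<partial>lebesgue)"
  using integral_distr[OF measurable_lebesgue_reflect assms, of h] by (simp add: distr_lebesgue_reflect)

lemma integrable_lebesgue_shift:
  fixes f :: "'a::euclidean_space \<Rightarrow> 'b::{banach, second_countable_topology}"
  assumes "integrable lebesgue f"
  shows "integrable lebesgue (\<lambda>x. f (x + h))"
  using integrable_distr_eq[OF measurable_lebesgue_shift borel_measurable_integrable[OF assms], of h] assms
  by (simp add: distr_lebesgue_shift)

lemma integrable_lebesgue_reflect:
  fixes f :: "'a::euclidean_space \<Rightarrow> 'b::{banach, second_countable_topology}"
  assumes "integrable lebesgue f"
  shows "integrable lebesgue (\<lambda>x. f (h - x))"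
  using integrable_distr_eq[OF measurable_lebesgue_reflect borel_measurable_integrable[OF assms], of h] assms
  by (simp add: distr_lebesgue_reflect)

lemma nn_integral_lebesgue_shift:
  fixes f :: "'a::euclidean_space \<Rightarrow> ennreal"
  assumes "f \<in> borel_measurable lebesgue"
  shows "(\<integral>\<^sup>+x. f (x + h) \<partial>lebesgue) = (\<integral>\<^sup>+x. f x \<partial>lebesgue)"
  using nn_integral_distr[OF measurable_lebesgue_shift, of f h] assms by (simp add: distr_lebesgue_shift)

lemma AE_lebesgue_shift:
  assumes "AE x in lebesgue. P (x::'a::euclidean_space)"
  shows "AE x in lebesgue. P (x + h)"
  by (rule AE_distrD[OF measurable_lebesgue_shift]) (subst distr_lebesgue_shift, fact)

subsection \<open>The space \<open>L\<^sup>2\<close>\<close>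

lemma mem_Lp_iff:
  "g \<in> elems (Lp p) \<longleftrightarrow> g \<in> borel_measurable lebesgue \<and> integrable lebesgue (\<lambda>x. cmod (g x) powr p)"
  by (simp add: Lp_def)

lemma mem_L2_iff:
  "g \<in> elems L2 \<longleftrightarrow> g \<in> borel_measurable lebesgue \<and> integrable lebesgue (\<lambda>x. (cmod (g x))\<^sup>2)"
  by (simp add: Lp_def)

lemma nrm_L2_eq: "nrm L2 g = sqrt (\<integral>x. (cmod (g x))\<^sup>2 \<partial>lebesgue)"
  by (simp add: Lp_def powr_half_sqrt integral_nonneg_AE)

lemma nrm_L2_nonneg [simp]: "0 \<le> nrm L2 g"
  by (simp add: nrm_L2_eq integral_nonneg_AE)

lemma nrm_L2_sq: "(nrm L2 g)\<^sup>2 = (\<integral>x. (cmod (g x))\<^sup>2 \<partial>lebesgue)"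
  by (simp add: nrm_L2_eq integral_nonneg_AE)

lemma L2_measurable [measurable_dest]: "g \<in> elems L2 \<Longrightarrow> g \<in> borel_measurable lebesgue"
  by (simp add: mem_L2_iff)

lemma L2_mult_integrable:
  assumes f: "f \<in> elems L2" and g: "g \<in> elems L2"
  shows "integrable lebesgue (\<lambda>x. cmod (f x) * cmod (g x))"
proof (rule Bochner_Integration.integrable_bound)
  show "integrable lebesgue (\<lambda>x. (cmod (f x))\<^sup>2 + (cmod (g x))\<^sup>2)"
    using f g by (auto simp: mem_L2_iff)
  show "(\<lambda>x. cmod (f x) * cmod (g x)) \<in> borel_measurable lebesgue"
    using f g by measurable
  show "AE x in lebesgue. norm (cmod (f x) * cmod (g x)) \<le> norm ((cmod (f x))\<^sup>2 + (cmod (g x))\<^sup>2)"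
  proof (rule AE_I2)
    fix x
    have "0 \<le> (cmod (f x) - cmod (g x))\<^sup>2 + (cmod (f x))\<^sup>2 + (cmod (g x))\<^sup>2" by simp
    then have "cmod (f x) * cmod (g x) \<le> (cmod (f x))\<^sup>2 + (cmod (g x))\<^sup>2"
      by (simp add: power2_diff)
    then show "norm (cmod (f x) * cmod (g x)) \<le> norm ((cmod (f x))\<^sup>2 + (cmod (g x))\<^sup>2)"
      by simp
  qed
qed

text \<open>The integral of \<open>(s * cmod (f x) - cmod (g x))\<^sup>2\<close> is nonnegative for
  every real \<open>s\<close>; the bound is the discriminant condition of this quadratic in
  \<open>s\<close>.\<close>

lemma L2_Cauchy_Schwarz:
  assumes f: "f \<in> elems L2" and g: "g \<in> elems L2"
  shows "(\<integral>x. cmod (f x) * cmod (g x) \<partial>lebesgue) \<le> nrm L2 f * nrm L2 g"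
proof -
  let ?F = "\<integral>x. (cmod (f x))\<^sup>2 \<partial>lebesgue" and ?G = "\<integral>x. (cmod (g x))\<^sup>2 \<partial>lebesgue"
    and ?I = "\<integral>x. cmod (f x) * cmod (g x) \<partial>lebesgue"
  have int: "integrable lebesgue (\<lambda>x. (cmod (f x))\<^sup>2)" "integrable lebesgue (\<lambda>x. (cmod (g x))\<^sup>2)"
    using f g by (auto simp: mem_L2_iff)
  have *: "0 \<le> s\<^sup>2 * ?F - 2 * s * ?I + ?G" for s :: real
  proof -
    have "0 \<le> (\<integral>x. (s * cmod (f x) - cmod (g x))\<^sup>2 \<partial>lebesgue)"
      by (rule integral_nonneg_AE) simp
    also have "\<dots> = (\<integral>x. s\<^sup>2 * (cmod (f x))\<^sup>2 - (2 * s) * (cmod (f x) * cmod (g x)) + (cmod (g x))\<^sup>2 \<partial>lebesgue)"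
      by (rule Bochner_Integration.integral_cong) (auto simp: power2_diff power_mult_distrib)
    also have "\<dots> = s\<^sup>2 * ?F - 2 * s * ?I + ?G"
      using int L2_mult_integrable[OF f g] by simp
    finally show ?thesis .
  qed
  have F0: "0 \<le> ?F" and G0: "0 \<le> ?G" by (auto intro: integral_nonneg_AE)
  have "?I\<^sup>2 \<le> ?F * ?G"
  proof (cases "?F = 0")
    case True
    have "?I = 0"
    proof (rule ccontr)
      assume "?I \<noteq> 0"
      \<comment> \<open>For \<open>?F = 0\<close> the quadratic is affine in \<open>s\<close>, and
        this value of \<open>s\<close> turns it into -1.\<close>
      then show False using *[of "(?G + 1) / (2 * ?I)"] True by (simp add: field_simps)
    qed
    then show ?thesis using True by simp
  next
    case False
    then have "0 < ?F" using F0 by linarith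
    then show ?thesis using *[of "?I / ?F"]
      by (simp add: field_simps power2_eq_square)
  qed
  then show ?thesis
    unfolding nrm_L2_eq real_sqrt_mult[symmetric] by (rule real_le_rsqrt)
qed

lemma L2_add:
  assumes f: "f \<in> elems L2" and g: "g \<in> elems L2"
  shows "(\<lambda>x. f x + g x) \<in> elems L2"
proof -
  have "integrable lebesgue (\<lambda>x. (cmod (f x + g x))\<^sup>2)"
  proof (rule Bochner_Integration.integrable_bound)
    show "integrable lebesgue (\<lambda>x. 2 * (cmod (f x))\<^sup>2 + 2 * (cmod (g x))\<^sup>2)"
      using f g by (auto simp: mem_L2_iff)
    show "(\<lambda>x. (cmod (f x + g x))\<^sup>2) \<in> borel_measurable lebesgue"
      using f g by measurable
    show "AE x in lebesgue. norm ((cmod (f x + g x))\<^sup>2) \<le> norm (2 * (cmod (f x))\<^sup>2 + 2 * (cmod (g x))\<^sup>2)"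
    proof (rule AE_I2)
      fix x
      have "(cmod (f x + g x))\<^sup>2 \<le> (cmod (f x) + cmod (g x))\<^sup>2"
        by (intro power_mono norm_triangle_ineq) auto
      moreover have "0 \<le> (cmod (f x) - cmod (g x))\<^sup>2" by simp
      ultimately show "norm ((cmod (f x + g x))\<^sup>2) \<le> norm (2 * (cmod (f x))\<^sup>2 + 2 * (cmod (g x))\<^sup>2)"
        by (simp add: power2_sum power2_diff)
    qed
  qed
  with f g show ?thesis by (auto simp: mem_L2_iff)
qed

lemma L2_cmult: "f \<in> elems L2 \<Longrightarrow> (\<lambda>x. c * f x) \<in> elems L2"
  by (auto simp: mem_L2_iff norm_mult power_mult_distrib)

lemma L2_uminus: "f \<in> elems L2 \<Longrightarrow> (\<lambda>x. - f x) \<in> elems L2"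
  using L2_cmult[of f "-1"] by simp

lemma L2_diff: "f \<in> elems L2 \<Longrightarrow> g \<in> elems L2 \<Longrightarrow> (\<lambda>x. f x - g x) \<in> elems L2"
  using L2_add[of f "\<lambda>x. - g x"] L2_uminus[of g] by simp

lemma L2_zero [simp]: "(\<lambda>x. 0) \<in> elems L2"
  by (simp add: mem_L2_iff)

lemma nrm_L2_zero [simp]: "nrm L2 (\<lambda>x. 0) = 0"
  by (simp add: nrm_L2_eq)

lemma nrm_L2_uminus: "nrm L2 (\<lambda>x. - f x) = nrm L2 f"
  by (simp add: nrm_L2_eq)

lemma nrm_L2_minus_commute: "nrm L2 (\<lambda>x. f x - g x) = nrm L2 (\<lambda>x. g x - f x)"
  by (simp add: nrm_L2_eq norm_minus_commute)

lemma nrm_L2_triangle: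
  assumes f: "f \<in> elems L2" and g: "g \<in> elems L2"
  shows "nrm L2 (\<lambda>x. f x + g x) \<le> nrm L2 f + nrm L2 g"
proof -
  have int: "integrable lebesgue (\<lambda>x. (cmod (f x))\<^sup>2)" "integrable lebesgue (\<lambda>x. (cmod (g x))\<^sup>2)"
      "integrable lebesgue (\<lambda>x. (cmod (f x + g x))\<^sup>2)"
    using f g L2_add[OF f g] by (auto simp: mem_L2_iff)
  have "(nrm L2 (\<lambda>x. f x + g x))\<^sup>2 \<le>
      (\<integral>x. (cmod (f x))\<^sup>2 + 2 * (cmod (f x) * cmod (g x)) + (cmod (g x))\<^sup>2 \<partial>lebesgue)"
    unfolding nrm_L2_sq
  proof (rule integral_mono)
    show "integrable lebesgue (\<lambda>x. (cmod (f x))\<^sup>2 + 2 * (cmod (f x) * cmod (g x)) + (cmod (g x))\<^sup>2)"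
      using int L2_mult_integrable[OF f g] by simp
    fix x
    have "(cmod (f x + g x))\<^sup>2 \<le> (cmod (f x) + cmod (g x))\<^sup>2"
      by (intro power_mono norm_triangle_ineq) auto
    then show "(cmod (f x + g x))\<^sup>2 \<le> (cmod (f x))\<^sup>2 + 2 * (cmod (f x) * cmod (g x)) + (cmod (g x))\<^sup>2"
      by (simp add: power2_sum)
  qed (use int in simp)
  also have "\<dots> = (nrm L2 f)\<^sup>2 + 2 * (\<integral>x. cmod (f x) * cmod (g x) \<partial>lebesgue) + (nrm L2 g)\<^sup>2"
    using int L2_mult_integrable[OF f g] by (simp add: nrm_L2_sq)
  also have "\<dots> \<le> (nrm L2 f + nrm L2 g)\<^sup>2"
    using L2_Cauchy_Schwarz[OF f g] by (simp add: power2_sum)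
  finally show ?thesis
    by (rule power2_le_imp_le) simp
qed

lemma nrm_L2_triangle_diff:
  assumes "f \<in> elems L2" "g \<in> elems L2"
  shows "nrm L2 (\<lambda>x. f x - g x) \<le> nrm L2 f + nrm L2 g"
  using nrm_L2_triangle[OF assms(1) L2_uminus[OF assms(2)]] by (simp add: nrm_L2_uminus)

lemma nrm_L2_abs_diff:
  assumes f: "f \<in> elems L2" and g: "g \<in> elems L2"
  shows "\<bar>nrm L2 f - nrm L2 g\<bar> \<le> nrm L2 (\<lambda>x. f x - g x)"
  using nrm_L2_triangle[OF L2_diff[OF f g] g] nrm_L2_triangle[OF L2_diff[OF g f] f]
    nrm_L2_minus_commute[of f g] by simp

lemma L2_shift: "f \<in> elems L2 \<Longrightarrow> (\<lambda>x. f (x + h)) \<in> elems L2"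
  using integrable_lebesgue_shift[of "\<lambda>x. (cmod (f x))\<^sup>2" h]
  by (auto simp: mem_L2_iff intro: borel_measurable_lebesgue_shift)

lemma nrm_L2_shift: "f \<in> elems L2 \<Longrightarrow> nrm L2 (\<lambda>x. f (x + h)) = nrm L2 f"
  unfolding nrm_L2_eq
  by (subst integral_lebesgue_shift[of "\<lambda>x. (cmod (f x))\<^sup>2" h]) (auto simp: mem_L2_iff)

subsection \<open>Continuity of translations\<close>

text \<open>By regularity \<open>A\<close> lies between a compact \<open>K\<close> and an open
  \<open>U\<close> with \<open>U - K\<close> of small measure. A shift shorter than the distance
  from \<open>K\<close> to the complement of \<open>U\<close> can change membership in
  \<open>A\<close> only if \<open>x\<close> or \<open>x + h\<close> lies in
  \<open>U - K\<close>.\<close>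

lemma L1_translation_indicator:
  fixes A :: "'a::euclidean_space set"
  assumes A: "A \<in> sets lebesgue" "emeasure lebesgue A < \<infinity>" "bounded A" and e: "0 < e"
  shows "\<exists>d>0. \<forall>h. norm h < d \<longrightarrow>
    (\<integral>x. \<bar>indicator A (x + h) - indicator A x\<bar> \<partial>lebesgue) < (e::real)"
proof -
  obtain U where U: "open U" "A \<subseteq> U" "U - A \<in> lmeasurable" "emeasure lebesgue (U - A) < ennreal (e/4)"
    using sets_lebesgue_outer_open[OF A(1), of "e/4"] e by auto
  obtain K where K: "closed K" "K \<subseteq> A" "A - K \<in> lmeasurable" "emeasure lebesgue (A - K) < ennreal (e/4)"
    using sets_lebesgue_inner_closed[OF A(1), of "e/4"] e by auto
  have "compact K" using K A(3) by (meson bounded_subset compact_eq_bounded_closed)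
  moreover have "closed (- U)" by (rule closed_Compl[OF U(1)])
  ultimately obtain d where d: "d > 0" "\<forall>x\<in>K. \<forall>y\<in>-U. d \<le> dist x y"
    using separate_compact_closed[of K "-U"] K U by auto
  let ?D = "U - K"
  have D: "?D = (U - A) \<union> (A - K)" using U K by auto
  have Dm: "?D \<in> lmeasurable" unfolding D using U K by auto
  have "measure lebesgue ?D \<le> measure lebesgue (U - A) + measure lebesgue (A - K)"
    unfolding D using U K by (intro measure_Un_le) (auto dest: fmeasurableD)
  moreover have "measure lebesgue (U - A) < e/4" "measure lebesgue (A - K) < e/4"
    using U K e by (auto simp: emeasure_eq_measure2 ennreal_less_iff)
  ultimately have mD: "measure lebesgue ?D < e / 2" by simp
  have intD: "integrable lebesgue (indicator ?D :: _ \<Rightarrow> real)" using Dm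
    by (intro integrable_real_indicator) (auto simp: fmeasurable_def)
  have "(\<integral>x. \<bar>indicator A (x + h) - indicator A x\<bar> \<partial>lebesgue) < e" if h: "norm h < d" for h
  proof -
    have "(\<integral>x. \<bar>indicator A (x + h) - indicator A x :: real\<bar> \<partial>lebesgue) \<le>
        (\<integral>x. indicator ?D (x + h) + indicator ?D x \<partial>lebesgue)"
    proof (rule integral_mono')
      show "integrable lebesgue (\<lambda>x. indicator ?D (x + h) + indicator ?D x :: real)"
        using intD integrable_lebesgue_shift[OF intD] by auto
      fix x
      show "\<bar>indicator A (x + h) - indicator A x\<bar> \<le> (indicator ?D (x + h) + indicator ?D x :: real)"
      proof (cases "x \<in> A \<longleftrightarrow> x + h \<in> A")
        case True then show ?thesis by (auto simp: indicator_def)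
      next
        case False
        \<comment> \<open>If exactly one of the two points is in \<open>A\<close> and that one lies
          in \<open>K\<close>, then the other one lies in \<open>U\<close> but not in
          \<open>K\<close>.\<close>
        have "x + h \<in> U" if "x \<in> K"
          using d(2) that h by (force simp: dist_norm)
        moreover have "x \<in> U" if "x + h \<in> K"
          using d(2) that h by (force simp: dist_norm)
        ultimately show ?thesis using False K(2) U(2) by (auto simp: indicator_def)
      qed
    qed auto
    also have "\<dots> = 2 * measure lebesgue ?D"
      using intD integrable_lebesgue_shift[OF intD] Dm
      by (simp add: integral_lebesgue_shift[of "indicator ?D"] fmeasurableD)
    finally show ?thesis using mD by simp
  qed
  then show ?thesis using d(1) by blast
qed

definition L1_equicontinuous :: "('a::euclidean_space \<Rightarrow> complex) \<Rightarrow> bool" where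
  "L1_equicontinuous f \<longleftrightarrow>
     (\<forall>e>0. \<exists>d>0. \<forall>h. norm h < d \<longrightarrow> (\<integral>x. cmod (f (x + h) - f x) \<partial>lebesgue) < e)"

text \<open>Three errors of size e/3: by translation invariance the approximation error is the same
  before and after the shift, so it counts twice.\<close>

lemma L1_equicontinuous_limit:
  fixes f :: "'a::euclidean_space \<Rightarrow> complex"
  assumes f: "integrable lebesgue f" and s: "\<And>i::nat. integrable lebesgue (s i)" "\<And>i. L1_equicontinuous (s i)"
    and lim: "(\<lambda>i. \<integral>x. cmod (s i x - f x) \<partial>lebesgue) \<longlonglongrightarrow> 0"
  shows "L1_equicontinuous f"
  unfolding L1_equicontinuous_def
proof (intro allI impI)
  fix e :: real assume e: "e > 0"
  then have "e / 3 > 0" by simp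
  from order_tendstoD(2)[OF lim this] obtain i where i: "(\<integral>x. cmod (s i x - f x) \<partial>lebesgue) < e / 3"
    unfolding eventually_sequentially by blast
  obtain d where d: "d > 0" "\<And>h. norm h < d \<Longrightarrow> (\<integral>x. cmod (s i (x + h) - s i x) \<partial>lebesgue) < e / 3"
    using s(2)[of i] e unfolding L1_equicontinuous_def by (meson divide_pos_pos zero_less_numeral)
  have "(\<integral>x. cmod (f (x + h) - f x) \<partial>lebesgue) < e" if h: "norm h < d" for h
  proof -
    let ?g = "\<lambda>x. cmod (s i x - f x)"
    have g: "integrable lebesgue ?g" using s(1)[of i] f by auto
    have si: "integrable lebesgue (\<lambda>x. cmod (s i (x + h) - s i x))"
      using s(1)[of i] integrable_lebesgue_shift[OF s(1)[of i]] by auto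
    have "(\<integral>x. cmod (f (x + h) - f x) \<partial>lebesgue) \<le>
        (\<integral>x. ?g (x + h) + cmod (s i (x + h) - s i x) + ?g x \<partial>lebesgue)"
    proof (rule integral_mono')
      show "integrable lebesgue (\<lambda>x. ?g (x + h) + cmod (s i (x + h) - s i x) + ?g x)"
        using g si integrable_lebesgue_shift[OF g] by auto
      fix x
      have "cmod (p - q) \<le> cmod (p' - p) + cmod (p' - q') + cmod (q' - q)" for p q p' q'
        using norm_triangle_ineq[of "p - p'" "p' - q"] norm_triangle_ineq[of "p' - q'" "q' - q"]
        by (simp add: norm_minus_commute)
      then show "cmod (f (x + h) - f x) \<le> ?g (x + h) + cmod (s i (x + h) - s i x) + ?g x" .
    qed auto
    also have "\<dots> = 2 * (\<integral>x. ?g x \<partial>lebesgue) + (\<integral>x. cmod (s i (x + h) - s i x) \<partial>lebesgue)"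
      using g si integrable_lebesgue_shift[OF g] integral_lebesgue_shift[of ?g h] by simp
    finally show ?thesis using i d(2)[OF h] by simp
  qed
  with d(1) show "\<exists>d>0. \<forall>h. norm h < d \<longrightarrow> (\<integral>x. cmod (f (x + h) - f x) \<partial>lebesgue) < e" by blast
qed

lemma L1_equicontinuous_indicator:
  fixes B :: "'a::euclidean_space set"
  assumes B: "B \<in> sets lebesgue" "emeasure lebesgue B < \<infinity>" "bounded B"
  shows "L1_equicontinuous (\<lambda>x. indicator B x *\<^sub>R c)"
  unfolding L1_equicontinuous_def
proof (intro allI impI)
  fix e :: real assume e: "e > 0"
  have eq: "cmod (indicator B (x + h) *\<^sub>R c - indicator B x *\<^sub>R c) =
      cmod c * \<bar>indicator B (x + h) - indicator B x\<bar>" for x h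
    by (simp add: scaleR_diff_left[symmetric] mult.commute del: scaleR_diff_left)
  \<comment> \<open>The added 1 keeps the denominator positive when \<open>c = 0\<close>.\<close>
  obtain d where d: "d > 0" "\<And>h. norm h < d \<Longrightarrow>
      (\<integral>x. \<bar>indicator B (x + h) - indicator B x\<bar> \<partial>lebesgue) < e / (cmod c + 1)"
    using L1_translation_indicator[OF B, of "e / (cmod c + 1)"] e
    by (metis add_nonneg_pos divide_pos_pos norm_ge_zero zero_less_one)
  have "cmod c * (\<integral>x. \<bar>indicator B (x + h) - indicator B x\<bar> \<partial>lebesgue) < e" if h: "norm h < d" for h
  proof -
    let ?I = "\<integral>x. \<bar>indicator B (x + h) - indicator B x :: real\<bar> \<partial>lebesgue"
    have "cmod c * ?I \<le> (cmod c + 1) * ?I"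
      by (intro mult_right_mono integral_nonneg_AE) auto
    also have "\<dots> < e"
      using d(2)[OF h] by (subst (asm) pos_less_divide_eq) (auto simp: mult.commute add_nonneg_pos)
    finally show ?thesis .
  qed
  then show "\<exists>d>0. \<forall>h. norm h < d \<longrightarrow>
      (\<integral>x. cmod (indicator B (x + h) *\<^sub>R c - indicator B x *\<^sub>R c) \<partial>lebesgue) < e"
    unfolding eq using d(1) by auto
qed

lemma L1_equicontinuous_integrable:
  fixes f :: "'a::euclidean_space \<Rightarrow> complex"
  assumes "integrable lebesgue f"
  shows "L1_equicontinuous f"
  using assms
proof (induction rule: integrable_induct)
  case lim: (lim f s)
  have si: "integrable lebesgue (s i)" and fi: "integrable lebesgue f" for i
    using lim by auto
  have "(\<lambda>i. \<integral>x. cmod (s i x - f x) \<partial>lebesgue) \<longlonglongrightarrow> (\<integral>x. cmod (f x - f x) \<partial>(lebesgue::'a measure))"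
  proof (rule integral_dominated_convergence)
    show "integrable lebesgue (\<lambda>x. 3 * cmod (f x))" using fi by auto
    have cv: "(\<lambda>i. s i x) \<longlonglongrightarrow> f x" for x using lim by auto
    show "AE x in lebesgue. (\<lambda>i. cmod (s i x - f x)) \<longlonglongrightarrow> cmod (f x - f x)"
      by (intro AE_I2 tendsto_intros cv)
    have bd: "cmod (s i x) \<le> 2 * cmod (f x)" for i x using lim by auto
    show "AE x in lebesgue. norm (cmod (s i x - f x)) \<le> 3 * cmod (f x)" for i
    proof (rule AE_I2)
      fix x :: 'a
      show "norm (cmod (s i x - f x)) \<le> 3 * cmod (f x)"
        using bd[where x=x and i=i] norm_triangle_ineq4[of "s i x" "f x"] by simp
    qed
  qed (use si fi in auto)
  then show ?case using L1_equicontinuous_limit[OF fi si lim.IH] by simp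
next
  case (add f g)
  show ?case
    unfolding L1_equicontinuous_def
  proof (intro allI impI)
    fix e :: real assume e: "e > 0"
    obtain d1 where d1: "d1 > 0" "\<And>h. norm h < d1 \<Longrightarrow> (\<integral>x. cmod (f (x + h) - f x) \<partial>lebesgue) < e / 2"
      using add(3) e unfolding L1_equicontinuous_def by (meson half_gt_zero)
    obtain d2 where d2: "d2 > 0" "\<And>h. norm h < d2 \<Longrightarrow> (\<integral>x. cmod (g (x + h) - g x) \<partial>lebesgue) < e / 2"
      using add(4) e unfolding L1_equicontinuous_def by (meson half_gt_zero)
    have "(\<integral>x. cmod (f (x + h) + g (x + h) - (f x + g x)) \<partial>lebesgue) < e"
      if h: "norm h < d1" "norm h < d2" for h
    proof -
      have i: "integrable lebesgue (\<lambda>x. cmod (f (x + h) - f x))" "integrable lebesgue (\<lambda>x. cmod (g (x + h) - g x))"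
        using add(1,2) integrable_lebesgue_shift[OF add(1)] integrable_lebesgue_shift[OF add(2)] by auto
      have "(\<integral>x. cmod (f (x + h) + g (x + h) - (f x + g x)) \<partial>lebesgue) \<le>
        (\<integral>x. cmod (f (x + h) - f x) + cmod (g (x + h) - g x) \<partial>lebesgue)"
        using i by (intro integral_mono') (auto simp: add_diff_add norm_triangle_ineq)
      also have "\<dots> < e" using i d1(2)[OF h(1)] d2(2)[OF h(2)] by simp
      finally show ?thesis .
    qed
    then show "\<exists>d>0. \<forall>h. norm h < d \<longrightarrow> (\<integral>x. cmod (f (x + h) + g (x + h) - (f x + g x)) \<partial>lebesgue) < e"
      using d1(1) d2(1) by (intro exI[of _ "min d1 d2"]) auto
  qed
next
  case (base A c)
  \<comment> \<open>The indicator case is available for bounded sets only, so \<open>A\<close> is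
    exhausted by its intersections with balls.\<close>
  let ?B = "\<lambda>n::nat. A \<inter> cball 0 (real n)"
  have [measurable]: "?B n \<in> sets lebesgue" "A \<in> sets lebesgue" for n
    using base by auto
  have Bf: "emeasure lebesgue (?B n) < \<infinity>" for n
    using base(2) emeasure_mono[of "?B n" A lebesgue] base(1) by (auto simp: less_top[symmetric] top_unique)
  have "(\<lambda>n. \<integral>x. cmod (indicator (?B n) x *\<^sub>R c - indicator A x *\<^sub>R c) \<partial>lebesgue) \<longlonglongrightarrow>
      (\<integral>x. 0 \<partial>(lebesgue :: 'a measure))"
  proof (rule integral_dominated_convergence)
    show "integrable lebesgue (\<lambda>x. cmod c * indicator A x)"
      using base by (auto simp: integrable_real_indicator)
    show "AE x in lebesgue. (\<lambda>i. cmod (indicator (?B i) x *\<^sub>R c - indicator A x *\<^sub>R c)) \<longlonglongrightarrow> 0"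
    proof (rule AE_I2)
      fix x :: 'a
      obtain n0 :: nat where n0: "norm x \<le> real n0" using real_arch_simple by blast
      have "\<forall>\<^sub>F i in sequentially. cmod (indicator (?B i) x *\<^sub>R c - indicator A x *\<^sub>R c) = 0"
        using eventually_ge_at_top[of n0]
      proof eventually_elim
        case (elim i)
        then have "norm x \<le> real i" using n0 by linarith
        then show ?case by (auto simp: indicator_def)
      qed
      then show "(\<lambda>i. cmod (indicator (?B i) x *\<^sub>R c - indicator A x *\<^sub>R c)) \<longlonglongrightarrow> 0"
        by (rule tendsto_eventually)
    qed
    show "AE x in lebesgue. norm (cmod (indicator (?B i) x *\<^sub>R c - indicator A x *\<^sub>R c)) \<le> cmod c * indicator A x" for i
      by (rule AE_I2) (auto simp: indicator_def)
    show "(\<lambda>x. cmod (indicator (?B n) x *\<^sub>R c - indicator A x *\<^sub>R c)) \<in> borel_measurable lebesgue" for n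
      by measurable
  qed simp
  then have lim: "(\<lambda>n. \<integral>x. cmod (indicator (?B n) x *\<^sub>R c - indicator A x *\<^sub>R c) \<partial>lebesgue) \<longlonglongrightarrow> 0" by simp
  show ?case
  proof (rule L1_equicontinuous_limit[OF _ _ _ lim])
    show "integrable lebesgue (\<lambda>x. indicator A x *\<^sub>R c)" "integrable lebesgue (\<lambda>x. indicator (?B n) x *\<^sub>R c)" for n
      using base Bf by (auto simp: integrable_real_indicator)
    show "L1_equicontinuous (\<lambda>x. indicator (?B n) x *\<^sub>R c)" for n
      using base(1) Bf by (intro L1_equicontinuous_indicator) (auto intro: bounded_subset[OF bounded_cball])
  qed
qed

lemma L1_translation:
  fixes f :: "'a::euclidean_space \<Rightarrow> complex"
  assumes "integrable lebesgue f"
  shows "((\<lambda>h. \<integral>x. cmod (f (x + h) - f x) \<partial>lebesgue) \<longlongrightarrow> 0) (nhds 0)"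
  unfolding tendsto_iff eventually_nhds_metric
  using L1_equicontinuous_integrable[OF assms, unfolded L1_equicontinuous_def] by (simp add: integral_nonneg_AE)

subsection \<open>The nonlinearity\<close>

lemma nonlin_0 [simp]: "nonlin m 0 = 0"
  by (simp add: nonlin_def)

lemma norm_nonlin:
  assumes "0 < m"
  shows "cmod (nonlin m z) = cmod z powr m"
proof (cases "z = 0")
  case False
  have "cmod z powr (m - 1) * cmod z powr 1 = cmod z powr m"
    using False by (subst powr_add[symmetric]) simp
  then show ?thesis using False by (simp add: nonlin_def norm_mult)
qed (use assms in simp)

lemma nonlin_mult_cnj:
  assumes "0 < m"
  shows "nonlin m z * cnj z = of_real (cmod z powr (m + 1))"
proof (cases "z = 0")
  case False
  have "cmod z powr (m - 1) * cmod z powr 2 = cmod z powr (m + 1)"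
    using False by (subst powr_add[symmetric]) (simp add: add.commute)
  then have "cmod z powr (m - 1) * (cmod z)\<^sup>2 = cmod z powr (m + 1)"
    using False by simp
  then show ?thesis using False
    by (simp add: nonlin_def mult.assoc complex_norm_square[symmetric] flip: of_real_mult of_real_power)
qed simp

text \<open>The moduli compose to the identity and the phase is untouched. Hence Hoelder continuity
  of the power with exponent 1/p bounds increments of \<open>g\<close> by those of
  \<open>nonlin p\<close> applied to \<open>g\<close>.\<close>

lemma nonlin_inverse:
  assumes "0 < p"
  shows "nonlin (1 / p) (nonlin p z) = z"
proof (cases "z = 0")
  case False
  then have n: "nonlin p z \<noteq> 0" using norm_nonlin[OF assms, of z] by auto
  have "(cmod z powr p) powr (- (1 - 1 / p)) * cmod z powr (- (1 - p)) = cmod z powr (p * (- (1 - 1 / p)) + (- (1 - p)))"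
    by (simp only: powr_powr powr_add)
  also have "p * (- (1 - 1 / p)) + (- (1 - p)) = 0" using assms by (simp add: field_simps)
  finally have "(cmod z powr p) powr (- (1 - 1 / p)) * cmod z powr (- (1 - p)) = 1"
    using False by simp
  then have "complex_of_real ((cmod z powr p) powr (- (1 - 1 / p)) * cmod z powr (- (1 - p))) * z = z" by simp
  moreover have "nonlin (1 / p) (nonlin p z) = of_real ((cmod z powr p) powr (- (1 - 1 / p))) * nonlin p z"
    using n by (simp add: nonlin_def[of "1/p"] norm_nonlin[OF assms])
  ultimately show ?thesis using False by (simp add: nonlin_def[of p] mult.assoc)
qed simp

text \<open>With \<open>r\<close> the larger modulus, the increment splits into
  \<open>r powr (m - 1) * (z - w)\<close> and the radial error
  \<open>r powr (m - 1) * w - nonlin m w\<close>. Each part is at most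
  \<open>r powr (m - 1) * d\<close>, which is at most \<open>2 * d powr m\<close>; this is the
  origin of the constant 4.\<close>

lemma nonlin_holder_aux:
  assumes m: "0 < m" "m \<le> 1" and zw: "cmod w \<le> cmod z"
  shows "cmod (nonlin m z - nonlin m w) \<le> 4 * cmod (z - w) powr m"
proof (cases "z = 0 \<or> z = w")
  case True
  then show ?thesis using zw by auto
next
  case False
  define r s d where "r = cmod z" and "s = cmod w" and "d = cmod (z - w)"
  have r: "r > 0" and d: "d > 0" and s: "0 \<le> s" "s \<le> r" using False zw by (auto simp: r_def s_def d_def)
  have dr: "d \<le> 2 * r" and rs: "r - s \<le> d"
    using norm_triangle_ineq4[of z w] norm_triangle_ineq2[of z w] zw by (auto simp: r_def s_def d_def)
  \<comment> \<open>The exponent \<open>m - 1\<close> is not positive and \<open>r\<close> is at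
    least \<open>d / 2\<close>; the factor 2 bounds \<open>2 powr (1 - m)\<close>.\<close>
  have key: "r powr (m - 1) * d \<le> 2 * d powr m"
  proof -
    have "r powr (m - 1) \<le> (d / 2) powr (m - 1)"
      using dr d m by (intro powr_mono2') auto
    also have "\<dots> = d powr (m - 1) * 2 powr (1 - m)"
      using d by (simp add: powr_divide powr_minus_divide[symmetric] divide_powr_uminus)
    also have "\<dots> \<le> d powr (m - 1) * 2"
      using m powr_mono[of "1 - m" 1 2] by (intro mult_left_mono) auto
    finally have "r powr (m - 1) * d \<le> d powr (m - 1) * 2 * d"
      using d by (intro mult_right_mono) auto
    also have "\<dots> = 2 * (d powr (m - 1) * d powr 1)" using d by simp
    also have "\<dots> = 2 * d powr m" by (subst powr_add[symmetric]) simp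
    finally show ?thesis .
  qed
  \<comment> \<open>Both terms are real multiples of \<open>w\<close>, so only moduli matter: the
    difference is \<open>s powr m - r powr (m - 1) * s\<close>, and enlarging
    \<open>s powr m\<close> to \<open>r powr m\<close> leaves
    \<open>r powr (m - 1) * (r - s)\<close>.\<close>
  have second: "cmod (of_real (r powr (m - 1)) * w - nonlin m w) \<le> r powr (m - 1) * d"
  proof (cases "w = 0")
    case True
    then show ?thesis using r d by (simp)
  next
    case w: False
    then have s0: "s > 0" by (simp add: s_def)
    have le: "r powr (m - 1) \<le> s powr (m - 1)" using s s0 m by (intro powr_mono2') auto
    have "of_real (r powr (m - 1)) * w - nonlin m w = of_real (r powr (m - 1) - s powr (m - 1)) * w"
      using w by (simp add: nonlin_def s_def algebra_simps)
    then have "cmod (of_real (r powr (m - 1)) * w - nonlin m w) = (s powr (m - 1) - r powr (m - 1)) * s"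
      using le by (simp add: norm_mult s_def del: of_real_diff)
    also have "\<dots> = s powr m - r powr (m - 1) * s"
    proof -
      have "s powr (m - 1) * s powr 1 = s powr m" by (subst powr_add[symmetric]) simp
      then show ?thesis using s0 by (simp add: algebra_simps)
    qed
    also have "\<dots> \<le> r powr m - r powr (m - 1) * s"
      using s m by (simp add: powr_mono2)
    also have "\<dots> = r powr (m - 1) * (r - s)"
    proof -
      have "r powr (m - 1) * r powr 1 = r powr m" by (subst powr_add[symmetric]) simp
      then show ?thesis using r by (simp add: algebra_simps)
    qed
    also have "\<dots> \<le> r powr (m - 1) * d" using rs by (intro mult_left_mono) auto
    finally show ?thesis .
  qed
  have "nonlin m z - nonlin m w = of_real (r powr (m - 1)) * (z - w) + (of_real (r powr (m - 1)) * w - nonlin m w)"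
    using False by (simp add: nonlin_def r_def algebra_simps)
  then have "cmod (nonlin m z - nonlin m w) \<le> cmod (of_real (r powr (m - 1)) * (z - w))
      + cmod (of_real (r powr (m - 1)) * w - nonlin m w)"
    by (simp only: norm_triangle_ineq)
  also have "\<dots> \<le> r powr (m - 1) * d + r powr (m - 1) * d"
    by (intro add_mono second) (simp add: norm_mult d_def)
  finally have "cmod (nonlin m z - nonlin m w) \<le> r powr (m - 1) * d + r powr (m - 1) * d" .
  then show ?thesis unfolding d_def[symmetric] using key by linarith
qed

lemma nonlin_holder:
  assumes "0 < m" "m \<le> 1"
  shows "cmod (nonlin m z - nonlin m w) \<le> 4 * cmod (z - w) powr m"
  using nonlin_holder_aux[OF assms, of w z] nonlin_holder_aux[OF assms, of z w]
  by (metis linear norm_minus_commute)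

lemma nonlin_measurable [measurable]: "nonlin m \<in> borel_measurable borel"
  unfolding nonlin_def[abs_def] by measurable

section \<open>The sector inequality for the power nonlinearity\<close>

lemma sinh_scale_mono:
  assumes "0 < s" "s \<le> t" "0 \<le> x"
  shows "t * sinh (s * x) \<le> s * sinh (t * x :: real)"
proof (cases "x = 0")
  case False
  \<comment> \<open>This difference vanishes at 0, and its derivative is
    \<open>s * t * (cosh (t * y) - cosh (s * y))\<close>.\<close>
  define g where "g y = s * sinh (t * y) - t * sinh (s * y)" for y :: real
  have "g 0 \<le> g x"
  proof (rule DERIV_nonneg_imp_nondecreasing[OF assms(3)])
    fix y :: real assume y: "0 \<le> y" "y \<le> x"
    have "(g has_real_derivative s * (cosh (t * y) * t) - t * (cosh (s * y) * s)) (at y)"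
      unfolding g_def by (auto intro!: derivative_eq_intros)
    moreover have "cosh (s * y) \<le> cosh (t * y)"
      using assms y by (simp add: cosh_real_nonneg_le_iff mult_right_mono)
    then have "0 \<le> s * (cosh (t * y) * t) - t * (cosh (s * y) * s)"
      using assms by (simp add: algebra_simps)
    ultimately show "\<exists>D. (g has_real_derivative D) (at y) \<and> 0 \<le> D" by blast
  qed
  then show ?thesis by (simp add: g_def)
qed simp

text \<open>With \<open>r = exp (p + q)\<close> and \<open>s = exp (p - q)\<close> this is
  \<open>(1 + m) sinh ((1 - m) q) \<le> (1 - m) sinh ((1 + m) q)\<close>.\<close>

lemma power_difference_ineq:
  fixes r s m :: real
  assumes m: "0 < m" "m < 1" and s: "0 < s" "s \<le> r"
  shows "4 * m * (r * s powr m - s * r powr m)\<^sup>2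
    \<le> (1 - m)\<^sup>2 * ((r powr m)\<^sup>2 - (s powr m)\<^sup>2) * (r\<^sup>2 - s\<^sup>2)"
proof -
  define p q where "p = (ln r + ln s) / 2" and "q = (ln r - ln s) / 2"
  have q: "0 \<le> q" using s by (simp add: q_def)
  have r0: "0 < r" using s by simp
  have er: "r = exp (p + q)" and es: "s = exp (p - q)" using s r0 by (simp_all add: p_def q_def field_simps)
  have rm: "r powr m = exp (m * (p + q))" and sm: "s powr m = exp (m * (p - q))"
    unfolding er es powr_def by simp_all
  let ?E = "exp ((1 + m) * p)"
  have 1: "r * s powr m - s * r powr m = 2 * ?E * sinh ((1 - m) * q)"
    unfolding rm sm unfolding er es sinh_field_def by (simp add: exp_add[symmetric] algebra_simps)
  have 2: "(r powr m)\<^sup>2 - (s powr m)\<^sup>2 = 2 * exp (2 * m * p) * sinh (2 * m * q)"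
    unfolding rm sm sinh_field_def power2_eq_square by (simp add: exp_add[symmetric] algebra_simps)
  have 3: "r\<^sup>2 - s\<^sup>2 = 2 * exp (2 * p) * sinh (2 * q)"
    unfolding er es sinh_field_def power2_eq_square by (simp add: exp_add[symmetric] algebra_simps)
  have E2: "exp (2 * m * p) * exp (2 * p) = ?E\<^sup>2"
    unfolding power2_eq_square by (simp add: exp_add[symmetric] algebra_simps)
  \<comment> \<open>The identity \<open>sinh (A + B) * sinh (A - B) = (sinh A)\<^sup>2 - (sinh
    B)\<^sup>2\<close> with \<open>A = (1 + m) * q\<close> and
    \<open>B = (1 - m) * q\<close>.\<close>
  have prod: "sinh (2 * m * q) * sinh (2 * q) = (sinh ((1 + m) * q))\<^sup>2 - (sinh ((1 - m) * q))\<^sup>2"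
    unfolding sinh_field_def power2_eq_square by (simp add: exp_add[symmetric] field_simps)
  have "(1 + m) * sinh ((1 - m) * q) \<le> (1 - m) * sinh ((1 + m) * q)"
    using m q by (intro sinh_scale_mono) auto
  moreover have "0 \<le> sinh ((1 - m) * q)" using m q by simp
  ultimately have "((1 + m) * sinh ((1 - m) * q))\<^sup>2 \<le> ((1 - m) * sinh ((1 + m) * q))\<^sup>2"
    using m by (intro power_mono) auto
  \<comment> \<open>Subtracting \<open>(1 - m)\<^sup>2 * (sinh ((1 - m) * q))\<^sup>2\<close> on
    both sides leaves the factor \<open>(1 + m)\<^sup>2 - (1 - m)\<^sup>2 = 4 * m\<close> on the
    left.\<close>
  then have "4 * m * (sinh ((1 - m) * q))\<^sup>2 \<le> (1 - m)\<^sup>2 * (sinh (2 * m * q) * sinh (2 * q))"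
    unfolding prod by (simp add: power_mult_distrib power2_eq_square algebra_simps)
  then have "4 * ?E\<^sup>2 * (4 * m * (sinh ((1 - m) * q))\<^sup>2) \<le> 4 * ?E\<^sup>2 * ((1 - m)\<^sup>2 * (sinh (2 * m * q) * sinh (2 * q)))"
    by (intro mult_left_mono) auto
  also have "4 * ?E\<^sup>2 * ((1 - m)\<^sup>2 * (sinh (2 * m * q) * sinh (2 * q))) =
      (1 - m)\<^sup>2 * (2 * exp (2 * m * p) * sinh (2 * m * q)) * (2 * exp (2 * p) * sinh (2 * q))"
    unfolding E2[symmetric] by (simp only: mult_ac)
  finally show ?thesis
    unfolding 1 2 3 by (simp add: power_mult_distrib mult_ac)
qed

text \<open>Put \<open>z * cnj w = r * s * (X + i Y)\<close> with \<open>(X, Y)\<close> on the unit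
  circle. Then \<open>Re Q = E - P * X\<close> and \<open>Im Q = M * Y\<close>, so the claim bounds
  the linear form \<open>(1 - m) * P * X + 2 * sqrt m * \<bar>M * Y\<bar>\<close> by
  \<open>(1 - m) * E\<close>. By Cauchy-Schwarz in the plane it suffices that \<open>4 * m *
  M\<^sup>2 \<le> (1 - m)\<^sup>2 * (E\<^sup>2 - P\<^sup>2)\<close>. The difference
  \<open>E\<^sup>2 - P\<^sup>2\<close> factors, and what remains is
  \<open>power_difference_ineq\<close>.\<close>

lemma nonlin_sector_aux:
  assumes m: "0 < m" "m < 1" and zw: "w \<noteq> 0" "cmod w \<le> cmod z"
  defines "Q \<equiv> (nonlin m z - nonlin m w) * cnj (z - w)"
  shows "2 * sqrt m * \<bar>Im Q\<bar> \<le> (1 - m) * Re Q"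
proof -
  define r s c where "r = cmod z" and "s = cmod w" and "c = z * cnj w"
  have s: "0 < s" "s \<le> r" using zw by (auto simp: r_def s_def)
  have r: "0 < r" using s by simp
  have z: "z \<noteq> 0" using r by (auto simp: r_def)
  define P M E where "P = r powr m * s + s powr m * r" and "M = r * s powr m - s * r powr m"
    and "E = r powr m * r + s powr m * s"
  have pr: "r powr (- (1 - m)) = r powr m / r" and ps: "s powr (- (1 - m)) = s powr m / s"
    using r s by (simp_all add: powr_diff)
  have Q: "Q = of_real E - of_real (r powr m / r) * c - of_real (s powr m / s) * cnj c"
  proof -
    have zz: "z * cnj z = of_real (r\<^sup>2)" and ww: "w * cnj w = of_real (s\<^sup>2)"
      by (simp_all only: r_def s_def complex_norm_square)
    have nz: "nonlin m z = of_real (r powr m / r) * z" and nw: "nonlin m w = of_real (s powr m / s) * w"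
      unfolding nonlin_def using zw(1) z pr ps by (simp_all only: r_def s_def if_False)
    have alg: "(A * z - B * w) * cnj (z - w) = A * (z * cnj z) + B * (w * cnj w) - A * (z * cnj w) - B * cnj (z * cnj w)" for A B
      by (simp add: algebra_simps)
    have "Q = of_real (r powr m / r) * (z * cnj z) + of_real (s powr m / s) * (w * cnj w)
        - of_real (r powr m / r) * c - of_real (s powr m / s) * cnj c"
      unfolding Q_def nz nw c_def by (rule alg)
    then show ?thesis
      unfolding zz ww E_def using r s by (simp add: power2_eq_square)
  qed
  define X Y where "X = Re c / (r * s)" and "Y = Im c / (r * s)"
  have c: "Re c = X * (r * s)" "Im c = Y * (r * s)" using r s by (simp_all add: X_def Y_def)
  have XY: "X\<^sup>2 + Y\<^sup>2 = 1"
  proof -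
    have "cmod c = r * s" by (simp add: c_def norm_mult r_def s_def)
    then have "(Re c)\<^sup>2 + (Im c)\<^sup>2 = (r * s)\<^sup>2"
      by (simp only: cmod_power2[symmetric])
    then have "(X\<^sup>2 + Y\<^sup>2) * (r * s)\<^sup>2 = 1 * (r * s)\<^sup>2" unfolding c by (simp add: algebra_simps power_mult_distrib)
    then show ?thesis using r s by auto
  qed
  have ReQ: "Re Q = E - P * X" unfolding Q P_def using r s by (simp add: c field_simps)
  have ImQ: "Im Q = M * Y" unfolding Q M_def using r s by (simp add: c field_simps)
  have EP: "E\<^sup>2 - P\<^sup>2 = ((r powr m)\<^sup>2 - (s powr m)\<^sup>2) * (r\<^sup>2 - s\<^sup>2)"
    unfolding E_def P_def by (simp add: power2_eq_square algebra_simps)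
  have key: "4 * m * M\<^sup>2 \<le> (1 - m)\<^sup>2 * (E\<^sup>2 - P\<^sup>2)"
    using power_difference_ineq[OF m s] unfolding EP M_def by (simp add: mult.assoc)
  have E0: "0 \<le> E" using r s by (simp add: E_def)
  have "((1 - m) * P * X + 2 * sqrt m * \<bar>M * Y\<bar>)\<^sup>2 \<le> (((1 - m) * P)\<^sup>2 + (2 * sqrt m * M)\<^sup>2) * (X\<^sup>2 + Y\<^sup>2)"
  proof -
    have cs: "(A * x + B * y)\<^sup>2 \<le> (A\<^sup>2 + B\<^sup>2) * (x\<^sup>2 + y\<^sup>2)" for A B x y :: real
      using zero_le_power2[of "A * y - B * x"] by (simp add: power2_eq_square algebra_simps)
    show ?thesis
      using cs[of "(1 - m) * P" X "2 * sqrt m * \<bar>M\<bar>" "\<bar>Y\<bar>"]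
      by (simp add: abs_mult power_mult_distrib mult.assoc)
  qed
  also have "\<dots> \<le> ((1 - m) * E)\<^sup>2"
    unfolding XY using key m by (simp add: power_mult_distrib right_diff_distrib)
  finally have "(1 - m) * P * X + 2 * sqrt m * \<bar>M * Y\<bar> \<le> (1 - m) * E"
    by (rule power2_le_imp_le) (use E0 m in simp)
  then show ?thesis unfolding ReQ ImQ by (simp add: algebra_simps)
qed

text \<open>Exchanging \<open>z\<close> and \<open>w\<close> does not change the product, so
  \<open>w\<close> may be taken as the smaller one in modulus; for \<open>w = 0\<close> the product
  is a nonnegative real.\<close>

lemma nonlin_sector:
  assumes m: "0 < m" "m < 1"
  shows "2 * sqrt m * \<bar>Im ((nonlin m z - nonlin m w) * cnj (z - w))\<bar>
    \<le> (1 - m) * Re ((nonlin m z - nonlin m w) * cnj (z - w))"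
proof -
  have *: "2 * sqrt m * \<bar>Im ((nonlin m z - nonlin m w) * cnj (z - w))\<bar>
    \<le> (1 - m) * Re ((nonlin m z - nonlin m w) * cnj (z - w))" if "cmod w \<le> cmod z" for z w
  proof (cases "w = 0")
    case True
    then show ?thesis using m by (simp add: nonlin_mult_cnj)
  next
    case False
    then show ?thesis using nonlin_sector_aux[OF m False that] by simp
  qed
  have sym: "(nonlin m z - nonlin m w) * cnj (z - w) = (nonlin m w - nonlin m z) * cnj (w - z)"
    by (simp add: algebra_simps)
  show ?thesis
    using *[of w z] *[of z w] sym by (cases "cmod w \<le> cmod z") (simp_all only: linear not_le less_imp_le)
qed

text \<open>The quantity is \<open>Re a * Im Q + Im a * Re Q\<close>. Multiplying the condition on
  \<open>a\<close> by the sector inequality for \<open>Q\<close> gives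
  \<open>\<bar>Re a\<bar> * \<bar>Im Q\<bar> \<le> Im a * Re Q\<close>.\<close>

lemma nonlin_dissipative:
  assumes m: "0 < m" "m < 1" and a: "2 * sqrt m * Im a \<ge> (1 - m) * \<bar>Re a\<bar>"
  shows "0 \<le> Im (a * ((nonlin m z - nonlin m w) * cnj (z - w)))"
proof -
  define Q where "Q = (nonlin m z - nonlin m w) * cnj (z - w)"
  have Q: "2 * sqrt m * \<bar>Im Q\<bar> \<le> (1 - m) * Re Q" unfolding Q_def by (rule nonlin_sector[OF m])
  have sm: "0 < sqrt m" using m by simp
  have "0 \<le> (1 - m) * Re Q" using Q sm by (smt (verit) mult_nonneg_nonneg abs_ge_zero)
  then have R: "0 \<le> Re Q" using m by (simp add: zero_le_mult_iff)
  have "(1 - m) * \<bar>Re a\<bar> * (2 * sqrt m * \<bar>Im Q\<bar>) \<le> (2 * sqrt m * Im a) * ((1 - m) * Re Q)"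
    using a Q m sm by (intro mult_mono'[OF a Q]) auto
  then have "((1 - m) * (2 * sqrt m)) * (\<bar>Re a\<bar> * \<bar>Im Q\<bar>) \<le> ((1 - m) * (2 * sqrt m)) * (Im a * Re Q)"
    by (simp add: mult_ac)
  then have "\<bar>Re a\<bar> * \<bar>Im Q\<bar> \<le> Im a * Re Q" using m sm by (simp add: mult_le_cancel_left_pos)
  moreover have "- (Re a * Im Q) \<le> \<bar>Re a\<bar> * \<bar>Im Q\<bar>" by (metis abs_ge_minus_self abs_mult)
  ultimately show ?thesis unfolding Q_def[symmetric] by simp
qed

subsection \<open>Translations in \<open>L\<^sup>p\<close>\<close>

text \<open>Reduced to \<open>L\<^sup>1\<close> by passing to \<open>|g|\<^bsup>p-1\<^esup>g\<close>, since the inverse power map is Hoelder continuous.\<close>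

lemma Lp_translation:
  fixes g :: "'a::euclidean_space \<Rightarrow> complex"
  assumes p: "1 \<le> p" and g: "g \<in> elems (Lp p)"
  shows "((\<lambda>h. \<integral>x. cmod (g (x + h) - g x) powr p \<partial>lebesgue) \<longlongrightarrow> 0) (nhds 0)"
proof -
  define G where "G x = nonlin p (g x)" for x
  have gm [measurable]: "g \<in> borel_measurable lebesgue" using g by (simp add: mem_Lp_iff)
  have Gm: "G \<in> borel_measurable lebesgue" unfolding G_def by measurable
  have "integrable lebesgue (\<lambda>x. cmod (G x))"
    using g p by (simp add: G_def norm_nonlin mem_Lp_iff)
  then have G: "integrable lebesgue G" using Gm by (simp only: integrable_norm_iff)
  have pt: "cmod (g (x + h) - g x) powr p \<le> 4 powr p * cmod (G (x + h) - G x)" for x h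
  proof -
    have "cmod (nonlin (1/p) (G (x + h)) - nonlin (1/p) (G x)) \<le> 4 * cmod (G (x + h) - G x) powr (1/p)"
      using p by (intro nonlin_holder) auto
    then have "cmod (g (x + h) - g x) \<le> 4 * cmod (G (x + h) - G x) powr (1/p)"
      using p by (simp add: G_def nonlin_inverse)
    then have "cmod (g (x + h) - g x) powr p \<le> (4 * cmod (G (x + h) - G x) powr (1/p)) powr p"
      using p by (intro powr_mono2) auto
    also have "\<dots> = 4 powr p * cmod (G (x + h) - G x)"
      using p by (simp add: powr_mult powr_powr)
    finally show ?thesis .
  qed
  have "(\<integral>x. cmod (g (x + h) - g x) powr p \<partial>lebesgue) \<le> 4 powr p * (\<integral>x. cmod (G (x + h) - G x) \<partial>lebesgue)" for h
  proof -
    have "(\<integral>x. cmod (g (x + h) - g x) powr p \<partial>lebesgue) \<le> (\<integral>x. 4 powr p * cmod (G (x + h) - G x) \<partial>lebesgue)"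
      using G integrable_lebesgue_shift[OF G] pt by (intro integral_mono') auto
    then show ?thesis by simp
  qed
  then show ?thesis
    by (intro tendsto_sandwich[OF _ _ tendsto_const tendsto_mult_right_zero[OF L1_translation[OF G], of "4 powr p"]])
       (auto intro!: always_eventually integral_nonneg_AE)
qed

lemma L2_translation:
  assumes "g \<in> elems L2"
  shows "((\<lambda>h. nrm L2 (\<lambda>x. g (x + h) - g x)) \<longlongrightarrow> 0) (nhds 0)"
  using tendsto_real_sqrt[OF Lp_translation[OF _ assms]] by (simp add: nrm_L2_eq)

subsection \<open>Convolution with a continuous compactly supported kernel\<close>

definition cc_kernel :: "('a::euclidean_space \<Rightarrow> complex) \<Rightarrow> bool" where
  "cc_kernel k \<longleftrightarrow> continuous_on UNIV k \<and> (\<exists>r. \<forall>x. k x \<noteq> 0 \<longrightarrow> norm x \<le> r)"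

definition conv :: "('a::euclidean_space \<Rightarrow> complex) \<Rightarrow> ('a \<Rightarrow> complex) \<Rightarrow> 'a \<Rightarrow> complex" where
  "conv k g x = (\<integral>y. k (x - y) * g y \<partial>lebesgue)"

text \<open>A common home for L^2 functions and for their images under \<open>nonlin m\<close>,
  which belong to L^2 only locally. Convolution with a compactly supported kernel is defined on
  it.\<close>

definition loc_integrable :: "('a::euclidean_space \<Rightarrow> complex) \<Rightarrow> bool" where
  "loc_integrable g \<longleftrightarrow> g \<in> borel_measurable lebesgue \<and>
     (\<forall>r. integrable lebesgue (\<lambda>x. indicator (cball 0 r) x *\<^sub>R g x))"

lemma kernel_measurable: "cc_kernel k \<Longrightarrow> k \<in> borel_measurable borel"
  by (simp add: cc_kernel_def borel_measurable_continuous_onI)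

lemma kernel_measurable_lebesgue: "cc_kernel k \<Longrightarrow> k \<in> borel_measurable lebesgue"
  using kernel_measurable[of k] by (intro measurable_completion) simp

lemma kernel_bounded:
  assumes "cc_kernel k"
  obtains B where "B > 0" "\<And>x. cmod (k x) \<le> B"
proof -
  obtain r where r: "\<And>x. k x \<noteq> 0 \<Longrightarrow> norm x \<le> r" using assms by (auto simp: cc_kernel_def)
  have "compact (k ` cball 0 r)"
    using assms by (intro compact_continuous_image) (auto simp: cc_kernel_def intro: continuous_on_subset)
  then obtain B where B: "B > 0" "\<forall>y\<in>k ` cball 0 r. cmod y \<le> B"
    using compact_imp_bounded bounded_pos by blast
  have "cmod (k x) \<le> B" for x
  proof (cases "k x = 0")
    case False
    then show ?thesis using r[OF False] B by auto
  qed (use B in simp)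
  with B(1) show ?thesis by (rule that)
qed

lemma indicator_cball_integrable:
  "integrable lebesgue (indicator (cball (x::'a::euclidean_space) r) :: 'a \<Rightarrow> real)"
  using lmeasurable_cball[of x r] by (intro integrable_real_indicator) (auto simp: fmeasurable_def)

lemma kernel_powr_integrable:
  assumes k: "cc_kernel k" and n: "n > 0"
  shows "integrable lebesgue (\<lambda>x. (cmod (k x)) ^ n)"
proof -
  obtain r where r: "\<And>x. k x \<noteq> 0 \<Longrightarrow> norm x \<le> r" using k by (auto simp: cc_kernel_def)
  obtain B where B: "B > 0" "\<And>x. cmod (k x) \<le> B" using kernel_bounded[OF k] by blast
  show ?thesis
  proof (rule Bochner_Integration.integrable_bound)
    show "integrable lebesgue (\<lambda>x. B ^ n * indicator (cball (0::'a) r) x)"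
      using indicator_cball_integrable by auto
    show "(\<lambda>x. (cmod (k x)) ^ n) \<in> borel_measurable lebesgue"
      using kernel_measurable_lebesgue[OF k] by measurable
    show "AE x in lebesgue. norm ((cmod (k x)) ^ n) \<le> norm (B ^ n * indicator (cball (0::'a) r) x)"
    proof (rule AE_I2)
      fix x
      show "norm ((cmod (k x)) ^ n) \<le> norm (B ^ n * indicator (cball (0::'a) r) x)"
        using r[of x] B n by (cases "k x = 0") (auto simp: power_mono zero_power)
    qed
  qed
qed

lemma kernel_L2: "cc_kernel k \<Longrightarrow> k \<in> elems L2"
  using kernel_powr_integrable[of k 2] kernel_measurable_lebesgue[of k] by (simp add: mem_L2_iff)

lemma kernel_integrable: "cc_kernel k \<Longrightarrow> integrable lebesgue k"
  using kernel_powr_integrable[of k 1] kernel_measurable_lebesgue[of k]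
  by (simp add: integrable_norm_iff)

lemma loc_integrable_measurable: "loc_integrable g \<Longrightarrow> g \<in> borel_measurable lebesgue"
  by (simp add: loc_integrable_def)

text \<open>On a ball the constant 1 is integrable as well. The bound covers both
  \<open>cmod (u x)\<close> and \<open>cmod (u x) powr m\<close>, because the exponents 1 and
  \<open>m\<close> lie between 0 and 2.\<close>

lemma loc_integrable_bound:
  assumes u: "u \<in> elems L2" and g: "g \<in> borel_measurable lebesgue"
    and le: "\<And>x. cmod (g x) \<le> C * (1 + (cmod (u x))\<^sup>2)"
  shows "loc_integrable g"
  unfolding loc_integrable_def
proof (intro conjI allI g)
  fix r
  show "integrable lebesgue (\<lambda>x. indicator (cball 0 r) x *\<^sub>R g x)"
  proof (rule Bochner_Integration.integrable_bound)
    show "integrable lebesgue (\<lambda>x. C * (indicator (cball (0::'a) r) x + (cmod (u x))\<^sup>2))"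
      using u by (intro integrable_mult_right Bochner_Integration.integrable_add indicator_cball_integrable) (simp add: mem_L2_iff)
    have [measurable]: "cball (0::'a) r \<in> sets lebesgue" by simp
    note [measurable] = g
    show "(\<lambda>x. indicator (cball 0 r) x *\<^sub>R g x) \<in> borel_measurable lebesgue" by measurable
    \<comment> \<open>Evaluating the hypothesis at an arbitrary point shows that \<open>C\<close> is
      nonnegative.\<close>
    have "0 \<le> C * (1 + (cmod (u undefined))\<^sup>2)" using le[of undefined] norm_ge_zero order_trans by blast
    moreover have "0 < 1 + (cmod (u undefined))\<^sup>2" by (simp add: add_pos_nonneg)
    ultimately have "0 \<le> C" using mult_neg_pos not_le by blast
    then show "AE x in lebesgue. norm (indicator (cball 0 r) x *\<^sub>R g x)
        \<le> norm (C * (indicator (cball (0::'a) r) x + (cmod (u x))\<^sup>2))"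
      using le by (intro AE_I2) (auto simp: indicator_def)
  qed
qed

lemma L2_loc_integrable:
  assumes "u \<in> elems L2"
  shows "loc_integrable u"
proof (rule loc_integrable_bound[OF assms])
  show "u \<in> borel_measurable lebesgue" using assms by (simp add: mem_L2_iff)
  have "t \<le> 1 + t\<^sup>2" for t :: real
    using zero_le_power2[of "t - 1 / 2"] zero_le_power2[of t] by (simp add: power2_diff power_divide)
  then show "cmod (u x) \<le> 1 * (1 + (cmod (u x))\<^sup>2)" for x by simp
qed

lemma nonlin_loc_integrable:
  assumes u: "u \<in> elems L2" and m: "0 < m" "m < 1"
  shows "loc_integrable (\<lambda>x. nonlin m (u x))"
proof (rule loc_integrable_bound[OF u])
  have um: "u \<in> borel_measurable lebesgue" using u by (simp add: mem_L2_iff)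
  show "(\<lambda>x. nonlin m (u x)) \<in> borel_measurable lebesgue" using um by measurable
  have "t powr m \<le> 1 + t\<^sup>2" if "0 \<le> t" for t :: real
  proof (cases "t \<le> 1")
    case True
    then have "t powr m \<le> 1" using that m by (intro powr_le1) auto
    then show ?thesis using zero_le_power2[of t] by linarith
  next
    case False
    then have "t powr m \<le> t powr 2" using m by (intro powr_mono) auto
    then show ?thesis using that by simp
  qed
  then show "cmod (nonlin m (u x)) \<le> 1 * (1 + (cmod (u x))\<^sup>2)" for x
    using m by (simp add: norm_nonlin)
qed

lemma conv_integrable:
  assumes k: "cc_kernel k" and g: "loc_integrable g"
  shows "integrable lebesgue (\<lambda>y. k (x - y) * g y)"
proof -
  obtain r where r: "\<And>x. k x \<noteq> 0 \<Longrightarrow> norm x \<le> r" using k by (auto simp: cc_kernel_def)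
  obtain B where B: "B > 0" "\<And>x. cmod (k x) \<le> B" using kernel_bounded[OF k] by blast
  have gm [measurable]: "g \<in> borel_measurable lebesgue" by (rule loc_integrable_measurable[OF g])
  have km [measurable]: "(\<lambda>y. k (x - y)) \<in> borel_measurable lebesgue"
    using kernel_measurable_lebesgue[OF k] by (rule borel_measurable_lebesgue_reflect)
  show ?thesis
  proof (rule Bochner_Integration.integrable_bound)
    show "integrable lebesgue (\<lambda>y. B *\<^sub>R (indicator (cball 0 (r + norm x)) y *\<^sub>R g y))"
      using g unfolding loc_integrable_def by (intro integrable_scaleR_right) blast
    show "(\<lambda>y. k (x - y) * g y) \<in> borel_measurable lebesgue" by measurable
    show "AE y in lebesgue. norm (k (x - y) * g y) \<le> norm (B *\<^sub>R (indicator (cball 0 (r + norm x)) y *\<^sub>R g y))"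
    proof (rule AE_I2)
      fix y
      have "norm y \<le> r + norm x" if "k (x - y) \<noteq> 0"
        using r[OF that] norm_triangle_ineq2[of y x] by (simp add: norm_minus_commute)
      then show "norm (k (x - y) * g y) \<le> norm (B *\<^sub>R (indicator (cball 0 (r + norm x)) y *\<^sub>R g y))"
        using B by (cases "k (x - y) = 0") (auto simp: norm_mult intro: mult_right_mono)
    qed
  qed
qed

lemma conv_diff:
  assumes "cc_kernel k" "loc_integrable g" "loc_integrable h"
  shows "conv k (\<lambda>x. g x - h x) x = conv k g x - conv k h x"
  using conv_integrable[OF assms(1,2), of x] conv_integrable[OF assms(1,3), of x]
  by (simp add: conv_def right_diff_distrib)

lemma conv_shift:
  assumes k: "cc_kernel k" and g: "g \<in> borel_measurable lebesgue"
  shows "conv k (\<lambda>y. g (y + h)) x = conv k g (x + h)"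
proof -
  have "(\<lambda>y. k ((x + h) - y) * g y) \<in> borel_measurable lebesgue"
    using g borel_measurable_lebesgue_reflect[OF kernel_measurable_lebesgue[OF k], of "x + h"] by measurable
  from integral_lebesgue_shift[OF this, of h] show ?thesis
    by (simp add: conv_def algebra_simps)
qed

lemma conv_cong_AE:
  assumes k: "cc_kernel k" and g: "g \<in> borel_measurable lebesgue" "g' \<in> borel_measurable lebesgue"
    and eq: "AE x in lebesgue. g x = g' x"
  shows "conv k g x = conv k g' x"
  unfolding conv_def
proof (rule integral_cong_AE)
  note [measurable] = borel_measurable_lebesgue_reflect[OF kernel_measurable_lebesgue[OF k], of x] g
  show "(\<lambda>y. k (x - y) * g y) \<in> borel_measurable lebesgue" "(\<lambda>y. k (x - y) * g' y) \<in> borel_measurable lebesgue"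
    by measurable
  show "AE y in lebesgue. k (x - y) * g y = k (x - y) * g' y" using eq by eventually_elim simp
qed

lemma conv_reflect:
  assumes k: "cc_kernel k" and g: "g \<in> borel_measurable lebesgue"
  shows "conv k g x = (\<integral>y. k y * g (x - y) \<partial>lebesgue)"
proof -
  have "(\<lambda>y. k (x - y) * g y) \<in> borel_measurable lebesgue"
    using g borel_measurable_lebesgue_reflect[OF kernel_measurable_lebesgue[OF k], of x] by measurable
  from integral_lebesgue_reflect[OF this, of x] show ?thesis by (simp add: conv_def)
qed

text \<open>Makes the value of a convolution at a point a continuous functional on L^2. This is how
  measurability and continuity in time pass from L^2-valued functions to scalar ones.\<close>

lemma conv_bound:
  assumes k: "cc_kernel k" and g: "g \<in> elems L2"
  shows "cmod (conv k g x) \<le> nrm L2 k * nrm L2 g"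
proof -
  have k2: "(\<lambda>y. k (x - y)) \<in> elems L2"
    using kernel_L2[OF k] integrable_lebesgue_reflect[of "\<lambda>y. (cmod (k y))\<^sup>2" x]
    by (auto simp: mem_L2_iff intro: borel_measurable_lebesgue_reflect)
  have "cmod (conv k g x) \<le> (\<integral>y. cmod (k (x - y)) * cmod (g y) \<partial>lebesgue)"
    unfolding conv_def norm_mult[symmetric] by (rule integral_norm_bound)
  also have "\<dots> \<le> nrm L2 (\<lambda>y. k (x - y)) * nrm L2 g"
    by (rule L2_Cauchy_Schwarz[OF k2 g])
  also have "nrm L2 (\<lambda>y. k (x - y)) = nrm L2 k"
    unfolding nrm_L2_eq using kernel_L2[OF k]
    by (subst integral_lebesgue_reflect[of "\<lambda>y. (cmod (k y))\<^sup>2" x]) (auto simp: mem_L2_iff)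
  finally show ?thesis .
qed

text \<open>Dominated convergence: a convergent sequence of points is bounded, so all kernels
  involved are supported in one ball, and a multiple of \<open>g\<close> on that ball
  dominates.\<close>

lemma conv_continuous:
  assumes k: "cc_kernel k" and g: "loc_integrable g"
  shows "continuous_on UNIV (conv k g)"
  unfolding continuous_on_eq_continuous_at[OF open_UNIV] continuous_at_sequentially
proof (intro ballI allI impI)
  fix x :: 'a and X :: "nat \<Rightarrow> 'a" assume X: "X \<longlonglongrightarrow> x"
  obtain r where r: "\<And>x. k x \<noteq> 0 \<Longrightarrow> norm x \<le> r" using k by (auto simp: cc_kernel_def)
  obtain B where B: "B > 0" "\<And>x. cmod (k x) \<le> B" using kernel_bounded[OF k] by blast
  obtain R where R: "\<And>n. norm (X n) \<le> R"
    using X convergent_imp_bounded[of X x] by (auto simp: bounded_iff)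
  have gm [measurable]: "g \<in> borel_measurable lebesgue" by (rule loc_integrable_measurable[OF g])
  have km [measurable]: "(\<lambda>y. k (x - y)) \<in> borel_measurable lebesgue" for x
    using kernel_measurable_lebesgue[OF k] by (rule borel_measurable_lebesgue_reflect)
  show "((conv k g) \<circ> X) \<longlonglongrightarrow> conv k g x"
    unfolding conv_def[abs_def] o_def
  proof (rule integral_dominated_convergence)
    show "integrable lebesgue (\<lambda>y. norm (B *\<^sub>R (indicator (cball 0 (r + R)) y *\<^sub>R g y)))"
      using g unfolding loc_integrable_def by (intro integrable_norm integrable_scaleR_right) blast
    have "isCont k z" for z using k by (simp add: cc_kernel_def continuous_on_eq_continuous_at)
    then show "AE y in lebesgue. (\<lambda>n. k (X n - y) * g y) \<longlonglongrightarrow> k (x - y) * g y"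
      by (intro AE_I2 tendsto_intros isCont_tendsto_compose[of _ k] X)
    show "AE y in lebesgue. norm (k (X n - y) * g y) \<le> norm (B *\<^sub>R (indicator (cball 0 (r + R)) y *\<^sub>R g y))" for n
    proof (rule AE_I2)
      fix y
      have "norm y \<le> r + R" if "k (X n - y) \<noteq> 0"
        using r[OF that] norm_triangle_ineq2[of y "X n"] R[of n] by (simp add: norm_minus_commute)
      then show "norm (k (X n - y) * g y) \<le> norm (B *\<^sub>R (indicator (cball 0 (r + R)) y *\<^sub>R g y))"
        using B by (cases "k (X n - y) = 0") (auto simp: norm_mult intro: mult_right_mono)
    qed
  qed measurable
qed


subsection \<open>Correlations\<close>

text \<open>The cross-correlation of \<open>u\<close> and \<open>v\<close>; its value at 0 is their
  L^2 pairing.\<close>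

definition corr :: "('a::euclidean_space \<Rightarrow> complex) \<Rightarrow> ('a \<Rightarrow> complex) \<Rightarrow> 'a \<Rightarrow> complex" where
  "corr u v h = (\<integral>x. u (x - h) * cnj (v x) \<partial>lebesgue)"

lemma borel_measurable_fst_snd [measurable]:
  "fst \<in> borel_measurable (borel :: ('a::euclidean_space \<times> 'b::euclidean_space) measure)"
  "snd \<in> borel_measurable (borel :: ('a::euclidean_space \<times> 'b::euclidean_space) measure)"
  by (intro borel_measurable_continuous_onI continuous_intros)+

lemma borel_measurable_cnj [measurable]: "cnj \<in> borel_measurable borel"
  by (intro borel_measurable_continuous_onI continuous_intros)

text \<open>Composition with \<open>x - y\<close> keeps Borel measurability on the product space.
  Fubini arguments are therefore run over \<open>lborel\<close> with Borel representatives and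
  carried back almost everywhere.\<close>

lemma lebesgue_ex_borel:
  fixes u :: "'a::euclidean_space \<Rightarrow> complex"
  assumes "u \<in> borel_measurable lebesgue"
  obtains u' where "u' \<in> borel_measurable borel" "AE x in lebesgue. u x = u' x"
proof -
  have "(\<lambda>x. Re (u x)) \<in> borel_measurable lebesgue" "(\<lambda>x. Im (u x)) \<in> borel_measurable lebesgue"
    using assms by measurable
  then obtain p q where p: "p \<in> borel_measurable lborel" "AE x in lborel. Re (u x) = p x"
    and q: "q \<in> borel_measurable lborel" "AE x in lborel. Im (u x) = q x"
    using completion_ex_borel_measurable_real by blast
  have "(\<lambda>x. Complex (p x) (q x)) \<in> borel_measurable borel"
    using p(1) q(1) unfolding borel_measurable_complex_iff by simp
  moreover have "AE x in lborel. u x = Complex (p x) (q x)"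
    using p(2) q(2) by eventually_elim (simp add: complex_eq_iff)
  then have "AE x in lebesgue. u x = Complex (p x) (q x)" by (rule AE_completion)
  ultimately show ?thesis by (rule that)
qed

lemma integrable_product_pair:
  fixes f :: "'a::euclidean_space \<Rightarrow> complex" and g :: "'b::euclidean_space \<Rightarrow> complex"
  assumes f: "integrable lborel f" and g: "integrable lborel g"
  shows integrable_lborel_product: "integrable lborel (\<lambda>q. f (fst q) * g (snd q))"
    and integral_lborel_product: "(\<integral>q. f (fst q) * g (snd q) \<partial>lborel) = (\<integral>x. f x \<partial>lborel) * (\<integral>x. g x \<partial>lborel)"
proof -
  have [measurable]: "f \<in> borel_measurable borel" "g \<in> borel_measurable borel"
    using f g by (auto dest: borel_measurable_integrable)
  have i: "integrable (lborel \<Otimes>\<^sub>M lborel) (\<lambda>q. f (fst q) * g (snd q))"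
  proof (rule lborel_pair.Fubini_integrable)
    show "integrable lborel (\<lambda>x. \<integral>y. norm (f (fst (x, y)) * g (snd (x, y))) \<partial>lborel)"
      using f by (simp add: norm_mult)
    show "AE x in lborel. integrable lborel (\<lambda>y. f (fst (x, y)) * g (snd (x, y)))"
      using g by simp
  qed measurable
  then show "integrable lborel (\<lambda>q. f (fst q) * g (snd q))" by (simp add: lborel_prod)
  show "(\<integral>q. f (fst q) * g (snd q) \<partial>lborel) = (\<integral>x. f x \<partial>lborel) * (\<integral>x. g x \<partial>lborel)"
    using lborel_pair.integral_fst'[OF i] by (simp add: lborel_prod)
qed

lemma integral_lborel_completion:
  fixes f :: "'a::euclidean_space \<Rightarrow> 'b::{banach, second_countable_topology}"
  shows "f \<in> borel_measurable borel \<Longrightarrow> (\<integral>x. f x \<partial>lebesgue) = (\<integral>x. f x \<partial>lborel)"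
  by (rule integral_completion) simp

lemma integrable_lborel_completion:
  fixes f :: "'a::euclidean_space \<Rightarrow> 'b::{banach, second_countable_topology}"
  shows "f \<in> borel_measurable borel \<Longrightarrow> integrable lebesgue f \<longleftrightarrow> integrable lborel f"
  by (rule integrable_completion) simp

text \<open>Fubini for \<open>k1 y * u (x - y) * cnj (k2 z * v (x - z))\<close> in the variables
  \<open>x\<close> and \<open>(y, z)\<close>. Integration over \<open>(y, z)\<close> gives the
  product of the two convolutions, integration over \<open>x\<close> gives the correlation at
  \<open>y - z\<close>. The bound \<open>G\<close> is uniform in the shift and does not refer to a
  particular pair of spaces, so it serves L^2 with L^2 as well as L^(m+1) with its dual.\<close>

lemma conv_correlation:
  fixes u v :: "'a::euclidean_space \<Rightarrow> complex"
  assumes k1: "cc_kernel k1" and k2: "cc_kernel k2" and u: "loc_integrable u" and v: "loc_integrable v"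
    and G: "\<And>h. (\<integral>\<^sup>+x. ennreal (cmod (u (x - h)) * cmod (v x)) \<partial>lebesgue) \<le> ennreal G" "0 \<le> G"
  shows conv_mult_integrable: "integrable lborel (\<lambda>x. conv k1 u x * cnj (conv k2 v x))"
    and conv_mult_kernel_integrable: "integrable lborel (\<lambda>q. k1 (fst q) * cnj (k2 (snd q)) * corr u v (fst q - snd q))"
    and conv_mult_integral: "(\<integral>x. conv k1 u x * cnj (conv k2 v x) \<partial>lborel) =
      (\<integral>q. k1 (fst q) * cnj (k2 (snd q)) * corr u v (fst q - snd q) \<partial>lborel)"
    and conv_mult_bound: "(\<integral>\<^sup>+x. ennreal (cmod (conv k1 u x * cnj (conv k2 v x))) \<partial>lborel) \<le>
      ennreal (G * (\<integral>x. cmod (k1 x) \<partial>lebesgue) * (\<integral>x. cmod (k2 x) \<partial>lebesgue))"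
proof -
  have um: "u \<in> borel_measurable lebesgue" and vm: "v \<in> borel_measurable lebesgue"
    using u v by (auto simp: loc_integrable_def)
  obtain u' where u': "u' \<in> borel_measurable borel" "AE x in lebesgue. u x = u' x"
    using lebesgue_ex_borel[OF um] by blast
  obtain v' where v': "v' \<in> borel_measurable borel" "AE x in lebesgue. v x = v' x"
    using lebesgue_ex_borel[OF vm] by blast
  note [measurable] = u'(1) v'(1) kernel_measurable[OF k1] kernel_measurable[OF k2]
  have um': "u' \<in> borel_measurable lebesgue" and vm': "v' \<in> borel_measurable lebesgue"
    using u'(1) v'(1) by (simp_all add: measurable_completion)
  define I where "I p = (case p of (x, (y, z)) \<Rightarrow> (k1 y * u' (x - y)) * (cnj (k2 z) * cnj (v' (x - z))))" for p
  have Im [measurable]: "I \<in> borel_measurable (lborel \<Otimes>\<^sub>M lborel)"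
  proof -
    have "I \<in> borel_measurable (borel \<Otimes>\<^sub>M (borel \<Otimes>\<^sub>M borel))" unfolding I_def case_prod_beta by measurable
    then have "I \<in> borel_measurable borel" by (simp add: borel_prod)
    then show ?thesis by (simp add: lborel_prod)
  qed
  have conv_eq: "conv k g x = (\<integral>y. k y * g' (x - y) \<partial>lborel)" "integrable lborel (\<lambda>y. k y * g' (x - y))"
    if "cc_kernel k" "loc_integrable g" "g' \<in> borel_measurable borel" "AE x in lebesgue. g x = g' x" for k g g' x
  proof -
    note [measurable] = kernel_measurable[OF that(1)] that(3)
    have gm: "g \<in> borel_measurable lebesgue" "g' \<in> borel_measurable lebesgue"
      using that by (auto simp: loc_integrable_def measurable_completion)
    show "conv k g x = (\<integral>y. k y * g' (x - y) \<partial>lborel)"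
      by (simp add: conv_cong_AE[OF that(1) gm that(4)] conv_reflect[OF that(1) gm(2)] integral_lborel_completion)
    have "integrable lebesgue (\<lambda>y. k (x - y) * g' y)"
    proof (subst integrable_cong_AE)
      note [measurable] = borel_measurable_lebesgue_reflect[OF kernel_measurable_lebesgue[OF that(1)], of x] gm
      show "(\<lambda>y. k (x - y) * g' y) \<in> borel_measurable lebesgue" "(\<lambda>y. k (x - y) * g y) \<in> borel_measurable lebesgue"
        by measurable
      show "AE y in lebesgue. k (x - y) * g' y = k (x - y) * g y" using that(4) by eventually_elim simp
    qed (rule conv_integrable[OF that(1,2)])
    from integrable_lebesgue_reflect[OF this, of x]
    have "integrable lebesgue (\<lambda>y. k y * g' (x - y))" by simp
    then show "integrable lborel (\<lambda>y. k y * g' (x - y))" by (subst (asm) integrable_lborel_completion) measurable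
  qed
  have slice: "conv k1 u x * cnj (conv k2 v x) = (\<integral>q. I (x, q) \<partial>lborel)" for x
  proof -
    have "cnj (conv k2 v x) = (\<integral>z. cnj (k2 z) * cnj (v' (x - z)) \<partial>lborel)"
      unfolding conv_eq(1)[OF k2 v v'] by (simp only: complex_cnj_mult[symmetric] Bochner_Integration.integral_cnj)
    moreover have i2: "integrable lborel (\<lambda>z. cnj (k2 z) * cnj (v' (x - z)))"
      using conv_eq(2)[OF k2 v v', of x] by (subst complex_integrable_cnj[symmetric]) simp
    ultimately show ?thesis
      using integral_lborel_product[OF conv_eq(2)[OF k1 u u'] i2]
      unfolding conv_eq(1)[OF k1 u u'] I_def case_prod_beta fst_conv snd_conv by simp
  qed
  \<comment> \<open>Translating \<open>x\<close> by \<open>z\<close> turns the inner integral into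
    an absolute correlation with shift \<open>y - z\<close>.\<close>
  have nn_eq: "(\<integral>\<^sup>+x. ennreal (cmod (u' (x - y)) * cmod (v' (x - z))) \<partial>lborel) \<le> ennreal G" for y z
  proof -
    have "(\<integral>\<^sup>+x. ennreal (cmod (u' (x - y)) * cmod (v' (x - z))) \<partial>lborel) =
      (\<integral>\<^sup>+x. ennreal (cmod (u' (x - y)) * cmod (v' (x - z))) \<partial>lebesgue)"
      by (simp add: nn_integral_completion)
    also have "\<dots> = (\<integral>\<^sup>+x. ennreal (cmod (u' ((x + z) - y)) * cmod (v' ((x + z) - z))) \<partial>lebesgue)"
      by (rule nn_integral_lebesgue_shift[symmetric], rule measurable_completion) measurable
    also have "\<dots> = (\<integral>\<^sup>+x. ennreal (cmod (u (x - (y - z))) * cmod (v x)) \<partial>lebesgue)"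
    proof (rule nn_integral_cong_AE)
      show "AE x in lebesgue. ennreal (cmod (u' (x + z - y)) * cmod (v' (x + z - z))) = ennreal (cmod (u (x - (y - z))) * cmod (v x))"
        using AE_lebesgue_shift[OF u'(2), of "- (y - z)"] v'(2) by eventually_elim (simp add: algebra_simps)
    qed
    also have "\<dots> \<le> ennreal G" by (rule G)
    finally show ?thesis .
  qed
  let ?A = "(\<integral>x. cmod (k1 x) \<partial>lebesgue)" and ?B = "(\<integral>x. cmod (k2 x) \<partial>lebesgue)"
  \<comment> \<open>Tonelli with \<open>x\<close> innermost: the uniform bound \<open>G\<close>
    comes out, and the kernels contribute their L^1 norms.\<close>
  have bound: "(\<integral>\<^sup>+x. (\<integral>\<^sup>+q. ennreal (norm (I (x, q))) \<partial>lborel) \<partial>lborel) \<le> ennreal (G * ?A * ?B)"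
  proof -
    have kn: "(\<integral>\<^sup>+x. ennreal (cmod (k x)) \<partial>lborel) = ennreal (\<integral>x. cmod (k x) \<partial>lebesgue)" if "cc_kernel k" for k :: "'a \<Rightarrow> complex"
      using kernel_integrable[OF that] kernel_measurable[OF that]
      by (subst nn_integral_completion[symmetric], subst nn_integral_eq_integral) auto
    have "(\<integral>\<^sup>+x. (\<integral>\<^sup>+q. ennreal (norm (I (x, q))) \<partial>lborel) \<partial>lborel) =
      (\<integral>\<^sup>+q. (\<integral>\<^sup>+x. ennreal (norm (I (x, q))) \<partial>lborel) \<partial>lborel)"
      by (rule lborel_pair.Fubini'[symmetric]) (simp add: case_prod_beta)
    also have "\<dots> \<le> (\<integral>\<^sup>+q. (ennreal (cmod (k1 (fst q))) * ennreal (cmod (k2 (snd q)))) * ennreal G \<partial>(lborel :: ('a \<times> 'a) measure))"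
    proof (rule nn_integral_mono)
      fix q :: "'a \<times> 'a"
      have "(\<integral>\<^sup>+x. ennreal (norm (I (x, q))) \<partial>lborel) =
        (\<integral>\<^sup>+x. (ennreal (cmod (k1 (fst q))) * ennreal (cmod (k2 (snd q)))) * ennreal (cmod (u' (x - fst q)) * cmod (v' (x - snd q))) \<partial>lborel)"
        unfolding I_def case_prod_beta fst_conv snd_conv
        by (rule nn_integral_cong) (simp add: norm_mult ennreal_mult' mult_ac)
      also have "\<dots> = (ennreal (cmod (k1 (fst q))) * ennreal (cmod (k2 (snd q)))) * (\<integral>\<^sup>+x. ennreal (cmod (u' (x - fst q)) * cmod (v' (x - snd q))) \<partial>lborel)"
        by (rule nn_integral_cmult) measurable
      also have "\<dots> \<le> (ennreal (cmod (k1 (fst q))) * ennreal (cmod (k2 (snd q)))) * ennreal G"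
        by (rule mult_left_mono[OF nn_eq]) simp
      finally show "(\<integral>\<^sup>+x. ennreal (norm (I (x, q))) \<partial>lborel) \<le> (ennreal (cmod (k1 (fst q))) * ennreal (cmod (k2 (snd q)))) * ennreal G" .
    qed
    also have "\<dots> = (\<integral>\<^sup>+q. (ennreal (cmod (k1 (fst q))) * ennreal (cmod (k2 (snd q)))) * ennreal G \<partial>(lborel \<Otimes>\<^sub>M lborel))"
      by (simp add: lborel_prod)
    also have "\<dots> = (\<integral>\<^sup>+y. \<integral>\<^sup>+z. (ennreal (cmod (k1 y)) * ennreal (cmod (k2 z))) * ennreal G \<partial>lborel \<partial>lborel)"
      by (subst lborel.nn_integral_fst[symmetric]) (auto simp: measurable_split_conv)
    also have "\<dots> = (\<integral>\<^sup>+y. ennreal (cmod (k1 y)) * (ennreal ?B * ennreal G) \<partial>lborel)"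
      by (simp add: nn_integral_multc nn_integral_cmult kn[OF k2] mult_ac)
    also have "\<dots> = ennreal ?A * (ennreal ?B * ennreal G)"
      by (simp add: nn_integral_multc kn[OF k1])
    also have "\<dots> = ennreal (G * ?A * ?B)"
      using G(2) by (simp add: ennreal_mult[symmetric] integral_nonneg_AE mult_ac)
    finally show ?thesis .
  qed
  have Iint: "integrable (lborel \<Otimes>\<^sub>M lborel) I"
  proof (rule integrableI_bounded)
    have "(\<integral>\<^sup>+p. ennreal (norm (I p)) \<partial>(lborel \<Otimes>\<^sub>M lborel)) = (\<integral>\<^sup>+x. (\<integral>\<^sup>+q. ennreal (norm (I (x, q))) \<partial>lborel) \<partial>lborel)"
      by (rule lborel.nn_integral_fst[symmetric]) measurable
    also note bound
    finally show "(\<integral>\<^sup>+p. ennreal (norm (I p)) \<partial>(lborel \<Otimes>\<^sub>M lborel)) < \<infinity>"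
      by (rule order.strict_trans1) simp
  qed measurable
  show "integrable lborel (\<lambda>x. conv k1 u x * cnj (conv k2 v x))"
    unfolding slice by (rule lborel_pair.integrable_fst'[OF Iint])
  have slice2: "(\<integral>x. I (x, q) \<partial>lborel) = k1 (fst q) * cnj (k2 (snd q)) * corr u v (fst q - snd q)" for q
  proof -
    let ?y = "fst q" and ?z = "snd q"
    have "(\<integral>x. I (x, q) \<partial>lborel) = k1 ?y * cnj (k2 ?z) * (\<integral>x. u' (x - ?y) * cnj (v' (x - ?z)) \<partial>lborel)"
      unfolding I_def case_prod_beta fst_conv snd_conv
      by (subst integral_mult_right_zero[symmetric]) (simp add: mult_ac)
    also have "(\<integral>x. u' (x - ?y) * cnj (v' (x - ?z)) \<partial>lborel) = (\<integral>x. u' (x - ?y) * cnj (v' (x - ?z)) \<partial>lebesgue)"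
      by (rule integral_lborel_completion[symmetric]) measurable
    also have "\<dots> = (\<integral>x. u' ((x + ?z) - ?y) * cnj (v' ((x + ?z) - ?z)) \<partial>lebesgue)"
      by (rule integral_lebesgue_shift[symmetric], rule measurable_completion) measurable
    also have "\<dots> = corr u v (?y - ?z)"
      unfolding corr_def
    proof (rule integral_cong_AE)
      show "(\<lambda>x. u' (x + ?z - ?y) * cnj (v' (x + ?z - ?z))) \<in> borel_measurable lebesgue"
        by (rule measurable_completion) measurable
      show "(\<lambda>x. u (x - (?y - ?z)) * cnj (v x)) \<in> borel_measurable lebesgue"
      proof -
        have "(\<lambda>x. u (x - (?y - ?z))) \<in> borel_measurable lebesgue"
          using borel_measurable_lebesgue_shift[OF um, of "?z - ?y"] by (simp add: algebra_simps)
        with vm show ?thesis by measurable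
      qed
      show "AE x in lebesgue. u' (x + ?z - ?y) * cnj (v' (x + ?z - ?z)) = u (x - (?y - ?z)) * cnj (v x)"
        using AE_lebesgue_shift[OF u'(2), of "- (?y - ?z)"] v'(2) by eventually_elim (simp add: algebra_simps)
    qed
    finally show ?thesis .
  qed
  have Iint': "integrable (lborel \<Otimes>\<^sub>M lborel) (\<lambda>(x, y). I (x, y))" using Iint by simp
  show "integrable lborel (\<lambda>q. k1 (fst q) * cnj (k2 (snd q)) * corr u v (fst q - snd q))"
    using lborel_pair.integrable_snd[OF Iint'] unfolding slice2 .
  show "(\<integral>x. conv k1 u x * cnj (conv k2 v x) \<partial>lborel) =
      (\<integral>q. k1 (fst q) * cnj (k2 (snd q)) * corr u v (fst q - snd q) \<partial>lborel)"
    using lborel_pair.Fubini_integral[OF Iint'] unfolding slice slice2 by simp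
  have "(\<integral>\<^sup>+x. ennreal (cmod (conv k1 u x * cnj (conv k2 v x))) \<partial>lborel) \<le> (\<integral>\<^sup>+x. (\<integral>\<^sup>+q. ennreal (norm (I (x, q))) \<partial>lborel) \<partial>lborel)"
  proof (rule nn_integral_mono_AE)
    show "AE x in lborel. ennreal (cmod (conv k1 u x * cnj (conv k2 v x))) \<le> (\<integral>\<^sup>+q. ennreal (norm (I (x, q))) \<partial>lborel)"
      using lborel_pair.AE_integrable_fst'[OF Iint]
      by eventually_elim (simp only: slice integral_norm_bound_ennreal)
  qed
  with bound show "(\<integral>\<^sup>+x. ennreal (cmod (conv k1 u x * cnj (conv k2 v x))) \<partial>lborel) \<le> ennreal (G * ?A * ?B)"
    by (rule order_trans[rotated])
qed

text \<open>Kernels are complex-valued so that they can be test functions; the second condition says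
  that \<open>\<rho>\<close> is real and nonnegative. Evenness is what later makes the Laplacian
  term real and removes signs from derivatives of reflected kernels.\<close>

definition mollifier :: "real \<Rightarrow> ('a::euclidean_space \<Rightarrow> complex) \<Rightarrow> bool" where
  "mollifier e \<rho> \<longleftrightarrow> cc_kernel \<rho> \<and> (\<forall>x. \<rho> x = of_real (cmod (\<rho> x))) \<and> (\<integral>x. cmod (\<rho> x) \<partial>lebesgue) = 1 \<and>
     (\<forall>x. \<rho> x \<noteq> 0 \<longrightarrow> norm x \<le> e) \<and> (\<forall>x. \<rho> (- x) = \<rho> x)"

lemma mollifierD:
  assumes "mollifier e \<rho>"
  shows mollifier_kernel: "cc_kernel \<rho>"
    and mollifier_norm: "\<rho> x = of_real (cmod (\<rho> x))"
    and mollifier_norm_integral: "(\<integral>x. cmod (\<rho> x) \<partial>lebesgue) = 1"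
    and mollifier_support: "\<rho> x \<noteq> 0 \<Longrightarrow> norm x \<le> e"
    and mollifier_even: "\<rho> (- x) = \<rho> x"
  using assms unfolding mollifier_def by blast+

lemma mollifier_cnj: "mollifier e \<rho> \<Longrightarrow> cnj (\<rho> x) = \<rho> x"
  by (metis complex_cnj_complex_of_real mollifier_norm)

lemma mollifier_integral:
  assumes "mollifier e \<rho>"
  shows "(\<integral>x. \<rho> x \<partial>lebesgue) = 1"
proof -
  have "(\<integral>x. \<rho> x \<partial>lebesgue) = (\<integral>x. of_real (cmod (\<rho> x)) \<partial>lebesgue)"
    by (rule Bochner_Integration.integral_cong[OF refl mollifier_norm[OF assms]])
  also have "\<dots> = of_real (\<integral>x. cmod (\<rho> x) \<partial>lebesgue)" by (rule integral_complex_of_real)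
  finally show ?thesis by (simp only: mollifier_norm_integral[OF assms] of_real_1)
qed

section \<open>Bounds and continuity at 0 of the correlations that occur in the energy
  identity\<close>

lemma nn_integral_le_of_integrable:
  assumes "integrable M f" "(\<integral>x. f x \<partial>M) \<le> C" "\<And>x. 0 \<le> f x"
  shows "(\<integral>\<^sup>+x. ennreal (f x) \<partial>M) \<le> ennreal C"
  using assms by (subst nn_integral_eq_integral) (auto intro: ennreal_leI)

lemma L2_mult_cnj_integrable:
  assumes "f \<in> elems L2" "g \<in> elems L2"
  shows "integrable lebesgue (\<lambda>x. f x * cnj (g x))"
proof (subst integrable_norm_iff[symmetric])
  show "(\<lambda>x. f x * cnj (g x)) \<in> borel_measurable lebesgue"
    using assms by measurable
  show "integrable lebesgue (\<lambda>x. norm (f x * cnj (g x)))"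
    using L2_mult_integrable[OF assms] by (simp add: norm_mult)
qed

lemma corr_L2_bound:
  assumes u: "u \<in> elems L2" and v: "v \<in> elems L2"
  shows "(\<integral>\<^sup>+x. ennreal (cmod (u (x - h)) * cmod (v x)) \<partial>lebesgue) \<le> ennreal (nrm L2 u * nrm L2 v)"
proof -
  have uh: "(\<lambda>x. u (x - h)) \<in> elems L2" "nrm L2 (\<lambda>x. u (x - h)) = nrm L2 u"
    using L2_shift[OF u, of "- h"] nrm_L2_shift[OF u, of "- h"] by simp_all
  show ?thesis
    using L2_Cauchy_Schwarz[OF uh(1) v] uh(2) L2_mult_integrable[OF uh(1) v]
    by (intro nn_integral_le_of_integrable) auto
qed

lemma corr_L2_continuous:
  assumes u: "u \<in> elems L2" and v: "v \<in> elems L2"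
  shows "((\<lambda>h. corr u v h) \<longlongrightarrow> corr u v 0) (nhds 0)"
proof -
  have b: "cmod (corr u v h - corr u v 0) \<le> nrm L2 (\<lambda>x. u (x + - h) - u x) * nrm L2 v" for h
  proof -
    have uh: "(\<lambda>x. u (x + - h)) \<in> elems L2" by (rule L2_shift[OF u])
    have i: "integrable lebesgue (\<lambda>x. u (x + - h) * cnj (v x))" "integrable lebesgue (\<lambda>x. u x * cnj (v x))"
      by (rule L2_mult_cnj_integrable[OF uh v] L2_mult_cnj_integrable[OF u v])+
    have "corr u v h - corr u v 0 = (\<integral>x. (u (x + - h) - u x) * cnj (v x) \<partial>lebesgue)"
      unfolding corr_def using i by (simp add: left_diff_distrib)
    also have "cmod \<dots> \<le> (\<integral>x. cmod (u (x + - h) - u x) * cmod (v x) \<partial>lebesgue)"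
      by (rule order_trans[OF integral_norm_bound]) (simp add: norm_mult)
    also have "\<dots> \<le> nrm L2 (\<lambda>x. u (x + - h) - u x) * nrm L2 v"
      by (rule L2_Cauchy_Schwarz[OF L2_diff[OF uh u] v])
    finally show ?thesis .
  qed
  have "filterlim (\<lambda>h. - h) (nhds 0) (nhds (0::'a))"
    using tendsto_minus[of "\<lambda>h. h" "0::'a" "nhds 0"] by (simp add: filterlim_ident)
  from filterlim_compose[OF L2_translation[OF u] this]
  have "((\<lambda>h. nrm L2 (\<lambda>x. u (x + - h) - u x) * nrm L2 v) \<longlongrightarrow> 0) (nhds 0)"
    by (rule tendsto_mult_left_zero)
  then have "((\<lambda>h. corr u v h - corr u v 0) \<longlongrightarrow> 0) (nhds 0)"
    by (rule Lim_null_comparison[rotated]) (intro always_eventually allI b)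
  then show ?thesis by (rule LIM_zero_cancel)
qed

text \<open>A form of Young's inequality with a free parameter, proved by splitting at
  \<open>y = \<eta> * x\<close>: on either side one of the two terms already dominates. A small
  \<open>\<eta>\<close> suppresses the factor that is merely bounded, while the other one is made to
  tend to 0.\<close>

lemma young_powr:
  fixes x y m \<eta> :: real
  assumes "0 \<le> x" "0 \<le> y" "0 < m" "0 < \<eta>"
  shows "x powr m * y \<le> \<eta> * x powr (m + 1) + \<eta> powr (- m) * y powr (m + 1)"
proof (cases "y \<le> \<eta> * x")
  case True
  have "x powr m * y \<le> x powr m * (\<eta> * x powr 1)" using True assms by (intro mult_left_mono) auto
  also have "\<dots> = \<eta> * x powr (m + 1)" by (simp only: powr_add mult_ac)
  finally show ?thesis by (simp add: add_increasing2)
next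
  case False
  then have "x \<le> y / \<eta>" using assms by (simp add: field_simps)
  then have "x powr m * y \<le> (y / \<eta>) powr m * y powr 1" using assms by (intro mult_mono powr_mono2) auto
  also have "\<dots> = \<eta> powr (- m) * (y powr m * y powr 1)"
    using assms by (simp add: powr_divide powr_minus_divide)
  also have "\<dots> = \<eta> powr (- m) * y powr (m + 1)" by (simp only: powr_add)
  finally show ?thesis using assms by (simp add: add_increasing)
qed

text \<open>The pairing of L^(m+1) with its dual, with Young's inequality in place of Hoelder's.
  Here \<open>N\<close> stands for the difference of two nonlinear terms and \<open>P\<close> for
  the sum of the two moduli, for which subadditivity up to the factor 2 is immediate.\<close>

lemma corr_power_pair:
  fixes N w :: "'a::euclidean_space \<Rightarrow> complex" and P :: "'a \<Rightarrow> real"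
  assumes m: "0 < m" and N: "N \<in> borel_measurable lebesgue" and w: "w \<in> elems (Lp (m + 1))"
    and P: "P \<in> borel_measurable lebesgue" "\<And>x. 0 \<le> P x" "integrable lebesgue (\<lambda>x. P x powr (m + 1))"
    and NP: "\<And>x. cmod (N x) \<le> 2 * P x powr m"
  shows corr_power_bound: "(\<integral>\<^sup>+x. ennreal (cmod (N (x - h)) * cmod (w x)) \<partial>lebesgue)
      \<le> ennreal (2 * ((\<integral>x. P x powr (m + 1) \<partial>lebesgue) + (\<integral>x. cmod (w x) powr (m + 1) \<partial>lebesgue)))"
    and corr_power_continuous: "((\<lambda>h. corr N w h) \<longlongrightarrow> corr N w 0) (nhds 0)"
proof -
  have wm [measurable]: "w \<in> borel_measurable lebesgue" and wi: "integrable lebesgue (\<lambda>x. cmod (w x) powr (m + 1))"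
    using w by (auto simp: mem_Lp_iff)
  have pair: "integrable lebesgue (\<lambda>x. cmod (N x) * cmod (g x))"
    "(\<integral>x. cmod (N x) * cmod (g x) \<partial>lebesgue) \<le>
      2 * (\<eta> * (\<integral>x. P x powr (m + 1) \<partial>lebesgue) + \<eta> powr (- m) * (\<integral>x. cmod (g x) powr (m + 1) \<partial>lebesgue))"
    if g: "g \<in> borel_measurable lebesgue" "integrable lebesgue (\<lambda>x. cmod (g x) powr (m + 1))" and \<eta>: "0 < \<eta>" for g \<eta>
  proof -
    have ii: "integrable lebesgue (\<lambda>x. 2 * (\<eta> * P x powr (m + 1) + \<eta> powr (- m) * cmod (g x) powr (m + 1)))"
      using P(3) g(2) by auto
    have le: "cmod (N x) * cmod (g x) \<le> 2 * (\<eta> * P x powr (m + 1) + \<eta> powr (- m) * cmod (g x) powr (m + 1))" for x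
    proof -
      have "cmod (N x) * cmod (g x) \<le> 2 * P x powr m * cmod (g x)" by (intro mult_right_mono NP) auto
      also have "\<dots> \<le> 2 * (\<eta> * P x powr (m + 1) + \<eta> powr (- m) * cmod (g x) powr (m + 1))"
        using young_powr[of "P x" "cmod (g x)" m \<eta>] P(2) m \<eta> by simp
      finally show ?thesis .
    qed
    show "integrable lebesgue (\<lambda>x. cmod (N x) * cmod (g x))"
    proof (rule Bochner_Integration.integrable_bound[OF ii])
      show "(\<lambda>x. cmod (N x) * cmod (g x)) \<in> borel_measurable lebesgue" using N g(1) by measurable
      show "AE x in lebesgue. norm (cmod (N x) * cmod (g x))
          \<le> norm (2 * (\<eta> * P x powr (m + 1) + \<eta> powr (- m) * cmod (g x) powr (m + 1)))"
        using le by (intro AE_I2) (auto intro: order_trans[OF _ abs_ge_self])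
    qed
    then have "(\<integral>x. cmod (N x) * cmod (g x) \<partial>lebesgue) \<le>
        (\<integral>x. 2 * (\<eta> * P x powr (m + 1) + \<eta> powr (- m) * cmod (g x) powr (m + 1)) \<partial>lebesgue)"
      using ii le by (intro integral_mono) auto
    also have "\<dots> = 2 * (\<eta> * (\<integral>x. P x powr (m + 1) \<partial>lebesgue) + \<eta> powr (- m) * (\<integral>x. cmod (g x) powr (m + 1) \<partial>lebesgue))"
      using P(3) g(2) by simp
    finally show "(\<integral>x. cmod (N x) * cmod (g x) \<partial>lebesgue) \<le>
      2 * (\<eta> * (\<integral>x. P x powr (m + 1) \<partial>lebesgue) + \<eta> powr (- m) * (\<integral>x. cmod (g x) powr (m + 1) \<partial>lebesgue))" .
  qed
  have ws: "(\<lambda>x. w (x + h)) \<in> borel_measurable lebesgue" "integrable lebesgue (\<lambda>x. cmod (w (x + h)) powr (m + 1))"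
    "(\<integral>x. cmod (w (x + h)) powr (m + 1) \<partial>lebesgue) = (\<integral>x. cmod (w x) powr (m + 1) \<partial>lebesgue)" for h
    using borel_measurable_lebesgue_shift[OF wm] integrable_lebesgue_shift[OF wi]
      integral_lebesgue_shift[OF borel_measurable_integrable[OF wi]] by auto
  have "(\<integral>\<^sup>+x. ennreal (cmod (N (x - h)) * cmod (w x)) \<partial>lebesgue) =
      (\<integral>\<^sup>+x. ennreal (cmod (N ((x + h) - h)) * cmod (w (x + h))) \<partial>lebesgue)"
  proof (rule nn_integral_lebesgue_shift[symmetric])
    show "(\<lambda>x. ennreal (cmod (N (x - h)) * cmod (w x))) \<in> borel_measurable lebesgue"
      using borel_measurable_lebesgue_shift[OF N, of "- h"] by simp
  qed
  also have "\<dots> \<le> ennreal (2 * ((\<integral>x. P x powr (m + 1) \<partial>lebesgue) + (\<integral>x. cmod (w x) powr (m + 1) \<partial>lebesgue)))"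
    using pair[OF ws(1,2), of 1 h] by (intro nn_integral_le_of_integrable) (auto simp: ws(3))
  finally show "(\<integral>\<^sup>+x. ennreal (cmod (N (x - h)) * cmod (w x)) \<partial>lebesgue)
      \<le> ennreal (2 * ((\<integral>x. P x powr (m + 1) \<partial>lebesgue) + (\<integral>x. cmod (w x) powr (m + 1) \<partial>lebesgue)))" .
  \<comment> \<open>The shift is moved from \<open>N\<close> to \<open>w\<close>, so only continuity
    of translations in L^(m+1) enters.\<close>
  have corr_eq: "corr N w h = (\<integral>x. N x * cnj (w (x + h)) \<partial>lebesgue)" for h
  proof -
    have "(\<lambda>x. N (x - h) * cnj (w x)) \<in> borel_measurable lebesgue"
      using borel_measurable_lebesgue_shift[OF N, of "- h"] by simp
    from integral_lebesgue_shift[OF this, of h] show ?thesis by (simp add: corr_def)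
  qed
  define T where "T h = (\<integral>x. cmod (w (x + h) - w x) powr (m + 1) \<partial>lebesgue)" for h
  have T: "(T \<longlongrightarrow> 0) (nhds 0)" unfolding T_def[abs_def] using m w by (intro Lp_translation) auto
  have T0: "0 \<le> T h" for h by (simp add: T_def integral_nonneg_AE)
  have wd: "(\<lambda>x. w (x + h) - w x) \<in> borel_measurable lebesgue" for h
    using borel_measurable_lebesgue_shift[OF wm, of h] by measurable
  have wdi: "integrable lebesgue (\<lambda>x. cmod (w (x + h) - w x) powr (m + 1))" for h
  proof (rule Bochner_Integration.integrable_bound)
    show "integrable lebesgue (\<lambda>x. 2 powr (m + 1) * (cmod (w (x + h)) powr (m + 1) + cmod (w x) powr (m + 1)))"
      using ws(2) wi by auto
    show "(\<lambda>x. cmod (w (x + h) - w x) powr (m + 1)) \<in> borel_measurable lebesgue" using wd[of h] by measurable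
    show "AE x in lebesgue. norm (cmod (w (x + h) - w x) powr (m + 1)) \<le>
        norm (2 powr (m + 1) * (cmod (w (x + h)) powr (m + 1) + cmod (w x) powr (m + 1)))"
    proof (rule AE_I2)
      fix x
      let ?p = "cmod (w (x + h))" and ?q = "cmod (w x)"
      have "cmod (w (x + h) - w x) \<le> 2 * max ?p ?q"
        using norm_triangle_ineq4[of "w (x + h)" "w x"] by linarith
      then have "cmod (w (x + h) - w x) powr (m + 1) \<le> (2 * max ?p ?q) powr (m + 1)"
        using m by (intro powr_mono2) auto
      also have "\<dots> = 2 powr (m + 1) * max ?p ?q powr (m + 1)" by (simp add: powr_mult)
      also have "\<dots> \<le> 2 powr (m + 1) * (?p powr (m + 1) + ?q powr (m + 1))"
        by (intro mult_left_mono) (auto simp: max_def)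
      finally show "norm (cmod (w (x + h) - w x) powr (m + 1)) \<le>
        norm (2 powr (m + 1) * (?p powr (m + 1) + ?q powr (m + 1)))" by simp
    qed
  qed
  define C where "C = (\<integral>x. P x powr (m + 1) \<partial>lebesgue)"
  have C0: "0 \<le> C" by (simp add: C_def integral_nonneg_AE)
  have diff: "cmod (corr N w h - corr N w 0) \<le> 2 * (\<eta> * C + \<eta> powr (- m) * T h)" if \<eta>: "0 < \<eta>" for h \<eta>
  proof -
    have i: "integrable lebesgue (\<lambda>x. N x * cnj (w (x + h)))" for h
      using pair(1)[OF ws(1,2) \<eta>, of h] N ws(1)[of h] by (subst integrable_norm_iff[symmetric]) (auto simp: norm_mult)
    have "corr N w h - corr N w 0 = (\<integral>x. N x * cnj (w (x + h) - w x) \<partial>lebesgue)"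
      unfolding corr_eq using i[of h] i[of 0] by (simp add: right_diff_distrib)
    also have "cmod \<dots> \<le> (\<integral>x. cmod (N x) * cmod (w (x + h) - w x) \<partial>lebesgue)"
      by (rule order_trans[OF integral_norm_bound]) (simp add: norm_mult flip: complex_cnj_diff)
    also have "\<dots> \<le> 2 * (\<eta> * C + \<eta> powr (- m) * T h)"
      unfolding C_def T_def by (rule pair(2)[OF wd wdi \<eta>])
    finally show ?thesis .
  qed
  show "((\<lambda>h. corr N w h) \<longlongrightarrow> corr N w 0) (nhds 0)"
    unfolding tendsto_iff
  proof (intro allI impI)
    fix e :: real assume e: "0 < e"
    \<comment> \<open>Chosen so that \<open>2 * \<eta> * C\<close> is at most e/2; the added 1
      covers \<open>C = 0\<close>.\<close>
    define \<eta> where "\<eta> = e / (4 * (C + 1))"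
    have \<eta>: "0 < \<eta>" "2 * (\<eta> * C) \<le> e / 2" using e C0 by (auto simp: \<eta>_def field_simps)
    have "((\<lambda>h. 2 * (\<eta> powr (- m) * T h)) \<longlongrightarrow> 0) (nhds 0)"
      by (intro tendsto_mult_right_zero T)
    then have "\<forall>\<^sub>F h in nhds 0. 2 * (\<eta> powr (- m) * T h) < e / 2"
      using e by (intro order_tendstoD(2)) auto
    then show "\<forall>\<^sub>F h in nhds 0. dist (corr N w h) (corr N w 0) < e"
    proof eventually_elim
      case (elim h)
      then show ?case using diff[OF \<eta>(1), of h] \<eta>(2) by (simp add: dist_norm distrib_left)
    qed
  qed
qed

text \<open>The mollified pairing is the average of \<open>corr u v (y - z)\<close> against the
  probability density \<open>\<rho> y * \<rho> z\<close>, which concentrates at the origin.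
  Convergence of the mollified functions themselves plays no part; continuity of the correlation at
  0 is enough.\<close>

lemma mollified_pairing_limit:
  fixes u v :: "'a::euclidean_space \<Rightarrow> complex"
  assumes u: "loc_integrable u" and v: "loc_integrable v"
    and G: "\<And>h. (\<integral>\<^sup>+x. ennreal (cmod (u (x - h)) * cmod (v x)) \<partial>lebesgue) \<le> ennreal G" "0 \<le> G"
    and c: "((\<lambda>h. corr u v h) \<longlongrightarrow> corr u v 0) (nhds 0)"
    and \<rho>: "\<And>n. mollifier (e n) (\<rho> n)" and e: "e \<longlonglongrightarrow> 0"
  shows "(\<lambda>n. \<integral>x. conv (\<rho> n) u x * cnj (conv (\<rho> n) v x) \<partial>lborel) \<longlonglongrightarrow> corr u v 0"
  unfolding tendsto_iff
proof (intro allI impI)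
  fix d :: real assume d: "0 < d"
  obtain s where s: "s > 0" "\<And>h. norm h < s \<Longrightarrow> cmod (corr u v h - corr u v 0) < d / 2"
    using tendstoD[OF c, of "d / 2"] d unfolding eventually_nhds_metric dist_norm by auto
  \<comment> \<open>Two points of the support differ by at most \<open>2 * e n\<close>.\<close>
  have "\<forall>\<^sub>F n in sequentially. e n < s / 2" using e s(1) by (intro order_tendstoD(2)) auto
  then show "\<forall>\<^sub>F n in sequentially. dist (\<integral>x. conv (\<rho> n) u x * cnj (conv (\<rho> n) v x) \<partial>lborel) (corr u v 0) < d"
  proof eventually_elim
    case (elim n)
    let ?r = "\<rho> n"
    have k: "cc_kernel ?r" by (rule mollifier_kernel[OF \<rho>])
    have supp: "norm x \<le> e n" if "?r x \<noteq> 0" for x by (rule mollifier_support[OF \<rho> that])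
    have rm [measurable]: "?r \<in> borel_measurable borel" by (rule kernel_measurable[OF k])
    have ri: "integrable lborel ?r" using kernel_integrable[OF k] by (simp add: integrable_lborel_completion)
    have r1: "(\<integral>x. ?r x \<partial>lborel) = 1"
      using mollifier_integral[OF \<rho>[of n]] by (simp add: integral_lborel_completion)
    have cn: "cnj (?r x) = ?r x" for x by (rule mollifier_cnj[OF \<rho>])
    have rr: "integrable lborel (\<lambda>q. ?r (fst q) * ?r (snd q))" "(\<integral>q. ?r (fst q) * ?r (snd q) \<partial>lborel) = 1"
      using integrable_lborel_product[OF ri ri] integral_lborel_product[OF ri ri] r1 by auto
    have nr: "integrable lborel (\<lambda>x. complex_of_real (cmod (?r x)))"
      using ri by (simp only: mollifier_norm[OF \<rho>, symmetric])
    have nri: "(\<integral>x. complex_of_real (cmod (?r x)) \<partial>lborel) = 1"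
      by (simp only: mollifier_norm[OF \<rho>, symmetric] r1)
    have nrr: "(\<integral>q. cmod (?r (fst q) * ?r (snd q)) \<partial>lborel) = 1"
    proof -
      have "complex_of_real (\<integral>q. cmod (?r (fst q) * ?r (snd q)) \<partial>lborel) =
        (\<integral>q. complex_of_real (cmod (?r (fst q))) * complex_of_real (cmod (?r (snd q))) \<partial>lborel)"
        by (simp only: norm_mult of_real_mult[symmetric] integral_complex_of_real)
      also have "\<dots> = 1"
        by (subst integral_lborel_product[OF nr nr]) (simp only: nri mult_1)
      finally show ?thesis by (simp only: of_real_eq_1_iff)
    qed
    let ?f = "\<lambda>q. ?r (fst q) * ?r (snd q) * corr u v (fst q - snd q)"
    have fi: "integrable lborel ?f" and fe: "(\<integral>x. conv ?r u x * cnj (conv ?r v x) \<partial>lborel) = (\<integral>q. ?f q \<partial>lborel)"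
      using conv_mult_kernel_integrable[OF k k u v G] conv_mult_integral[OF k k u v G] by (simp_all add: cn)
    have "(\<integral>q. ?f q \<partial>lborel) - corr u v 0 = (\<integral>q. ?r (fst q) * ?r (snd q) * (corr u v (fst q - snd q) - corr u v 0) \<partial>lborel)"
      using fi rr by (simp add: right_diff_distrib)
    also have "cmod \<dots> \<le> (\<integral>q. cmod (?r (fst q) * ?r (snd q)) * (d / 2) \<partial>lborel)"
    proof (rule Bochner_Integration.integral_norm_bound_integral)
      show "integrable lborel (\<lambda>q. ?r (fst q) * ?r (snd q) * (corr u v (fst q - snd q) - corr u v 0))"
        using fi rr by (simp add: right_diff_distrib)
      show "integrable lborel (\<lambda>q. cmod (?r (fst q) * ?r (snd q)) * (d / 2))"
        using rr(1) by (intro integrable_mult_left integrable_norm)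
      fix q :: "'a \<times> 'a"
      show "cmod (?r (fst q) * ?r (snd q) * (corr u v (fst q - snd q) - corr u v 0)) \<le> cmod (?r (fst q) * ?r (snd q)) * (d / 2)"
      proof (cases "?r (fst q) * ?r (snd q) = 0")
        case False
        then have "norm (fst q) \<le> e n" "norm (snd q) \<le> e n" using supp by auto
        then have "norm (fst q - snd q) < s"
          using elim norm_triangle_ineq4[of "fst q" "snd q"] by linarith
        from s(2)[OF this] show ?thesis unfolding norm_mult by (intro mult_left_mono) auto
      qed auto
    qed
    also have "\<dots> = d / 2" using nrr by simp
    finally show ?case unfolding dist_norm fe using d by linarith
  qed
qed

text \<open>An autocorrelation is Hermitian: conjugation equals reflection of the argument. Since
  both kernels are real and even, the substitution \<open>q \<mapsto> -q\<close> shows that the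
  integral equals its conjugate. With \<open>L\<close> the Laplacian of \<open>r\<close> this
  replaces the integration by parts that makes the pairing of \<open>w\<close> with its Laplacian
  real, and \<open>w\<close> is never differentiated.\<close>

lemma conv_laplace_real:
  assumes L: "cc_kernel L" "\<And>x. cnj (L x) = L x" "\<And>x. L (- x) = L x"
    and r: "cc_kernel r" "\<And>x. cnj (r x) = r x" "\<And>x. r (- x) = r x" and w: "w \<in> elems L2"
  shows "Im (\<integral>x. conv L w x * cnj (conv r w x) \<partial>lborel) = 0"
proof -
  have wl: "loc_integrable w" by (rule L2_loc_integrable[OF w])
  have wm: "w \<in> borel_measurable lebesgue" using w by (simp add: mem_L2_iff)
  note * = conv_correlation[OF L(1) r(1) wl wl corr_L2_bound[OF w w]]
  have cc: "cnj (corr w w h) = corr w w (- h)" for h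
  proof -
    have "(\<lambda>x. w (x - h) * cnj (w x)) \<in> borel_measurable lebesgue"
      using borel_measurable_lebesgue_shift[OF wm, of "- h"] wm by simp
    from integral_lebesgue_shift[OF this, of h]
    have "corr w w h = (\<integral>x. w x * cnj (w (x + h)) \<partial>lebesgue)" by (simp add: corr_def)
    then show ?thesis
      by (simp only: Bochner_Integration.integral_cnj[symmetric]) (simp add: corr_def mult.commute)
  qed
  let ?f = "\<lambda>q. L (fst q) * r (snd q) * corr w w (fst q - snd q)"
  have e: "(\<integral>x. conv L w x * cnj (conv r w x) \<partial>lborel) = (\<integral>q. ?f q \<partial>lborel)"
    using *(3) by (simp add: r)
  have fm: "?f \<in> borel_measurable borel" using *(2) by (auto simp: r dest: borel_measurable_integrable)
  have "cnj (\<integral>q. ?f q \<partial>lborel) = (\<integral>q. L (fst q) * r (snd q) * corr w w (snd q - fst q) \<partial>lborel)"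
    by (simp only: Bochner_Integration.integral_cnj[symmetric]) (simp add: cc L r)
  also have "\<dots> = (\<integral>q. ?f (0 - q) \<partial>lborel)" by (simp add: L r)
  also have "\<dots> = (\<integral>q. ?f (0 - q) \<partial>lebesgue)"
  proof (rule integral_lborel_completion[symmetric])
    have "(\<lambda>q. 0 - q) \<in> borel \<rightarrow>\<^sub>M (borel :: ('a \<times> 'a) measure)" by measurable
    from measurable_compose[OF this fm] show "(\<lambda>q. ?f (0 - q)) \<in> borel_measurable borel" .
  qed
  also have "\<dots> = (\<integral>q. ?f q \<partial>lebesgue)"
    by (rule integral_lebesgue_reflect) (use fm in \<open>simp add: measurable_completion\<close>)
  also have "\<dots> = (\<integral>q. ?f q \<partial>lborel)" by (rule integral_lborel_completion[OF fm])
  finally have "cnj (\<integral>q. ?f q \<partial>lborel) = (\<integral>q. ?f q \<partial>lborel)" .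
  then show ?thesis unfolding e by (simp only: complex_eq_iff cnj.simps) linarith
qed

subsection \<open>Smooth functions\<close>

lemma dir_deriv_eq: "(\<phi> has_derivative D) (at x) \<Longrightarrow> dir_deriv \<phi> v x = D v"
  by (simp add: dir_deriv_def frechet_derivative_at[symmetric])

lemma differentiable_has_dir_deriv:
  assumes "\<phi> differentiable (at x)"
  shows "(\<phi> has_derivative (\<lambda>v. dir_deriv \<phi> v x)) (at x)"
  using assms by (simp add: dir_deriv_def frechet_derivative_works)

lemma Ck_SucI:
  assumes "\<And>x. (\<phi> has_derivative D x) (at x)" "\<And>v. Ck k (\<lambda>x. D x v)"
  shows "Ck (Suc k) \<phi>"
proof -
  have "dir_deriv \<phi> v = (\<lambda>x. D x v)" for v
    using assms(1) by (auto simp: dir_deriv_eq)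
  then show ?thesis using assms by (auto simp: differentiable_def)
qed

lemma Ck_Suc_imp_Ck: "Ck (Suc k) \<phi> \<Longrightarrow> Ck k \<phi>"
proof (induction k arbitrary: \<phi>)
  case 0
  then show ?case
    by (auto simp: continuous_on_eq_continuous_at intro: differentiable_imp_continuous_within)
qed auto

lemma Ck_continuous: "Ck k \<phi> \<Longrightarrow> continuous_on UNIV \<phi>"
proof (induction k)
  case (Suc k)
  show ?case by (rule Suc.IH[OF Ck_Suc_imp_Ck[OF Suc.prems]])
qed simp

lemma Ck_const: "Ck k (\<lambda>x. c)"
proof (induction k arbitrary: c)
  case (Suc k)
  show ?case by (rule Ck_SucI[of _ "\<lambda>_ _. 0"]) (auto intro: Suc)
qed simp

lemma Ck_add: "Ck k f \<Longrightarrow> Ck k g \<Longrightarrow> Ck k (\<lambda>x. f x + g x)"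
proof (induction k arbitrary: f g)
  case (Suc k)
  show ?case
  proof (rule Ck_SucI)
    show "((\<lambda>x. f x + g x) has_derivative (\<lambda>v. dir_deriv f v x + dir_deriv g v x)) (at x)" for x
      using Suc.prems by (intro has_derivative_add differentiable_has_dir_deriv) auto
    show "Ck k (\<lambda>x. dir_deriv f v x + dir_deriv g v x)" for v
      using Suc.prems by (intro Suc.IH) auto
  qed
qed (auto intro: continuous_on_add)

lemma Ck_mult: "Ck k f \<Longrightarrow> Ck k g \<Longrightarrow> Ck k (\<lambda>x. f x * g x)"
proof (induction k arbitrary: f g)
  case (Suc k)
  show ?case
  proof (rule Ck_SucI)
    show "((\<lambda>x. f x * g x) has_derivative (\<lambda>v. f x * dir_deriv g v x + dir_deriv f v x * g x)) (at x)" for x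
      using Suc.prems by (intro has_derivative_mult differentiable_has_dir_deriv) auto
    show "Ck k (\<lambda>x. f x * dir_deriv g v x + dir_deriv f v x * g x)" for v
      using Suc.prems Ck_Suc_imp_Ck[OF Suc.prems(1)] Ck_Suc_imp_Ck[OF Suc.prems(2)]
      by (intro Ck_add Suc.IH) auto
  qed
qed (auto intro: continuous_on_mult)

lemma Ck_cmult: "Ck k f \<Longrightarrow> Ck k (\<lambda>x. c * f x)"
  by (rule Ck_mult[OF Ck_const])

lemma Ck_diff: "Ck k f \<Longrightarrow> Ck k g \<Longrightarrow> Ck k (\<lambda>x. f x - g x)"
  using Ck_add[of k f "\<lambda>x. (-1) * g x"] Ck_cmult[of k g "-1"] by simp

lemma Ck_compose_affine:
  fixes A :: "'b::euclidean_space \<Rightarrow> 'a::euclidean_space"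
  assumes "bounded_linear A"
  shows "Ck k f \<Longrightarrow> Ck k (\<lambda>x. f (c + A x))"
proof (induction k arbitrary: f)
  case 0
  have "continuous_on UNIV (\<lambda>x. c + A x)"
    using assms by (intro continuous_intros linear_continuous_on)
  then show ?case using 0 by (auto intro: continuous_on_compose2)
next
  case (Suc k)
  show ?case
  proof (rule Ck_SucI)
    show "((\<lambda>x. f (c + A x)) has_derivative (\<lambda>v. dir_deriv f (A v) (c + A x))) (at x)" for x
    proof (rule has_derivative_compose[of "\<lambda>x. c + A x" A x UNIV f "\<lambda>v. dir_deriv f v (c + A x)"])
      show "((\<lambda>x. c + A x) has_derivative A) (at x)"
        using has_derivative_add[OF has_derivative_const[of c] bounded_linear_imp_has_derivative[OF assms]] by simp
    qed (use Suc.prems in \<open>auto intro: differentiable_has_dir_deriv\<close>)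
    show "Ck k (\<lambda>x. dir_deriv f (A v) (c + A x))" for v
      using Suc.prems by (intro Suc.IH) auto
  qed
qed

lemma Ck_inner: "Ck k (\<lambda>x. complex_of_real (x \<bullet> v))"
proof (cases k)
  case 0
  then show ?thesis by (auto intro!: continuous_intros)
next
  case (Suc j)
  show ?thesis unfolding Suc
  proof (rule Ck_SucI)
    show "((\<lambda>x. complex_of_real (x \<bullet> v)) has_derivative (\<lambda>h. complex_of_real (h \<bullet> v))) (at x)" for x
      by (auto intro!: derivative_eq_intros)
  qed (rule Ck_const)
qed

lemma Ck_antiderivative:
  fixes B \<beta> :: "real \<Rightarrow> complex"
  assumes B: "\<And>t. (B has_vector_derivative \<beta> t) (at t)" and \<beta>: "\<And>k. Ck k \<beta>"
  shows "Ck k B"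
proof -
  have "Ck (Suc k) B" for k
  proof (rule Ck_SucI)
    show "(B has_derivative (\<lambda>v. v *\<^sub>R \<beta> t)) (at t)" for t
      using B[of t] by (simp add: has_vector_derivative_def)
    show "Ck k (\<lambda>t. v *\<^sub>R \<beta> t)" for v
      using Ck_cmult[OF \<beta>, of k "of_real v"] by (simp add: scaleR_conv_of_real)
  qed
  then show ?thesis using Ck_Suc_imp_Ck by blast
qed

section \<open>Support, reality and parity of derivatives of kernels\<close>

lemma dir_deriv_support:
  assumes "\<And>x. \<phi> x \<noteq> 0 \<Longrightarrow> norm x \<le> r" "dir_deriv \<phi> v x \<noteq> 0"
  shows "norm x \<le> r"
proof (rule ccontr)
  assume "\<not> norm x \<le> r"
  then have x: "x \<in> - cball 0 r" by simp
  have "((\<lambda>_. 0) has_derivative (\<lambda>_. 0)) (at x)" by simp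
  then have "(\<phi> has_derivative (\<lambda>_. 0)) (at x)"
    by (rule has_derivative_transform_within_open[OF _ open_Compl[OF closed_cball] x]) (use assms(1) in force)
  then show False using assms(2) by (simp add: dir_deriv_eq)
qed

lemma test_fun_cc_kernel:
  assumes "k \<in> test_fun UNIV"
  shows "cc_kernel k"
proof -
  have "compact (closure {x. k x \<noteq> 0})" "continuous_on UNIV k"
    using assms by (auto simp: test_fun_def intro: Ck_continuous)
  then show ?thesis unfolding cc_kernel_def
    using compact_imp_bounded[of "closure {x. k x \<noteq> 0}"] closure_subset[of "{x. k x \<noteq> 0}"]
    by (auto simp: bounded_iff)
qed

lemma cc_kernel_dir_deriv:
  assumes "cc_kernel k" "\<And>n. Ck n k"
  shows "cc_kernel (dir_deriv k v)"
proof -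
  obtain r where r: "\<And>x. k x \<noteq> 0 \<Longrightarrow> norm x \<le> r" using assms(1) by (auto simp: cc_kernel_def)
  have "Ck 0 (dir_deriv k v)" using assms(2)[of "Suc 0"] by simp
  then show ?thesis using dir_deriv_support[OF r] by (auto simp: cc_kernel_def)
qed

lemma Ck_dir_deriv: "(\<And>n. Ck n k) \<Longrightarrow> Ck n (dir_deriv k v)"
  by (metis Ck.simps(2))

lemma cc_kernel_sum:
  assumes "finite I" "\<And>i. i \<in> I \<Longrightarrow> cc_kernel (k i)"
  shows "cc_kernel (\<lambda>x. \<Sum>i\<in>I. k i x)"
  using assms
proof (induction I)
  case empty
  then show ?case by (auto simp: cc_kernel_def)
next
  case (insert i I)
  have ki: "cc_kernel (k i)" and kI: "cc_kernel (\<lambda>x. \<Sum>i\<in>I. k i x)" using insert by auto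
  obtain r where r: "\<And>x. k i x \<noteq> 0 \<Longrightarrow> norm x \<le> r" using ki by (auto simp: cc_kernel_def)
  obtain s where s: "\<And>x. (\<Sum>i\<in>I. k i x) \<noteq> 0 \<Longrightarrow> norm x \<le> s" using kI by (auto simp: cc_kernel_def)
  have "norm x \<le> max r s" if "k i x + (\<Sum>i\<in>I. k i x) \<noteq> 0" for x
    using that r[of x] s[of x] by (cases "k i x = 0") auto
  moreover have "continuous_on UNIV (\<lambda>x. k i x + (\<Sum>i\<in>I. k i x))"
    using ki kI by (auto simp: cc_kernel_def intro: continuous_on_add)
  ultimately show ?case using insert(1,2) unfolding cc_kernel_def by auto
qed

lemma laplacian_kernel:
  assumes "cc_kernel k" "\<And>n. Ck n k"
  shows "cc_kernel (laplacian k)"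
  unfolding laplacian_def[abs_def]
  using assms by (intro cc_kernel_sum cc_kernel_dir_deriv Ck_dir_deriv) auto

lemma dir_deriv_cnj:
  assumes "\<phi> differentiable (at x)" "\<And>x. cnj (\<phi> x) = \<phi> x"
  shows "cnj (dir_deriv \<phi> v x) = dir_deriv \<phi> v x"
proof -
  have "((\<lambda>x. cnj (\<phi> x)) has_derivative (\<lambda>v. cnj (dir_deriv \<phi> v x))) (at x)"
    by (rule bounded_linear.has_derivative[OF bounded_linear_cnj differentiable_has_dir_deriv[OF assms(1)]])
  moreover have "(\<lambda>x. cnj (\<phi> x)) = \<phi>" using assms(2) by (rule ext)
  ultimately have "(\<phi> has_derivative (\<lambda>v. cnj (dir_deriv \<phi> v x))) (at x)" by (simp only:)
  from dir_deriv_eq[OF this, of v] show ?thesis by (rule sym)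
qed

lemma dir_deriv_reflect:
  assumes "\<phi> differentiable (at (c - x))"
  shows "dir_deriv (\<lambda>x. \<phi> (c - x)) v x = - dir_deriv \<phi> v (c - x)"
proof -
  have "((\<lambda>x. \<phi> (c - x)) has_derivative (\<lambda>v. dir_deriv \<phi> (- v) (c - x))) (at x)"
    by (rule has_derivative_compose[of "\<lambda>x. c - x" uminus x UNIV \<phi> "\<lambda>v. dir_deriv \<phi> v (c - x)"])
       (auto intro!: derivative_eq_intros differentiable_has_dir_deriv assms)
  moreover have "dir_deriv \<phi> (- v) (c - x) = - dir_deriv \<phi> v (c - x)"
    by (rule linear_neg[OF bounded_linear.linear[OF has_derivative_bounded_linear[OF differentiable_has_dir_deriv[OF assms]]]])
  ultimately show ?thesis by (simp add: dir_deriv_eq)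
qed

lemma laplacian_cnj:
  assumes "\<And>n. Ck n k" "\<And>x. cnj (k x) = k x"
  shows "cnj (laplacian k x) = laplacian k x"
proof -
  have d: "k differentiable (at x)" "dir_deriv k v differentiable (at x)" for x v
    using assms(1)[of "Suc 0"] Ck_dir_deriv[OF assms(1), of "Suc 0" v] by auto
  have "cnj (dir_deriv (dir_deriv k i) i x) = dir_deriv (dir_deriv k i) i x" for i
    by (rule dir_deriv_cnj[OF d(2) dir_deriv_cnj[OF d(1) assms(2)]])
  then show ?thesis by (simp add: laplacian_def)
qed

text \<open>A directional derivative of an even function is odd, and a second one restores
  evenness.\<close>

lemma laplacian_even:
  assumes "\<And>n. Ck n k" "\<And>x. k (- x) = k x"
  shows "laplacian k (- x) = laplacian k x"
proof -
  have d: "k differentiable (at x)" "dir_deriv k v differentiable (at x)" for x v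
    using assms(1)[of "Suc 0"] Ck_dir_deriv[OF assms(1), of "Suc 0" v] by auto
  have k: "(\<lambda>x. k (0 - x)) = k" using assms(2) by simp
  have o: "dir_deriv k v (- x) = - dir_deriv k v x" for v x
    using dir_deriv_reflect[of k 0 x v, OF d(1), unfolded k] by simp
  have "dir_deriv (dir_deriv k v) v (- x) = dir_deriv (dir_deriv k v) v x" for v x
  proof -
    have e: "(\<lambda>x. dir_deriv k v (0 - x)) = (\<lambda>x. - dir_deriv k v x)" by (simp add: o)
    have "dir_deriv (\<lambda>x. - dir_deriv k v x) v x = - dir_deriv (dir_deriv k v) v (0 - x)"
      using dir_deriv_reflect[of "dir_deriv k v" 0 x v, OF d(2), unfolded e] .
    moreover have "dir_deriv (\<lambda>x. - dir_deriv k v x) v x = - dir_deriv (dir_deriv k v) v x"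
      by (rule dir_deriv_eq[OF has_derivative_minus[OF differentiable_has_dir_deriv[OF d(2)]]])
    ultimately show ?thesis by simp
  qed
  then show ?thesis by (simp add: laplacian_def)
qed


subsection \<open>Smooth mollifiers\<close>

text \<open>The function \<open>r powr (-j) * exp (-1/r)\<close>, extended by 0 to
  \<open>r \<le> 0\<close>. The whole family in \<open>j\<close> is introduced because
  differentiation maps it into its own span, so smoothness of the case \<open>j = 0\<close> follows
  by induction over all \<open>j\<close> at once.\<close>

definition flat_exp :: "nat \<Rightarrow> real \<Rightarrow> real" where
  "flat_exp j r = (if r > 0 then (1 / r) ^ j / exp (1 / r) else 0)"

lemma flat_exp_deriv:
  "(flat_exp j has_real_derivative (flat_exp (j + 2) r - real j * flat_exp (j + 1) r)) (at r)"
proof -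
  consider "r < 0" | "r = 0" | "r > 0" by linarith
  then show ?thesis
  proof cases
    case 1
    have "((\<lambda>_. 0) has_real_derivative 0) (at r)" by simp
    then have "(flat_exp j has_real_derivative 0) (at r)"
      by (rule has_field_derivative_transform_within_open[of _ _ _ "{..<0}"]) (use 1 in \<open>auto simp: flat_exp_def\<close>)
    then show ?thesis using 1 by (simp add: flat_exp_def)
  next
    case 2
    have "((\<lambda>r. (flat_exp j r - flat_exp j 0) / (r - 0)) \<longlongrightarrow> 0) (at 0)"
    proof (rule filterlim_split_at)
      show "((\<lambda>r. (flat_exp j r - flat_exp j 0) / (r - 0)) \<longlongrightarrow> 0) (at_left 0)"
        by (rule tendsto_eventually) (auto simp: eventually_at_filter flat_exp_def)
      \<comment> \<open>In terms of \<open>inverse r\<close>, which tends to infinity, the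
        difference quotient at 0 is a power divided by an exponential.\<close>
      have "((\<lambda>r. inverse r ^ (j + 1) / exp (inverse r)) \<longlongrightarrow> 0) (at_right (0::real))"
        by (rule filterlim_compose[OF tendsto_power_div_exp_0 filterlim_inverse_at_top_right])
      moreover have "\<forall>\<^sub>F r in at_right 0. inverse r ^ (j + 1) / exp (inverse r) = (flat_exp j r - flat_exp j 0) / (r - 0)"
        by (auto simp: eventually_at_filter flat_exp_def divide_inverse mult_ac)
      ultimately show "((\<lambda>r. (flat_exp j r - flat_exp j 0) / (r - 0)) \<longlongrightarrow> 0) (at_right 0)"
        by (rule Lim_transform_eventually)
    qed
    then have "(flat_exp j has_real_derivative 0) (at 0)" by (simp add: has_field_derivative_iff)
    then show ?thesis using 2 by (simp add: flat_exp_def)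
  next
    case 3
    define y where "y = inverse r"
    have fe: "flat_exp i r = y ^ i * exp (- y)" for i
      using 3 by (simp add: flat_exp_def y_def exp_minus divide_inverse)
    have dy: "(inverse has_real_derivative - (y * y)) (at r)"
      using DERIV_inverse[of r] 3 by (simp add: y_def)
    have d1: "((\<lambda>r. inverse r ^ j) has_real_derivative real j * (- (y * y) * y ^ (j - 1))) (at r)"
      using DERIV_power[of inverse, OF dy, of j] by (simp add: y_def)
    have d2: "((\<lambda>r. exp (- inverse r)) has_real_derivative exp (- y) * (y * y)) (at r)"
      using DERIV_fun_exp[OF DERIV_minus[OF dy]] by (simp add: y_def)
    have "((\<lambda>r. inverse r ^ j * exp (- inverse r)) has_real_derivative
        real j * (- (y * y) * y ^ (j - 1)) * exp (- y) + exp (- y) * (y * y) * y ^ j) (at r)"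
      using DERIV_mult[OF d1 d2] by (simp add: y_def)
    then have "(flat_exp j has_real_derivative
        real j * (- (y * y) * y ^ (j - 1)) * exp (- y) + exp (- y) * (y * y) * y ^ j) (at r)"
      by (rule has_field_derivative_transform_within_open[of _ _ _ "{0<..}"])
         (use 3 in \<open>auto simp: flat_exp_def exp_minus divide_inverse\<close>)
    moreover have "real j * (- (y * y) * y ^ (j - 1)) * exp (- y) + exp (- y) * (y * y) * y ^ j
      = flat_exp (j + 2) r - real j * flat_exp (j + 1) r"
      unfolding fe by (cases j) (simp_all add: algebra_simps)
    ultimately show ?thesis by simp
  qed
qed

lemma Ck_flat_exp: "Ck k (\<lambda>x::'a::euclidean_space. complex_of_real (flat_exp j (c - x \<bullet> x)))"
proof (induction k arbitrary: j)
  case 0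
  have "continuous_on UNIV (flat_exp j)"
    by (rule DERIV_continuous_on[OF DERIV_subset[OF flat_exp_deriv]]) simp
  then have "continuous_on UNIV (\<lambda>x::'a. flat_exp j (c - x \<bullet> x))"
    by (rule continuous_on_compose2) (auto intro!: continuous_intros)
  then show ?case by (auto intro!: continuous_intros)
next
  case (Suc k)
  let ?D = "\<lambda>x v::'a. (complex_of_real (flat_exp (j + 2) (c - x \<bullet> x)) - of_nat j * complex_of_real (flat_exp (j + 1) (c - x \<bullet> x)))
      * (- 2 * complex_of_real (x \<bullet> v))"
  show ?case
  proof (rule Ck_SucI)
    show "((\<lambda>x. complex_of_real (flat_exp j (c - x \<bullet> x))) has_derivative ?D x) (at x)" for x
    proof -
      have "((\<lambda>x. c - x \<bullet> x) has_derivative (\<lambda>v. - (2 * (x \<bullet> v)))) (at x)"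
        by (auto intro!: derivative_eq_intros simp: inner_commute)
      from has_derivative_compose[OF this flat_exp_deriv[of j "c - x \<bullet> x", unfolded has_field_derivative_def]]
      have "((\<lambda>x. flat_exp j (c - x \<bullet> x)) has_derivative
          (\<lambda>v. (flat_exp (j + 2) (c - x \<bullet> x) - real j * flat_exp (j + 1) (c - x \<bullet> x)) * (- (2 * (x \<bullet> v))))) (at x)"
        by simp
      then have "((\<lambda>x. complex_of_real (flat_exp j (c - x \<bullet> x))) has_derivative
          (\<lambda>v. complex_of_real ((flat_exp (j + 2) (c - x \<bullet> x) - real j * flat_exp (j + 1) (c - x \<bullet> x)) * (- (2 * (x \<bullet> v)))))) (at x)"
        by (rule bounded_linear.has_derivative[OF bounded_linear_of_real])
      then show ?thesis by simp
    qed
    show "Ck k (\<lambda>x. ?D x v)" for v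
      by (intro Ck_mult Ck_diff Ck_cmult Ck_inner Suc)
  qed
qed

text \<open>The bump \<open>exp (-1 / (e\<^sup>2 - x \<bullet> x))\<close> divided by its integral.
  A positive lower bound on a smaller ball shows that the integral is not 0.\<close>

lemma mollifier_exists:
  assumes e: "0 < e"
  obtains \<rho> :: "'a::euclidean_space \<Rightarrow> complex" where "mollifier e \<rho>" "\<rho> \<in> test_fun UNIV"
proof -
  define g where "g x = flat_exp 0 (e\<^sup>2 - x \<bullet> x)" for x :: 'a
  have g0: "0 \<le> g x" for x by (simp add: g_def flat_exp_def)
  have supp: "norm x \<le> e" if "g x \<noteq> 0" for x
  proof -
    have "x \<bullet> x < e\<^sup>2" using that by (auto simp: g_def flat_exp_def split: if_splits)
    then have "(norm x)\<^sup>2 < e\<^sup>2" by (simp add: power2_norm_eq_inner)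
    then show ?thesis using e power2_less_imp_less[of "norm x" e] by simp
  qed
  have gC: "Ck k (\<lambda>x. complex_of_real (g x))" for k unfolding g_def by (rule Ck_flat_exp)
  have gk: "cc_kernel (\<lambda>x. complex_of_real (g x))"
    using supp Ck_continuous[OF gC[of 0]] by (auto simp: cc_kernel_def)
  have gi: "integrable lebesgue g"
    using kernel_powr_integrable[OF gk, of 1] g0 by simp
  \<comment> \<open>On the ball of radius e/2 the argument is at least
    \<open>3 / 4 * e\<^sup>2\<close>, so \<open>c\<close> bounds the bump from below there.\<close>
  define c where "c = flat_exp 0 (3 / 4 * e\<^sup>2)"
  have c0: "0 < c" using e by (simp add: c_def flat_exp_def)
  have "0 < c * measure lebesgue (cball (0::'a) (e / 2))"
    using c0 e by (simp add: content_cball_pos)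
  also have "\<dots> = (\<integral>x. c * indicator (cball (0::'a) (e / 2)) x \<partial>lebesgue)"
    by simp
  also have "\<dots> \<le> (\<integral>x. g x \<partial>lebesgue)"
  proof (rule integral_mono[OF _ gi])
    show "integrable lebesgue (\<lambda>x. c * indicator (cball (0::'a) (e / 2)) x)"
      using indicator_cball_integrable by auto
    fix x :: 'a
    show "c * indicator (cball 0 (e / 2)) x \<le> g x"
    proof (cases "x \<in> cball 0 (e / 2)")
      case True
      then have "(norm x)\<^sup>2 \<le> (e / 2)\<^sup>2" by (intro power_mono) auto
      then have le: "3 / 4 * e\<^sup>2 \<le> e\<^sup>2 - x \<bullet> x"
        by (simp add: power2_norm_eq_inner power_divide)
      moreover have p: "0 < 3 / 4 * e\<^sup>2" using e by simp
      ultimately have p2: "0 < e\<^sup>2 - x \<bullet> x" by linarith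
      have "1 / (e\<^sup>2 - x \<bullet> x) \<le> 1 / (3 / 4 * e\<^sup>2)"
        by (rule divide_left_mono[OF le]) (use p p2 in \<open>auto intro: mult_pos_pos\<close>)
      then have "1 / exp (1 / (3 / 4 * e\<^sup>2)) \<le> 1 / exp (1 / (e\<^sup>2 - x \<bullet> x))"
        by (intro divide_left_mono) auto
      then have "c \<le> g x" using p p2 unfolding c_def g_def flat_exp_def by (simp only: if_True power_0)
      then show ?thesis using True by simp
    qed (simp add: g0)
  qed
  finally have pos: "0 < (\<integral>x. g x \<partial>lebesgue)" .
  define \<rho> where "\<rho> x = complex_of_real (1 / (\<integral>x. g x \<partial>lebesgue)) * complex_of_real (g x)" for x
  have nr: "cmod (\<rho> x) = 1 / (\<integral>x. g x \<partial>lebesgue) * g x" for x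
    unfolding \<rho>_def using pos g0[of x] by (simp add: norm_mult norm_divide)
  have \<rho>C: "Ck k \<rho>" for k unfolding \<rho>_def by (rule Ck_cmult[OF gC])
  have \<rho>supp: "norm x \<le> e" if "\<rho> x \<noteq> 0" for x
    using that supp[of x] by (auto simp: \<rho>_def)
  have "{x. \<rho> x \<noteq> 0} \<subseteq> cball 0 e" using \<rho>supp by auto
  then have "compact (closure {x. \<rho> x \<noteq> 0})"
    by (meson bounded_cball bounded_closure bounded_subset compact_closure)
  then have "\<rho> \<in> test_fun UNIV" using \<rho>C by (simp add: test_fun_def)
  moreover have "mollifier e \<rho>"
    unfolding mollifier_def
  proof (intro conjI allI impI)
    show "cc_kernel \<rho>" by (rule test_fun_cc_kernel) fact
    show "\<rho> x = of_real (cmod (\<rho> x))" for x unfolding nr by (simp add: \<rho>_def)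
    show "(\<integral>x. cmod (\<rho> x) \<partial>lebesgue) = 1" unfolding nr using pos by simp
    show "norm x \<le> e" if "\<rho> x \<noteq> 0" for x by (rule \<rho>supp[OF that])
    show "\<rho> (- x) = \<rho> x" for x by (simp add: \<rho>_def g_def)
  qed
  ultimately show ?thesis using that by blast
qed

subsection \<open>Measurability in time\<close>

text \<open>Completeness of Lebesgue measure: a change on a null set keeps measurability.\<close>

lemma borel_measurable_lebesgue_on_AE:
  fixes f g :: "'a::euclidean_space \<Rightarrow> 'b::euclidean_space"
  assumes S: "S \<in> sets lebesgue" and f: "f \<in> borel_measurable (lebesgue_on S)"
    and ae: "AE x in lebesgue_on S. f x = g x"
  shows "g \<in> borel_measurable (lebesgue_on S)"
proof -
  have "(\<lambda>x. if x \<in> S then f x else 0) \<in> borel_measurable lebesgue"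
    using f S by (simp add: borel_measurable_if)
  moreover have "AE x in lebesgue. x \<in> S \<longrightarrow> f x = g x"
    using ae S by (simp add: AE_restrict_space_iff)
  then have "AE x in lebesgue. (if x \<in> S then f x else 0) = (if x \<in> S then g x else 0)"
    by eventually_elim auto
  ultimately have "(\<lambda>x. if x \<in> S then g x else 0) \<in> borel_measurable lebesgue"
    by (rule borel_measurable_AE)
  then show ?thesis using S by (simp add: borel_measurable_if)
qed

text \<open>A functional of a simple function is again simple, and sequential continuity of
  \<open>\<Psi>\<close> turns the approximation in norm into a pointwise limit of measurable scalar
  functions.\<close>

lemma strongly_measurable_functional:
  fixes \<Psi> :: "('a \<Rightarrow> complex) \<Rightarrow> 'b::euclidean_space"
  assumes S: "S \<in> sets lebesgue" and w: "strongly_measurable_on S X w"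
    and \<Psi>: "\<And>s g. (\<And>n. s n \<in> elems X) \<Longrightarrow> g \<in> elems X \<Longrightarrow> (\<lambda>n. nrm X (\<lambda>x. s n x - g x)) \<longlonglongrightarrow> 0 \<Longrightarrow>
        (\<lambda>n. \<Psi> (s n)) \<longlonglongrightarrow> \<Psi> g"
  shows "(\<lambda>t. \<Psi> (w t)) \<in> borel_measurable (lebesgue_on S)"
proof -
  obtain s where s: "\<And>n. simple_function (lebesgue_on S) (s n)" "\<And>n. s n ` S \<subseteq> elems X"
    and lim: "AE t in lebesgue_on S. w t \<in> elems X \<and> (\<lambda>n. nrm X (\<lambda>x. s n t x - w t x)) \<longlonglongrightarrow> 0"
    using w unfolding strongly_measurable_on_def by blast
  have m: "(\<lambda>t. \<Psi> (s n t)) \<in> borel_measurable (lebesgue_on S)" for n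
    using simple_function_compose1[OF s(1)[of n], of \<Psi>] by (rule borel_measurable_simple_function)
  have "AE t in lebesgue_on S. t \<in> S" using AE_space[of "lebesgue_on S"] by simp
  then have "AE t in lebesgue_on S. lim (\<lambda>n. \<Psi> (s n t)) = \<Psi> (w t)"
    using lim
  proof eventually_elim
    case (elim t)
    have "(\<lambda>n. \<Psi> (s n t)) \<longlonglongrightarrow> \<Psi> (w t)"
      by (rule \<Psi>) (use elim s(2) in auto)
    then show ?case by (rule limI)
  qed
  with S borel_measurable_lim_metric[OF m] show ?thesis by (rule borel_measurable_lebesgue_on_AE)
qed

lemma nrm_L2_tendsto:
  assumes "\<And>n. s n \<in> elems L2" "g \<in> elems L2" "(\<lambda>n. nrm L2 (\<lambda>x. s n x - g x)) \<longlonglongrightarrow> 0"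
  shows "(\<lambda>n. nrm L2 (s n)) \<longlonglongrightarrow> nrm L2 g"
proof (rule LIM_zero_cancel, rule Lim_null_comparison[OF _ assms(3)], rule always_eventually, rule allI)
  show "norm (nrm L2 (s n) - nrm L2 g) \<le> nrm L2 (\<lambda>x. s n x - g x)" for n
    using nrm_L2_abs_diff[OF assms(1)[of n] assms(2)] by simp
qed

text \<open>Stated for a general filter because it is used both along sequences of simple functions,
  for measurability, and at a point of the half-line, for continuity in time.\<close>

lemma conv_tendsto:
  assumes k: "cc_kernel k" and s: "\<forall>\<^sub>F n in F. s n \<in> elems L2" and g: "g \<in> elems L2"
    and lim: "((\<lambda>n. nrm L2 (\<lambda>x. s n x - g x)) \<longlongrightarrow> 0) F"
  shows "((\<lambda>n. conv k (s n) x) \<longlongrightarrow> conv k g x) F"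
proof (rule LIM_zero_cancel, rule Lim_null_comparison[OF _ tendsto_mult_right_zero[OF lim, of "nrm L2 k"]])
  show "\<forall>\<^sub>F n in F. norm (conv k (s n) x - conv k g x) \<le> nrm L2 k * nrm L2 (\<lambda>x. s n x - g x)"
    using s
  proof eventually_elim
    case (elim n)
    show ?case
      using conv_bound[OF k L2_diff[OF elim g], of x]
        conv_diff[OF k L2_loc_integrable[OF elim] L2_loc_integrable[OF g], of x] by simp
  qed
qed

lemma strongly_measurable_diff:
  assumes f: "strongly_measurable_on S L2 f" and g: "strongly_measurable_on S L2 g"
  shows "strongly_measurable_on S L2 (\<lambda>t x. f t x - g t x)"
proof -
  obtain s where s: "\<And>n. simple_function (lebesgue_on S) (s n)" "\<And>n. s n ` S \<subseteq> elems L2"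
    and sl: "AE t in lebesgue_on S. f t \<in> elems L2 \<and> (\<lambda>n. nrm L2 (\<lambda>x. s n t x - f t x)) \<longlonglongrightarrow> 0"
    using f unfolding strongly_measurable_on_def by blast
  obtain r where r: "\<And>n. simple_function (lebesgue_on S) (r n)" "\<And>n. r n ` S \<subseteq> elems L2"
    and rl: "AE t in lebesgue_on S. g t \<in> elems L2 \<and> (\<lambda>n. nrm L2 (\<lambda>x. r n t x - g t x)) \<longlonglongrightarrow> 0"
    using g unfolding strongly_measurable_on_def by blast
  show ?thesis
    unfolding strongly_measurable_on_def
  proof (intro exI[of _ "\<lambda>n t x. s n t x - r n t x"] conjI allI)
    fix n
    show "simple_function (lebesgue_on S) (\<lambda>t x. s n t x - r n t x)"
      by (rule simple_function_compose2[OF s(1) r(1)])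
    show "(\<lambda>t x. s n t x - r n t x) ` S \<subseteq> elems L2"
      using s(2)[of n] r(2)[of n] by (auto intro!: L2_diff)
  next
    have "AE t in lebesgue_on S. t \<in> S" using AE_space[of "lebesgue_on S"] by simp
    with sl rl show "AE t in lebesgue_on S. (\<lambda>x. f t x - g t x) \<in> elems L2 \<and>
        (\<lambda>n. nrm L2 (\<lambda>x. s n t x - r n t x - (f t x - g t x))) \<longlonglongrightarrow> 0"
    proof eventually_elim
      case (elim t)
      have sr: "s n t \<in> elems L2" "r n t \<in> elems L2" for n
        using elim s(2)[of n] r(2)[of n] by auto
      have le: "nrm L2 (\<lambda>x. s n t x - r n t x - (f t x - g t x)) \<le>
          nrm L2 (\<lambda>x. s n t x - f t x) + nrm L2 (\<lambda>x. r n t x - g t x)" for n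
      proof -
        have "(\<lambda>x. s n t x - r n t x - (f t x - g t x)) = (\<lambda>x. (s n t x - f t x) - (r n t x - g t x))"
          by (simp add: algebra_simps)
        then show ?thesis
          using nrm_L2_triangle_diff[OF L2_diff[OF sr(1)[of n], of "f t"] L2_diff[OF sr(2)[of n], of "g t"]] elim by simp
      qed
      have Z: "(\<lambda>n. nrm L2 (\<lambda>x. s n t x - f t x) + nrm L2 (\<lambda>x. r n t x - g t x)) \<longlonglongrightarrow> 0"
        using tendsto_add[of _ 0 sequentially _ 0] elim by fastforce
      have "(\<lambda>n. nrm L2 (\<lambda>x. s n t x - r n t x - (f t x - g t x))) \<longlonglongrightarrow> 0"
        by (rule tendsto_sandwich[OF _ _ tendsto_const Z]) (use le in auto)
      then show ?case using elim L2_diff by auto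
    qed
  qed
qed

lemma strongly_measurable_shift:
  assumes f: "strongly_measurable_on S L2 f"
  shows "strongly_measurable_on S L2 (\<lambda>t x. f t (x + h))"
proof -
  obtain s where s: "\<And>n. simple_function (lebesgue_on S) (s n)" "\<And>n. s n ` S \<subseteq> elems L2"
    and sl: "AE t in lebesgue_on S. f t \<in> elems L2 \<and> (\<lambda>n. nrm L2 (\<lambda>x. s n t x - f t x)) \<longlonglongrightarrow> 0"
    using f unfolding strongly_measurable_on_def by blast
  show ?thesis
    unfolding strongly_measurable_on_def
  proof (intro exI[of _ "\<lambda>n t x. s n t (x + h)"] conjI allI)
    fix n
    show "simple_function (lebesgue_on S) (\<lambda>t x. s n t (x + h))"
      using simple_function_compose1[OF s(1)[of n], of "\<lambda>g x. g (x + h)"] .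
    show "(\<lambda>t x. s n t (x + h)) ` S \<subseteq> elems L2"
      using s(2)[of n] by (auto intro!: L2_shift)
  next
    have "AE t in lebesgue_on S. t \<in> S" using AE_space[of "lebesgue_on S"] by simp
    with sl show "AE t in lebesgue_on S. (\<lambda>x. f t (x + h)) \<in> elems L2 \<and>
        (\<lambda>n. nrm L2 (\<lambda>x. s n t (x + h) - f t (x + h))) \<longlonglongrightarrow> 0"
    proof eventually_elim
      case (elim t)
      have "nrm L2 (\<lambda>x. s n t (x + h) - f t (x + h)) = nrm L2 (\<lambda>x. s n t x - f t x)" for n
        using elim s(2)[of n] by (intro nrm_L2_shift L2_diff) auto
      then show ?case using elim by (auto intro: L2_shift)
    qed
  qed
qed

section \<open>Integrable functions of time with values in L^2\<close>

lemma bochner_L1_iff: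
  "w \<in> bochner_Lp 1 I L2 \<longleftrightarrow> strongly_measurable_on I L2 w \<and> integrable (lebesgue_on I) (\<lambda>t. nrm L2 (w t))"
  by (simp add: bochner_Lp_def)

lemma strongly_measurable_AE:
  "strongly_measurable_on S X w \<Longrightarrow> AE t in lebesgue_on S. w t \<in> elems X"
  unfolding strongly_measurable_on_def by (auto elim: AE_mp)

lemma strongly_measurable_nrm:
  assumes "S \<in> sets lebesgue" "strongly_measurable_on S L2 w"
  shows "(\<lambda>t. nrm L2 (w t)) \<in> borel_measurable (lebesgue_on S)"
  by (rule strongly_measurable_functional[OF assms]) (rule nrm_L2_tendsto)

lemma strongly_measurable_conv:
  assumes "S \<in> sets lebesgue" "strongly_measurable_on S L2 w" "cc_kernel k"
  shows "(\<lambda>t. conv k (w t) x) \<in> borel_measurable (lebesgue_on S)"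
  by (rule strongly_measurable_functional[OF assms(1,2)]) (auto intro!: conv_tendsto[OF assms(3)])

lemma bochner_L1_diff:
  assumes S: "S \<in> sets lebesgue" and f: "f \<in> bochner_Lp 1 S L2" and g: "g \<in> bochner_Lp 1 S L2"
  shows "(\<lambda>t x. f t x - g t x) \<in> bochner_Lp 1 S L2"
  unfolding bochner_L1_iff
proof
  show sm: "strongly_measurable_on S L2 (\<lambda>t x. f t x - g t x)"
    using f g by (intro strongly_measurable_diff) (auto simp: bochner_L1_iff)
  show "integrable (lebesgue_on S) (\<lambda>t. nrm L2 (\<lambda>x. f t x - g t x))"
  proof (rule Bochner_Integration.integrable_bound)
    show "integrable (lebesgue_on S) (\<lambda>t. nrm L2 (f t) + nrm L2 (g t))"
      using f g by (auto simp: bochner_L1_iff)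
    show "(\<lambda>t. nrm L2 (\<lambda>x. f t x - g t x)) \<in> borel_measurable (lebesgue_on S)"
      by (rule strongly_measurable_nrm[OF S sm])
    have "AE t in lebesgue_on S. f t \<in> elems L2" "AE t in lebesgue_on S. g t \<in> elems L2"
      using f g strongly_measurable_AE by (auto simp: bochner_L1_iff)
    then show "AE t in lebesgue_on S. norm (nrm L2 (\<lambda>x. f t x - g t x)) \<le> norm (nrm L2 (f t) + nrm L2 (g t))"
      by eventually_elim (simp add: nrm_L2_triangle_diff)
  qed
qed

lemma bochner_L1_shift:
  assumes S: "S \<in> sets lebesgue" and f: "f \<in> bochner_Lp 1 S L2"
  shows "(\<lambda>t x. f t (x + h)) \<in> bochner_Lp 1 S L2"
  unfolding bochner_L1_iff
proof
  show sm: "strongly_measurable_on S L2 (\<lambda>t x. f t (x + h))"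
    using f by (intro strongly_measurable_shift) (auto simp: bochner_L1_iff)
  show "integrable (lebesgue_on S) (\<lambda>t. nrm L2 (\<lambda>x. f t (x + h)))"
  proof (rule integrable_cong_AE_imp)
    show "integrable (lebesgue_on S) (\<lambda>t. nrm L2 (f t))" using f by (simp add: bochner_L1_iff)
    show "(\<lambda>t. nrm L2 (\<lambda>x. f t (x + h))) \<in> borel_measurable (lebesgue_on S)"
      by (rule strongly_measurable_nrm[OF S sm])
    have "AE t in lebesgue_on S. f t \<in> elems L2"
      using f strongly_measurable_AE by (auto simp: bochner_L1_iff)
    then show "AE t in lebesgue_on S. nrm L2 (f t) = nrm L2 (\<lambda>x. f t (x + h))"
      by eventually_elim (simp add: nrm_L2_shift)
  qed
qed

text \<open>Joint measurability of functions that are measurable in \<open>t\<close> and continuous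
  in \<open>x\<close>: \<open>x\<close> is replaced by simple functions converging to it. It is
  applied to convolutions, where it provides the measurability for Fubini in time and space even
  though the functions \<open>u t\<close> are arbitrary representatives.\<close>

lemma caratheodory_measurable:
  fixes f :: "'c \<Rightarrow> 'a::euclidean_space \<Rightarrow> complex"
  assumes m: "\<And>x. (\<lambda>t. f t x) \<in> borel_measurable M"
    and c: "\<And>t. t \<in> space M \<Longrightarrow> continuous_on UNIV (f t)"
  shows "(\<lambda>(t, x). f t x) \<in> borel_measurable (M \<Otimes>\<^sub>M lborel)"
proof -
  have "(\<lambda>x. x) \<in> borel_measurable (lborel :: 'a measure)" by simp
  from borel_measurable_implies_sequence_metric[OF this, of 0]
  obtain s where s: "\<And>i. simple_function lborel (s i)" "\<And>x. (\<lambda>i. s i x) \<longlonglongrightarrow> (x::'a)"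
    by auto
  show ?thesis
  proof (rule borel_measurable_LIMSEQ_metric)
    fix i
    have fin: "finite (range (s i))" using simple_functionD(1)[OF s(1)[of i]] by simp
    have [measurable]: "s i -` {y} \<in> sets borel" for y
      using simple_functionD(2)[OF s(1)[of i], of "{y}"] by simp
    \<comment> \<open>A simple function takes finitely many values \<open>y\<close>, so only
      finitely many functions \<open>f t y\<close> of \<open>t\<close> occur.\<close>
    have eq: "f t (s i x) = (\<Sum>y\<in>range (s i). indicator (s i -` {y}) x *\<^sub>R f t y)" for t x
    proof -
      have "(\<Sum>y\<in>range (s i). indicator (s i -` {y}) x *\<^sub>R f t y) = (\<Sum>y\<in>{s i x}. f t y)"
        by (rule sum.mono_neutral_cong_right[OF fin]) auto
      then show ?thesis by simp
    qed
    show "(\<lambda>(t, x). f t (s i x)) \<in> borel_measurable (M \<Otimes>\<^sub>M lborel)"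
      unfolding eq case_prod_beta
    proof (rule borel_measurable_sum)
      fix y
      note [measurable] = m[of y]
      show "(\<lambda>p. indicator (s i -` {y}) (snd p) *\<^sub>R f (fst p) y) \<in> borel_measurable (M \<Otimes>\<^sub>M lborel)"
        by measurable
    qed
  next
    fix p assume "p \<in> space (M \<Otimes>\<^sub>M (lborel :: 'a measure))"
    then have "continuous_on UNIV (f (fst p))" using c by (auto simp: space_pair_measure)
    then have "isCont (f (fst p)) (snd p)" by (simp add: continuous_on_eq_continuous_at)
    then show "(\<lambda>i. case p of (t, x) \<Rightarrow> f t (s i x)) \<longlonglongrightarrow> (case p of (t, x) \<Rightarrow> f t x)"
      unfolding case_prod_beta by (rule isCont_tendsto_compose[OF _ s(2)])
  qed
qed

text \<open>The increment of \<open>nonlin m\<close> is of order \<open>d powr m\<close> with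
  \<open>d\<close> the modulus of the increment of \<open>u\<close>, and \<open>m < 1\<close> puts
  it outside the reach of the L^2 norm. Pointwise, \<open>d powr m\<close> is at most a small
  constant plus a large multiple of \<open>d\<^sup>2\<close>; integrated against the kernel, the
  constant is harmless and the square is controlled by the L^2 distance.\<close>

lemma nonlin_conv_tendsto:
  assumes m: "0 < m" "m < 1" and k: "cc_kernel k"
    and ev: "\<forall>\<^sub>F s in F. u s \<in> elems L2" and g: "g \<in> elems L2"
    and lim: "((\<lambda>s. nrm L2 (\<lambda>x. u s x - g x)) \<longlongrightarrow> 0) F"
  shows "((\<lambda>s. conv k (\<lambda>y. nonlin m (u s y)) x) \<longlongrightarrow> conv k (\<lambda>y. nonlin m (g y)) x) F"
proof -
  obtain B where B: "B > 0" "\<And>x. cmod (k x) \<le> B" using kernel_bounded[OF k] by blast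
  define K where "K = (\<integral>y. cmod (k (x - y)) \<partial>lebesgue)"
  have ki: "integrable lebesgue (\<lambda>y. k (x - y))"
    by (rule integrable_lebesgue_reflect[OF kernel_integrable[OF k]])
  have K0: "0 \<le> K" by (simp add: K_def integral_nonneg_AE)
  \<comment> \<open>If \<open>d powr m > \<eta>\<close>, then
    \<open>d powr (m - 2) = (d powr m) powr ((m - 2) / m)\<close>, and the last exponent is
    negative; this explains the power of \<open>\<eta>\<close>.\<close>
  have pt: "d powr m \<le> \<eta> + \<eta> powr ((m - 2) / m) * d\<^sup>2" if "0 \<le> d" "0 < \<eta>" for d \<eta> :: real
  proof (cases "d powr m \<le> \<eta>")
    case True
    then show ?thesis by (simp add: add_increasing2)
  next
    case False
    then have d: "0 < d" using that m by (cases "d = 0") auto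
    have "d powr (m - 2) = (d powr m) powr ((m - 2) / m)" using m by (simp add: powr_powr)
    also have "\<dots> \<le> \<eta> powr ((m - 2) / m)"
      using False that m by (intro powr_mono2') (auto simp: divide_nonpos_pos)
    finally have "d powr (m - 2) * d powr 2 \<le> \<eta> powr ((m - 2) / m) * d powr 2"
      by (intro mult_right_mono) auto
    also have "d powr (m - 2) * d powr 2 = d powr m" by (subst powr_add[symmetric]) simp
    finally show ?thesis using that d by simp
  qed
  have bound: "cmod (conv k (\<lambda>y. nonlin m (u s y)) x - conv k (\<lambda>y. nonlin m (g y)) x)
      \<le> 4 * (\<eta> * K + \<eta> powr ((m - 2) / m) * B * (nrm L2 (\<lambda>x. u s x - g x))\<^sup>2)" if \<eta>: "0 < \<eta>" and u: "u s \<in> elems L2" for \<eta> s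
  proof -
    have d: "(\<lambda>y. u s y - g y) \<in> elems L2" by (rule L2_diff[OF u g])
    then have di: "integrable lebesgue (\<lambda>y. (cmod (u s y - g y))\<^sup>2)" by (simp add: mem_L2_iff)
    have i: "integrable lebesgue (\<lambda>y. k (x - y) * nonlin m (u s y))" "integrable lebesgue (\<lambda>y. k (x - y) * nonlin m (g y))"
      by (rule conv_integrable[OF k nonlin_loc_integrable[OF _ m]], fact)+
    have "cmod (conv k (\<lambda>y. nonlin m (u s y)) x - conv k (\<lambda>y. nonlin m (g y)) x) =
        cmod (\<integral>y. k (x - y) * (nonlin m (u s y) - nonlin m (g y)) \<partial>lebesgue)"
      unfolding conv_def using i by (simp add: right_diff_distrib)
    also have "\<dots> \<le> (\<integral>y. 4 * (\<eta> * cmod (k (x - y)) + \<eta> powr ((m - 2) / m) * B * (cmod (u s y - g y))\<^sup>2) \<partial>lebesgue)"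
    proof (rule Bochner_Integration.integral_norm_bound_integral)
      show "integrable lebesgue (\<lambda>y. k (x - y) * (nonlin m (u s y) - nonlin m (g y)))"
        using i by (simp add: right_diff_distrib)
      show "integrable lebesgue (\<lambda>y. 4 * (\<eta> * cmod (k (x - y)) + \<eta> powr ((m - 2) / m) * B * (cmod (u s y - g y))\<^sup>2))"
        using ki di by auto
      fix y
      let ?d = "cmod (u s y - g y)" and ?k = "cmod (k (x - y))"
      have "cmod (k (x - y) * (nonlin m (u s y) - nonlin m (g y))) \<le> ?k * (4 * ?d powr m)"
        unfolding norm_mult using m by (intro mult_left_mono nonlin_holder) auto
      also have "\<dots> \<le> ?k * (4 * (\<eta> + \<eta> powr ((m - 2) / m) * ?d\<^sup>2))"
        using pt[of ?d \<eta>] \<eta> by (intro mult_left_mono) auto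
      also have "\<dots> = 4 * (\<eta> * ?k + \<eta> powr ((m - 2) / m) * ?k * ?d\<^sup>2)" by (simp add: algebra_simps)
      also have "\<dots> \<le> 4 * (\<eta> * ?k + \<eta> powr ((m - 2) / m) * B * ?d\<^sup>2)"
        using B(2) by (intro mult_left_mono add_left_mono mult_right_mono) auto
      finally show "cmod (k (x - y) * (nonlin m (u s y) - nonlin m (g y))) \<le> 4 * (\<eta> * ?k + \<eta> powr ((m - 2) / m) * B * ?d\<^sup>2)" .
    qed
    also have "\<dots> = 4 * (\<eta> * K + \<eta> powr ((m - 2) / m) * B * (nrm L2 (\<lambda>x. u s x - g x))\<^sup>2)"
      unfolding K_def nrm_L2_sq using ki di by simp
    finally show ?thesis .
  qed
  show ?thesis
    unfolding tendsto_iff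
  proof (intro allI impI)
    fix e :: real assume e: "0 < e"
    \<comment> \<open>Makes the constant part \<open>4 * \<eta> * K\<close> at most e/2, also if
      \<open>K = 0\<close>.\<close>
    define \<eta> where "\<eta> = e / (8 * (K + 1))"
    have \<eta>: "0 < \<eta>" "4 * (\<eta> * K) \<le> e / 2" using e K0 by (auto simp: \<eta>_def field_simps)
    have "((\<lambda>s. 4 * (\<eta> powr ((m - 2) / m) * B * (nrm L2 (\<lambda>x. u s x - g x))\<^sup>2)) \<longlongrightarrow> 4 * (\<eta> powr ((m - 2) / m) * B * 0\<^sup>2)) F"
      by (intro tendsto_intros lim)
    then have "\<forall>\<^sub>F s in F. 4 * (\<eta> powr ((m - 2) / m) * B * (nrm L2 (\<lambda>x. u s x - g x))\<^sup>2) < e / 2"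
      using e by (intro order_tendstoD(2)) auto
    then show "\<forall>\<^sub>F s in F. dist (conv k (\<lambda>y. nonlin m (u s y)) x) (conv k (\<lambda>y. nonlin m (g y)) x) < e"
      using ev
    proof eventually_elim
      case (elim s)
      then show ?case using bound[OF \<eta>(1), of s] \<eta>(2) by (simp add: dist_norm distrib_left)
    qed
  qed
qed

subsection \<open>Absolutely continuous functions\<close>

text \<open>The square of the integral is a double integral whose parts below and above the diagonal are conjugate.\<close>

lemma indefinite_integral_sq:
  fixes r :: "real \<Rightarrow> complex"
  assumes r: "integrable lborel r"
  defines "V \<equiv> \<lambda>t. \<integral>s. indicator {..t} s *\<^sub>R r s \<partial>lborel"
  shows "integrable lborel (\<lambda>t. r t * cnj (V t))"
    and "(cmod (\<integral>s. r s \<partial>lborel))\<^sup>2 = 2 * Re (\<integral>t. r t * cnj (V t) \<partial>lborel)"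
proof -
  have [measurable]: "r \<in> borel_measurable borel" using r by (auto dest: borel_measurable_integrable)
  have cr: "integrable lborel (\<lambda>s. cnj (r s))" using r by simp
  have P: "integrable (lborel \<Otimes>\<^sub>M lborel) (\<lambda>p. r (fst p) * cnj (r (snd p)))"
    using integrable_lborel_product[OF r cr] by (simp add: lborel_prod)
  define I1 where "I1 = (\<lambda>p. indicator {p. snd p \<le> fst p} p *\<^sub>R (r (fst p) * cnj (r (snd p))))"
  define I2 where "I2 = (\<lambda>p. indicator {p. fst p < snd p} p *\<^sub>R (r (fst p) * cnj (r (snd p))))"
  have S [measurable]: "{p :: real \<times> real. snd p \<le> fst p} \<in> sets (borel \<Otimes>\<^sub>M borel)"
      "{p :: real \<times> real. fst p < snd p} \<in> sets (borel \<Otimes>\<^sub>M borel)"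
    unfolding borel_prod by (auto intro!: closed_Collect_le open_Collect_less borel_closed borel_open continuous_intros)
  have i1: "integrable (lborel \<Otimes>\<^sub>M lborel) I1" and i2: "integrable (lborel \<Otimes>\<^sub>M lborel) I2"
    unfolding I1_def I2_def by (intro integrable_mult_indicator P; use S in simp)+
  have V1: "(\<integral>s. I1 (t, s) \<partial>lborel) = r t * cnj (V t)" for t
  proof -
    have "(\<integral>s. I1 (t, s) \<partial>lborel) = (\<integral>s. r t * cnj (indicator {..t} s *\<^sub>R r s) \<partial>lborel)"
      by (rule Bochner_Integration.integral_cong) (auto simp: I1_def indicator_def)
    also have "\<dots> = r t * (\<integral>s. cnj (indicator {..t} s *\<^sub>R r s) \<partial>lborel)" by (rule integral_mult_right_zero)
    also have "\<dots> = r t * cnj (V t)" unfolding V_def by (simp only: Bochner_Integration.integral_cnj)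
    finally show ?thesis .
  qed
  have V2: "(\<integral>t. I2 (t, s) \<partial>lborel) = cnj (r s * cnj (V s))" for s
  proof -
    have "(\<integral>t. I2 (t, s) \<partial>lborel) = (\<integral>t. (indicator {..s} t *\<^sub>R r t) * cnj (r s) \<partial>lborel)"
    proof (rule integral_cong_AE)
      show "(\<lambda>t. I2 (t, s)) \<in> borel_measurable lborel"
        using measurable_compose[OF measurable_Pair2' borel_measurable_integrable[OF i2], of s] by simp
      \<comment> \<open>\<open>I2\<close> omits the diagonal whereas \<open>{..s}\<close> contains
        \<open>s\<close>; the two integrands differ at one point only.\<close>
      show "AE t in lborel. I2 (t, s) = (indicator {..s} t *\<^sub>R r t) * cnj (r s)"
        using AE_lborel_singleton[of s] by eventually_elim (auto simp: I2_def indicator_def)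
    qed simp
    also have "\<dots> = V s * cnj (r s)" unfolding V_def by (rule integral_mult_left_zero)
    finally show ?thesis by (simp add: mult.commute)
  qed
  show int: "integrable lborel (\<lambda>t. r t * cnj (V t))"
    using lborel_pair.integrable_fst'[OF i1] unfolding V1 .
  have "(\<integral>s. r s \<partial>lborel) * cnj (\<integral>s. r s \<partial>lborel) = (\<integral>q. r (fst q) * cnj (r (snd q)) \<partial>lborel)"
    using integral_lborel_product[OF r cr] by simp
  also have "\<dots> = (\<integral>p. I1 p + I2 p \<partial>(lborel \<Otimes>\<^sub>M lborel))"
    unfolding lborel_prod by (rule Bochner_Integration.integral_cong) (auto simp: I1_def I2_def indicator_def)
  also have "\<dots> = (\<integral>p. I1 p \<partial>(lborel \<Otimes>\<^sub>M lborel)) + (\<integral>p. I2 p \<partial>(lborel \<Otimes>\<^sub>M lborel))"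
    by (rule Bochner_Integration.integral_add[OF i1 i2])
  also have "(\<integral>p. I1 p \<partial>(lborel \<Otimes>\<^sub>M lborel)) = (\<integral>t. r t * cnj (V t) \<partial>lborel)"
    using lborel_pair.integral_fst'[OF i1] unfolding V1 by simp
  also have "(\<integral>p. I2 p \<partial>(lborel \<Otimes>\<^sub>M lborel)) = cnj (\<integral>t. r t * cnj (V t) \<partial>lborel)"
  proof -
    have i2': "integrable (lborel \<Otimes>\<^sub>M lborel) (\<lambda>(t, s). I2 (t, s))" using i2 by simp
    have "(\<integral>s. (\<integral>t. I2 (t, s) \<partial>lborel) \<partial>lborel) = (\<integral>p. I2 p \<partial>(lborel \<Otimes>\<^sub>M lborel))"
      using lborel_pair.integral_snd[OF i2'] by simp
    then show ?thesis unfolding V2 by (simp only: Bochner_Integration.integral_cnj)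
  qed
  finally have "complex_of_real ((cmod (\<integral>s. r s \<partial>lborel))\<^sup>2) = complex_of_real (2 * Re (\<integral>t. r t * cnj (V t) \<partial>lborel))"
    by (simp only: complex_norm_square complex_add_cnj)
  then show "(cmod (\<integral>s. r s \<partial>lborel))\<^sup>2 = 2 * Re (\<integral>t. r t * cnj (V t) \<partial>lborel)"
    by (simp only: of_real_eq_iff)
qed

text \<open>The chain rule for the squared modulus, obtained without differentiating
  \<open>W\<close> at any point. With \<open>W b = W a + V b\<close>, expanding the square leaves a
  mixed term, which is linear in the derivative, and the squared modulus of \<open>V b\<close>,
  which \<open>indefinite_integral_sq\<close> expresses as an integral.\<close>

lemma abs_continuous_sq:
  fixes W R :: "real \<Rightarrow> complex"
  assumes ab: "a \<le> b" and R: "integrable (lebesgue_on {a..b}) R"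
    and W: "\<And>t. a \<le> t \<Longrightarrow> t \<le> b \<Longrightarrow> \<i> * (W t - W a) = (\<integral>s. R s \<partial>lebesgue_on {a..t})"
  shows "(cmod (W b))\<^sup>2 - (cmod (W a))\<^sup>2 = 2 * (\<integral>t. Im (R t * cnj (W t)) \<partial>lebesgue_on {a..b})"
proof -
  have Ri: "integrable lebesgue (\<lambda>t. indicator {a..b} t *\<^sub>R R t)"
    using R by (simp add: integrable_restrict_space)
  obtain R' where R': "R' \<in> borel_measurable borel" "AE t in lebesgue. indicator {a..b} t *\<^sub>R R t = R' t"
    using lebesgue_ex_borel[OF borel_measurable_integrable[OF Ri]] by blast
  \<comment> \<open>A Borel representative of the derivative \<open>- \<i> * R\<close> of
    \<open>W\<close>, equal to 0 almost everywhere outside \<open>{a..b}\<close>. Its integral from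
    minus infinity therefore starts at \<open>a\<close> and is complete at \<open>b\<close>.\<close>
  define r where "r t = - \<i> * R' t" for t
  have [measurable]: "r \<in> borel_measurable borel" unfolding r_def using R'(1) by measurable
  have req: "AE t in lebesgue. r t = indicator {a..b} t *\<^sub>R (- \<i> * R t)"
    using R'(2) unfolding r_def by eventually_elim (metis mult_scaleR_right)
  have rl: "integrable lebesgue r"
  proof (rule integrable_cong_AE_imp)
    show "integrable lebesgue (\<lambda>t. - \<i> * (indicator {a..b} t *\<^sub>R R t))" by (rule integrable_mult_right[OF Ri])
    show "r \<in> borel_measurable lebesgue" by (rule measurable_completion) simp
    show "AE t in lebesgue. - \<i> * (indicator {a..b} t *\<^sub>R R t) = r t" using req by eventually_elim simp
  qed
  then have ri: "integrable lborel r" by (simp add: integrable_lborel_completion)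
  define V where "V t = (\<integral>s. indicator {..t} s *\<^sub>R r s \<partial>lborel)" for t
  have WV: "W t = W a + V t" if t: "a \<le> t" "t \<le> b" for t
  proof -
    have "V t = (\<integral>s. indicator {..t} s *\<^sub>R r s \<partial>lebesgue)"
      unfolding V_def by (rule integral_lborel_completion[symmetric]) measurable
    also have "\<dots> = (\<integral>s. - \<i> * (indicator {a..t} s *\<^sub>R R s) \<partial>lebesgue)"
    proof (rule integral_cong_AE)
      show "(\<lambda>s. indicator {..t} s *\<^sub>R r s) \<in> borel_measurable lebesgue" by (rule measurable_completion) measurable
      have "(\<lambda>s. indicator {a..t} s *\<^sub>R R s) = (\<lambda>s. indicator {a..t} s *\<^sub>R (indicator {a..b} s *\<^sub>R R s))"
        using t by (auto simp: indicator_def)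
      moreover have "(\<lambda>s. indicator {a..t} s *\<^sub>R (indicator {a..b} s *\<^sub>R R s)) \<in> borel_measurable lebesgue"
        by (rule borel_measurable_scaleR[OF borel_measurable_indicator borel_measurable_integrable[OF Ri]]) simp
      ultimately show "(\<lambda>s. - \<i> * (indicator {a..t} s *\<^sub>R R s)) \<in> borel_measurable lebesgue"
        by (simp only: borel_measurable_times borel_measurable_const)
      show "AE s in lebesgue. indicator {..t} s *\<^sub>R r s = - \<i> * (indicator {a..t} s *\<^sub>R R s)"
        using req by eventually_elim (use t in \<open>auto simp: indicator_def\<close>)
    qed
    also have "\<dots> = - \<i> * (\<integral>s. R s \<partial>lebesgue_on {a..t})"
      by (subst integral_mult_right_zero) (simp add: integral_restrict_space)
    also have "\<dots> = W t - W a" unfolding W[OF t, symmetric] by (simp flip: mult.assoc)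
    finally show ?thesis by simp
  qed
  note sq = indefinite_integral_sq[OF ri, folded V_def]
  have Vb: "V b = (\<integral>s. r s \<partial>lborel)"
  proof -
    have "(\<integral>s. indicator {..b} s *\<^sub>R r s \<partial>lebesgue) = (\<integral>s. r s \<partial>lebesgue)"
    proof (rule integral_cong_AE)
      show "(\<lambda>s. indicator {..b} s *\<^sub>R r s) \<in> borel_measurable lebesgue" "r \<in> borel_measurable lebesgue"
        by (rule measurable_completion, measurable)+
      show "AE s in lebesgue. indicator {..b} s *\<^sub>R r s = r s"
        using req by eventually_elim (auto simp: indicator_def)
    qed
    then show ?thesis unfolding V_def by (simp add: integral_lborel_completion)
  qed
  have Vm: "(\<lambda>t. r t * cnj (V t)) \<in> borel_measurable borel" using sq(1) by (auto dest: borel_measurable_integrable)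
  have "(\<integral>t. Im (R t * cnj (W t)) \<partial>lebesgue_on {a..b}) = (\<integral>t. indicator {a..b} t *\<^sub>R Im (R t * cnj (W t)) \<partial>lebesgue)"
    by (simp add: integral_restrict_space)
  also have "\<dots> = (\<integral>t. Re (r t * cnj (W a) + r t * cnj (V t)) \<partial>lebesgue)"
  proof (rule integral_cong_AE)
    have eq: "AE t in lebesgue. Re (r t * cnj (W a) + r t * cnj (V t)) = indicator {a..b} t *\<^sub>R Im (R t * cnj (W t))"
      using req
    proof eventually_elim
      case (elim t)
      show ?case
      proof (cases "t \<in> {a..b}")
        case True
        then have "r t * cnj (W a) + r t * cnj (V t) = - \<i> * (R t * cnj (W t))"
          using elim WV[of t] by (simp add: algebra_simps)
        then show ?thesis using True by simp
      qed (use elim in simp)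
    qed
    show m: "(\<lambda>t. Re (r t * cnj (W a) + r t * cnj (V t))) \<in> borel_measurable lebesgue"
      by (rule measurable_completion) (use Vm in measurable)
    show "(\<lambda>t. indicator {a..b} t *\<^sub>R Im (R t * cnj (W t))) \<in> borel_measurable lebesgue"
      using borel_measurable_AE[OF m eq] .
    show "AE t in lebesgue. indicator {a..b} t *\<^sub>R Im (R t * cnj (W t)) = Re (r t * cnj (W a) + r t * cnj (V t))"
      using eq by eventually_elim simp
  qed
  also have "\<dots> = (\<integral>t. Re (r t * cnj (W a) + r t * cnj (V t)) \<partial>lborel)"
    by (rule integral_lborel_completion) (use Vm in measurable)
  also have "\<dots> = Re (\<integral>t. r t * cnj (W a) + r t * cnj (V t) \<partial>lborel)"
    using ri sq(1) by (intro integral_Re) auto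
  also have "\<dots> = Re (V b * cnj (W a)) + Re (\<integral>t. r t * cnj (V t) \<partial>lborel)"
    using ri sq(1) by (simp add: Vb)
  finally have "2 * (\<integral>t. Im (R t * cnj (W t)) \<partial>lebesgue_on {a..b}) = 2 * Re (V b * cnj (W a)) + (cmod (V b))\<^sup>2"
    using sq(2) by (simp add: Vb)
  moreover have "(cmod (W a + V b))\<^sup>2 = (cmod (W a))\<^sup>2 + (cmod (V b))\<^sup>2 + 2 * Re (V b * cnj (W a))"
    unfolding cmod_power2 by (simp add: power2_eq_square algebra_simps)
  ultimately show ?thesis using WV[OF ab order.refl] by simp
qed

subsection \<open>Restriction to smaller time intervals\<close>

lemma integrable_lebesgue_on_subset:
  fixes f :: "'a::euclidean_space \<Rightarrow> 'b::{banach, second_countable_topology}"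
  assumes f: "integrable (lebesgue_on S) f" and T: "T \<subseteq> S" "T \<in> sets lebesgue" "S \<in> sets lebesgue"
  shows "integrable (lebesgue_on T) f"
proof -
  have "integrable lebesgue (\<lambda>x. indicator S x *\<^sub>R f x)" using f T by (simp add: integrable_restrict_space)
  then have "integrable lebesgue (\<lambda>x. indicator T x *\<^sub>R (indicator S x *\<^sub>R f x))"
    by (rule integrable_mult_indicator[OF T(2)])
  moreover have "(\<lambda>x. indicator T x *\<^sub>R (indicator S x *\<^sub>R f x)) = (\<lambda>x. indicator T x *\<^sub>R f x)"
    by (rule ext) (use T(1) in \<open>auto simp: indicator_def\<close>)
  ultimately show ?thesis using T by (simp add: integrable_restrict_space)
qed

lemma AE_lebesgue_on_subset:
  assumes "AE x in lebesgue_on S. P x" and T: "T \<subseteq> S" "T \<in> sets lebesgue" "S \<in> sets lebesgue"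
  shows "AE x in lebesgue_on T. P x"
  using assms by (auto simp: AE_restrict_space_iff elim: AE_mp)

lemma strongly_measurable_subset:
  assumes w: "strongly_measurable_on S X w" and T: "T \<subseteq> S" "T \<in> sets lebesgue" "S \<in> sets lebesgue"
  shows "strongly_measurable_on T X w"
proof -
  obtain s where s: "\<And>n. simple_function (lebesgue_on S) (s n)" "\<And>n. s n ` S \<subseteq> elems X"
    and sl: "AE t in lebesgue_on S. w t \<in> elems X \<and> (\<lambda>n. nrm X (\<lambda>x. s n t x - w t x)) \<longlonglongrightarrow> 0"
    using w unfolding strongly_measurable_on_def by blast
  show ?thesis
    unfolding strongly_measurable_on_def
  proof (intro exI[of _ s] conjI allI)
    fix n
    show "simple_function (lebesgue_on T) (s n)"
      unfolding simple_function_def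
    proof (intro conjI ballI)
      have "finite (s n ` S)" using simple_functionD(1)[OF s(1)[of n]] by simp
      then show "finite (s n ` space (lebesgue_on T))"
        by (rule finite_subset[rotated]) (use T(1) in auto)
      fix y
      have "s n -` {y} \<inter> S \<in> sets (lebesgue_on S)" using simple_functionD(2)[OF s(1)[of n], of "{y}"] by simp
      then have "s n -` {y} \<inter> S \<in> sets lebesgue" using T by (simp add: sets_restrict_space_iff)
      then have "(s n -` {y} \<inter> S) \<inter> T \<in> sets lebesgue" using T by blast
      moreover have "(s n -` {y} \<inter> S) \<inter> T = s n -` {y} \<inter> T" using T by blast
      ultimately show "s n -` {y} \<inter> space (lebesgue_on T) \<in> sets (lebesgue_on T)"
        using T by (simp add: sets_restrict_space_iff)
    qed
    show "s n ` T \<subseteq> elems X" using s(2)[of n] T by blast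
  qed (rule AE_lebesgue_on_subset[OF sl T])
qed

lemma bochner_L1_subset:
  assumes "w \<in> bochner_Lp 1 S L2" and T: "T \<subseteq> S" "T \<in> sets lebesgue" "S \<in> sets lebesgue"
  shows "w \<in> bochner_Lp 1 T L2"
  using assms(1) strongly_measurable_subset[OF _ T] integrable_lebesgue_on_subset[OF _ T]
  by (auto simp: bochner_L1_iff)

lemma bochner_L1_loc_interval:
  assumes "w \<in> bochner_Lp_loc 1 L2" "0 < s"
  shows "w \<in> bochner_Lp 1 {s..t} L2"
proof -
  \<comment> \<open>The right endpoint has to be positive and to exceed \<open>t\<close>, also when
    \<open>t < s\<close>.\<close>
  have "w \<in> bochner_Lp 1 {0<..<max s t + 1} L2"
    using assms unfolding bochner_Lp_loc_def by simp
  then show ?thesis by (rule bochner_L1_subset) (use assms(2) in auto)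
qed

section \<open>Continuous functions of time with values in L^2\<close>

lemma cont_space_L2: "u \<in> cont_space L2 \<Longrightarrow> 0 \<le> t \<Longrightarrow> u t \<in> elems L2"
  by (simp add: cont_space_def)

lemma cont_space_diff:
  assumes u: "u \<in> cont_space L2" and v: "v \<in> cont_space L2"
  shows "(\<lambda>t x. u t x - v t x) \<in> cont_space L2"
  unfolding cont_space_def
proof (intro CollectI allI impI conjI)
  fix t :: real assume t: "0 \<le> t"
  show "(\<lambda>x. u t x - v t x) \<in> elems L2" by (intro L2_diff cont_space_L2 u v t)
  have Z: "((\<lambda>s. nrm L2 (\<lambda>x. u s x - u t x) + nrm L2 (\<lambda>x. v s x - v t x)) \<longlongrightarrow> 0) (at t within {0..})"
    by (rule tendsto_add_zero) (use u v t in \<open>auto simp: cont_space_def\<close>)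
  show "((\<lambda>s. nrm L2 (\<lambda>x. u s x - v s x - (u t x - v t x))) \<longlongrightarrow> 0) (at t within {0..})"
  proof (rule tendsto_sandwich[OF _ _ tendsto_const Z])
    show "\<forall>\<^sub>F s in at t within {0..}. nrm L2 (\<lambda>x. u s x - v s x - (u t x - v t x)) \<le>
        nrm L2 (\<lambda>x. u s x - u t x) + nrm L2 (\<lambda>x. v s x - v t x)"
      unfolding eventually_at_filter
    proof (intro always_eventually allI impI)
      fix s :: real assume "s \<in> {0..}"
      then have s: "0 \<le> s" by simp
      have "(\<lambda>x. u s x - v s x - (u t x - v t x)) = (\<lambda>x. (u s x - u t x) - (v s x - v t x))"
        by (simp add: algebra_simps)
      then show "nrm L2 (\<lambda>x. u s x - v s x - (u t x - v t x)) \<le>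
          nrm L2 (\<lambda>x. u s x - u t x) + nrm L2 (\<lambda>x. v s x - v t x)"
        using nrm_L2_triangle_diff[OF L2_diff[OF cont_space_L2[OF u s] cont_space_L2[OF u t]]
            L2_diff[OF cont_space_L2[OF v s] cont_space_L2[OF v t]]] by simp
    qed
  qed simp
qed

lemma cont_space_shift:
  assumes u: "u \<in> cont_space L2"
  shows "(\<lambda>t x. u t (x + h)) \<in> cont_space L2"
  unfolding cont_space_def
proof (intro CollectI allI impI conjI)
  fix t :: real assume t: "0 \<le> t"
  show "(\<lambda>x. u t (x + h)) \<in> elems L2" by (intro L2_shift cont_space_L2 u t)
  have Z: "((\<lambda>s. nrm L2 (\<lambda>x. u s x - u t x)) \<longlongrightarrow> 0) (at t within {0..})"
    using u t by (simp add: cont_space_def)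
  have "\<forall>\<^sub>F s in at t within {0..}. nrm L2 (\<lambda>x. u s x - u t x) = nrm L2 (\<lambda>x. u s (x + h) - u t (x + h))"
    unfolding eventually_at_filter
  proof (intro always_eventually allI impI)
    fix s :: real assume "s \<in> {0..}"
    then have s: "0 \<le> s" by simp
    show "nrm L2 (\<lambda>x. u s x - u t x) = nrm L2 (\<lambda>x. u s (x + h) - u t (x + h))"
      by (rule nrm_L2_shift[symmetric, OF L2_diff[OF cont_space_L2[OF u s] cont_space_L2[OF u t]]])
  qed
  with Z show "((\<lambda>s. nrm L2 (\<lambda>x. u s (x + h) - u t (x + h))) \<longlongrightarrow> 0) (at t within {0..})"
    by (rule Lim_transform_eventually)
qed

lemma cont_space_continuous:
  fixes \<Psi> :: "('a::euclidean_space \<Rightarrow> complex) \<Rightarrow> 'b::topological_space"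
  assumes u: "u \<in> cont_space L2"
    and \<Psi>: "\<And>s g F. \<forall>\<^sub>F n in F. s n \<in> elems L2 \<Longrightarrow> g \<in> elems L2 \<Longrightarrow>
      ((\<lambda>n::real. nrm L2 (\<lambda>x. s n x - g x)) \<longlongrightarrow> 0) F \<Longrightarrow> ((\<lambda>n. \<Psi> (s n)) \<longlongrightarrow> \<Psi> g) F"
  shows "continuous_on {0..} (\<lambda>t. \<Psi> (u t))"
  unfolding continuous_on_def
proof (intro ballI)
  fix t :: real assume "t \<in> {0..}"
  then show "((\<lambda>t. \<Psi> (u t)) \<longlongrightarrow> \<Psi> (u t)) (at t within {0..})"
    using u by (intro \<Psi>) (auto simp: cont_space_def eventually_at_filter)
qed

lemma cont_space_conv:
  assumes "u \<in> cont_space L2" "cc_kernel k"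
  shows "continuous_on {0..} (\<lambda>t. conv k (u t) x)"
  by (rule cont_space_continuous[OF assms(1), of "\<lambda>g. conv k g x"]) (rule conv_tendsto[OF assms(2)])

lemma cont_space_nonlin_conv:
  assumes "u \<in> cont_space L2" "cc_kernel k" "0 < m" "m < 1"
  shows "continuous_on {0..} (\<lambda>t. conv k (\<lambda>y. nonlin m (u t y)) x)"
  by (rule cont_space_continuous[OF assms(1), of "\<lambda>g. conv k (\<lambda>y. nonlin m (g y)) x"])
     (rule nonlin_conv_tendsto[OF assms(3,4,2)])

lemma cont_space_nrm:
  assumes "u \<in> cont_space L2"
  shows "continuous_on {0..} (\<lambda>t. nrm L2 (u t))"
proof (rule cont_space_continuous[OF assms])
  fix s :: "real \<Rightarrow> 'a \<Rightarrow> complex" and g :: "'a \<Rightarrow> complex" and F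
  assume ev: "\<forall>\<^sub>F n in F. s n \<in> elems L2" and g: "g \<in> elems L2"
    and lim: "((\<lambda>n::real. nrm L2 (\<lambda>x. s n x - g x)) \<longlongrightarrow> 0) F"
  have "\<forall>\<^sub>F n in F. norm (nrm L2 (s n) - nrm L2 g) \<le> nrm L2 (\<lambda>x. s n x - g x)"
    using ev by eventually_elim (use nrm_L2_abs_diff[OF _ g] in auto)
  then have "((\<lambda>n. nrm L2 (s n) - nrm L2 g) \<longlongrightarrow> 0) F"
    using lim by (rule Lim_null_comparison)
  then show "((\<lambda>n. nrm L2 (s n)) \<longlongrightarrow> nrm L2 g) F" by (rule LIM_zero_cancel)
qed

lemma continuous_interval_measurable:
  fixes f :: "real \<Rightarrow> 'b::euclidean_space"
  assumes "continuous_on {0..} f" "0 \<le> s"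
  shows "integrable (lebesgue_on {s..t}) f" "f \<in> borel_measurable (lebesgue_on {s..t})"
proof -
  have "continuous_on {s..t} f" by (rule continuous_on_subset[OF assms(1)]) (use assms(2) in auto)
  then show "integrable (lebesgue_on {s..t}) f" by (rule continuous_imp_integrable_real)
  then show "f \<in> borel_measurable (lebesgue_on {s..t})" by (rule borel_measurable_integrable)
qed


subsection \<open>Mild solutions\<close>

text \<open>The equation of an \<open>H\<^sup>2\<close>-solution convolved with a test function \<open>k\<close> in space and integrated in time.\<close>

definition mild_solution ::
  "complex \<Rightarrow> real \<Rightarrow> (real \<Rightarrow> 'a::euclidean_space \<Rightarrow> complex) \<Rightarrow> (real \<Rightarrow> 'a \<Rightarrow> complex) \<Rightarrow> bool" where
  "mild_solution a m f u \<longleftrightarrow>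
     u \<in> cont_space L2 \<and> f \<in> bochner_Lp_loc 1 L2 \<and>
     (\<forall>T>0. \<exists>g. integrable (lebesgue_on {0<..<T}) g \<and>
        (AE t in lebesgue_on {0<..<T}. u t \<in> elems (Lp (m + 1)) \<and> (\<integral>x. cmod (u t x) powr (m + 1) \<partial>lebesgue) \<le> g t)) \<and>
     (\<forall>k\<in>test_fun UNIV. \<forall>x s t. 0 < s \<longrightarrow> s \<le> t \<longrightarrow>
        \<i> * (conv k (u t) x - conv k (u s) x) =
        (\<integral>\<tau>. conv k (f \<tau>) x - conv (laplacian k) (u \<tau>) x - a * conv k (\<lambda>y. nonlin m (u \<tau> y)) x \<partial>lebesgue_on {s..t}))"

text \<open>Lets every estimate for a difference of solutions bound a single solution.\<close>

lemma mild_solution_zero: "mild_solution a m (\<lambda>t x. 0) (\<lambda>t x. 0)"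
proof -
  have "simple_function (lebesgue_on S) (\<lambda>t. (\<lambda>x::'a. 0::complex))" for S :: "real set" by simp
  then have "strongly_measurable_on S L2 (\<lambda>t x::'a. 0)" for S
    unfolding strongly_measurable_on_def by (intro exI[of _ "\<lambda>n t x. 0"]) auto
  then have "(\<lambda>t x::'a. 0) \<in> bochner_Lp_loc 1 L2" by (simp add: bochner_Lp_loc_def bochner_L1_iff)
  moreover have "conv k (\<lambda>x. 0) x = 0" for k and x :: 'a by (simp add: conv_def)
  moreover have "(\<lambda>x::'a. 0) \<in> elems (Lp (m + 1))" by (simp add: mem_Lp_iff)
  ultimately show ?thesis
    unfolding mild_solution_def by (auto simp: cont_space_def intro!: exI[of _ "\<lambda>_. 0"])
qed

text \<open>Convolution commutes with translation, so the equation of the translate at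
  \<open>x\<close> is the original equation at \<open>x + h\<close>. This makes a solution and its
  translate a pair to which the contraction applies.\<close>

lemma mild_solution_shift:
  assumes m: "0 < m" "m < 1" and u: "mild_solution a m f u"
  shows "mild_solution a m (\<lambda>t x. f t (x + h)) (\<lambda>t x. u t (x + h))"
  unfolding mild_solution_def
proof (intro conjI allI impI ballI)
  have uc: "u \<in> cont_space L2" and f: "f \<in> bochner_Lp_loc 1 L2" using u by (auto simp: mild_solution_def)
  show "(\<lambda>t x. u t (x + h)) \<in> cont_space L2" by (rule cont_space_shift[OF uc])
  show "(\<lambda>t x. f t (x + h)) \<in> bochner_Lp_loc 1 L2"
    using f by (auto simp: bochner_Lp_loc_def intro!: bochner_L1_shift)
  show "\<exists>g. integrable (lebesgue_on {0<..<T}) g \<and>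
        (AE t in lebesgue_on {0<..<T}. (\<lambda>x. u t (x + h)) \<in> elems (Lp (m + 1)) \<and> (\<integral>x. cmod (u t (x + h)) powr (m + 1) \<partial>lebesgue) \<le> g t)"
    if T: "0 < T" for T
  proof -
    obtain g where g: "integrable (lebesgue_on {0<..<T}) g"
      "AE t in lebesgue_on {0<..<T}. u t \<in> elems (Lp (m + 1)) \<and> (\<integral>x. cmod (u t x) powr (m + 1) \<partial>lebesgue) \<le> g t"
      using u T unfolding mild_solution_def by blast
    have "AE t in lebesgue_on {0<..<T}. (\<lambda>x. u t (x + h)) \<in> elems (Lp (m + 1)) \<and> (\<integral>x. cmod (u t (x + h)) powr (m + 1) \<partial>lebesgue) \<le> g t"
      using g(2)
    proof eventually_elim
      case (elim t)
      then have i: "integrable lebesgue (\<lambda>x. cmod (u t x) powr (m + 1))" by (simp add: mem_Lp_iff)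
      show ?case
        using elim integrable_lebesgue_shift[OF i, of h] integral_lebesgue_shift[OF borel_measurable_integrable[OF i], of h]
        by (auto simp: mem_Lp_iff intro: borel_measurable_lebesgue_shift)
    qed
    with g(1) show ?thesis by blast
  qed
  fix k :: "'a \<Rightarrow> complex" and x s t
  assume k: "k \<in> test_fun UNIV" and st: "(0::real) < s" "s \<le> t"
  have kk: "cc_kernel k" by (rule test_fun_cc_kernel[OF k])
  have lk: "cc_kernel (laplacian k)" using k by (intro laplacian_kernel[OF kk]) (simp add: test_fun_def)
  have ul: "conv K (\<lambda>x. u t (x + h)) x = conv K (u t) (x + h)" if "cc_kernel K" "0 \<le> t" for K t
    using cont_space_L2[OF uc that(2)] by (intro conv_shift that) (simp add: mem_L2_iff)
  have nl: "conv k (\<lambda>x. nonlin m (u t (x + h))) x = conv k (\<lambda>x. nonlin m (u t x)) (x + h)" if "0 \<le> t" for t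
    using conv_shift[OF kk loc_integrable_measurable[OF nonlin_loc_integrable[OF cont_space_L2[OF uc that] m]]] .
  have fm: "f \<in> bochner_Lp 1 {s..t} L2" by (rule bochner_L1_loc_interval[OF f st(1)])
  have "\<i> * (conv k (u t) (x + h) - conv k (u s) (x + h)) =
      (\<integral>\<tau>. conv k (f \<tau>) (x + h) - conv (laplacian k) (u \<tau>) (x + h) - a * conv k (\<lambda>y. nonlin m (u \<tau> y)) (x + h) \<partial>lebesgue_on {s..t})"
    using u k st unfolding mild_solution_def by blast
  also have "\<dots> = (\<integral>\<tau>. conv k (\<lambda>x. f \<tau> (x + h)) x - conv (laplacian k) (\<lambda>x. u \<tau> (x + h)) x - a * conv k (\<lambda>y. nonlin m (u \<tau> (y + h))) x \<partial>lebesgue_on {s..t})"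
  proof (rule integral_cong_AE)
    have S: "{s..t} \<in> sets lebesgue" by simp
    have m1: "(\<lambda>\<tau>. conv k (f \<tau>) (x + h)) \<in> borel_measurable (lebesgue_on {s..t})"
      using fm by (intro strongly_measurable_conv[OF S _ kk]) (simp add: bochner_L1_iff)
    have m2: "(\<lambda>\<tau>. conv (laplacian k) (u \<tau>) (x + h)) \<in> borel_measurable (lebesgue_on {s..t})"
      "(\<lambda>\<tau>. conv k (\<lambda>y. nonlin m (u \<tau> y)) (x + h)) \<in> borel_measurable (lebesgue_on {s..t})"
      using continuous_interval_measurable(2)[OF cont_space_conv[OF uc lk]]
        continuous_interval_measurable(2)[OF cont_space_nonlin_conv[OF uc kk m]] st by auto
    show meas: "(\<lambda>\<tau>. conv k (f \<tau>) (x + h) - conv (laplacian k) (u \<tau>) (x + h) - a * conv k (\<lambda>y. nonlin m (u \<tau> y)) (x + h))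
        \<in> borel_measurable (lebesgue_on {s..t})"
      using m1 m2 by measurable
    have "AE \<tau> in lebesgue_on {s..t}. \<tau> \<in> {s..t}" using AE_space[of "lebesgue_on {s..t}"] by simp
    moreover have "AE \<tau> in lebesgue_on {s..t}. f \<tau> \<in> elems L2"
      using fm by (intro strongly_measurable_AE) (simp add: bochner_L1_iff)
    ultimately show ae: "AE \<tau> in lebesgue_on {s..t}.
        conv k (f \<tau>) (x + h) - conv (laplacian k) (u \<tau>) (x + h) - a * conv k (\<lambda>y. nonlin m (u \<tau> y)) (x + h) =
        conv k (\<lambda>x. f \<tau> (x + h)) x - conv (laplacian k) (\<lambda>x. u \<tau> (x + h)) x - a * conv k (\<lambda>y. nonlin m (u \<tau> (y + h))) x"
    proof eventually_elim
      case (elim \<tau>)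
      then show ?case
        using st ul[OF lk, of \<tau>] nl[of \<tau>] conv_shift[OF kk, of "f \<tau>" h x] by (simp add: mem_L2_iff)
    qed
    show "(\<lambda>\<tau>. conv k (\<lambda>x. f \<tau> (x + h)) x - conv (laplacian k) (\<lambda>x. u \<tau> (x + h)) x - a * conv k (\<lambda>y. nonlin m (u \<tau> (y + h))) x)
        \<in> borel_measurable (lebesgue_on {s..t})"
      by (rule borel_measurable_lebesgue_on_AE[OF S meas ae])
  qed
  finally show "\<i> * (conv k (\<lambda>x. u t (x + h)) x - conv k (\<lambda>x. u s (x + h)) x) =
      (\<integral>\<tau>. conv k (\<lambda>x. f \<tau> (x + h)) x - conv (laplacian k) (\<lambda>x. u \<tau> (x + h)) x - a * conv k (\<lambda>y. nonlin m (u \<tau> (y + h))) x \<partial>lebesgue_on {s..t})"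
    using ul[OF kk] st by simp
qed

lemma conv_L1_integrable:
  assumes f: "f \<in> bochner_Lp 1 S L2" and S: "S \<in> sets lebesgue" and k: "cc_kernel k"
  shows "integrable (lebesgue_on S) (\<lambda>\<tau>. conv k (f \<tau>) x)"
proof (rule Bochner_Integration.integrable_bound)
  show "integrable (lebesgue_on S) (\<lambda>\<tau>. nrm L2 k * nrm L2 (f \<tau>))"
    using f by (simp add: bochner_L1_iff)
  show "(\<lambda>\<tau>. conv k (f \<tau>) x) \<in> borel_measurable (lebesgue_on S)"
    using f by (intro strongly_measurable_conv[OF S _ k]) (simp add: bochner_L1_iff)
  have "AE \<tau> in lebesgue_on S. f \<tau> \<in> elems L2"
    using f by (intro strongly_measurable_AE) (simp add: bochner_L1_iff)
  then show "AE \<tau> in lebesgue_on S. norm (conv k (f \<tau>) x) \<le> norm (nrm L2 k * nrm L2 (f \<tau>))"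
    by eventually_elim (use conv_bound[OF k] in simp)
qed

lemma mild_rhs_integrable:
  assumes m: "0 < m" "m < 1" and uc: "u \<in> cont_space L2" and f: "f \<in> bochner_Lp_loc 1 L2"
    and k: "cc_kernel k" and L: "cc_kernel L" and s: "0 < s"
  shows "integrable (lebesgue_on {s..t}) (\<lambda>\<tau>. conv k (f \<tau>) x - conv L (u \<tau>) x - a * conv k (\<lambda>y. nonlin m (u \<tau> y)) x)"
  using conv_L1_integrable[OF bochner_L1_loc_interval[OF f s] _ k]
    continuous_interval_measurable(1)[OF cont_space_conv[OF uc L]]
    continuous_interval_measurable(1)[OF cont_space_nonlin_conv[OF uc k m]] s
  by (intro Bochner_Integration.integrable_diff integrable_mult_right) auto

subsection \<open>The energy inequality\<close>

lemma integrable_pair_lborelI: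
  fixes P :: "'c \<times> 'a::euclidean_space \<Rightarrow> complex"
  assumes P: "P \<in> borel_measurable (M \<Otimes>\<^sub>M lborel)" and \<beta>: "integrable M \<beta>"
    and le: "AE \<tau> in M. (\<integral>\<^sup>+x. ennreal (norm (P (\<tau>, x))) \<partial>lborel) \<le> ennreal (\<beta> \<tau>)"
  shows "integrable (M \<Otimes>\<^sub>M lborel) P"
proof (rule integrableI_bounded[OF P])
  have "(\<integral>\<^sup>+p. ennreal (norm (P p)) \<partial>(M \<Otimes>\<^sub>M lborel)) = (\<integral>\<^sup>+\<tau>. \<integral>\<^sup>+x. ennreal (norm (P (\<tau>, x))) \<partial>lborel \<partial>M)"
    by (rule lborel.nn_integral_fst[symmetric], rule measurable_compose[OF P]) measurable
  also have "\<dots> \<le> (\<integral>\<^sup>+\<tau>. ennreal (norm (\<beta> \<tau>)) \<partial>M)"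
    using le by (intro nn_integral_mono_AE) (auto elim!: eventually_mono intro: order_trans ennreal_leI)
  also have "\<dots> < \<infinity>" using \<beta> by (simp add: integrable_iff_bounded)
  finally show "(\<integral>\<^sup>+p. ennreal (norm (P p)) \<partial>(M \<Otimes>\<^sub>M lborel)) < \<infinity>" .
qed

text \<open>For each fixed point \<open>x\<close> the mollified difference is absolutely continuous
  in time, which gives the identity for its squared modulus; integrating over \<open>x\<close> and
  exchanging the integrals gives the energy balance. The nonlinear pairing \<open>C\<close> is kept
  on the left as it stands: dissipativity is a pointwise property of the unmollified functions, so a
  sign is available only in the limit. The majorant \<open>\<beta>\<close> provides integrability
  for Fubini and later dominates \<open>C\<close>.\<close>

lemma mollified_energy:
  fixes u v f g :: "real \<Rightarrow> 'a::euclidean_space \<Rightarrow> complex"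
  assumes m: "0 < m" "m < 1" and U: "mild_solution a m f u" and V: "mild_solution a m g v"
    and st: "0 < s" "s \<le> t" and \<rho>: "mollifier e \<rho>" "\<rho> \<in> test_fun UNIV"
    and \<beta>: "integrable (lebesgue_on {s..t}) \<beta>"
    and \<beta>_bound: "AE \<tau> in lebesgue_on {s..t}. 0 \<le> \<beta> \<tau> \<and>
      (\<forall>h. (\<integral>\<^sup>+x. ennreal (cmod (nonlin m (u \<tau> (x - h)) - nonlin m (v \<tau> (x - h))) * cmod (u \<tau> x - v \<tau> x)) \<partial>lebesgue) \<le> ennreal (\<beta> \<tau>))"
  defines "w \<equiv> \<lambda>\<tau> x. u \<tau> x - v \<tau> x" and "N \<equiv> \<lambda>\<tau> x. nonlin m (u \<tau> x) - nonlin m (v \<tau> x)"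
    and "F \<equiv> \<lambda>\<tau> x. f \<tau> x - g \<tau> x"
  defines "C \<equiv> \<lambda>\<tau>. \<integral>x. conv \<rho> (N \<tau>) x * cnj (conv \<rho> (w \<tau>) x) \<partial>lborel"
    and "E \<equiv> \<lambda>\<tau>. \<integral>x. conv \<rho> (w \<tau>) x * cnj (conv \<rho> (w \<tau>) x) \<partial>lborel"
  shows "C \<in> borel_measurable (lebesgue_on {s..t})"
    and "AE \<tau> in lebesgue_on {s..t}. cmod (C \<tau>) \<le> \<beta> \<tau>"
    and "Re (E t) + 2 * (\<integral>\<tau>. Im (a * C \<tau>) \<partial>lebesgue_on {s..t}) \<le>
      Re (E s) + 2 * (\<integral>\<tau>. nrm L2 (F \<tau>) * nrm L2 (w \<tau>) \<partial>lebesgue_on {s..t})"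
proof -
  define M where "M = lebesgue_on {s..t}"
  define L where "L = laplacian \<rho>"
  have uc: "u \<in> cont_space L2" and vc: "v \<in> cont_space L2" and fl: "f \<in> bochner_Lp_loc 1 L2" and gl: "g \<in> bochner_Lp_loc 1 L2"
    using U V by (auto simp: mild_solution_def)
  have wc: "w \<in> cont_space L2" unfolding w_def by (rule cont_space_diff[OF uc vc])
  have k: "cc_kernel \<rho>" by (rule mollifier_kernel[OF \<rho>(1)])
  have C\<rho>: "Ck n \<rho>" for n using \<rho>(2) by (simp add: test_fun_def)
  have L: "cc_kernel L" unfolding L_def by (rule laplacian_kernel[OF k C\<rho>])
  have Lr: "cnj (L x) = L x" "L (- x) = L x" for x
    unfolding L_def by (rule laplacian_cnj[OF C\<rho> mollifier_cnj[OF \<rho>(1)]], rule laplacian_even[OF C\<rho> mollifier_even[OF \<rho>(1)]])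
  have wL2: "w \<tau> \<in> elems L2" if "0 \<le> \<tau>" for \<tau> by (rule cont_space_L2[OF wc that])
  have I: "{s..t} \<in> sets lebesgue" by simp
  have fb: "f \<in> bochner_Lp 1 {s..t} L2" "g \<in> bochner_Lp 1 {s..t} L2"
    by (rule bochner_L1_loc_interval[OF fl st(1)], rule bochner_L1_loc_interval[OF gl st(1)])
  have F: "F \<in> bochner_Lp 1 {s..t} L2" unfolding F_def by (rule bochner_L1_diff[OF I fb])
  have FL2: "AE \<tau> in M. F \<tau> \<in> elems L2"
    unfolding M_def using F by (intro strongly_measurable_AE) (simp add: bochner_L1_iff)
  have fgL2: "AE \<tau> in M. f \<tau> \<in> elems L2 \<and> g \<tau> \<in> elems L2"
    unfolding M_def using fb strongly_measurable_AE by (auto simp: bochner_L1_iff)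
  have inI: "AE \<tau> in M. \<tau> \<in> {s..t}" unfolding M_def by (rule AE_I2) simp
  have NL: "loc_integrable (N \<tau>)" if "0 \<le> \<tau>" for \<tau>
  proof -
    have "loc_integrable (\<lambda>x. nonlin m (u \<tau> x))" "loc_integrable (\<lambda>x. nonlin m (v \<tau> x))"
      by (rule nonlin_loc_integrable[OF cont_space_L2[OF uc that] m], rule nonlin_loc_integrable[OF cont_space_L2[OF vc that] m])
    then show ?thesis unfolding loc_integrable_def N_def
      by (auto simp: scaleR_diff_right intro!: Bochner_Integration.integrable_diff)
  qed
  \<comment> \<open>\<open>F \<tau>\<close> lies in L^2 only for almost every time. Putting 0 at the
    remaining times makes the function continuous in \<open>x\<close> for every time, as
    \<open>caratheodory_measurable\<close> demands.\<close>
  define Fk where "Fk \<tau> x = (if F \<tau> \<in> elems L2 then conv \<rho> (F \<tau>) x else 0)" for \<tau> x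
  have N_conv: "conv \<rho> (N \<tau>) x = conv \<rho> (\<lambda>y. nonlin m (u \<tau> y)) x - conv \<rho> (\<lambda>y. nonlin m (v \<tau> y)) x" if "0 \<le> \<tau>" for \<tau> x
    unfolding N_def by (intro conv_diff k nonlin_loc_integrable cont_space_L2 uc vc m that)
  have w_conv: "conv K (w \<tau>) x = conv K (u \<tau>) x - conv K (v \<tau>) x" if "0 \<le> \<tau>" "cc_kernel K" for \<tau> x K
    unfolding w_def by (intro conv_diff that L2_loc_integrable cont_space_L2 uc vc)
  have M_w: "(\<lambda>\<tau>. conv K (w \<tau>) x) \<in> borel_measurable M" if "cc_kernel K" for K x
    unfolding M_def using continuous_interval_measurable(2)[OF cont_space_conv[OF wc that]] st by simp
  have M_N: "(\<lambda>\<tau>. conv \<rho> (N \<tau>) x) \<in> borel_measurable M" for x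
  proof -
    have "(\<lambda>\<tau>. conv \<rho> (\<lambda>y. nonlin m (u \<tau> y)) x - conv \<rho> (\<lambda>y. nonlin m (v \<tau> y)) x) \<in> borel_measurable M"
      unfolding M_def using st
      by (intro borel_measurable_diff continuous_interval_measurable(2) cont_space_nonlin_conv uc vc k m) auto
    moreover have "\<tau> \<in> space M \<Longrightarrow> conv \<rho> (\<lambda>y. nonlin m (u \<tau> y)) x - conv \<rho> (\<lambda>y. nonlin m (v \<tau> y)) x = conv \<rho> (N \<tau>) x" for \<tau>
      using st by (simp add: M_def N_conv)
    ultimately show ?thesis by (subst measurable_cong[symmetric])
  qed
  have M_F: "(\<lambda>\<tau>. Fk \<tau> x) \<in> borel_measurable M" for x
    unfolding M_def
  proof (rule borel_measurable_lebesgue_on_AE[OF I])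
    show "(\<lambda>\<tau>. conv \<rho> (F \<tau>) x) \<in> borel_measurable (lebesgue_on {s..t})"
      using F by (intro strongly_measurable_conv[OF I _ k]) (simp add: bochner_L1_iff)
    show "AE \<tau> in lebesgue_on {s..t}. conv \<rho> (F \<tau>) x = Fk \<tau> x"
      using FL2 unfolding M_def by eventually_elim (simp add: Fk_def)
  qed
  have pos: "0 \<le> \<tau>" if "\<tau> \<in> space M" for \<tau> using that st by (simp add: M_def)
  have J_w: "(\<lambda>(\<tau>, x). conv K (w \<tau>) x) \<in> borel_measurable (M \<Otimes>\<^sub>M lborel)" if "cc_kernel K" for K
    by (rule caratheodory_measurable[OF M_w[OF that]]) (intro conv_continuous that L2_loc_integrable wL2 pos)
  have J_N: "(\<lambda>(\<tau>, x). conv \<rho> (N \<tau>) x) \<in> borel_measurable (M \<Otimes>\<^sub>M lborel)"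
    by (rule caratheodory_measurable[OF M_N]) (intro conv_continuous k NL pos)
  have J_F: "(\<lambda>(\<tau>, x). Fk \<tau> x) \<in> borel_measurable (M \<Otimes>\<^sub>M lborel)"
  proof (rule caratheodory_measurable[OF M_F])
    show "continuous_on UNIV (Fk \<tau>)" for \<tau>
      using conv_continuous[OF k L2_loc_integrable, of "F \<tau>"] by (cases "F \<tau> \<in> elems L2") (auto simp: Fk_def[abs_def])
  qed
  let ?W = "\<lambda>\<tau> x. cnj (conv \<rho> (w \<tau>) x)"
  have k1: "(\<integral>x. cmod (\<rho> x) \<partial>lebesgue) = 1" by (rule mollifier_norm_integral[OF \<rho>(1)])
  \<comment> \<open>Each of the three pairings is bounded in absolute value through correlations.
    The L^1 norm 1 of \<open>\<rho>\<close> disappears; for the Laplacian the L^1 norm of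
    \<open>L\<close> remains, which depends on \<open>\<rho>\<close> but is finite.\<close>
  have b_F: "AE \<tau> in M. (\<integral>\<^sup>+x. ennreal (norm (Fk \<tau> x * ?W \<tau> x)) \<partial>lborel) \<le> ennreal (nrm L2 (F \<tau>) * nrm L2 (w \<tau>))"
    using FL2 inI
  proof eventually_elim
    case (elim \<tau>)
    then have w: "w \<tau> \<in> elems L2" using st by (intro wL2) auto
    show ?case
      using conv_mult_bound[OF k k L2_loc_integrable[OF elim(1)] L2_loc_integrable[OF w] corr_L2_bound[OF elim(1) w]]
        elim(1) by (simp add: Fk_def k1)
  qed
  have b_L: "AE \<tau> in M. (\<integral>\<^sup>+x. ennreal (norm (conv L (w \<tau>) x * ?W \<tau> x)) \<partial>lborel) \<le> ennreal (nrm L2 (w \<tau>) * nrm L2 (w \<tau>) * (\<integral>x. cmod (L x) \<partial>lebesgue))"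
    using inI
  proof eventually_elim
    case (elim \<tau>)
    then have w: "w \<tau> \<in> elems L2" using st by (intro wL2) auto
    show ?case
      using conv_mult_bound[OF L k L2_loc_integrable[OF w] L2_loc_integrable[OF w] corr_L2_bound[OF w w]]
      by (simp add: k1)
  qed
  have b_N: "AE \<tau> in M. (\<integral>\<^sup>+x. ennreal (norm (conv \<rho> (N \<tau>) x * ?W \<tau> x)) \<partial>lborel) \<le> ennreal (\<beta> \<tau>)"
    using \<beta>_bound inI unfolding M_def
  proof eventually_elim
    case (elim \<tau>)
    then have w: "w \<tau> \<in> elems L2" and n: "loc_integrable (N \<tau>)" using st by (auto intro!: wL2 NL)
    have "(\<integral>\<^sup>+x. ennreal (cmod (N \<tau> (x - h)) * cmod (w \<tau> x)) \<partial>lebesgue) \<le> ennreal (\<beta> \<tau>)" for h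
      using elim(1) unfolding N_def w_def by blast
    from conv_mult_bound[OF k k n L2_loc_integrable[OF w] this] elim(1)
    show ?case by (simp add: k1)
  qed
  have wn: "continuous_on {s..t} (\<lambda>\<tau>. nrm L2 (w \<tau>))"
    by (rule continuous_on_subset[OF cont_space_nrm[OF wc]]) (use st in auto)
  have Fw: "integrable M (\<lambda>\<tau>. nrm L2 (F \<tau>) * nrm L2 (w \<tau>))"
  proof -
    obtain B where "\<forall>y\<in>(\<lambda>\<tau>. nrm L2 (w \<tau>)) ` {s..t}. norm y \<le> B"
      using compact_imp_bounded[OF compact_continuous_image[OF wn compact_Icc]] unfolding bounded_iff by blast
    then have B: "nrm L2 (w \<tau>) \<le> B" if "\<tau> \<in> {s..t}" for \<tau>
      using that by auto
    have Fi: "integrable M (\<lambda>\<tau>. nrm L2 (F \<tau>))" using F by (simp add: bochner_L1_iff M_def)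
    show ?thesis
    proof (rule Bochner_Integration.integrable_bound)
      show "integrable M (\<lambda>\<tau>. nrm L2 (F \<tau>) * B)" using Fi by simp
      have "(\<lambda>\<tau>. nrm L2 (w \<tau>)) \<in> borel_measurable M"
        unfolding M_def by (rule borel_measurable_integrable[OF continuous_imp_integrable_real[OF wn]])
      then show "(\<lambda>\<tau>. nrm L2 (F \<tau>) * nrm L2 (w \<tau>)) \<in> borel_measurable M"
        using borel_measurable_integrable[OF Fi] by measurable
      show "AE \<tau> in M. norm (nrm L2 (F \<tau>) * nrm L2 (w \<tau>)) \<le> norm (nrm L2 (F \<tau>) * B)"
        using inI
      proof eventually_elim
        case (elim \<tau>)
        have "nrm L2 (F \<tau>) * nrm L2 (w \<tau>) \<le> nrm L2 (F \<tau>) * B"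
          using B[OF elim] by (intro mult_left_mono) auto
        then show ?case by (auto intro: order_trans[OF _ abs_ge_self])
      qed
    qed
  qed
  have i_F: "integrable (M \<Otimes>\<^sub>M lborel) (\<lambda>p. Fk (fst p) (snd p) * ?W (fst p) (snd p))"
    by (rule integrable_pair_lborelI[OF _ Fw]) (use J_F J_w[OF k] b_F in \<open>simp_all add: case_prod_beta\<close>)
  have i_L: "integrable (M \<Otimes>\<^sub>M lborel) (\<lambda>p. conv L (w (fst p)) (snd p) * ?W (fst p) (snd p))"
  proof (rule integrable_pair_lborelI)
    show "integrable M (\<lambda>\<tau>. nrm L2 (w \<tau>) * nrm L2 (w \<tau>) * (\<integral>x. cmod (L x) \<partial>lebesgue))"
      unfolding M_def by (intro continuous_imp_integrable_real continuous_intros wn)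
  qed (use J_w[OF L] J_w[OF k] b_L in \<open>simp_all add: case_prod_beta\<close>)
  have i_N: "integrable (M \<Otimes>\<^sub>M lborel) (\<lambda>p. conv \<rho> (N (fst p)) (snd p) * ?W (fst p) (snd p))"
    by (rule integrable_pair_lborelI[OF _ \<beta>[folded M_def]]) (use J_N J_w[OF k] b_N in \<open>simp_all add: case_prod_beta\<close>)
  define R where "R \<tau> x = Fk \<tau> x - conv L (w \<tau>) x - a * conv \<rho> (N \<tau>) x" for \<tau> x
  have i_R: "integrable (M \<Otimes>\<^sub>M lborel) (\<lambda>p. R (fst p) (snd p) * ?W (fst p) (snd p))"
  proof -
    have "(\<lambda>p. R (fst p) (snd p) * ?W (fst p) (snd p)) = (\<lambda>p. Fk (fst p) (snd p) * ?W (fst p) (snd p) -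
        conv L (w (fst p)) (snd p) * ?W (fst p) (snd p) - a * (conv \<rho> (N (fst p)) (snd p) * ?W (fst p) (snd p)))"
      by (simp add: R_def algebra_simps)
    then show ?thesis using i_F i_L i_N by simp
  qed
  interpret Mf: finite_measure M
    unfolding M_def by (rule finite_measure_lebesgue_on) simp
  interpret Mp: pair_sigma_finite M "lborel :: 'a measure" ..
  \<comment> \<open>Subtracting the two mild equations at the point \<open>x\<close> shows that
    \<open>R\<close> integrates to \<open>\<i>\<close> times the increment of the mollified
    difference.\<close>
  have AC: "(cmod (conv \<rho> (w t) x))\<^sup>2 - (cmod (conv \<rho> (w s) x))\<^sup>2 = 2 * (\<integral>\<tau>. Im (R \<tau> x * ?W \<tau> x) \<partial>M)" for x
    unfolding M_def
  proof (rule abs_continuous_sq[OF st(2)])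
    define Ru where "Ru \<tau> = conv \<rho> (f \<tau>) x - conv L (u \<tau>) x - a * conv \<rho> (\<lambda>y. nonlin m (u \<tau> y)) x" for \<tau>
    define Rv where "Rv \<tau> = conv \<rho> (g \<tau>) x - conv L (v \<tau>) x - a * conv \<rho> (\<lambda>y. nonlin m (v \<tau> y)) x" for \<tau>
    have Ri: "integrable (lebesgue_on {s..\<tau>}) Ru" "integrable (lebesgue_on {s..\<tau>}) Rv" for \<tau>
      unfolding Ru_def Rv_def by (rule mild_rhs_integrable[OF m uc fl k L st(1)], rule mild_rhs_integrable[OF m vc gl k L st(1)])
    have Rae: "AE \<tau> in M. Ru \<tau> - Rv \<tau> = R \<tau> x"
      using fgL2 FL2 inI
    proof eventually_elim
      case (elim \<tau>)
      then have "0 \<le> \<tau>" using st by simp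
      moreover have "conv \<rho> (F \<tau>) x = conv \<rho> (f \<tau>) x - conv \<rho> (g \<tau>) x"
        unfolding F_def using elim by (intro conv_diff k L2_loc_integrable) auto
      ultimately show ?case
        using elim by (simp add: Ru_def Rv_def R_def Fk_def N_conv w_conv[OF _ L] algebra_simps)
    qed
    have Rm: "(\<lambda>\<tau>. R \<tau> x) \<in> borel_measurable (lebesgue_on {s..t})"
      using M_F[of x] M_w[OF L, of x] M_N[of x] unfolding R_def M_def by measurable
    show Rint: "integrable (lebesgue_on {s..t}) (\<lambda>\<tau>. R \<tau> x)"
      using Rae unfolding M_def
      by (intro integrable_cong_AE_imp[OF Bochner_Integration.integrable_diff[OF Ri(1) Ri(2)] Rm])
    fix \<tau> assume \<tau>: "s \<le> \<tau>" "\<tau> \<le> t"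
    have "\<i> * (conv \<rho> (w \<tau>) x - conv \<rho> (w s) x) =
        \<i> * (conv \<rho> (u \<tau>) x - conv \<rho> (u s) x) - \<i> * (conv \<rho> (v \<tau>) x - conv \<rho> (v s) x)"
      using \<tau> st by (simp add: w_conv[OF _ k] algebra_simps)
    also have "\<i> * (conv \<rho> (u \<tau>) x - conv \<rho> (u s) x) = (\<integral>r. Ru r \<partial>lebesgue_on {s..\<tau>})"
      using U \<rho>(2) st(1) \<tau>(1) unfolding mild_solution_def Ru_def L_def by blast
    also have "\<i> * (conv \<rho> (v \<tau>) x - conv \<rho> (v s) x) = (\<integral>r. Rv r \<partial>lebesgue_on {s..\<tau>})"
      using V \<rho>(2) st(1) \<tau>(1) unfolding mild_solution_def Rv_def L_def by blast
    also have "(\<integral>r. Ru r \<partial>lebesgue_on {s..\<tau>}) - (\<integral>r. Rv r \<partial>lebesgue_on {s..\<tau>}) = (\<integral>r. Ru r - Rv r \<partial>lebesgue_on {s..\<tau>})"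
      by (rule Bochner_Integration.integral_diff[symmetric, OF Ri])
    also have "\<dots> = (\<integral>r. R r x \<partial>lebesgue_on {s..\<tau>})"
    proof (rule integral_cong_AE)
      show "(\<lambda>r. Ru r - Rv r) \<in> borel_measurable (lebesgue_on {s..\<tau>})" using Ri[of \<tau>] by auto
      show "(\<lambda>r. R r x) \<in> borel_measurable (lebesgue_on {s..\<tau>})"
        using integrable_lebesgue_on_subset[OF Rint, of "{s..\<tau>}"] \<tau> by auto
      show "AE r in lebesgue_on {s..\<tau>}. Ru r - Rv r = R r x"
        by (rule AE_lebesgue_on_subset[OF Rae[unfolded M_def]]) (use \<tau> in auto)
    qed
    finally show "\<i> * (conv \<rho> (w \<tau>) x - conv \<rho> (w s) x) = (\<integral>r. R r x \<partial>lebesgue_on {s..\<tau>})" .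
  qed
  have Ei: "integrable lborel (\<lambda>x. conv \<rho> (w \<tau>) x * cnj (conv \<rho> (w \<tau>) x))" if "0 \<le> \<tau>" for \<tau>
    using conv_mult_integrable[OF k k L2_loc_integrable[OF wL2[OF that]] L2_loc_integrable[OF wL2[OF that]] corr_L2_bound[OF wL2[OF that] wL2[OF that]]]
    by simp
  have E_eq: "Re (E \<tau>) = (\<integral>x. (cmod (conv \<rho> (w \<tau>) x))\<^sup>2 \<partial>lborel)" and
    E_int: "integrable lborel (\<lambda>x. (cmod (conv \<rho> (w \<tau>) x))\<^sup>2)" if "0 \<le> \<tau>" for \<tau>
  proof -
    have *: "(cmod (conv \<rho> (w \<tau>) x))\<^sup>2 = Re (conv \<rho> (w \<tau>) x * cnj (conv \<rho> (w \<tau>) x))" for x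
      by (metis Re_complex_of_real complex_norm_square)
    show "integrable lborel (\<lambda>x. (cmod (conv \<rho> (w \<tau>) x))\<^sup>2)" unfolding * by (rule integrable_Re[OF Ei[OF that]])
    show "Re (E \<tau>) = (\<integral>x. (cmod (conv \<rho> (w \<tau>) x))\<^sup>2 \<partial>lborel)" unfolding * E_def by (rule integral_Re[symmetric, OF Ei[OF that]])
  qed
  have Im_int: "integrable (M \<Otimes>\<^sub>M lborel) (\<lambda>p. Im (R (fst p) (snd p) * ?W (fst p) (snd p)))"
    by (rule integrable_Im[OF i_R])
  then have Im_int': "integrable (M \<Otimes>\<^sub>M lborel) (\<lambda>(\<tau>, x). Im (R \<tau> x * ?W \<tau> x))" by (simp only: case_prod_unfold)
  have "Re (E t) - Re (E s) = (\<integral>x. (cmod (conv \<rho> (w t) x))\<^sup>2 - (cmod (conv \<rho> (w s) x))\<^sup>2 \<partial>lborel)"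
    using st by (simp add: E_eq E_int)
  also have "\<dots> = 2 * (\<integral>x. (\<integral>\<tau>. Im (R \<tau> x * ?W \<tau> x) \<partial>M) \<partial>lborel)"
    unfolding AC by simp
  also have "(\<integral>x. (\<integral>\<tau>. Im (R \<tau> x * ?W \<tau> x) \<partial>M) \<partial>lborel) = (\<integral>\<tau>. (\<integral>x. Im (R \<tau> x * ?W \<tau> x) \<partial>lborel) \<partial>M)"
    by (rule Mp.Fubini_integral[OF Im_int'])
  finally have EE: "Re (E t) - Re (E s) = 2 * (\<integral>\<tau>. (\<integral>x. Im (R \<tau> x * ?W \<tau> x) \<partial>lborel) \<partial>M)" .
  have Cint: "integrable M C"
    unfolding C_def using Mp.integrable_fst'[OF i_N] by simp
  then show "C \<in> borel_measurable (lebesgue_on {s..t})" by (auto simp: M_def)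
  \<comment> \<open>A function that is not integrable has integral 0, so the bound on the absolute
    integral carries over in either case.\<close>
  have norm_le: "cmod (\<integral>x. h x \<partial>lborel) \<le> G" if "(\<integral>\<^sup>+x. ennreal (norm (h x)) \<partial>lborel) \<le> ennreal G" "0 \<le> G" for h :: "'a \<Rightarrow> complex" and G
  proof (cases "integrable lborel h")
    case True
    have "ennreal (cmod (\<integral>x. h x \<partial>lborel)) \<le> ennreal G"
      by (rule order_trans[OF integral_norm_bound_ennreal[OF True] that(1)])
    then show ?thesis using that(2) by simp
  next
    case False
    then show ?thesis using that(2) by (simp add: not_integrable_integral_eq)
  qed
  show "AE \<tau> in lebesgue_on {s..t}. cmod (C \<tau>) \<le> \<beta> \<tau>"
    using b_N \<beta>_bound unfolding M_def by eventually_elim (simp add: C_def norm_le)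
  have "(\<integral>\<tau>. (\<integral>x. Im (R \<tau> x * ?W \<tau> x) \<partial>lborel) \<partial>M) \<le> (\<integral>\<tau>. nrm L2 (F \<tau>) * nrm L2 (w \<tau>) - Im (a * C \<tau>) \<partial>M)"
  proof (rule integral_mono_AE)
    show "integrable M (\<lambda>\<tau>. \<integral>x. Im (R \<tau> x * ?W \<tau> x) \<partial>lborel)"
      using Mp.integrable_fst'[OF Im_int] by simp
    show "integrable M (\<lambda>\<tau>. nrm L2 (F \<tau>) * nrm L2 (w \<tau>) - Im (a * C \<tau>))"
      by (intro Bochner_Integration.integrable_diff Fw integrable_Im integrable_mult_right Cint)
    show "AE \<tau> in M. (\<integral>x. Im (R \<tau> x * ?W \<tau> x) \<partial>lborel) \<le> nrm L2 (F \<tau>) * nrm L2 (w \<tau>) - Im (a * C \<tau>)"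
      using Mp.AE_integrable_fst'[OF i_F] Mp.AE_integrable_fst'[OF i_L] Mp.AE_integrable_fst'[OF i_N] b_F inI
    proof eventually_elim
      case (elim \<tau>)
      have w: "w \<tau> \<in> elems L2" using elim st by (intro wL2) auto
      have iF: "integrable lborel (\<lambda>x. Fk \<tau> x * ?W \<tau> x)" and iL: "integrable lborel (\<lambda>x. conv L (w \<tau>) x * ?W \<tau> x)"
        and iN: "integrable lborel (\<lambda>x. conv \<rho> (N \<tau>) x * ?W \<tau> x)" using elim by simp_all
      have eq: "R \<tau> x * ?W \<tau> x = Fk \<tau> x * ?W \<tau> x - conv L (w \<tau>) x * ?W \<tau> x - a * (conv \<rho> (N \<tau>) x * ?W \<tau> x)" for x
        by (simp add: R_def algebra_simps)
      have "(\<integral>x. Im (R \<tau> x * ?W \<tau> x) \<partial>lborel) = Im (\<integral>x. R \<tau> x * ?W \<tau> x \<partial>lborel)"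
        unfolding eq using iF iL iN by (intro integral_Im) auto
      also have "\<dots> = Im (\<integral>x. Fk \<tau> x * ?W \<tau> x \<partial>lborel) - Im (\<integral>x. conv L (w \<tau>) x * ?W \<tau> x \<partial>lborel) - Im (a * C \<tau>)"
        unfolding eq C_def using iF iL iN by simp
      \<comment> \<open>The only place where the Laplacian could contribute.\<close>
      also have "Im (\<integral>x. conv L (w \<tau>) x * ?W \<tau> x \<partial>lborel) = 0"
        by (rule conv_laplace_real[OF L Lr k mollifier_cnj[OF \<rho>(1)] mollifier_even[OF \<rho>(1)] w])
      also have "Im (\<integral>x. Fk \<tau> x * ?W \<tau> x \<partial>lborel) \<le> nrm L2 (F \<tau>) * nrm L2 (w \<tau>)"
        using norm_le[OF elim(4)] abs_Im_le_cmod[of "\<integral>x. Fk \<tau> x * ?W \<tau> x \<partial>lborel"] by simp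
      finally show ?case by simp
    qed
  qed
  also have "\<dots> = (\<integral>\<tau>. nrm L2 (F \<tau>) * nrm L2 (w \<tau>) \<partial>M) - (\<integral>\<tau>. Im (a * C \<tau>) \<partial>M)"
    by (intro Bochner_Integration.integral_diff Fw integrable_Im integrable_mult_right Cint)
  finally show "Re (E t) + 2 * (\<integral>\<tau>. Im (a * C \<tau>) \<partial>lebesgue_on {s..t}) \<le>
      Re (E s) + 2 * (\<integral>\<tau>. nrm L2 (F \<tau>) * nrm L2 (w \<tau>) \<partial>lebesgue_on {s..t})"
    using EE unfolding M_def by linarith
qed

text \<open>The limit of \<open>mollified_energy\<close> along mollifiers of radius
  \<open>1 / Suc n\<close>. At almost every time the nonlinear pairing converges to
  \<open>D\<close>, because the correlation is continuous at 0; the majorant \<open>\<beta>\<close>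
  then allows dominated convergence in time. The forcing term does not depend on the
  mollifier.\<close>

lemma mild_energy:
  fixes u v f g :: "real \<Rightarrow> 'a::euclidean_space \<Rightarrow> complex"
  assumes m: "0 < m" "m < 1" and U: "mild_solution a m f u" and V: "mild_solution a m g v"
    and st: "0 < s" "s \<le> t"
  defines "w \<equiv> \<lambda>\<tau> x. u \<tau> x - v \<tau> x"
    and "D \<equiv> \<lambda>\<tau>. \<integral>x. (nonlin m (u \<tau> x) - nonlin m (v \<tau> x)) * cnj (u \<tau> x - v \<tau> x) \<partial>lebesgue"
  shows "integrable (lebesgue_on {s..t}) D"
    and "(nrm L2 (w t))\<^sup>2 + 2 * (\<integral>\<tau>. Im (a * D \<tau>) \<partial>lebesgue_on {s..t}) \<le>
      (nrm L2 (w s))\<^sup>2 + 2 * (\<integral>\<tau>. nrm L2 (\<lambda>x. f \<tau> x - g \<tau> x) * nrm L2 (w \<tau>) \<partial>lebesgue_on {s..t})"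
proof -
  define N where "N = (\<lambda>\<tau> x. nonlin m (u \<tau> x) - nonlin m (v \<tau> x))"
  let ?M = "lebesgue_on {s..t}"
  have I: "{s..t} \<in> sets lebesgue" by simp
  have uc: "u \<in> cont_space L2" and vc: "v \<in> cont_space L2" using U V by (auto simp: mild_solution_def)
  have wc: "w \<in> cont_space L2" unfolding w_def by (rule cont_space_diff[OF uc vc])
  have T: "0 < t + 1" "{s..t} \<subseteq> {0<..<t + 1}" "{0<..<t + 1} \<in> sets lebesgue" using st by auto
  obtain gu where gu: "integrable (lebesgue_on {0<..<t + 1}) gu"
      "AE \<tau> in lebesgue_on {0<..<t + 1}. u \<tau> \<in> elems (Lp (m + 1)) \<and> (\<integral>x. cmod (u \<tau> x) powr (m + 1) \<partial>lebesgue) \<le> gu \<tau>"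
    using U T(1) unfolding mild_solution_def by blast
  obtain gv where gv: "integrable (lebesgue_on {0<..<t + 1}) gv"
      "AE \<tau> in lebesgue_on {0<..<t + 1}. v \<tau> \<in> elems (Lp (m + 1)) \<and> (\<integral>x. cmod (v \<tau> x) powr (m + 1) \<partial>lebesgue) \<le> gv \<tau>"
    using V T(1) unfolding mild_solution_def by blast
  \<comment> \<open>\<open>corr_power_bound\<close> doubles the sum of two integrals, one for
    \<open>P\<close> and one for \<open>w \<tau>\<close>. Each is at most
    \<open>4 * (gu \<tau> + gv \<tau>)\<close>, the 4 being a bound for
    \<open>2 powr (m + 1)\<close>.\<close>
  define \<beta> where "\<beta> \<tau> = 16 * (gu \<tau> + gv \<tau>)" for \<tau>
  have \<beta>: "integrable ?M \<beta>"
    unfolding \<beta>_def using integrable_lebesgue_on_subset[OF gu(1) T(2) I T(3)] integrable_lebesgue_on_subset[OF gv(1) T(2) I T(3)] by simp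
  have inI: "AE \<tau> in ?M. \<tau> \<in> {s..t}" using AE_space[of ?M] by simp
  have good: "AE \<tau> in ?M. 0 \<le> \<beta> \<tau> \<and>
      (\<forall>h. (\<integral>\<^sup>+x. ennreal (cmod (N \<tau> (x - h)) * cmod (w \<tau> x)) \<partial>lebesgue) \<le> ennreal (\<beta> \<tau>)) \<and>
      ((\<lambda>h. corr (N \<tau>) (w \<tau>) h) \<longlongrightarrow> corr (N \<tau>) (w \<tau>) 0) (nhds 0)"
    using AE_lebesgue_on_subset[OF gu(2) T(2) I T(3)] AE_lebesgue_on_subset[OF gv(2) T(2) I T(3)]
  proof eventually_elim
    case (elim \<tau>)
    have um [measurable]: "u \<tau> \<in> borel_measurable lebesgue" and vm [measurable]: "v \<tau> \<in> borel_measurable lebesgue"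
      and ui: "integrable lebesgue (\<lambda>x. cmod (u \<tau> x) powr (m + 1))" and vi: "integrable lebesgue (\<lambda>x. cmod (v \<tau> x) powr (m + 1))"
      using elim by (auto simp: mem_Lp_iff)
    define P where "P x = cmod (u \<tau> x) + cmod (v \<tau> x)" for x
    have P0: "0 \<le> P x" for x by (simp add: P_def)
    have Pm [measurable]: "P \<in> borel_measurable lebesgue" unfolding P_def by measurable
    have Ple: "P x powr (m + 1) \<le> 4 * (cmod (u \<tau> x) powr (m + 1) + cmod (v \<tau> x) powr (m + 1))" for x
    proof -
      let ?p = "cmod (u \<tau> x)" and ?q = "cmod (v \<tau> x)"
      have "P x powr (m + 1) \<le> (2 * max ?p ?q) powr (m + 1)" unfolding P_def using m by (intro powr_mono2) auto
      also have "\<dots> = 2 powr (m + 1) * max ?p ?q powr (m + 1)" by (simp add: powr_mult)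
      also have "\<dots> \<le> 4 * (?p powr (m + 1) + ?q powr (m + 1))"
      proof (rule mult_mono)
        have "2 powr (m + 1) \<le> 2 powr (2::real)" using m by (intro powr_mono) auto
        then show "2 powr (m + 1) \<le> 4" by simp
        show "max ?p ?q powr (m + 1) \<le> ?p powr (m + 1) + ?q powr (m + 1)" by (auto simp: max_def)
      qed auto
      finally show ?thesis .
    qed
    have i4: "integrable lebesgue (\<lambda>x. 4 * (cmod (u \<tau> x) powr (m + 1) + cmod (v \<tau> x) powr (m + 1)))" using ui vi by simp
    have Pi: "integrable lebesgue (\<lambda>x. P x powr (m + 1))"
      by (rule Bochner_Integration.integrable_bound[OF i4]) (use Ple in \<open>auto intro: order_trans[OF _ abs_ge_self]\<close>)
    have Pint: "(\<integral>x. P x powr (m + 1) \<partial>lebesgue) \<le> 4 * (gu \<tau> + gv \<tau>)"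
    proof -
      have "(\<integral>x. P x powr (m + 1) \<partial>lebesgue) \<le> (\<integral>x. 4 * (cmod (u \<tau> x) powr (m + 1) + cmod (v \<tau> x) powr (m + 1)) \<partial>lebesgue)"
        by (intro integral_mono Pi i4 Ple)
      also have "\<dots> \<le> 4 * (gu \<tau> + gv \<tau>)" using ui vi elim by simp
      finally show ?thesis .
    qed
    have wm [measurable]: "w \<tau> \<in> borel_measurable lebesgue" unfolding w_def by measurable
    have wP: "cmod (w \<tau> x) powr (m + 1) \<le> P x powr (m + 1)" for x
      unfolding w_def P_def using m by (intro powr_mono2 norm_triangle_ineq4) auto
    have wi: "integrable lebesgue (\<lambda>x. cmod (w \<tau> x) powr (m + 1))"
      by (rule Bochner_Integration.integrable_bound[OF Pi]) (use wP in auto)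
    have wL: "w \<tau> \<in> elems (Lp (m + 1))" using wi by (simp add: mem_Lp_iff)
    have wint: "(\<integral>x. cmod (w \<tau> x) powr (m + 1) \<partial>lebesgue) \<le> 4 * (gu \<tau> + gv \<tau>)"
      using integral_mono[OF wi Pi wP] Pint by linarith
    have Nm: "N \<tau> \<in> borel_measurable lebesgue" unfolding N_def by measurable
    have NP: "cmod (N \<tau> x) \<le> 2 * P x powr m" for x
    proof -
      have "cmod (N \<tau> x) \<le> cmod (u \<tau> x) powr m + cmod (v \<tau> x) powr m"
        unfolding N_def using norm_triangle_ineq4[of "nonlin m (u \<tau> x)" "nonlin m (v \<tau> x)"] m by (simp add: norm_nonlin)
      also have "\<dots> \<le> P x powr m + P x powr m"
        unfolding P_def using m by (intro add_mono powr_mono2) auto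
      finally show ?thesis by simp
    qed
    have le: "2 * ((\<integral>x. P x powr (m + 1) \<partial>lebesgue) + (\<integral>x. cmod (w \<tau> x) powr (m + 1) \<partial>lebesgue)) \<le> \<beta> \<tau>"
      using Pint wint by (simp add: \<beta>_def)
    have "0 \<le> 2 * ((\<integral>x. P x powr (m + 1) \<partial>lebesgue) + (\<integral>x. cmod (w \<tau> x) powr (m + 1) \<partial>lebesgue))"
      by (simp add: integral_nonneg_AE)
    then have "0 \<le> \<beta> \<tau>" using le by linarith
    moreover have "(\<integral>\<^sup>+x. ennreal (cmod (N \<tau> (x - h)) * cmod (w \<tau> x)) \<partial>lebesgue) \<le> ennreal (\<beta> \<tau>)" for h
      using corr_power_bound[OF m(1) Nm wL Pm P0 Pi NP] le by (meson ennreal_leI order_trans)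
    ultimately show ?case using corr_power_continuous[OF m(1) Nm wL Pm P0 Pi NP] by blast
  qed
  have bound: "AE \<tau> in ?M. 0 \<le> \<beta> \<tau> \<and>
      (\<forall>h. (\<integral>\<^sup>+x. ennreal (cmod (nonlin m (u \<tau> (x - h)) - nonlin m (v \<tau> (x - h))) * cmod (u \<tau> x - v \<tau> x)) \<partial>lebesgue) \<le> ennreal (\<beta> \<tau>))"
    using good unfolding N_def w_def by eventually_elim blast
  have "\<exists>\<rho> :: 'a \<Rightarrow> complex. mollifier (1 / real (Suc n)) \<rho> \<and> \<rho> \<in> test_fun UNIV" for n
    using mollifier_exists[of "1 / real (Suc n)"] by auto
  then obtain \<rho> :: "nat \<Rightarrow> 'a \<Rightarrow> complex" where \<rho>: "\<And>n. mollifier (1 / real (Suc n)) (\<rho> n)" "\<And>n. \<rho> n \<in> test_fun UNIV"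
    by metis
  have e0: "(\<lambda>n. 1 / real (Suc n)) \<longlonglongrightarrow> 0" using LIMSEQ_inverse_real_of_nat by (simp add: inverse_eq_divide)
  define C where "C n \<tau> = (\<integral>x. conv (\<rho> n) (N \<tau>) x * cnj (conv (\<rho> n) (w \<tau>) x) \<partial>lborel)" for n \<tau>
  define E where "E n \<tau> = (\<integral>x. conv (\<rho> n) (w \<tau>) x * cnj (conv (\<rho> n) (w \<tau>) x) \<partial>lborel)" for n \<tau>
  define Q where "Q = (\<integral>\<tau>. nrm L2 (\<lambda>x. f \<tau> x - g \<tau> x) * nrm L2 (w \<tau>) \<partial>?M)"
  have mE1: "C n \<in> borel_measurable ?M" for n
    unfolding C_def N_def w_def by (rule mollified_energy(1)[OF m U V st \<rho> \<beta> bound])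
  have mE2: "AE \<tau> in ?M. cmod (C n \<tau>) \<le> \<beta> \<tau>" for n
    unfolding C_def N_def w_def by (rule mollified_energy(2)[OF m U V st \<rho> \<beta> bound])
  have mE3: "Re (E n t) + 2 * (\<integral>\<tau>. Im (a * C n \<tau>) \<partial>?M) \<le> Re (E n s) + 2 * Q" for n
    unfolding C_def E_def Q_def N_def w_def by (rule mollified_energy(3)[OF m U V st \<rho> \<beta> bound])
  have Dcorr: "D \<tau> = corr (N \<tau>) (w \<tau>) 0" for \<tau> by (simp add: D_def corr_def N_def w_def)
  \<comment> \<open>Besides convergence of the majorised pairings, this gives measurability of
    \<open>D\<close> as an almost everywhere limit.\<close>
  have Clim: "AE \<tau> in ?M. (\<lambda>n. C n \<tau>) \<longlonglongrightarrow> D \<tau>"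
    using good inI
  proof eventually_elim
    case (elim \<tau>)
    then have \<tau>: "0 \<le> \<tau>" using st by simp
    have NL: "loc_integrable (N \<tau>)"
    proof -
      have "loc_integrable (\<lambda>x. nonlin m (u \<tau> x))" "loc_integrable (\<lambda>x. nonlin m (v \<tau> x))"
        by (rule nonlin_loc_integrable[OF cont_space_L2[OF uc \<tau>] m], rule nonlin_loc_integrable[OF cont_space_L2[OF vc \<tau>] m])
      then show ?thesis unfolding loc_integrable_def N_def
        by (auto simp: scaleR_diff_right intro!: Bochner_Integration.integrable_diff)
    qed
    have "(\<integral>\<^sup>+x. ennreal (cmod (N \<tau> (x - h)) * cmod (w \<tau> x)) \<partial>lebesgue) \<le> ennreal (\<beta> \<tau>)" for h
      using elim by blast
    from mollified_pairing_limit[OF NL L2_loc_integrable[OF cont_space_L2[OF wc \<tau>]] this _ _ \<rho>(1) e0] elim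
    show ?case unfolding C_def Dcorr by blast
  qed
  have Dm: "D \<in> borel_measurable ?M"
  proof (rule borel_measurable_lebesgue_on_AE[OF I])
    show "(\<lambda>\<tau>. lim (\<lambda>n. C n \<tau>)) \<in> borel_measurable ?M" by (rule borel_measurable_lim_metric[OF mE1])
    show "AE \<tau> in ?M. lim (\<lambda>n. C n \<tau>) = D \<tau>" using Clim by eventually_elim (rule limI)
  qed
  show Dint: "integrable ?M D"
    by (rule integrable_dominated_convergence[OF Dm mE1 \<beta> Clim mE2])
  have "(\<lambda>n. \<integral>\<tau>. C n \<tau> \<partial>?M) \<longlonglongrightarrow> (\<integral>\<tau>. D \<tau> \<partial>?M)"
    by (rule integral_dominated_convergence[OF Dm mE1 \<beta> Clim mE2])
  then have lim1: "(\<lambda>n. Im (a * (\<integral>\<tau>. C n \<tau> \<partial>?M))) \<longlonglongrightarrow> Im (a * (\<integral>\<tau>. D \<tau> \<partial>?M))"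
    by (intro tendsto_intros)
  have Cint: "integrable ?M (C n)" for n
    by (rule Bochner_Integration.integrable_bound[OF \<beta> mE1])
       (use mE2[of n] in \<open>auto elim!: eventually_mono intro: order_trans[OF _ abs_ge_self]\<close>)
  have Im_eq: "(\<integral>\<tau>. Im (a * C n \<tau>) \<partial>?M) = Im (a * (\<integral>\<tau>. C n \<tau> \<partial>?M))" for n
    using integral_Im[OF integrable_mult_right[OF Cint[of n]], of a] by simp
  have Im_D: "(\<integral>\<tau>. Im (a * D \<tau>) \<partial>?M) = Im (a * (\<integral>\<tau>. D \<tau> \<partial>?M))"
    using integral_Im[OF integrable_mult_right[OF Dint], of a] by simp
  have Elim: "(\<lambda>n. Re (E n \<tau>)) \<longlonglongrightarrow> (nrm L2 (w \<tau>))\<^sup>2" if "0 \<le> \<tau>" for \<tau>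
  proof -
    have w: "w \<tau> \<in> elems L2" by (rule cont_space_L2[OF wc that])
    have "(\<lambda>n. E n \<tau>) \<longlonglongrightarrow> corr (w \<tau>) (w \<tau>) 0"
      unfolding E_def
      by (rule mollified_pairing_limit[OF L2_loc_integrable[OF w] L2_loc_integrable[OF w] corr_L2_bound[OF w w] _ corr_L2_continuous[OF w w] \<rho>(1) e0]) simp
    then have "(\<lambda>n. Re (E n \<tau>)) \<longlonglongrightarrow> Re (corr (w \<tau>) (w \<tau>) 0)" by (rule tendsto_Re)
    also have "corr (w \<tau>) (w \<tau>) 0 = of_real ((nrm L2 (w \<tau>))\<^sup>2)"
      unfolding corr_def nrm_L2_sq by (simp add: complex_norm_square[symmetric] flip: of_real_power)
    finally show ?thesis by simp
  qed
  have "(nrm L2 (w t))\<^sup>2 + 2 * Im (a * (\<integral>\<tau>. D \<tau> \<partial>?M)) \<le> (nrm L2 (w s))\<^sup>2 + 2 * Q"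
  proof (rule LIMSEQ_le)
    show "(\<lambda>n. Re (E n t) + 2 * Im (a * (\<integral>\<tau>. C n \<tau> \<partial>?M))) \<longlonglongrightarrow> (nrm L2 (w t))\<^sup>2 + 2 * Im (a * (\<integral>\<tau>. D \<tau> \<partial>?M))"
      using st by (intro tendsto_add tendsto_mult tendsto_const lim1 Elim) auto
    show "(\<lambda>n. Re (E n s) + 2 * Q) \<longlonglongrightarrow> (nrm L2 (w s))\<^sup>2 + 2 * Q"
      using st by (intro tendsto_add tendsto_const Elim) auto
    show "\<exists>n0. \<forall>n\<ge>n0. Re (E n t) + 2 * Im (a * (\<integral>\<tau>. C n \<tau> \<partial>?M)) \<le> Re (E n s) + 2 * Q"
      using mE3 unfolding Im_eq by blast
  qed
  then show "(nrm L2 (w t))\<^sup>2 + 2 * (\<integral>\<tau>. Im (a * D \<tau>) \<partial>?M) \<le>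
      (nrm L2 (w s))\<^sup>2 + 2 * (\<integral>\<tau>. nrm L2 (\<lambda>x. f \<tau> x - g \<tau> x) * nrm L2 (w \<tau>) \<partial>?M)"
    unfolding Im_D Q_def .
qed

subsection \<open>From \<open>H\<^sup>2\<close>-solutions to mild solutions\<close>

text \<open>The primitive of a mollifier is a smoothed Heaviside function. Differences of its
  translates are smooth cut-offs of an interval, and their derivatives are differences of
  mollifiers.\<close>

lemma smooth_step_exists:
  assumes e: "0 < e"
  obtains \<beta> B :: "real \<Rightarrow> complex" where "mollifier e \<beta>" "\<beta> \<in> test_fun UNIV"
    "\<And>t. (B has_vector_derivative \<beta> t) (at t)" "\<And>k. Ck k B"
    "\<And>t. t \<le> - e \<Longrightarrow> B t = 0" "\<And>t. e \<le> t \<Longrightarrow> B t = 1" "\<And>t. cmod (B t) \<le> 1"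
proof -
  obtain \<beta> :: "real \<Rightarrow> complex" where \<beta>: "mollifier e \<beta>" "\<beta> \<in> test_fun UNIV"
    using mollifier_exists[OF e] by blast
  have k: "cc_kernel \<beta>" by (rule mollifier_kernel[OF \<beta>(1)])
  have C: "Ck k \<beta>" for k using \<beta>(2) by (simp add: test_fun_def)
  have cont: "continuous_on S \<beta>" for S
    using Ck_continuous[OF C] by (rule continuous_on_subset) simp
  have supp: "\<beta> t = 0" if "e < \<bar>t\<bar>" for t
    using mollifier_support[OF \<beta>(1), of t] that by fastforce
  have \<beta>i: "integrable lebesgue \<beta>" by (rule kernel_integrable[OF k])
  \<comment> \<open>The lower limit is \<open>- e - 1\<close> instead of \<open>- e\<close>, so that
    every \<open>t \<ge> - e\<close> is an interior point when the fundamental theorem is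
    applied.\<close>
  define B where "B t = (\<integral>x. indicator {- e - 1..t} x *\<^sub>R \<beta> x \<partial>lebesgue)" for t
  have B_HK: "B t = integral {- e - 1..t} \<beta>" for t
  proof -
    have "B t = (\<integral>x. \<beta> x \<partial>lebesgue_on {- e - 1..t})" by (simp add: B_def integral_restrict_space)
    also have "\<dots> = integral {- e - 1..t} \<beta>"
      by (rule lebesgue_integral_eq_integral) (auto intro: continuous_imp_integrable_real cont)
    finally show ?thesis .
  qed
  have B0: "B t = 0" if "t \<le> - e" for t
  proof -
    have "B t = (\<integral>x. 0 \<partial>(lebesgue :: real measure))"
      unfolding B_def
    proof (rule integral_cong_AE)
      show "AE x in lebesgue. indicator {- e - 1..t} x *\<^sub>R \<beta> x = 0"
      proof -
        have "{- e} \<in> null_sets lebesgue" by simp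
        then have "AE x in lebesgue. x \<notin> {- e}" by (rule AE_not_in)
        then show ?thesis
        proof eventually_elim
          case (elim x)
          then show ?case using that e supp[of x] by (auto simp: indicator_def)
        qed
      qed
      show "(\<lambda>x. indicator {- e - 1..t} x *\<^sub>R \<beta> x) \<in> borel_measurable lebesgue"
        by (rule borel_measurable_scaleR[OF borel_measurable_indicator borel_measurable_integrable[OF \<beta>i]]) simp
    qed simp
    then show ?thesis by simp
  qed
  have B1: "B t = 1" if "e \<le> t" for t
  proof -
    have "B t = (\<integral>x. \<beta> x \<partial>lebesgue)"
      unfolding B_def
    proof (rule Bochner_Integration.integral_cong[OF refl])
      fix x
      show "indicator {- e - 1..t} x *\<^sub>R \<beta> x = \<beta> x" using that supp[of x] by (auto simp: indicator_def)
    qed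
    then show ?thesis by (simp only: mollifier_integral[OF \<beta>(1)])
  qed
  have Bn: "cmod (B t) \<le> 1" for t
  proof -
    have "cmod (B t) \<le> (\<integral>x. cmod (indicator {- e - 1..t} x *\<^sub>R \<beta> x) \<partial>lebesgue)"
      unfolding B_def by (rule integral_norm_bound)
    also have "\<dots> \<le> (\<integral>x. cmod (\<beta> x) \<partial>lebesgue)"
      using \<beta>i by (intro integral_mono') (auto simp: indicator_def)
    also have "\<dots> = 1" by (rule mollifier_norm_integral[OF \<beta>(1)])
    finally show ?thesis .
  qed
  have Bd: "(B has_vector_derivative \<beta> t) (at t)" for t
  proof (cases "t < - e")
    case True
    have "((\<lambda>_. 0) has_vector_derivative 0) (at t)" by simp
    then have "(B has_vector_derivative 0) (at t)"
      by (rule has_vector_derivative_transform_within_open[of _ _ _ "{..<- e}"]) (use True B0 in auto)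
    then show ?thesis using True e supp[of t] by simp
  next
    case False
    have "((\<lambda>u. integral {- e - 1..u} \<beta>) has_vector_derivative \<beta> t) (at t within {- e - 1..t + 1})"
      by (rule integral_has_vector_derivative) (use False cont in auto)
    moreover have "at t within {- e - 1..t + 1} = at t"
      by (rule at_within_interior) (use False in auto)
    ultimately show ?thesis by (simp add: B_HK[abs_def])
  qed
  have "Ck k B" for k by (rule Ck_antiderivative[OF Bd C])
  from that[OF \<beta> Bd this B0 B1 Bn] show ?thesis .
qed

text \<open>The reflected mollifier at \<open>x\<close> is a probability density supported within
  distance \<open>e n\<close> of \<open>x\<close>, where \<open>g\<close> is close to
  \<open>g x\<close>.\<close>

lemma conv_mollifier_tendsto:
  assumes g: "loc_integrable g" "isCont g x"
    and \<rho>: "\<And>n. mollifier (e n) (\<rho> n)" and e: "e \<longlonglongrightarrow> 0"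
  shows "(\<lambda>n. conv (\<rho> n) g x) \<longlonglongrightarrow> g x"
  unfolding tendsto_iff
proof (intro allI impI)
  fix d :: real assume d: "0 < d"
  obtain r where r: "r > 0" "\<And>y. dist y x < r \<Longrightarrow> dist (g y) (g x) < d / 2"
    using g(2) d unfolding continuous_at_eps_delta by (metis half_gt_zero)
  have "\<forall>\<^sub>F n in sequentially. e n < r" using e r(1) by (intro order_tendstoD(2)) auto
  then show "\<forall>\<^sub>F n in sequentially. dist (conv (\<rho> n) g x) (g x) < d"
  proof eventually_elim
    case (elim n)
    have k: "cc_kernel (\<rho> n)" by (rule mollifier_kernel[OF \<rho>])
    have ki: "integrable lebesgue (\<lambda>y. \<rho> n (x - y))"
      by (rule integrable_lebesgue_reflect[OF kernel_integrable[OF k]])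
    have k1: "(\<integral>y. \<rho> n (x - y) \<partial>lebesgue) = 1"
      using integral_lebesgue_reflect[OF kernel_measurable_lebesgue[OF k], of x] mollifier_integral[OF \<rho>[of n]] by simp
    have kn: "(\<integral>y. cmod (\<rho> n (x - y)) \<partial>lebesgue) = 1"
      using integral_lebesgue_reflect[of "\<lambda>y. cmod (\<rho> n y)" x] kernel_measurable_lebesgue[OF k]
        mollifier_norm_integral[OF \<rho>[of n]] by simp
    have i: "integrable lebesgue (\<lambda>y. \<rho> n (x - y) * g y)" by (rule conv_integrable[OF k g(1)])
    have "conv (\<rho> n) g x - g x = (\<integral>y. \<rho> n (x - y) * (g y - g x) \<partial>lebesgue)"
      using i ki k1 by (simp add: conv_def right_diff_distrib)
    also have "cmod \<dots> \<le> (\<integral>y. cmod (\<rho> n (x - y)) * (d / 2) \<partial>lebesgue)"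
    proof (rule Bochner_Integration.integral_norm_bound_integral)
      show "integrable lebesgue (\<lambda>y. \<rho> n (x - y) * (g y - g x))"
        using i ki by (simp add: right_diff_distrib)
      show "integrable lebesgue (\<lambda>y. cmod (\<rho> n (x - y)) * (d / 2))"
        using ki by (intro integrable_mult_left integrable_norm)
      fix y
      show "cmod (\<rho> n (x - y) * (g y - g x)) \<le> cmod (\<rho> n (x - y)) * (d / 2)"
      proof (cases "\<rho> n (x - y) = 0")
        case False
        then have "norm (x - y) < r" using mollifier_support[OF \<rho>[of n], of "x - y"] elim by linarith
        then show ?thesis
          using r(2)[of y] unfolding norm_mult
          by (intro mult_left_mono) (auto simp: dist_norm norm_minus_commute)
      qed simp
    qed
    also have "\<dots> = d / 2" using kn by simp
    finally show ?case using d by (simp add: dist_norm)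
  qed
qed

lemma continuous_loc_integrable:
  fixes g :: "real \<Rightarrow> complex"
  assumes "continuous_on UNIV g"
  shows "loc_integrable g"
  unfolding loc_integrable_def
proof (intro conjI allI)
  show "g \<in> borel_measurable lebesgue"
    using borel_measurable_continuous_onI[OF assms] by (simp add: measurable_completion)
  fix r :: real
  have "integrable (lebesgue_on {- r..r}) g"
    by (rule continuous_imp_integrable_real[OF continuous_on_subset[OF assms]]) simp
  moreover have "cball 0 r = {- r..r}" by (auto simp: dist_real_def)
  ultimately show "integrable lebesgue (\<lambda>x. indicator (cball 0 r) x *\<^sub>R g x)"
    by (simp add: integrable_restrict_space)
qed

text \<open>A compact subset of the open half-line stays away from 0. Hence integrability on
  intervals with positive left endpoint is all that a product with a test function demands.\<close>

lemma test_fun_interval: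
  assumes "\<theta> \<in> test_fun {0<..}"
  obtains \<alpha> b B where "0 < \<alpha>" "\<And>\<tau>::real. \<theta> \<tau> \<noteq> 0 \<Longrightarrow> \<tau> \<in> {\<alpha>..b}" "\<And>\<tau>. cmod (\<theta> \<tau>) \<le> B"
proof -
  let ?K = "closure {\<tau>. \<theta> \<tau> \<noteq> 0}"
  have K: "compact ?K" "?K \<subseteq> {0<..}" using assms by (auto simp: test_fun_def)
  have k: "cc_kernel \<theta>" using assms by (intro test_fun_cc_kernel) (auto simp: test_fun_def)
  obtain B where B: "\<And>\<tau>. cmod (\<theta> \<tau>) \<le> B" using kernel_bounded[OF k] by blast
  show ?thesis
  proof (cases "?K = {}")
    case True
    then have "\<theta> \<tau> = 0" for \<tau> using closure_subset[of "{\<tau>. \<theta> \<tau> \<noteq> 0}"] by blast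
    then show ?thesis using that[of 1 0 B] B by auto
  next
    case False
    obtain \<alpha> where \<alpha>: "\<alpha> \<in> ?K" "\<And>\<tau>. \<tau> \<in> ?K \<Longrightarrow> \<alpha> \<le> \<tau>" using compact_attains_inf[OF K(1) False] by blast
    obtain b where b: "\<And>\<tau>. \<tau> \<in> ?K \<Longrightarrow> \<tau> \<le> b" using compact_attains_sup[OF K(1) False] by blast
    have "0 < \<alpha>" using \<alpha>(1) K(2) by auto
    moreover have "\<tau> \<in> {\<alpha>..b}" if "\<theta> \<tau> \<noteq> 0" for \<tau>
    proof -
      have "\<tau> \<in> ?K" using that closure_subset[of "{\<tau>. \<theta> \<tau> \<noteq> 0}"] by blast
      then show ?thesis using \<alpha>(2) b by simp
    qed
    ultimately show ?thesis using that B by blast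
  qed
qed

lemma test_fun_mult_integrable:
  fixes h :: "real \<Rightarrow> complex"
  assumes \<theta>: "\<theta> \<in> test_fun {0<..}" and h: "\<And>s t. 0 < s \<Longrightarrow> integrable (lebesgue_on {s..t}) h"
  shows "integrable (lebesgue_on {0<..}) (\<lambda>\<tau>. \<theta> \<tau> * h \<tau>)"
proof -
  obtain \<alpha> b B where \<alpha>: "0 < \<alpha>" "\<And>\<tau>. \<theta> \<tau> \<noteq> 0 \<Longrightarrow> \<tau> \<in> {\<alpha>..b}" and B: "\<And>\<tau>. cmod (\<theta> \<tau>) \<le> B"
    using test_fun_interval[OF \<theta>] by metis
  have k: "cc_kernel \<theta>" using \<theta> by (intro test_fun_cc_kernel) (auto simp: test_fun_def)
  have hi: "integrable lebesgue (\<lambda>\<tau>. indicator {\<alpha>..b} \<tau> *\<^sub>R h \<tau>)" using h[OF \<alpha>(1)] by (simp add: integrable_restrict_space)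
  have "integrable lebesgue (\<lambda>\<tau>. \<theta> \<tau> * (indicator {\<alpha>..b} \<tau> *\<^sub>R h \<tau>))"
  proof (rule Bochner_Integration.integrable_bound)
    show "integrable lebesgue (\<lambda>\<tau>. of_real B * (indicator {\<alpha>..b} \<tau> *\<^sub>R h \<tau>))" by (rule integrable_mult_right[OF hi])
    show "(\<lambda>\<tau>. \<theta> \<tau> * (indicator {\<alpha>..b} \<tau> *\<^sub>R h \<tau>)) \<in> borel_measurable lebesgue"
      by (rule borel_measurable_times[OF kernel_measurable_lebesgue[OF k] borel_measurable_integrable[OF hi]])
    show "AE \<tau> in lebesgue. norm (\<theta> \<tau> * (indicator {\<alpha>..b} \<tau> *\<^sub>R h \<tau>)) \<le> norm (of_real B * (indicator {\<alpha>..b} \<tau> *\<^sub>R h \<tau>))"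
      unfolding norm_mult using B by (intro AE_I2 mult_right_mono) (auto intro: order_trans[OF _ abs_ge_self])
  qed
  moreover have "\<theta> \<tau> * (indicator {\<alpha>..b} \<tau> *\<^sub>R h \<tau>) = indicator {0<..} \<tau> *\<^sub>R (\<theta> \<tau> * h \<tau>)" for \<tau>
    using \<alpha>(1) \<alpha>(2)[of \<tau>] by (cases "\<theta> \<tau> = 0") (auto simp: indicator_def)
  ultimately have "integrable lebesgue (\<lambda>\<tau>. indicator {0<..} \<tau> *\<^sub>R (\<theta> \<tau> * h \<tau>))" by (simp only:)
  then show ?thesis by (simp add: integrable_restrict_space)
qed

text \<open>The weak equation is tested with smoothed indicators of \<open>{s..t}\<close>. Their
  derivatives are differences of mollifiers at \<open>s\<close> and at \<open>t\<close>, so the left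
  side is a difference of mollified values of \<open>W\<close>, which converge to \<open>W s\<close>
  and \<open>W t\<close> by continuity.\<close>

lemma du_Bois_Reymond:
  fixes W R :: "real \<Rightarrow> complex"
  assumes W: "continuous_on {0..} W" and R: "\<And>s t. 0 < s \<Longrightarrow> integrable (lebesgue_on {s..t}) R"
    and eq: "\<And>\<theta>. \<theta> \<in> test_fun {0<..} \<Longrightarrow>
      - \<i> * (\<integral>\<tau>. dir_deriv \<theta> 1 \<tau> * W \<tau> \<partial>lebesgue_on {0<..}) = (\<integral>\<tau>. \<theta> \<tau> * R \<tau> \<partial>lebesgue_on {0<..})"
    and st: "0 < s" "s \<le> t"
  shows "\<i> * (W t - W s) = (\<integral>\<tau>. R \<tau> \<partial>lebesgue_on {s..t})"
proof (cases "s = t")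
  case True
  have "(\<integral>\<tau>. R \<tau> \<partial>lebesgue_on {s..t}) = (\<integral>\<tau>. indicator {s..t} \<tau> *\<^sub>R R \<tau> \<partial>lebesgue)" by (simp add: integral_restrict_space)
  also have "\<dots> = 0"
  proof (rule integral_eq_zero_AE)
    have "{s} \<in> null_sets lebesgue" by simp
    then have "AE x in lebesgue. x \<notin> {s}" by (rule AE_not_in)
    then show "AE x in lebesgue. indicator {s..t} x *\<^sub>R R x = 0"
      by eventually_elim (use True in \<open>auto simp: indicator_def\<close>)
  qed
  finally show ?thesis using True by simp
next
  case False
  then have lt: "s < t" using st by simp
  \<comment> \<open>Constant continuation to negative times: it makes \<open>W\<close> continuous on
    the whole line, as the convolution lemmas expect.\<close>
  define W' where "W' \<tau> = W (max \<tau> 0)" for \<tau>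
  have "continuous_on UNIV W'"
    unfolding W'_def by (rule continuous_on_compose2[OF W]) (auto intro!: continuous_intros)
  then have W': "loc_integrable W'" "isCont W' x" for x
    by (auto intro: continuous_loc_integrable simp: continuous_on_eq_continuous_at)
  \<comment> \<open>All radii are at most \<open>s / 2\<close>, which keeps the test functions
    supported in \<open>{s / 2..t + s / 2}\<close>, away from time 0.\<close>
  define d where "d = s / 2"
  define e where "e n = d / real (Suc n)" for n
  have d: "0 < d" using st by (simp add: d_def)
  have e: "0 < e n" "e n \<le> d" for n using d by (auto simp: e_def field_simps)
  have e0: "e \<longlonglongrightarrow> 0"
    using tendsto_mult_right_zero[OF LIMSEQ_inverse_real_of_nat, of d] by (simp add: e_def[abs_def] divide_inverse)
  have "\<exists>p. mollifier (e n) (fst p) \<and> fst p \<in> test_fun UNIV \<and> (\<forall>t. (snd p has_vector_derivative fst p t) (at t)) \<and> (\<forall>k. Ck k (snd p)) \<and>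
      (\<forall>t\<le>- e n. snd p t = 0) \<and> (\<forall>t\<ge>e n. snd p t = 1) \<and> (\<forall>t. cmod (snd p t) \<le> 1)" for n
  proof (rule smooth_step_exists[OF e(1)[of n]])
    fix \<beta> B :: "real \<Rightarrow> complex"
    assume "mollifier (e n) \<beta>" "\<beta> \<in> test_fun UNIV" "\<And>t. (B has_vector_derivative \<beta> t) (at t)" "\<And>k. Ck k B"
      "\<And>t. t \<le> - e n \<Longrightarrow> B t = 0" "\<And>t. e n \<le> t \<Longrightarrow> B t = 1" "\<And>t. cmod (B t) \<le> 1"
    then show ?thesis by (intro exI[of _ "(\<beta>, B)"]) simp
  qed
  then obtain p where p: "\<forall>n. mollifier (e n) (fst (p n)) \<and> fst (p n) \<in> test_fun UNIV \<and> (\<forall>t. (snd (p n) has_vector_derivative fst (p n) t) (at t)) \<and> (\<forall>k. Ck k (snd (p n))) \<and>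
      (\<forall>t\<le>- e n. snd (p n) t = 0) \<and> (\<forall>t\<ge>e n. snd (p n) t = 1) \<and> (\<forall>t. cmod (snd (p n) t) \<le> 1)"
    using choice[of "\<lambda>n p. mollifier (e n) (fst p) \<and> fst p \<in> test_fun UNIV \<and> (\<forall>t. (snd p has_vector_derivative fst p t) (at t)) \<and> (\<forall>k. Ck k (snd p)) \<and>
      (\<forall>t\<le>- e n. snd p t = 0) \<and> (\<forall>t\<ge>e n. snd p t = 1) \<and> (\<forall>t. cmod (snd p t) \<le> 1)"] by blast
  define \<beta> B where "\<beta> n = fst (p n)" and "B n = snd (p n)" for n
  have \<beta>: "mollifier (e n) (\<beta> n)" and Bd: "(B n has_vector_derivative \<beta> n \<tau>) (at \<tau>)" and BC: "Ck k (B n)"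
    and B0: "\<tau> \<le> - e n \<Longrightarrow> B n \<tau> = 0" and B1: "e n \<le> \<tau> \<Longrightarrow> B n \<tau> = 1" and Bn: "cmod (B n \<tau>) \<le> 1" for n k \<tau>
    using p by (auto simp: \<beta>_def B_def)
  define \<theta> where "\<theta> n \<tau> = B n (\<tau> - s) - B n (\<tau> - t)" for n \<tau>
  have \<theta>supp: "\<tau> \<in> {d..t + d}" if "\<theta> n \<tau> \<noteq> 0" for n \<tau>
  proof (rule ccontr)
    assume "\<tau> \<notin> {d..t + d}"
    then consider "\<tau> < d" | "t + d < \<tau>" by fastforce
    then show False
    proof cases
      case 1
      then have "\<tau> - s \<le> - e n" "\<tau> - t \<le> - e n" using e(2)[of n] lt by (auto simp: d_def)
      then show False using that B0 by (simp add: \<theta>_def)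
    next
      case 2
      then have "e n \<le> \<tau> - s" "e n \<le> \<tau> - t" using e(2)[of n] lt by auto
      then show False using that B1 by (simp add: \<theta>_def)
    qed
  qed
  have \<theta>C: "Ck k (\<theta> n)" for k n
  proof -
    have "Ck k (\<lambda>\<tau>. B n (- s + \<tau>) - B n (- t + \<tau>))"
      by (intro Ck_diff Ck_compose_affine bounded_linear_ident BC)
    then show ?thesis by (simp add: \<theta>_def[abs_def])
  qed
  have \<theta>t: "\<theta> n \<in> test_fun {0<..}" for n
  proof -
    have "closure {\<tau>. \<theta> n \<tau> \<noteq> 0} \<subseteq> {d..t + d}" using \<theta>supp by (intro closure_minimal) auto
    moreover from this have "compact (closure {\<tau>. \<theta> n \<tau> \<noteq> 0})"
      by (meson bounded_closed_interval bounded_subset closed_closure compact_eq_bounded_closed)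
    ultimately show ?thesis using \<theta>C d by (auto simp: test_fun_def)
  qed
  have \<theta>d: "dir_deriv (\<theta> n) 1 \<tau> = \<beta> n (s - \<tau>) - \<beta> n (t - \<tau>)" for n \<tau>
  proof -
    have "((\<lambda>\<tau>. B n (\<tau> - r)) has_vector_derivative \<beta> n (\<tau> - r)) (at \<tau>)" for r
    proof -
      have "((\<lambda>\<tau>. \<tau> - r) has_vector_derivative 1) (at \<tau>)"
        by (auto intro!: derivative_eq_intros)
      from vector_diff_chain_at[OF this Bd] show ?thesis by (simp add: o_def)
    qed
    then have "(\<theta> n has_vector_derivative \<beta> n (\<tau> - s) - \<beta> n (\<tau> - t)) (at \<tau>)"
      unfolding \<theta>_def by (intro has_vector_derivative_diff)
    then have "(\<theta> n has_derivative (\<lambda>v. v *\<^sub>R (\<beta> n (\<tau> - s) - \<beta> n (\<tau> - t)))) (at \<tau>)"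
      by (simp add: has_vector_derivative_def)
    then have "dir_deriv (\<theta> n) 1 \<tau> = \<beta> n (\<tau> - s) - \<beta> n (\<tau> - t)" by (simp add: dir_deriv_eq)
    then show ?thesis using mollifier_even[OF \<beta>, of n "s - \<tau>"] mollifier_even[OF \<beta>, of n "t - \<tau>"] by simp
  qed
  have L: "(\<integral>\<tau>. dir_deriv (\<theta> n) 1 \<tau> * W \<tau> \<partial>lebesgue_on {0<..}) = conv (\<beta> n) W' s - conv (\<beta> n) W' t" for n
  proof -
    \<comment> \<open>Both mollifiers vanish at nonpositive times, so the integral over the
      half-line is a convolution over the whole line.\<close>
    have sm: "\<beta> n (r - \<tau>) = 0" if "s \<le> r" "\<tau> \<le> 0" for r \<tau>
      using mollifier_support[OF \<beta>, of n "r - \<tau>"] that e(2)[of n] st by (auto simp: d_def)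
    have "(\<integral>\<tau>. dir_deriv (\<theta> n) 1 \<tau> * W \<tau> \<partial>lebesgue_on {0<..}) =
        (\<integral>\<tau>. indicator {0<..} \<tau> *\<^sub>R (dir_deriv (\<theta> n) 1 \<tau> * W \<tau>) \<partial>lebesgue)" by (simp add: integral_restrict_space)
    also have "\<dots> = (\<integral>\<tau>. \<beta> n (s - \<tau>) * W' \<tau> - \<beta> n (t - \<tau>) * W' \<tau> \<partial>lebesgue)"
    proof (rule Bochner_Integration.integral_cong[OF refl])
      fix \<tau>
      show "indicator {0<..} \<tau> *\<^sub>R (dir_deriv (\<theta> n) 1 \<tau> * W \<tau>) = \<beta> n (s - \<tau>) * W' \<tau> - \<beta> n (t - \<tau>) * W' \<tau>"
        using sm[of s \<tau>] sm[of t \<tau>] st by (cases "0 < \<tau>") (auto simp: \<theta>d W'_def left_diff_distrib)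
    qed
    also have "\<dots> = conv (\<beta> n) W' s - conv (\<beta> n) W' t"
      unfolding conv_def by (rule Bochner_Integration.integral_diff) (rule conv_integrable[OF mollifier_kernel[OF \<beta>] W'(1)])+
    finally show ?thesis .
  qed
  have Rd: "integrable lebesgue (\<lambda>\<tau>. indicator {d..t + d} \<tau> *\<^sub>R R \<tau>)" using R[OF d, of "t + d"] by (simp add: integrable_restrict_space)
  have Rm: "(\<lambda>\<tau>. indicator {d..t + d} \<tau> *\<^sub>R R \<tau>) \<in> borel_measurable lebesgue" using Rd by (rule borel_measurable_integrable)
  have Req: "indicator {s..t} \<tau> *\<^sub>R R \<tau> = indicator {s..t} \<tau> *\<^sub>R (indicator {d..t + d} \<tau> *\<^sub>R R \<tau>)" for \<tau>
    using st d by (auto simp: indicator_def d_def)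
  have "(\<lambda>n. \<integral>\<tau>. \<theta> n \<tau> * (indicator {d..t + d} \<tau> *\<^sub>R R \<tau>) \<partial>lebesgue) \<longlonglongrightarrow> (\<integral>\<tau>. indicator {s..t} \<tau> *\<^sub>R R \<tau> \<partial>lebesgue)"
  proof (rule integral_dominated_convergence)
    show "integrable lebesgue (\<lambda>\<tau>. 2 * norm (indicator {d..t + d} \<tau> *\<^sub>R R \<tau>))" using Rd by (intro integrable_mult_right integrable_norm)
    show "(\<lambda>\<tau>. indicator {s..t} \<tau> *\<^sub>R R \<tau>) \<in> borel_measurable lebesgue"
      unfolding Req by (rule borel_measurable_scaleR[OF borel_measurable_indicator Rm]) simp
    show "(\<lambda>\<tau>. \<theta> n \<tau> * (indicator {d..t + d} \<tau> *\<^sub>R R \<tau>)) \<in> borel_measurable lebesgue" for n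
    proof (rule borel_measurable_times[OF _ Rm])
      show "\<theta> n \<in> borel_measurable lebesgue"
        using borel_measurable_continuous_onI[OF Ck_continuous[OF \<theta>C]] by (simp add: measurable_completion)
    qed
    show "AE \<tau> in lebesgue. norm (\<theta> n \<tau> * (indicator {d..t + d} \<tau> *\<^sub>R R \<tau>)) \<le> 2 * norm (indicator {d..t + d} \<tau> *\<^sub>R R \<tau>)" for n
    proof (rule AE_I2)
      fix \<tau>
      have "cmod (\<theta> n \<tau>) \<le> 2"
        unfolding \<theta>_def using norm_triangle_ineq4[of "B n (\<tau> - s)" "B n (\<tau> - t)"] Bn[of n "\<tau> - s"] Bn[of n "\<tau> - t"] by linarith
      then show "norm (\<theta> n \<tau> * (indicator {d..t + d} \<tau> *\<^sub>R R \<tau>)) \<le> 2 * norm (indicator {d..t + d} \<tau> *\<^sub>R R \<tau>)"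
        unfolding norm_mult by (intro mult_right_mono) auto
    qed
    \<comment> \<open>Pointwise convergence to the indicator is shown off the two endpoints, where
      the smoothed steps are eventually constant in \<open>n\<close>.\<close>
    have "{s, t} \<in> null_sets lebesgue" by simp
    then have "AE \<tau> in lebesgue. \<tau> \<notin> {s, t}" by (rule AE_not_in)
    then show "AE \<tau> in lebesgue. (\<lambda>n. \<theta> n \<tau> * (indicator {d..t + d} \<tau> *\<^sub>R R \<tau>)) \<longlonglongrightarrow> indicator {s..t} \<tau> *\<^sub>R R \<tau>"
    proof eventually_elim
      case (elim \<tau>)
      have Blim: "(\<lambda>n. B n \<sigma>) \<longlonglongrightarrow> (if \<sigma> > 0 then 1 else 0)" if "\<sigma> \<noteq> 0" for \<sigma>
      proof -
        have "\<forall>\<^sub>F n in sequentially. e n < \<bar>\<sigma>\<bar>" using e0 that by (intro order_tendstoD(2)) auto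
        then have "\<forall>\<^sub>F n in sequentially. B n \<sigma> = (if \<sigma> > 0 then 1 else 0)"
          by eventually_elim (use B0 B1 that in auto)
        then show ?thesis by (rule tendsto_eventually)
      qed
      have "(\<lambda>n. \<theta> n \<tau>) \<longlonglongrightarrow> (if \<tau> - s > 0 then 1 else 0) - (if \<tau> - t > 0 then 1 else 0)"
        unfolding \<theta>_def using elim by (intro tendsto_diff Blim) auto
      from tendsto_mult_right[OF this, of "indicator {d..t + d} \<tau> *\<^sub>R R \<tau>"]
      show ?case using elim lt d by (auto simp: indicator_def d_def split: if_splits)
    qed
  qed
  moreover have "(\<integral>\<tau>. \<theta> n \<tau> * (indicator {d..t + d} \<tau> *\<^sub>R R \<tau>) \<partial>lebesgue) = - \<i> * (conv (\<beta> n) W' s - conv (\<beta> n) W' t)" for n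
  proof -
    have "(\<integral>\<tau>. \<theta> n \<tau> * (indicator {d..t + d} \<tau> *\<^sub>R R \<tau>) \<partial>lebesgue) = (\<integral>\<tau>. indicator {0<..} \<tau> *\<^sub>R (\<theta> n \<tau> * R \<tau>) \<partial>lebesgue)"
    proof (rule Bochner_Integration.integral_cong[OF refl])
      fix \<tau>
      show "\<theta> n \<tau> * (indicator {d..t + d} \<tau> *\<^sub>R R \<tau>) = indicator {0<..} \<tau> *\<^sub>R (\<theta> n \<tau> * R \<tau>)"
        using \<theta>supp[of n \<tau>] d by (cases "\<theta> n \<tau> = 0") (auto simp: indicator_def)
    qed
    also have "\<dots> = (\<integral>\<tau>. \<theta> n \<tau> * R \<tau> \<partial>lebesgue_on {0<..})" by (simp add: integral_restrict_space)
    also have "\<dots> = - \<i> * (conv (\<beta> n) W' s - conv (\<beta> n) W' t)" using eq[OF \<theta>t[of n]] by (simp only: L)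
    finally show ?thesis .
  qed
  moreover have "(\<lambda>n. - \<i> * (conv (\<beta> n) W' s - conv (\<beta> n) W' t)) \<longlonglongrightarrow> - \<i> * (W' s - W' t)"
    by (intro tendsto_intros conv_mollifier_tendsto[OF W' \<beta> e0])
  ultimately have "(\<integral>\<tau>. indicator {s..t} \<tau> *\<^sub>R R \<tau> \<partial>lebesgue) = - \<i> * (W' s - W' t)"
    by (simp only:) (rule LIMSEQ_unique)
  then show ?thesis using st by (simp add: integral_restrict_space W'_def algebra_simps)
qed

section \<open>Test functions that separate time and space\<close>

lemma product_has_derivative:
  assumes "\<theta> differentiable (at (fst p))" "h differentiable (at (x - snd p))"
  shows "((\<lambda>p. \<theta> (fst p) * h (x - snd p)) has_derivative
    (\<lambda>d. \<theta> (fst p) * dir_deriv h (- snd d) (x - snd p) + dir_deriv \<theta> (fst d) (fst p) * h (x - snd p))) (at p)"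
proof (rule has_derivative_mult)
  show "((\<lambda>p. \<theta> (fst p)) has_derivative (\<lambda>d. dir_deriv \<theta> (fst d) (fst p))) (at p)"
    by (rule has_derivative_compose[OF has_derivative_fst[OF has_derivative_ident] differentiable_has_dir_deriv[OF assms(1)]])
  have "((\<lambda>p. x - snd p) has_derivative (\<lambda>d. - snd d)) (at p)"
    by (auto intro!: derivative_eq_intros)
  from has_derivative_compose[OF this differentiable_has_dir_deriv[OF assms(2)]]
  show "((\<lambda>p. h (x - snd p)) has_derivative (\<lambda>d. dir_deriv h (- snd d) (x - snd p))) (at p)" .
qed

lemma product_dir_deriv:
  assumes "\<theta> differentiable (at (fst p))" "h differentiable (at (x - snd p))"
  shows "dir_deriv (\<lambda>p. \<theta> (fst p) * h (x - snd p)) (1, 0) p = dir_deriv \<theta> 1 (fst p) * h (x - snd p)"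
    and "dir_deriv (\<lambda>p. \<theta> (fst p) * h (x - snd p)) (0, i) p = \<theta> (fst p) * (- dir_deriv h i (x - snd p))"
proof -
  have h: "linear (\<lambda>v. dir_deriv h v (x - snd p))"
    by (rule bounded_linear.linear[OF has_derivative_bounded_linear[OF differentiable_has_dir_deriv[OF assms(2)]]])
  have t: "linear (\<lambda>v. dir_deriv \<theta> v (fst p))"
    by (rule bounded_linear.linear[OF has_derivative_bounded_linear[OF differentiable_has_dir_deriv[OF assms(1)]]])
  show "dir_deriv (\<lambda>p. \<theta> (fst p) * h (x - snd p)) (1, 0) p = dir_deriv \<theta> 1 (fst p) * h (x - snd p)"
    using dir_deriv_eq[OF product_has_derivative[OF assms], of "(1, 0)"] linear_0[OF h] by simp
  show "dir_deriv (\<lambda>p. \<theta> (fst p) * h (x - snd p)) (0, i) p = \<theta> (fst p) * (- dir_deriv h i (x - snd p))"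
    using dir_deriv_eq[OF product_has_derivative[OF assms], of "(0, i)"] linear_0[OF t] linear_neg[OF h, of i] by simp
qed

text \<open>Testing with \<open>\<theta> t * k (x - y)\<close> turns the space-time equation into a
  scalar weak equation in time for the convolution with \<open>k\<close> at \<open>x\<close>. The
  two signs from differentiating \<open>k (x - y)\<close> twice in \<open>y\<close> cancel, so the
  Laplacian falls on \<open>k\<close> unchanged.\<close>

lemma product_test_fun:
  fixes k :: "'a::euclidean_space \<Rightarrow> complex" and x :: 'a
  assumes \<theta>: "\<theta> \<in> test_fun {0<..}" and k: "k \<in> test_fun UNIV"
  defines "\<phi> \<equiv> \<lambda>p. \<theta> (fst p) * k (x - snd p)"
  shows product_in_test_fun: "\<phi> \<in> test_fun ({0<..} \<times> UNIV)"
    and product_time_deriv: "time_deriv \<phi> (t, y) = dir_deriv \<theta> 1 t * k (x - y)"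
    and product_space_laplacian: "space_laplacian \<phi> (t, y) = \<theta> t * laplacian k (x - y)"
proof -
  have \<theta>C: "Ck n \<theta>" and kC: "Ck n k" for n using \<theta> k by (auto simp: test_fun_def)
  have d\<theta>: "\<theta> differentiable (at r)" for r using \<theta>C[of "Suc 0"] by simp
  have dk: "k differentiable (at y)" "dir_deriv k i differentiable (at y)" for i y
    using kC[of "Suc 0"] Ck_dir_deriv[OF kC, of "Suc 0" i] by auto
  show "time_deriv \<phi> (t, y) = dir_deriv \<theta> 1 t * k (x - y)"
    unfolding time_deriv_def \<phi>_def using product_dir_deriv(1)[of \<theta> "(t, y)" k x, OF d\<theta> dk(1)] by simp
  have m: "(\<lambda>y. - dir_deriv k i y) differentiable (at y)" "dir_deriv (\<lambda>y. - dir_deriv k i y) i y = - dir_deriv (dir_deriv k i) i y" for i y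
    using has_derivative_minus[OF differentiable_has_dir_deriv[OF dk(2)[of i y]]]
    by (auto simp: dir_deriv_eq differentiable_def)
  have "dir_deriv \<phi> (0, i) = (\<lambda>p. \<theta> (fst p) * (- dir_deriv k i (x - snd p)))" for i
    unfolding \<phi>_def using product_dir_deriv(2)[OF d\<theta> dk(1)] by blast
  then have "dir_deriv (dir_deriv \<phi> (0, i)) (0, i) (t, y) = \<theta> t * dir_deriv (dir_deriv k i) i (x - y)" for i
    using product_dir_deriv(2)[of \<theta> "(t, y)" "\<lambda>y. - dir_deriv k i y" x i, OF d\<theta> m(1)] by (simp add: m(2))
  then show "space_laplacian \<phi> (t, y) = \<theta> t * laplacian k (x - y)"
    by (simp add: space_laplacian_def laplacian_def sum_distrib_left)
  have \<phi>C: "Ck n \<phi>" for n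
  proof -
    have "Ck n (\<lambda>p. \<theta> (0 + fst p) * k (x + - snd p))"
      by (intro Ck_mult Ck_compose_affine \<theta>C kC bounded_linear_fst bounded_linear_minus bounded_linear_snd)
    then show ?thesis by (simp add: \<phi>_def)
  qed
  obtain \<alpha> b B where \<alpha>: "0 < \<alpha>" "\<And>\<tau>. \<theta> \<tau> \<noteq> 0 \<Longrightarrow> \<tau> \<in> {\<alpha>..b}" "\<And>\<tau>. cmod (\<theta> \<tau>) \<le> B"
    using test_fun_interval[OF \<theta>] by metis
  obtain r where r: "\<And>y. k y \<noteq> 0 \<Longrightarrow> norm y \<le> r" using test_fun_cc_kernel[OF k] by (auto simp: cc_kernel_def)
  have sub: "closure {p. \<phi> p \<noteq> 0} \<subseteq> {\<alpha>..b} \<times> cball x r"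
  proof (rule closure_minimal)
    show "{p. \<phi> p \<noteq> 0} \<subseteq> {\<alpha>..b} \<times> cball x r"
      using \<alpha>(2) r by (auto simp: \<phi>_def dist_norm)
  qed (intro closed_Times closed_cball closed_atLeastAtMost)
  moreover have "compact ({\<alpha>..b} \<times> cball x r)" by (intro compact_Times compact_Icc compact_cball)
  ultimately have "compact (closure {p. \<phi> p \<noteq> 0})"
    using compact_Int_closed[of "{\<alpha>..b} \<times> cball x r" "closure {p. \<phi> p \<noteq> 0}"] by (simp add: Int_absorb1)
  then show "\<phi> \<in> test_fun ({0<..} \<times> UNIV)"
    using \<phi>C sub \<alpha>(1) by (auto simp: test_fun_def)
qed

text \<open>With separated test functions, each pairing in the distributional equation becomes a
  time integral of \<open>\<theta>\<close> or its derivative against a convolution at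
  \<open>x\<close>; \<open>du_Bois_Reymond\<close> then removes \<open>\<theta>\<close>. The
  majorant in time is the power \<open>m + 1\<close> of the norm of the intersection space.\<close>

lemma H2_solution_imp_mild:
  fixes u :: "real \<Rightarrow> 'a::euclidean_space \<Rightarrow> complex"
  assumes m: "0 < m" "m < 1" and H: "H2_solution a m f u0 u" and uc: "u \<in> cont_space L2" and f: "f \<in> bochner_Lp_loc 1 L2"
  shows "mild_solution a m f u"
  unfolding mild_solution_def
proof (intro conjI uc f allI impI ballI)
  let ?X = "inter_space H1 (Lp (m + 1)) :: 'a fspace"
  fix T :: real assume T: "0 < T"
  have "u \<in> bochner_Lp (m + 1) {0<..<T} ?X"
    using H T by (simp add: H2_solution_def bochner_Lp_loc_def)
  then have sm: "strongly_measurable_on {0<..<T} ?X u" and i: "integrable (lebesgue_on {0<..<T}) (\<lambda>t. nrm ?X (u t) powr (m + 1))"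
    by (auto simp: bochner_Lp_def)
  have "AE t in lebesgue_on {0<..<T}. u t \<in> elems (Lp (m + 1)) \<and> (\<integral>x. cmod (u t x) powr (m + 1) \<partial>lebesgue) \<le> nrm ?X (u t) powr (m + 1)"
    using strongly_measurable_AE[OF sm]
  proof eventually_elim
    case (elim t)
    let ?J = "\<integral>x. cmod (u t x) powr (m + 1) \<partial>lebesgue"
    have J0: "0 \<le> ?J" by (simp add: integral_nonneg_AE)
    \<comment> \<open>Since the norm of the intersection is a sum, nonnegativity of this part makes
      it dominate the L^(m+1) norm.\<close>
    have "0 \<le> nrm H1 (u t)" by (simp add: H1_def sum_nonneg)
    then have "?J powr (1 / (m + 1)) \<le> nrm ?X (u t)" by (simp add: inter_space_def Lp_def)
    then have "(?J powr (1 / (m + 1))) powr (m + 1) \<le> nrm ?X (u t) powr (m + 1)"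
      using m by (intro powr_mono2) auto
    also have "(?J powr (1 / (m + 1))) powr (m + 1) = ?J" using J0 m by (simp add: powr_powr)
    finally show ?case using elim by (simp add: inter_space_def)
  qed
  with i show "\<exists>g. integrable (lebesgue_on {0<..<T}) g \<and>
        (AE t in lebesgue_on {0<..<T}. u t \<in> elems (Lp (m + 1)) \<and> (\<integral>x. cmod (u t x) powr (m + 1) \<partial>lebesgue) \<le> g t)"
    by blast
next
  fix k :: "'a \<Rightarrow> complex" and x s t
  assume k: "k \<in> test_fun UNIV" and st: "(0::real) < s" "s \<le> t"
  have kk: "cc_kernel k" by (rule test_fun_cc_kernel[OF k])
  have lk: "cc_kernel (laplacian k)" using k by (intro laplacian_kernel[OF kk]) (simp add: test_fun_def)
  have i1: "integrable (lebesgue_on {s..t}) (\<lambda>\<tau>. conv k (f \<tau>) x)" if "0 < s" for s t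
    by (rule conv_L1_integrable[OF bochner_L1_loc_interval[OF f that] _ kk]) simp
  have i2: "integrable (lebesgue_on {s..t}) (\<lambda>\<tau>. conv (laplacian k) (u \<tau>) x)" if "0 < s" for s t
    by (rule continuous_interval_measurable(1)[OF cont_space_conv[OF uc lk]]) (use that in simp)
  have i3: "integrable (lebesgue_on {s..t}) (\<lambda>\<tau>. conv k (\<lambda>y. nonlin m (u \<tau> y)) x)" if "0 < s" for s t
    by (rule continuous_interval_measurable(1)[OF cont_space_nonlin_conv[OF uc kk m]]) (use that in simp)
  show "\<i> * (conv k (u t) x - conv k (u s) x) =
      (\<integral>\<tau>. conv k (f \<tau>) x - conv (laplacian k) (u \<tau>) x - a * conv k (\<lambda>y. nonlin m (u \<tau> y)) x \<partial>lebesgue_on {s..t})"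
  proof (rule du_Bois_Reymond[OF cont_space_conv[OF uc kk] mild_rhs_integrable[OF m uc f kk lk] _ st])
    fix \<theta> :: "real \<Rightarrow> complex" assume \<theta>: "\<theta> \<in> test_fun {0<..}"
    let ?\<phi> = "\<lambda>p :: real \<times> 'a. \<theta> (fst p) * k (x - snd p)"
    have eq: "- \<i> * dist_pairing u (time_deriv ?\<phi>) + dist_pairing u (space_laplacian ?\<phi>)
          + a * dist_pairing (\<lambda>t x. nonlin m (u t x)) ?\<phi> = dist_pairing f ?\<phi>"
      using H product_in_test_fun[OF \<theta> k] unfolding H2_solution_def solves_in_distributions_def by blast
    have pull: "(\<integral>y. w y * (c * K (x - y)) \<partial>lebesgue) = c * conv K w x" for w K and c :: complex
      unfolding conv_def by (subst integral_mult_right_zero[symmetric]) (simp add: mult_ac)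
    have p1: "dist_pairing u (time_deriv ?\<phi>) = (\<integral>\<tau>. dir_deriv \<theta> 1 \<tau> * conv k (u \<tau>) x \<partial>lebesgue_on {0<..})"
      unfolding dist_pairing_def product_time_deriv[OF \<theta> k] pull ..
    have p2: "dist_pairing u (space_laplacian ?\<phi>) = (\<integral>\<tau>. \<theta> \<tau> * conv (laplacian k) (u \<tau>) x \<partial>lebesgue_on {0<..})"
      unfolding dist_pairing_def product_space_laplacian[OF \<theta> k] pull ..
    have p3: "dist_pairing w ?\<phi> = (\<integral>\<tau>. \<theta> \<tau> * conv k (w \<tau>) x \<partial>lebesgue_on {0<..})" for w
      unfolding dist_pairing_def fst_conv snd_conv pull ..
    have "(\<integral>\<tau>. \<theta> \<tau> * (conv k (f \<tau>) x - conv (laplacian k) (u \<tau>) x - a * conv k (\<lambda>y. nonlin m (u \<tau> y)) x) \<partial>lebesgue_on {0<..}) =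
      (\<integral>\<tau>. \<theta> \<tau> * conv k (f \<tau>) x - \<theta> \<tau> * conv (laplacian k) (u \<tau>) x - a * (\<theta> \<tau> * conv k (\<lambda>y. nonlin m (u \<tau> y)) x) \<partial>lebesgue_on {0<..})"
      by (rule Bochner_Integration.integral_cong[OF refl]) (simp add: algebra_simps)
    also have "\<dots> = (\<integral>\<tau>. \<theta> \<tau> * conv k (f \<tau>) x \<partial>lebesgue_on {0<..}) - (\<integral>\<tau>. \<theta> \<tau> * conv (laplacian k) (u \<tau>) x \<partial>lebesgue_on {0<..})
        - a * (\<integral>\<tau>. \<theta> \<tau> * conv k (\<lambda>y. nonlin m (u \<tau> y)) x \<partial>lebesgue_on {0<..})"
      using test_fun_mult_integrable[OF \<theta> i1] test_fun_mult_integrable[OF \<theta> i2] test_fun_mult_integrable[OF \<theta> i3] by simp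
    also have "\<dots> = - \<i> * (\<integral>\<tau>. dir_deriv \<theta> 1 \<tau> * conv k (u \<tau>) x \<partial>lebesgue_on {0<..})"
      using eq unfolding p1 p2 p3 by (simp add: algebra_simps)
    finally show "- \<i> * (\<integral>\<tau>. dir_deriv \<theta> 1 \<tau> * conv k (u \<tau>) x \<partial>lebesgue_on {0<..}) =
        (\<integral>\<tau>. \<theta> \<tau> * (conv k (f \<tau>) x - conv (laplacian k) (u \<tau>) x - a * conv k (\<lambda>y. nonlin m (u \<tau> y)) x) \<partial>lebesgue_on {0<..})"
      by (rule sym)
  qed
qed

subsection \<open>Consequences of the energy inequality\<close>

text \<open>At a maximum point \<open>p\<close> the hypothesis reads
  \<open>(y p)\<^sup>2 \<le> (y s)\<^sup>2 + 2 * K * y p\<close>; completing the square gives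
  \<open>y p \<le> y s + 2 * K\<close>. Working at the maximum avoids a division by
  \<open>y\<close>, which may vanish, and costs the factor 2.\<close>

lemma quadratic_growth_bound:
  fixes y \<kappa> :: "real \<Rightarrow> real"
  assumes st: "s \<le> t" and y: "continuous_on {s..t} y" "\<And>\<tau>. 0 \<le> y \<tau>"
    and \<kappa>: "integrable (lebesgue_on {s..t}) \<kappa>" "\<And>\<tau>. 0 \<le> \<kappa> \<tau>"
    and le: "\<And>\<tau>. s \<le> \<tau> \<Longrightarrow> \<tau> \<le> t \<Longrightarrow> (y \<tau>)\<^sup>2 \<le> (y s)\<^sup>2 + 2 * (\<integral>r. \<kappa> r * y r \<partial>lebesgue_on {s..\<tau>})"
    and \<tau>: "s \<le> \<tau>" "\<tau> \<le> t"
  shows "y \<tau> \<le> y s + 2 * (\<integral>r. \<kappa> r \<partial>lebesgue_on {s..t})"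
proof -
  obtain p where p: "p \<in> {s..t}" "\<And>q. q \<in> {s..t} \<Longrightarrow> y q \<le> y p"
    using continuous_attains_sup[OF compact_Icc _ y(1)] st by auto
  define K where "K = (\<integral>r. \<kappa> r \<partial>lebesgue_on {s..t})"
  have K0: "0 \<le> K" unfolding K_def using \<kappa>(2) by (intro integral_nonneg_AE) auto
  have "(\<integral>r. \<kappa> r * y r \<partial>lebesgue_on {s..p}) \<le> (\<integral>r. \<kappa> r * y p \<partial>lebesgue_on {s..t})"
  proof (rule integral_mono_lebesgue_on_AE)
    show "AE r in lebesgue_on {s..p}. \<kappa> r * y r \<le> \<kappa> r * y p"
      by (rule AE_I2) (use p \<kappa>(2) in \<open>auto intro!: mult_left_mono\<close>)
  qed (use \<kappa> p y(2) in auto)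
  also have "\<dots> = K * y p" unfolding K_def using \<kappa>(1) by simp
  finally have "(y p)\<^sup>2 \<le> (y s)\<^sup>2 + 2 * (K * y p)" using le[of p] p(1) by simp
  then have "(y p - K)\<^sup>2 \<le> (y s)\<^sup>2 + K\<^sup>2" by (simp add: power2_diff mult.commute)
  also have "\<dots> \<le> (y s + K)\<^sup>2" using K0 y(2)[of s] by (simp add: power2_sum)
  finally have "(y p - K)\<^sup>2 \<le> (y s + K)\<^sup>2" .
  then have "y p - K \<le> y s + K" by (rule power2_le_imp_le) (use K0 y(2)[of s] in simp)
  moreover have "y \<tau> \<le> y p" using p(2) \<tau> by simp
  ultimately show ?thesis unfolding K_def by linarith
qed

lemma cont_space_interval:
  assumes "u \<in> cont_space L2" "0 \<le> s"
  shows "continuous_on {s..t} (\<lambda>\<tau>. nrm L2 (u \<tau>))"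
  by (rule continuous_on_subset[OF cont_space_nrm[OF assms(1)]]) (use assms(2) in auto)

text \<open>Dissipativity lets the nonlinear term be dropped from the energy inequality; what
  remains is of the form treated by \<open>quadratic_growth_bound\<close>.\<close>

lemma mild_contraction:
  assumes m: "0 < m" "m < 1" and a: "2 * sqrt m * Im a \<ge> (1 - m) * \<bar>Re a\<bar>"
    and U: "mild_solution a m f u" and V: "mild_solution a m g v" and st: "0 < s" "s \<le> t"
  shows "nrm L2 (\<lambda>x. u t x - v t x) \<le> nrm L2 (\<lambda>x. u s x - v s x)
    + 2 * (\<integral>\<tau>. nrm L2 (\<lambda>x. f \<tau> x - g \<tau> x) \<partial>lebesgue_on {s..t})"
proof -
  have uc: "u \<in> cont_space L2" and vc: "v \<in> cont_space L2" and fl: "f \<in> bochner_Lp_loc 1 L2" and gl: "g \<in> bochner_Lp_loc 1 L2"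
    using U V by (auto simp: mild_solution_def)
  have F: "(\<lambda>\<tau> x. f \<tau> x - g \<tau> x) \<in> bochner_Lp 1 {s..t} L2"
    using bochner_L1_loc_interval[OF fl st(1)] bochner_L1_loc_interval[OF gl st(1)] by (intro bochner_L1_diff) auto
  show ?thesis
  proof (rule quadratic_growth_bound[OF st(2), of "\<lambda>\<tau>. nrm L2 (\<lambda>x. u \<tau> x - v \<tau> x)"])
    show "continuous_on {s..t} (\<lambda>\<tau>. nrm L2 (\<lambda>x. u \<tau> x - v \<tau> x))"
      using cont_space_interval[OF cont_space_diff[OF uc vc]] st by simp
    show "integrable (lebesgue_on {s..t}) (\<lambda>\<tau>. nrm L2 (\<lambda>x. f \<tau> x - g \<tau> x))"
      using F by (simp add: bochner_L1_iff)
    fix \<tau> assume \<tau>: "s \<le> \<tau>" "\<tau> \<le> t"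
    let ?D = "\<lambda>\<tau>. \<integral>x. (nonlin m (u \<tau> x) - nonlin m (v \<tau> x)) * cnj (u \<tau> x - v \<tau> x) \<partial>lebesgue"
    \<comment> \<open>If the integrand is not integrable, the integral is 0 by convention, which
      also has the right sign.\<close>
    have "0 \<le> Im (a * ?D r)" for r
    proof (cases "integrable lebesgue (\<lambda>x. (nonlin m (u r x) - nonlin m (v r x)) * cnj (u r x - v r x))")
      case True
      have "Im (a * ?D r) = (\<integral>x. Im (a * ((nonlin m (u r x) - nonlin m (v r x)) * cnj (u r x - v r x))) \<partial>lebesgue)"
        by (subst integral_Im) (use True in auto)
      then show ?thesis by (simp only:) (intro integral_nonneg_AE AE_I2 nonlin_dissipative[OF m a])
    qed (simp add: not_integrable_integral_eq)
    then have "0 \<le> (\<integral>r. Im (a * ?D r) \<partial>lebesgue_on {s..\<tau>})" by (intro integral_nonneg_AE) auto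
    with mild_energy(2)[OF m U V st(1) \<tau>(1)]
    show "(nrm L2 (\<lambda>x. u \<tau> x - v \<tau> x))\<^sup>2 \<le> (nrm L2 (\<lambda>x. u s x - v s x))\<^sup>2 +
        2 * (\<integral>r. nrm L2 (\<lambda>x. f r x - g r x) * nrm L2 (\<lambda>x. u r x - v r x) \<partial>lebesgue_on {s..\<tau>})"
      by linarith
  qed (use st in auto)
qed

text \<open>A functional below the \<open>L\<^bsup>m+1\<^esup>\<close>-integral that is continuous on \<open>L\<^sup>2\<close>, unlike that integral.\<close>

definition trunc_sq :: "real \<Rightarrow> real" where "trunc_sq p = min p (p\<^sup>2)"

definition trunc_energy :: "('a::euclidean_space \<Rightarrow> complex) \<Rightarrow> real" where
  "trunc_energy g = (\<integral>x. trunc_sq (cmod (g x)) \<partial>lebesgue)"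

section \<open>The truncated square and its integral\<close>

lemma trunc_sq_le_sq: "trunc_sq p \<le> p\<^sup>2"
  by (simp add: trunc_sq_def)

lemma trunc_sq_nonneg: "0 \<le> p \<Longrightarrow> 0 \<le> trunc_sq p"
  by (simp add: trunc_sq_def)

text \<open>The exponent \<open>m + 1\<close> lies between 1 and 2: below 1 the square is the
  smaller power, above 1 the first power is.\<close>

lemma trunc_sq_le_powr:
  assumes "0 \<le> p" "0 < m" "m < 1"
  shows "trunc_sq p \<le> p powr (m + 1)"
proof (cases "p \<le> 1")
  case True
  have "p powr 2 \<le> p powr (m + 1)" using assms True by (intro powr_mono') auto
  then show ?thesis using assms by (simp add: trunc_sq_def)
next
  case False
  have "p powr 1 \<le> p powr (m + 1)" using assms False by (intro powr_mono) auto
  then show ?thesis using assms by (simp add: trunc_sq_def)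
qed

text \<open>The right side is the increment of the square. Below 1 both increments agree; above 1
  the truncation has slope 1, which is less than \<open>p + q\<close>; between them,
  \<open>p\<^sup>2 \<le> p\<close> and \<open>q \<le> q\<^sup>2\<close> decide.\<close>

lemma trunc_sq_diff:
  assumes "0 \<le> p" "0 \<le> q"
  shows "\<bar>trunc_sq p - trunc_sq q\<bar> \<le> \<bar>p - q\<bar> * (p + q)"
proof -
  have *: "trunc_sq q - trunc_sq p \<le> (q - p) * (p + q) \<and> trunc_sq p \<le> trunc_sq q" if "0 \<le> p" "p \<le> q" for p q :: real
  proof -
    have sq: "x\<^sup>2 \<le> x" if "0 \<le> x" "x \<le> 1" for x :: real
      using that mult_left_mono[of x 1 x] by (simp add: power2_eq_square)
    have sq': "x \<le> x\<^sup>2" if "1 \<le> x" for x :: real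
      using that mult_left_mono[of 1 x x] by (simp add: power2_eq_square)
    have e: "(q - p) * (p + q) = q\<^sup>2 - p\<^sup>2" by (simp add: power2_eq_square algebra_simps)
    have pq: "p\<^sup>2 \<le> q\<^sup>2" using that by (intro power_mono) auto
    consider "q \<le> 1" | "p \<le> 1" "1 \<le> q" | "1 \<le> p" using that by linarith
    then show ?thesis
    proof cases
      case 1
      then have "trunc_sq p = p\<^sup>2" "trunc_sq q = q\<^sup>2" using that sq[of p] sq[of q] by (simp_all add: trunc_sq_def min_absorb2)
      then show ?thesis using e pq by simp
    next
      case 2
      then have "trunc_sq p = p\<^sup>2" "trunc_sq q = q" using that sq[of p] sq'[of q] by (simp_all add: trunc_sq_def min_absorb1 min_absorb2)
      then show ?thesis using e that 2 sq[of p] sq'[of q] by simp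
    next
      case 3
      have "(q - p) * 1 \<le> (q - p) * (p + q)" using 3 that by (intro mult_left_mono) auto
      moreover have "trunc_sq p = p" "trunc_sq q = q" using 3 that sq'[of p] sq'[of q] by (simp_all add: trunc_sq_def min_absorb1)
      ultimately show ?thesis using that by simp
    qed
  qed
  show ?thesis
    using *[of p q] *[of q p] assms by (cases "p \<le> q") (auto simp: add.commute)
qed

text \<open>If both numbers exceed 1, their product is the product of the truncations; if one of
  them does not, the product is absorbed by the linear terms. The product term is the one that
  becomes the square of the energy after averaging over shifts.\<close>

lemma mult_le_trunc_sq:
  assumes "0 \<le> p" "0 \<le> q"
  shows "p * q \<le> trunc_sq p + trunc_sq q + trunc_sq p * trunc_sq q"
proof -
  have sq: "trunc_sq x = x\<^sup>2" if "0 \<le> x" "x \<le> 1" for x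
    using that mult_left_mono[of x 1 x] by (simp add: trunc_sq_def power2_eq_square)
  have sq': "trunc_sq x = x" if "1 \<le> x" for x
    using that mult_left_mono[of 1 x x] by (simp add: trunc_sq_def power2_eq_square)
  have n: "0 \<le> trunc_sq p" "0 \<le> trunc_sq q" "0 \<le> trunc_sq p * trunc_sq q" using assms by (auto simp: trunc_sq_nonneg)
  consider "p \<le> 1" "q \<le> 1" | "p \<le> 1" "1 \<le> q" | "1 \<le> p" "q \<le> 1" | "1 \<le> p" "1 \<le> q" by linarith
  then show ?thesis
  proof cases
    case 1
    have "2 * (p * q) \<le> p\<^sup>2 + q\<^sup>2" using zero_le_power2[of "p - q"] by (simp add: power2_diff)
    moreover have "0 \<le> p * q" "0 \<le> p\<^sup>2 * q\<^sup>2" using assms by auto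
    ultimately have "p * q \<le> p\<^sup>2 + q\<^sup>2 + p\<^sup>2 * q\<^sup>2" by linarith
    moreover have "trunc_sq p = p\<^sup>2" "trunc_sq q = q\<^sup>2" using 1 assms sq by auto
    ultimately show ?thesis by (simp only:)
  next
    case 2
    then have "p * q \<le> trunc_sq q" using assms mult_right_mono[of p 1 q] sq' by simp
    then show ?thesis using n by linarith
  next
    case 3
    then have "p * q \<le> trunc_sq p" using assms mult_left_mono[of q 1 p] sq' by simp
    then show ?thesis using n by linarith
  next
    case 4
    then show ?thesis using sq' n by simp
  qed
qed

lemma trunc_sq_measurable [measurable]: "trunc_sq \<in> borel_measurable borel"
  unfolding trunc_sq_def[abs_def] by measurable

lemma trunc_sq_integrable:
  assumes "g \<in> elems L2"
  shows "integrable lebesgue (\<lambda>x. trunc_sq (cmod (g x)))"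
proof (rule Bochner_Integration.integrable_bound)
  show "integrable lebesgue (\<lambda>x. (cmod (g x))\<^sup>2)" using assms by (simp add: mem_L2_iff)
  show "(\<lambda>x. trunc_sq (cmod (g x))) \<in> borel_measurable lebesgue" using assms by measurable
qed (auto simp: trunc_sq_nonneg trunc_sq_le_sq)

lemma trunc_energy_nonneg: "0 \<le> trunc_energy g"
  unfolding trunc_energy_def by (intro integral_nonneg_AE) (simp add: trunc_sq_nonneg)

lemma trunc_energy_le_nrm:
  assumes "g \<in> elems L2"
  shows "trunc_energy g \<le> (nrm L2 g)\<^sup>2"
  unfolding trunc_energy_def nrm_L2_sq
  using assms by (intro integral_mono trunc_sq_integrable trunc_sq_le_sq) (auto simp: mem_L2_iff)

text \<open>The increment bound for \<open>trunc_sq\<close> integrated by Cauchy-Schwarz; it makes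
  the functional locally Lipschitz on L^2.\<close>

lemma trunc_energy_diff:
  assumes g: "g \<in> elems L2" and h: "h \<in> elems L2"
  shows "\<bar>trunc_energy g - trunc_energy h\<bar> \<le> nrm L2 (\<lambda>x. g x - h x) * (nrm L2 g + nrm L2 h)"
proof -
  have gh: "(\<lambda>x. g x - h x) \<in> elems L2" by (rule L2_diff[OF g h])
  have "\<bar>trunc_energy g - trunc_energy h\<bar> = \<bar>\<integral>x. trunc_sq (cmod (g x)) - trunc_sq (cmod (h x)) \<partial>lebesgue\<bar>"
    unfolding trunc_energy_def by (simp add: trunc_sq_integrable g h)
  also have "\<dots> \<le> (\<integral>x. \<bar>trunc_sq (cmod (g x)) - trunc_sq (cmod (h x))\<bar> \<partial>lebesgue)"
    by (rule integral_abs_bound)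
  also have "\<dots> \<le> (\<integral>x. cmod (g x - h x) * cmod (g x) + cmod (g x - h x) * cmod (h x) \<partial>lebesgue)"
  proof (rule integral_mono)
    fix x
    have "\<bar>trunc_sq (cmod (g x)) - trunc_sq (cmod (h x))\<bar> \<le> \<bar>cmod (g x) - cmod (h x)\<bar> * (cmod (g x) + cmod (h x))"
      by (rule trunc_sq_diff) auto
    also have "\<dots> \<le> cmod (g x - h x) * (cmod (g x) + cmod (h x))"
      by (intro mult_right_mono norm_triangle_ineq3) auto
    finally show "\<bar>trunc_sq (cmod (g x)) - trunc_sq (cmod (h x))\<bar> \<le> cmod (g x - h x) * cmod (g x) + cmod (g x - h x) * cmod (h x)"
      by (simp add: distrib_left)
  qed (use g h gh in \<open>auto intro!: trunc_sq_integrable L2_mult_integrable\<close>)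
  also have "\<dots> = (\<integral>x. cmod (g x - h x) * cmod (g x) \<partial>lebesgue) + (\<integral>x. cmod (g x - h x) * cmod (h x) \<partial>lebesgue)"
    by (rule Bochner_Integration.integral_add[OF L2_mult_integrable[OF gh g] L2_mult_integrable[OF gh h]])
  also have "\<dots> \<le> nrm L2 (\<lambda>x. g x - h x) * (nrm L2 g + nrm L2 h)"
    using L2_Cauchy_Schwarz[OF gh g] L2_Cauchy_Schwarz[OF gh h] by (simp add: distrib_left)
  finally show ?thesis .
qed

lemma trunc_energy_tendsto:
  assumes ev: "\<forall>\<^sub>F n in F. s n \<in> elems L2" and g: "g \<in> elems L2"
    and lim: "((\<lambda>n. nrm L2 (\<lambda>x. s n x - g x)) \<longlongrightarrow> 0) F"
  shows "((\<lambda>n. trunc_energy (s n)) \<longlongrightarrow> trunc_energy g) F"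
proof (rule LIM_zero_cancel, rule Lim_null_comparison)
  let ?d = "\<lambda>n. nrm L2 (\<lambda>x. s n x - g x)"
  show "\<forall>\<^sub>F n in F. norm (trunc_energy (s n) - trunc_energy g) \<le> ?d n * (?d n + 2 * nrm L2 g)"
    using ev
  proof eventually_elim
    case (elim n)
    have "nrm L2 (s n) \<le> ?d n + nrm L2 g" using nrm_L2_abs_diff[OF elim g] by linarith
    then have "?d n * (nrm L2 (s n) + nrm L2 g) \<le> ?d n * (?d n + 2 * nrm L2 g)"
      by (intro mult_left_mono) auto
    then show ?case using trunc_energy_diff[OF elim g] by simp
  qed
  have "((\<lambda>n. ?d n * (?d n + 2 * nrm L2 g)) \<longlongrightarrow> 0 * (0 + 2 * nrm L2 g)) F"
    by (intro tendsto_intros lim)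
  then show "((\<lambda>n. ?d n * (?d n + 2 * nrm L2 g)) \<longlongrightarrow> 0) F" by simp
qed

lemma cont_space_trunc_energy:
  assumes "u \<in> cont_space L2"
  shows "continuous_on {0..} (\<lambda>t. trunc_energy (u t))"
  by (rule cont_space_continuous[OF assms, of trunc_energy]) (rule trunc_energy_tendsto)

text \<open>Against the zero solution the nonlinear pairing is exactly the L^(m+1) integral, which
  is real; its product with \<open>a\<close> has imaginary part \<open>Im a\<close> times that
  integral. The energy inequality thus bounds the total dissipation.\<close>

lemma mild_trunc_energy:
  assumes m: "0 < m" "m < 1" and a: "2 * sqrt m * Im a \<ge> (1 - m) * \<bar>Re a\<bar>" "0 < Im a"
    and U: "mild_solution a m f u" and st: "0 < s" "s \<le> t"
  shows "2 * Im a * (\<integral>\<tau>. trunc_energy (u \<tau>) \<partial>lebesgue_on {s..t})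
    \<le> 2 * (nrm L2 (u s) + 2 * (\<integral>\<tau>. nrm L2 (f \<tau>) \<partial>lebesgue_on {s..t}))\<^sup>2"
proof -
  let ?M = "lebesgue_on {s..t}"
  define K where "K = (\<integral>\<tau>. nrm L2 (f \<tau>) \<partial>?M)"
  \<comment> \<open>\<open>Y\<close> bounds the norm on all of \<open>{s..t}\<close>, so the forcing
    contributes at most \<open>2 * K * Y\<close>. Both \<open>nrm L2 (u s)\<close> and
    \<open>2 * K\<close> are at most \<open>Y\<close>, whence the final
    \<open>2 * Y\<^sup>2\<close>.\<close>
  define Y where "Y = nrm L2 (u s) + 2 * K"
  have uc: "u \<in> cont_space L2" and fl: "f \<in> bochner_Lp_loc 1 L2" using U by (auto simp: mild_solution_def)
  have fi: "integrable ?M (\<lambda>\<tau>. nrm L2 (f \<tau>))"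
    using bochner_L1_loc_interval[OF fl st(1)] by (simp add: bochner_L1_iff)
  have K0: "0 \<le> K" unfolding K_def by (intro integral_nonneg_AE) simp
  have Yb: "nrm L2 (u \<tau>) \<le> Y" if \<tau>: "s \<le> \<tau>" "\<tau> \<le> t" for \<tau>
  proof -
    have "(\<integral>r. nrm L2 (f r) \<partial>lebesgue_on {s..\<tau>}) \<le> K"
      unfolding K_def by (rule integral_mono_lebesgue_on_AE[OF fi]) (use \<tau> in auto)
    then show ?thesis
      using mild_contraction[OF m a(1) U mild_solution_zero st(1) \<tau>(1)] by (simp add: Y_def)
  qed
  define D where "D \<tau> = (\<integral>x. nonlin m (u \<tau> x) * cnj (u \<tau> x) \<partial>lebesgue)" for \<tau>
  have D_eq: "D = (\<lambda>\<tau>. \<integral>x. nonlin m (u \<tau> x) * cnj (u \<tau> x) \<partial>lebesgue)" by (rule ext) (simp add: D_def)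
  have en: "integrable ?M D" "(nrm L2 (u t))\<^sup>2 + 2 * (\<integral>\<tau>. Im (a * D \<tau>) \<partial>?M) \<le>
      (nrm L2 (u s))\<^sup>2 + 2 * (\<integral>\<tau>. nrm L2 (f \<tau>) * nrm L2 (u \<tau>) \<partial>?M)"
    unfolding D_eq using mild_energy[OF m U mild_solution_zero st] by (simp_all only: nonlin_0 diff_zero)
  have "(\<integral>\<tau>. nrm L2 (f \<tau>) * nrm L2 (u \<tau>) \<partial>?M) \<le> (\<integral>\<tau>. nrm L2 (f \<tau>) * Y \<partial>?M)"
  proof (rule integral_mono_lebesgue_on_AE)
    show "AE \<tau> in ?M. nrm L2 (f \<tau>) * nrm L2 (u \<tau>) \<le> nrm L2 (f \<tau>) * Y"
      by (rule AE_I2) (auto intro!: mult_left_mono Yb)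
    have "0 \<le> Y" using Yb[OF order.refl st(2)] nrm_L2_nonneg[of "u s"] by linarith
    then show "AE \<tau> in ?M. 0 \<le> nrm L2 (f \<tau>) * Y" by simp
  qed (use fi in auto)
  also have "\<dots> = K * Y" using fi by (simp add: K_def)
  finally have KY: "(\<integral>\<tau>. nrm L2 (f \<tau>) * nrm L2 (u \<tau>) \<partial>?M) \<le> K * Y" .
  have t1: "0 < t + 1" using st by simp
  obtain g where g: "AE \<tau> in lebesgue_on {0<..<t + 1}. u \<tau> \<in> elems (Lp (m + 1)) \<and> (\<integral>x. cmod (u \<tau> x) powr (m + 1) \<partial>lebesgue) \<le> g \<tau>"
    using U t1 unfolding mild_solution_def by blast
  have "Im a * (\<integral>\<tau>. trunc_energy (u \<tau>) \<partial>?M) = (\<integral>\<tau>. Im a * trunc_energy (u \<tau>) \<partial>?M)" by simp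
  also have "\<dots> \<le> (\<integral>\<tau>. Im (a * D \<tau>) \<partial>?M)"
  proof (rule integral_mono_AE)
    show "integrable ?M (\<lambda>\<tau>. Im a * trunc_energy (u \<tau>))"
      using continuous_interval_measurable(1)[OF cont_space_trunc_energy[OF uc]] st by simp
    show "integrable ?M (\<lambda>\<tau>. Im (a * D \<tau>))" by (intro integrable_Im integrable_mult_right en(1))
    have inI: "AE \<tau> in ?M. \<tau> \<in> {s..t}" by (rule AE_I2) simp
    have "AE \<tau> in ?M. u \<tau> \<in> elems (Lp (m + 1)) \<and> (\<integral>x. cmod (u \<tau> x) powr (m + 1) \<partial>lebesgue) \<le> g \<tau>"
      by (rule AE_lebesgue_on_subset[OF g]) (use st in auto)
    with inI show "AE \<tau> in ?M. Im a * trunc_energy (u \<tau>) \<le> Im (a * D \<tau>)"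
    proof eventually_elim
      case (elim \<tau>)
      have i: "integrable lebesgue (\<lambda>x. cmod (u \<tau> x) powr (m + 1))" using elim by (simp add: mem_Lp_iff)
      have "trunc_energy (u \<tau>) \<le> (\<integral>x. cmod (u \<tau> x) powr (m + 1) \<partial>lebesgue)"
        unfolding trunc_energy_def
        using elim st m by (intro integral_mono i trunc_sq_integrable cont_space_L2[OF uc] trunc_sq_le_powr) auto
      moreover have "D \<tau> = of_real (\<integral>x. cmod (u \<tau> x) powr (m + 1) \<partial>lebesgue)"
        unfolding D_def nonlin_mult_cnj[OF m(1)] by (rule integral_complex_of_real)
      ultimately show ?case using a(2) by (simp add: mult_left_mono)
    qed
  qed
  finally have "2 * Im a * (\<integral>\<tau>. trunc_energy (u \<tau>) \<partial>?M) \<le> (nrm L2 (u s))\<^sup>2 + 2 * (K * Y)"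
    using en(2) KY zero_le_power2[of "nrm L2 (u t)"] by linarith
  also have "\<dots> \<le> 2 * Y\<^sup>2"
  proof -
    have Yn: "nrm L2 (u s) \<le> Y" "0 \<le> Y" "2 * K \<le> Y" using K0 by (auto simp: Y_def)
    have "(nrm L2 (u s))\<^sup>2 \<le> Y\<^sup>2" using Yn by (intro power_mono) auto
    moreover have "2 * K * Y \<le> Y * Y" using Yn by (intro mult_right_mono) auto
    ultimately show ?thesis by (simp add: power2_eq_square)
  qed
  finally show ?thesis unfolding Y_def K_def .
qed

text \<open>For a short shift \<open>h\<close>, one factor in the integral of the squared modulus
  may be replaced by its translate at the cost \<open>\<eta> * nrm L2 g\<close>. The resulting
  product is bounded by truncations through \<open>mult_le_trunc_sq\<close>. Averaging over
  \<open>h\<close> in the ball decouples the two factors of the product term and leaves the square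
  of the energy divided by the volume of the ball.\<close>

lemma nrm_L2_le_of_equicontinuous:
  fixes g :: "'a::euclidean_space \<Rightarrow> complex"
  assumes g: "g \<in> elems L2" and \<delta>: "0 < \<delta>"
    and eq: "\<And>h. norm h < \<delta> \<Longrightarrow> nrm L2 (\<lambda>x. g (x + h) - g x) \<le> \<eta>"
  shows "(nrm L2 g)\<^sup>2 \<le> \<eta>\<^sup>2 + 4 * trunc_energy g + 2 * (trunc_energy g)\<^sup>2 / measure lebesgue (ball (0::'a) \<delta>)"
proof -
  define \<Phi> where "\<Phi> = trunc_energy g"
  define b where "b = measure lebesgue (ball (0::'a) \<delta>)"
  have b: "0 < b" unfolding b_def using \<delta> by (simp add: content_ball_pos)
  have \<eta>: "0 \<le> \<eta>" using eq[of 0] \<delta> by simp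
  have gm: "g \<in> borel_measurable lebesgue" using g by (simp add: mem_L2_iff)
  obtain g' where g': "g' \<in> borel_measurable borel" "AE x in lebesgue. g x = g' x"
    using lebesgue_ex_borel[OF gm] by blast
  \<comment> \<open>A Borel version of the truncated square, so that Tonelli applies in
    \<open>x\<close> and \<open>h\<close> jointly.\<close>
  define \<gamma> where "\<gamma> x = ennreal (trunc_sq (cmod (g' x)))" for x
  have \<gamma>m [measurable]: "\<gamma> \<in> borel_measurable borel" unfolding \<gamma>_def[abs_def] using g'(1) by measurable
  have \<Phi>: "(\<integral>\<^sup>+x. \<gamma> x \<partial>lborel) = ennreal \<Phi>"
  proof -
    have "(\<integral>\<^sup>+x. \<gamma> x \<partial>lborel) = (\<integral>\<^sup>+x. \<gamma> x \<partial>lebesgue)"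
      by (rule nn_integral_completion[symmetric])
    also have "\<dots> = (\<integral>\<^sup>+x. ennreal (trunc_sq (cmod (g x))) \<partial>lebesgue)"
      unfolding \<gamma>_def
      by (rule nn_integral_cong_AE) (use g'(2) in \<open>auto elim!: eventually_mono\<close>)
    also have "\<dots> = ennreal \<Phi>"
      unfolding \<Phi>_def trunc_energy_def by (rule nn_integral_eq_integral[OF trunc_sq_integrable[OF g]]) (simp add: trunc_sq_nonneg)
    finally show ?thesis .
  qed
  have \<Phi>0: "0 \<le> \<Phi>" by (simp add: \<Phi>_def trunc_energy_nonneg)
  \<comment> \<open>What the product term must still account for: \<open>\<eta> * nrm L2 g\<close>
    is absorbed as half of \<open>\<eta>\<^sup>2\<close> plus half of the squared norm, and the two
    linear truncations integrate to \<open>2 * \<Phi>\<close>.\<close>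
  define c where "c = ((nrm L2 g)\<^sup>2 - \<eta>\<^sup>2 - 4 * \<Phi>) / 2"
  have lower: "ennreal c \<le> (\<integral>\<^sup>+x. \<gamma> (x + h) * \<gamma> x \<partial>lborel)" if h: "norm h < \<delta>" for h
  proof -
    have gh: "(\<lambda>x. g (x + h)) \<in> elems L2" by (rule L2_shift[OF g])
    have dh: "(\<lambda>x. g (x + h) - g x) \<in> elems L2" by (rule L2_diff[OF gh g])
    have i1: "integrable lebesgue (\<lambda>x. cmod (g (x + h)) * cmod (g x))" by (rule L2_mult_integrable[OF gh g])
    have i2: "integrable lebesgue (\<lambda>x. cmod (g (x + h) - g x) * cmod (g x))" by (rule L2_mult_integrable[OF dh g])
    have "(nrm L2 g)\<^sup>2 \<le> (\<integral>x. cmod (g (x + h)) * cmod (g x) + cmod (g (x + h) - g x) * cmod (g x) \<partial>lebesgue)"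
      unfolding nrm_L2_sq
    proof (rule integral_mono)
      show "integrable lebesgue (\<lambda>x. (cmod (g x))\<^sup>2)" using g by (simp add: mem_L2_iff)
      fix x
      have "cmod (g x) \<le> cmod (g (x + h)) + cmod (g (x + h) - g x)"
        by (metis norm_minus_commute norm_triangle_sub)
      then have "cmod (g x) * cmod (g x) \<le> (cmod (g (x + h)) + cmod (g (x + h) - g x)) * cmod (g x)"
        by (intro mult_right_mono) auto
      then show "(cmod (g x))\<^sup>2 \<le> cmod (g (x + h)) * cmod (g x) + cmod (g (x + h) - g x) * cmod (g x)"
        by (simp add: power2_eq_square distrib_right)
    qed (use i1 i2 in simp)
    also have "\<dots> = (\<integral>x. cmod (g (x + h)) * cmod (g x) \<partial>lebesgue) + (\<integral>x. cmod (g (x + h) - g x) * cmod (g x) \<partial>lebesgue)"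
      by (rule Bochner_Integration.integral_add[OF i1 i2])
    also have "(\<integral>x. cmod (g (x + h) - g x) * cmod (g x) \<partial>lebesgue) \<le> \<eta> * nrm L2 g"
      using L2_Cauchy_Schwarz[OF dh g] mult_right_mono[OF eq[OF h] nrm_L2_nonneg[of g]] by linarith
    finally have "(nrm L2 g)\<^sup>2 \<le> (\<integral>x. cmod (g (x + h)) * cmod (g x) \<partial>lebesgue) + \<eta> * nrm L2 g" by simp
    moreover have "2 * (\<eta> * nrm L2 g) \<le> \<eta>\<^sup>2 + (nrm L2 g)\<^sup>2"
      using zero_le_power2[of "\<eta> - nrm L2 g"] by (simp add: power2_diff)
    ultimately have P: "c + 2 * \<Phi> \<le> (\<integral>x. cmod (g (x + h)) * cmod (g x) \<partial>lebesgue)"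
      unfolding c_def by (simp add: field_simps)
    have t2: "integrable lebesgue (\<lambda>x. trunc_sq (cmod (g (x + h))))" "(\<integral>x. trunc_sq (cmod (g (x + h))) \<partial>lebesgue) = \<Phi>"
      using trunc_sq_integrable[OF gh] integral_lebesgue_shift[OF borel_measurable_integrable[OF trunc_sq_integrable[OF g]], of h]
      by (auto simp: \<Phi>_def trunc_energy_def)
    have "c \<le> (\<integral>x. cmod (g (x + h)) * cmod (g x) - trunc_sq (cmod (g (x + h))) - trunc_sq (cmod (g x)) \<partial>lebesgue)"
      using P i1 t2 trunc_sq_integrable[OF g] by (simp add: \<Phi>_def trunc_energy_def)
    then have "ennreal c \<le> ennreal (\<integral>x. cmod (g (x + h)) * cmod (g x) - trunc_sq (cmod (g (x + h))) - trunc_sq (cmod (g x)) \<partial>lebesgue)"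
      by (rule ennreal_leI)
    also have "\<dots> \<le> (\<integral>\<^sup>+x. ennreal (cmod (g (x + h)) * cmod (g x) - trunc_sq (cmod (g (x + h))) - trunc_sq (cmod (g x))) \<partial>lebesgue)"
    proof -
      let ?f = "\<lambda>x. cmod (g (x + h)) * cmod (g x) - trunc_sq (cmod (g (x + h))) - trunc_sq (cmod (g x))"
      have fi: "integrable lebesgue ?f" using i1 t2(1) trunc_sq_integrable[OF g] by simp
      have "(\<integral>x. ?f x \<partial>lebesgue) \<le> (\<integral>x. max 0 (?f x) \<partial>lebesgue)"
        using fi by (intro integral_mono integrable_max) auto
      then have "ennreal (\<integral>x. ?f x \<partial>lebesgue) \<le> ennreal (\<integral>x. max 0 (?f x) \<partial>lebesgue)" by (rule ennreal_leI)
      also have "\<dots> = (\<integral>\<^sup>+x. ennreal (max 0 (?f x)) \<partial>lebesgue)"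
        using fi by (intro nn_integral_eq_integral[symmetric] integrable_max) auto
      also have "\<dots> = (\<integral>\<^sup>+x. ennreal (?f x) \<partial>lebesgue)"
        by (rule nn_integral_cong) (simp add: max_def ennreal_neg)
      finally show ?thesis .
    qed
    also have "\<dots> \<le> (\<integral>\<^sup>+x. \<gamma> (x + h) * \<gamma> x \<partial>lebesgue)"
    proof (rule nn_integral_mono_AE)
      show "AE x in lebesgue. ennreal (cmod (g (x + h)) * cmod (g x) - trunc_sq (cmod (g (x + h))) - trunc_sq (cmod (g x))) \<le> \<gamma> (x + h) * \<gamma> x"
        using g'(2) AE_lebesgue_shift[OF g'(2), of h]
      proof eventually_elim
        case (elim x)
        have "\<gamma> (x + h) * \<gamma> x = ennreal (trunc_sq (cmod (g (x + h))) * trunc_sq (cmod (g x)))"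
          using elim by (simp add: \<gamma>_def ennreal_mult[symmetric] trunc_sq_nonneg)
        then show ?case
          using mult_le_trunc_sq[of "cmod (g (x + h))" "cmod (g x)"] by (simp only:) (rule ennreal_leI, simp)
      qed
    qed
    finally show ?thesis by (simp add: nn_integral_completion)
  qed
  have "ennreal c * ennreal b = (\<integral>\<^sup>+h. ennreal c * indicator (ball (0::'a) \<delta>) h \<partial>lborel)"
  proof -
    have "emeasure lborel (ball (0::'a) \<delta>) = ennreal b"
      unfolding b_def using emeasure_lborel_ball_finite[of 0 \<delta>] by (subst emeasure_eq_ennreal_measure) (auto simp: less_top)
    then show ?thesis by (subst nn_integral_cmult_indicator) auto
  qed
  \<comment> \<open>The lower bound holds on the ball; on the right \<open>h\<close> may range over
    the whole space because the integrand is nonnegative.\<close>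
  also have "\<dots> \<le> (\<integral>\<^sup>+h. (\<integral>\<^sup>+x. \<gamma> (x + h) * \<gamma> x \<partial>lborel) \<partial>lborel)"
    by (rule nn_integral_mono) (use lower in \<open>auto simp: indicator_def\<close>)
  also have "\<dots> = (\<integral>\<^sup>+x. (\<integral>\<^sup>+h. \<gamma> (x + h) * \<gamma> x \<partial>lborel) \<partial>lborel)"
    by (rule lborel_pair.Fubini') measurable
  also have "\<dots> = (\<integral>\<^sup>+x. ennreal \<Phi> * \<gamma> x \<partial>lborel)"
  proof (rule nn_integral_cong)
    fix x
    have "(\<integral>\<^sup>+h. \<gamma> (x + h) * \<gamma> x \<partial>lborel) = (\<integral>\<^sup>+h. \<gamma> (x + h) \<partial>lborel) * \<gamma> x"
      by (rule nn_integral_multc) measurable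
    also have "(\<integral>\<^sup>+h. \<gamma> (x + h) \<partial>lborel) = (\<integral>\<^sup>+h. \<gamma> h \<partial>lborel)"
      using nn_integral_lebesgue_shift[of \<gamma> x] by (simp add: nn_integral_completion measurable_completion add.commute)
    finally show "(\<integral>\<^sup>+h. \<gamma> (x + h) * \<gamma> x \<partial>lborel) = ennreal \<Phi> * \<gamma> x" by (simp add: \<Phi>)
  qed
  also have "\<dots> = ennreal \<Phi> * ennreal \<Phi>" by (subst nn_integral_cmult) (auto simp: \<Phi>)
  finally have fin: "ennreal c * ennreal b \<le> ennreal \<Phi> * ennreal \<Phi>" .
  \<comment> \<open>Conversion to \<open>ennreal\<close> replaces a negative \<open>c\<close> by 0,
    so that case is settled separately; it is trivial.\<close>
  have "c * b \<le> \<Phi>\<^sup>2"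
  proof (cases "0 \<le> c")
    case True
    then have "ennreal (c * b) \<le> ennreal (\<Phi> * \<Phi>)" using fin b \<Phi>0 by (simp add: ennreal_mult)
    then show ?thesis using \<Phi>0 by (simp add: power2_eq_square)
  next
    case False
    then have "c * b \<le> 0" using b by (intro mult_nonpos_nonneg) auto
    then show ?thesis using zero_le_power2[of \<Phi>] by linarith
  qed
  then have "c \<le> \<Phi>\<^sup>2 / b" using b by (simp add: field_simps)
  then have "(nrm L2 g)\<^sup>2 \<le> \<eta>\<^sup>2 + 4 * \<Phi> + 2 * (\<Phi>\<^sup>2 / b)" unfolding c_def by (simp add: field_simps)
  then show ?thesis unfolding \<Phi>_def b_def by simp
qed

subsection \<open>Weak solutions\<close>

text \<open>Each estimate is proved for the approximating solutions, which are mild, and involves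
  only quantities that are continuous under convergence of the data in L^1 in time and of the
  solutions uniformly in time. This is why the dissipation is stated with
  \<open>trunc_energy\<close>.\<close>

lemma weak_solution_estimates:
  fixes f u :: "real \<Rightarrow> 'a::euclidean_space \<Rightarrow> complex"
  assumes m: "0 < m" "m < 1" and a: "2 * sqrt m * Im a \<ge> (1 - m) * \<bar>Re a\<bar>"
    and W: "weak_solution a m f u0 u" and fl: "f \<in> bochner_Lp_loc 1 L2" and st: "0 < s" "s \<le> t"
  shows weak_solution_growth: "nrm L2 (u t) \<le> nrm L2 (u s) + 2 * (\<integral>\<tau>. nrm L2 (f \<tau>) \<partial>lebesgue_on {s..t})"
    and weak_solution_translate: "nrm L2 (\<lambda>x. u t (x + h) - u t x) \<le> nrm L2 (\<lambda>x. u s (x + h) - u s x)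
      + 2 * (\<integral>\<tau>. nrm L2 (\<lambda>x. f \<tau> (x + h) - f \<tau> x) \<partial>lebesgue_on {s..t})"
    and weak_solution_trunc_energy: "0 < Im a \<Longrightarrow> 2 * Im a * (\<integral>\<tau>. trunc_energy (u \<tau>) \<partial>lebesgue_on {s..t})
      \<le> 2 * (nrm L2 (u s) + 2 * (\<integral>\<tau>. nrm L2 (f \<tau>) \<partial>lebesgue_on {s..t}))\<^sup>2"
proof -
  let ?M = "lebesgue_on {s..t}"
  obtain fs us where fs: "\<And>n. fs n \<in> bochner_Lp_loc 1 L2" and usc: "\<And>n. us n \<in> cont_space L2"
    and H: "\<And>n. H2_solution a m (fs n) (us n 0) (us n)"
    and flim: "\<And>T. 0 < T \<Longrightarrow> (\<lambda>n. \<integral>\<tau>. nrm L2 (\<lambda>x. fs n \<tau> x - f \<tau> x) \<partial>lebesgue_on {0<..<T}) \<longlonglongrightarrow> 0"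
    and ulim: "\<And>T. 0 < T \<Longrightarrow> uniform_limit {0..T} (\<lambda>n t. nrm L2 (\<lambda>x. us n t x - u t x)) (\<lambda>t. 0) sequentially"
    using W unfolding weak_solution_def by blast
  have uc: "u \<in> cont_space L2" using W by (simp add: weak_solution_def)
  have mild: "mild_solution a m (fs n) (us n)" for n
    by (rule H2_solution_imp_mild[OF m H usc fs])
  have uL: "u \<tau> \<in> elems L2" and usL: "us n \<tau> \<in> elems L2" if "0 \<le> \<tau>" for n \<tau>
    by (rule cont_space_L2[OF uc that], rule cont_space_L2[OF usc that])
  define d where "d n = (\<integral>\<tau>. nrm L2 (\<lambda>x. fs n \<tau> x - f \<tau> x) \<partial>lebesgue_on {0<..<t + 1})" for n
  define c where "c n \<tau> = nrm L2 (\<lambda>x. us n \<tau> x - u \<tau> x)" for n \<tau>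
  have d: "d \<longlonglongrightarrow> 0" unfolding d_def using st by (intro flim) auto
  have cu: "uniform_limit {0..t} c (\<lambda>t. 0) sequentially" unfolding c_def[abs_def] using st by (intro ulim) auto
  have c: "(\<lambda>n. c n \<tau>) \<longlonglongrightarrow> 0" if "0 \<le> \<tau>" "\<tau> \<le> t" for \<tau>
    using tendsto_uniform_limitI[OF cu] that by auto
  have I: "{s..t} \<in> sets lebesgue" by simp
  have f1: "f \<in> bochner_Lp 1 {s..t} L2" by (rule bochner_L1_loc_interval[OF fl st(1)])
  have fs1: "fs n \<in> bochner_Lp 1 {s..t} L2" for n by (rule bochner_L1_loc_interval[OF fs st(1)])
  have df: "(\<lambda>\<tau> x. fs n \<tau> x - f \<tau> x) \<in> bochner_Lp 1 {s..t} L2" for n by (rule bochner_L1_diff[OF I fs1 f1])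
  have dle: "(\<integral>\<tau>. nrm L2 (\<lambda>x. fs n \<tau> x - f \<tau> x) \<partial>?M) \<le> d n" for n
  proof -
    have "fs n \<in> bochner_Lp 1 {0<..<t + 1} L2" "f \<in> bochner_Lp 1 {0<..<t + 1} L2"
      using fs[of n] fl st by (auto simp: bochner_Lp_loc_def)
    then have "(\<lambda>\<tau> x. fs n \<tau> x - f \<tau> x) \<in> bochner_Lp 1 {0<..<t + 1} L2" by (intro bochner_L1_diff) auto
    then have "integrable (lebesgue_on {0<..<t + 1}) (\<lambda>\<tau>. nrm L2 (\<lambda>x. fs n \<tau> x - f \<tau> x))" by (simp add: bochner_L1_iff)
    then show ?thesis
      unfolding d_def by (rule integral_mono_lebesgue_on_AE) (use st in auto)
  qed
  have ae: "AE \<tau> in ?M. f \<tau> \<in> elems L2 \<and> fs n \<tau> \<in> elems L2" for n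
    using f1 fs1[of n] strongly_measurable_AE by (auto simp: bochner_L1_iff)
  have K: "(\<integral>\<tau>. nrm L2 (fs n \<tau>) \<partial>?M) \<le> (\<integral>\<tau>. nrm L2 (f \<tau>) \<partial>?M) + d n" for n
  proof -
    have "(\<integral>\<tau>. nrm L2 (fs n \<tau>) \<partial>?M) \<le> (\<integral>\<tau>. nrm L2 (f \<tau>) + nrm L2 (\<lambda>x. fs n \<tau> x - f \<tau> x) \<partial>?M)"
    proof (rule integral_mono_AE)
      show "AE \<tau> in ?M. nrm L2 (fs n \<tau>) \<le> nrm L2 (f \<tau>) + nrm L2 (\<lambda>x. fs n \<tau> x - f \<tau> x)"
        using ae[of n]
      proof eventually_elim
        case (elim \<tau>)
        then show ?case using nrm_L2_abs_diff[of "fs n \<tau>" "f \<tau>"] by linarith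
      qed
    qed (use f1 fs1[of n] df[of n] in \<open>auto simp: bochner_L1_iff\<close>)
    also have "\<dots> = (\<integral>\<tau>. nrm L2 (f \<tau>) \<partial>?M) + (\<integral>\<tau>. nrm L2 (\<lambda>x. fs n \<tau> x - f \<tau> x) \<partial>?M)"
      using f1 df[of n] by (simp add: bochner_L1_iff)
    finally show ?thesis using dle[of n] by linarith
  qed
  have near: "\<bar>nrm L2 (us n \<tau>) - nrm L2 (u \<tau>)\<bar> \<le> c n \<tau>" if "0 \<le> \<tau>" for n \<tau>
    unfolding c_def by (rule nrm_L2_abs_diff[OF usL[OF that] uL[OF that]])
  show "nrm L2 (u t) \<le> nrm L2 (u s) + 2 * (\<integral>\<tau>. nrm L2 (f \<tau>) \<partial>?M)"
  proof (rule LIMSEQ_le_const)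
    have "(\<lambda>n. nrm L2 (u s) + c n s + 2 * ((\<integral>\<tau>. nrm L2 (f \<tau>) \<partial>?M) + d n) + c n t) \<longlonglongrightarrow>
        nrm L2 (u s) + 0 + 2 * ((\<integral>\<tau>. nrm L2 (f \<tau>) \<partial>?M) + 0) + 0"
      using st by (intro tendsto_intros c d) auto
    then show "(\<lambda>n. nrm L2 (u s) + c n s + 2 * ((\<integral>\<tau>. nrm L2 (f \<tau>) \<partial>?M) + d n) + c n t) \<longlonglongrightarrow>
        nrm L2 (u s) + 2 * (\<integral>\<tau>. nrm L2 (f \<tau>) \<partial>?M)" by simp
    have "nrm L2 (u t) \<le> nrm L2 (u s) + c n s + 2 * ((\<integral>\<tau>. nrm L2 (f \<tau>) \<partial>?M) + d n) + c n t" for n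
    proof -
      have "nrm L2 (us n t) \<le> nrm L2 (us n s) + 2 * (\<integral>\<tau>. nrm L2 (fs n \<tau>) \<partial>?M)"
        using mild_contraction[OF m a mild mild_solution_zero st, of n] by simp
      moreover have "nrm L2 (u t) \<le> nrm L2 (us n t) + c n t" "nrm L2 (us n s) \<le> nrm L2 (u s) + c n s"
        using near[of t n] near[of s n] st by auto
      ultimately show ?thesis using K[of n] unfolding distrib_left by linarith
    qed
    then show "\<exists>N. \<forall>n\<ge>N. nrm L2 (u t) \<le> nrm L2 (u s) + c n s + 2 * ((\<integral>\<tau>. nrm L2 (f \<tau>) \<partial>?M) + d n) + c n t" by blast
  qed
  \<comment> \<open>Subtracting a function from its translate at most doubles L^2 distances; hence
    the factors 2 in front of the errors \<open>c\<close> and \<open>d\<close> below.\<close>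
  have sh_near: "\<bar>nrm L2 (\<lambda>x. g (x + h) - g x) - nrm L2 (\<lambda>x. k (x + h) - k x)\<bar> \<le> 2 * nrm L2 (\<lambda>x. g x - k x)"
    if g: "g \<in> elems L2" and k: "k \<in> elems L2" for g k :: "'a \<Rightarrow> complex"
  proof -
    have gk: "(\<lambda>x. g x - k x) \<in> elems L2" by (rule L2_diff[OF g k])
    have "\<bar>nrm L2 (\<lambda>x. g (x + h) - g x) - nrm L2 (\<lambda>x. k (x + h) - k x)\<bar> \<le>
        nrm L2 (\<lambda>x. (g (x + h) - g x) - (k (x + h) - k x))"
      by (intro nrm_L2_abs_diff L2_diff L2_shift g k)
    also have "(\<lambda>x. (g (x + h) - g x) - (k (x + h) - k x)) = (\<lambda>x. (g (x + h) - k (x + h)) - (g x - k x))"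
      by (simp add: algebra_simps)
    also have "nrm L2 \<dots> \<le> nrm L2 (\<lambda>x. g (x + h) - k (x + h)) + nrm L2 (\<lambda>x. g x - k x)"
      by (rule nrm_L2_triangle_diff[OF L2_shift[OF gk] gk])
    also have "nrm L2 (\<lambda>x. g (x + h) - k (x + h)) = nrm L2 (\<lambda>x. g x - k x)" by (rule nrm_L2_shift[OF gk])
    finally show ?thesis by simp
  qed
  define S where "S = (\<integral>\<tau>. nrm L2 (\<lambda>x. f \<tau> (x + h) - f \<tau> x) \<partial>?M)"
  have SK: "(\<integral>\<tau>. nrm L2 (\<lambda>x. fs n \<tau> (x + h) - fs n \<tau> x) \<partial>?M) \<le> S + 2 * d n" for n
  proof -
    have b1: "(\<lambda>\<tau> x. f \<tau> (x + h) - f \<tau> x) \<in> bochner_Lp 1 {s..t} L2" "(\<lambda>\<tau> x. fs n \<tau> (x + h) - fs n \<tau> x) \<in> bochner_Lp 1 {s..t} L2"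
      by (rule bochner_L1_diff[OF I bochner_L1_shift[OF I f1] f1], rule bochner_L1_diff[OF I bochner_L1_shift[OF I fs1] fs1])
    have "(\<integral>\<tau>. nrm L2 (\<lambda>x. fs n \<tau> (x + h) - fs n \<tau> x) \<partial>?M) \<le>
        (\<integral>\<tau>. nrm L2 (\<lambda>x. f \<tau> (x + h) - f \<tau> x) + 2 * nrm L2 (\<lambda>x. fs n \<tau> x - f \<tau> x) \<partial>?M)"
    proof (rule integral_mono_AE)
      show "AE \<tau> in ?M. nrm L2 (\<lambda>x. fs n \<tau> (x + h) - fs n \<tau> x) \<le>
          nrm L2 (\<lambda>x. f \<tau> (x + h) - f \<tau> x) + 2 * nrm L2 (\<lambda>x. fs n \<tau> x - f \<tau> x)"
        using ae[of n]
      proof eventually_elim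
        case (elim \<tau>)
        then show ?case using sh_near[of "fs n \<tau>" "f \<tau>"] by linarith
      qed
    qed (use b1 df[of n] in \<open>auto simp: bochner_L1_iff\<close>)
    also have "\<dots> = S + 2 * (\<integral>\<tau>. nrm L2 (\<lambda>x. fs n \<tau> x - f \<tau> x) \<partial>?M)"
      unfolding S_def using b1 df[of n] by (simp add: bochner_L1_iff)
    finally show ?thesis using dle[of n] by linarith
  qed
  have "nrm L2 (\<lambda>x. u t (x + h) - u t x) \<le> nrm L2 (\<lambda>x. u s (x + h) - u s x) + 2 * S"
  proof (rule LIMSEQ_le_const)
    have "(\<lambda>n. nrm L2 (\<lambda>x. u s (x + h) - u s x) + 2 * c n s + 2 * (S + 2 * d n) + 2 * c n t) \<longlonglongrightarrow>
        nrm L2 (\<lambda>x. u s (x + h) - u s x) + 2 * 0 + 2 * (S + 2 * 0) + 2 * 0"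
      using st by (intro tendsto_intros c d) auto
    then show "(\<lambda>n. nrm L2 (\<lambda>x. u s (x + h) - u s x) + 2 * c n s + 2 * (S + 2 * d n) + 2 * c n t) \<longlonglongrightarrow>
        nrm L2 (\<lambda>x. u s (x + h) - u s x) + 2 * S" by simp
    have "nrm L2 (\<lambda>x. u t (x + h) - u t x) \<le> nrm L2 (\<lambda>x. u s (x + h) - u s x) + 2 * c n s + 2 * (S + 2 * d n) + 2 * c n t" for n
    proof -
      \<comment> \<open>The contraction is applied to the approximate solution and its own
        translate.\<close>
      have "nrm L2 (\<lambda>x. us n t (x + h) - us n t x) \<le> nrm L2 (\<lambda>x. us n s (x + h) - us n s x) +
          2 * (\<integral>\<tau>. nrm L2 (\<lambda>x. fs n \<tau> (x + h) - fs n \<tau> x) \<partial>?M)"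
        by (rule mild_contraction[OF m a mild_solution_shift[OF m mild] mild st])
      moreover have "\<bar>nrm L2 (\<lambda>x. us n \<tau> (x + h) - us n \<tau> x) - nrm L2 (\<lambda>x. u \<tau> (x + h) - u \<tau> x)\<bar> \<le> 2 * c n \<tau>" if "0 \<le> \<tau>" for \<tau>
        unfolding c_def by (rule sh_near[OF usL[OF that] uL[OF that]])
      from this[of s] this[of t] st
      have "nrm L2 (\<lambda>x. u t (x + h) - u t x) \<le> nrm L2 (\<lambda>x. us n t (x + h) - us n t x) + 2 * c n t"
        "nrm L2 (\<lambda>x. us n s (x + h) - us n s x) \<le> nrm L2 (\<lambda>x. u s (x + h) - u s x) + 2 * c n s" by auto
      ultimately show ?thesis using SK[of n] unfolding distrib_left by linarith
    qed
    then show "\<exists>N. \<forall>n\<ge>N. nrm L2 (\<lambda>x. u t (x + h) - u t x) \<le>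
        nrm L2 (\<lambda>x. u s (x + h) - u s x) + 2 * c n s + 2 * (S + 2 * d n) + 2 * c n t" by blast
  qed
  then show "nrm L2 (\<lambda>x. u t (x + h) - u t x) \<le> nrm L2 (\<lambda>x. u s (x + h) - u s x)
      + 2 * (\<integral>\<tau>. nrm L2 (\<lambda>x. f \<tau> (x + h) - f \<tau> x) \<partial>?M)"
    unfolding S_def .
  assume a0: "0 < Im a"
  define B where "B = (\<integral>\<tau>. nrm L2 (f \<tau>) \<partial>?M)"
  have B0: "0 \<le> B" unfolding B_def by (intro integral_nonneg_AE) simp
  obtain Y where Y: "\<And>\<tau>. \<tau> \<in> {s..t} \<Longrightarrow> nrm L2 (u \<tau>) \<le> Y"
  proof -
    have "continuous_on {s..t} (\<lambda>\<tau>. nrm L2 (u \<tau>))" using cont_space_interval[OF uc] st by simp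
    then have "bounded ((\<lambda>\<tau>. nrm L2 (u \<tau>)) ` {s..t})" by (intro compact_imp_bounded compact_continuous_image) auto
    then obtain Y where "\<forall>y\<in>(\<lambda>\<tau>. nrm L2 (u \<tau>)) ` {s..t}. norm y \<le> Y" unfolding bounded_iff by blast
    then show ?thesis by (intro that[of Y]) auto
  qed
  have "(\<lambda>n. \<integral>\<tau>. trunc_energy (us n \<tau>) \<partial>?M) \<longlonglongrightarrow> (\<integral>\<tau>. trunc_energy (u \<tau>) \<partial>?M)"
  proof -
    have "\<forall>\<^sub>F n in sequentially. \<forall>\<tau>\<in>{0..t}. dist (c n \<tau>) 0 < 1"
      using cu by (rule uniform_limitD) simp
    then obtain n0 where "\<forall>n\<ge>n0. \<forall>\<tau>\<in>{0..t}. dist (c n \<tau>) 0 < 1"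
      unfolding eventually_sequentially by blast
    then have n0: "\<bar>c n \<tau>\<bar> < 1" if "n0 \<le> n" "\<tau> \<in> {0..t}" for n \<tau>
      using that by (auto simp: dist_real_def)
    \<comment> \<open>From index \<open>n0\<close> on, all approximations are within 1 of
      \<open>u\<close> on the interval, so \<open>(Y + 1)\<^sup>2\<close> dominates.\<close>
    have "(\<lambda>n. \<integral>\<tau>. trunc_energy (us (n + n0) \<tau>) \<partial>?M) \<longlonglongrightarrow> (\<integral>\<tau>. trunc_energy (u \<tau>) \<partial>?M)"
    proof (rule integral_dominated_convergence)
      show "(\<lambda>\<tau>. trunc_energy (u \<tau>)) \<in> borel_measurable ?M" "(\<lambda>\<tau>. trunc_energy (us (n + n0) \<tau>)) \<in> borel_measurable ?M" for n
        using continuous_interval_measurable(2)[OF cont_space_trunc_energy[OF uc]]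
          continuous_interval_measurable(2)[OF cont_space_trunc_energy[OF usc]] st by auto
      show "integrable ?M (\<lambda>\<tau>. (Y + 1)\<^sup>2)" by (rule continuous_imp_integrable_real) simp
      show "AE \<tau> in ?M. (\<lambda>n. trunc_energy (us (n + n0) \<tau>)) \<longlonglongrightarrow> trunc_energy (u \<tau>)"
      proof (rule AE_I2)
        fix \<tau> assume "\<tau> \<in> space ?M"
        then have \<tau>: "0 \<le> \<tau>" "\<tau> \<le> t" using st by auto
        have "(\<lambda>n. trunc_energy (us n \<tau>)) \<longlonglongrightarrow> trunc_energy (u \<tau>)"
          using c[OF \<tau>] usL[OF \<tau>(1)] unfolding c_def by (intro trunc_energy_tendsto uL \<tau>) auto
        then show "(\<lambda>n. trunc_energy (us (n + n0) \<tau>)) \<longlonglongrightarrow> trunc_energy (u \<tau>)" by (rule LIMSEQ_ignore_initial_segment)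
      qed
      show "AE \<tau> in ?M. norm (trunc_energy (us (n + n0) \<tau>)) \<le> (Y + 1)\<^sup>2" for n
      proof (rule AE_I2)
        fix \<tau> assume "\<tau> \<in> space ?M"
        then have \<tau>: "0 \<le> \<tau>" "\<tau> \<in> {0..t}" "\<tau> \<in> {s..t}" using st by auto
        have "nrm L2 (us (n + n0) \<tau>) \<le> Y + 1" using near[OF \<tau>(1), of "n + n0"] n0[OF _ \<tau>(2), of "n + n0"] Y[OF \<tau>(3)] by simp
        then have "(nrm L2 (us (n + n0) \<tau>))\<^sup>2 \<le> (Y + 1)\<^sup>2" by (intro power_mono) auto
        then show "norm (trunc_energy (us (n + n0) \<tau>)) \<le> (Y + 1)\<^sup>2"
          using trunc_energy_le_nrm[OF usL[OF \<tau>(1)], of "n + n0"] trunc_energy_nonneg[of "us (n + n0) \<tau>"] by simp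
      qed
    qed
    then show ?thesis by (rule LIMSEQ_offset)
  qed
  then have L: "(\<lambda>n. 2 * Im a * (\<integral>\<tau>. trunc_energy (us n \<tau>) \<partial>?M)) \<longlonglongrightarrow> 2 * Im a * (\<integral>\<tau>. trunc_energy (u \<tau>) \<partial>?M)"
    by (intro tendsto_intros)
  have "(\<lambda>n. 2 * (nrm L2 (u s) + c n s + 2 * (B + d n))\<^sup>2) \<longlonglongrightarrow> 2 * (nrm L2 (u s) + 0 + 2 * (B + 0))\<^sup>2"
    using st by (intro tendsto_intros c d) auto
  then have R: "(\<lambda>n. 2 * (nrm L2 (u s) + c n s + 2 * (B + d n))\<^sup>2) \<longlonglongrightarrow> 2 * (nrm L2 (u s) + 2 * B)\<^sup>2" by simp
  have "2 * Im a * (\<integral>\<tau>. trunc_energy (us n \<tau>) \<partial>?M) \<le> 2 * (nrm L2 (u s) + c n s + 2 * (B + d n))\<^sup>2" for n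
  proof -
    have "2 * Im a * (\<integral>\<tau>. trunc_energy (us n \<tau>) \<partial>?M) \<le> 2 * (nrm L2 (us n s) + 2 * (\<integral>\<tau>. nrm L2 (fs n \<tau>) \<partial>?M))\<^sup>2"
      by (rule mild_trunc_energy[OF m a a0 mild st])
    also have "\<dots> \<le> 2 * (nrm L2 (u s) + c n s + 2 * (B + d n))\<^sup>2"
    proof (intro mult_left_mono power_mono)
      show "nrm L2 (us n s) + 2 * (\<integral>\<tau>. nrm L2 (fs n \<tau>) \<partial>?M) \<le> nrm L2 (u s) + c n s + 2 * (B + d n)"
        using near[of s n] K[of n] st unfolding B_def distrib_left by auto
      show "0 \<le> nrm L2 (us n s) + 2 * (\<integral>\<tau>. nrm L2 (fs n \<tau>) \<partial>?M)"
        by (intro add_nonneg_nonneg mult_nonneg_nonneg integral_nonneg_AE) auto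
    qed simp
    finally show ?thesis .
  qed
  then show "2 * Im a * (\<integral>\<tau>. trunc_energy (u \<tau>) \<partial>?M) \<le> 2 * (nrm L2 (u s) + 2 * (\<integral>\<tau>. nrm L2 (f \<tau>) \<partial>?M))\<^sup>2"
    unfolding B_def[symmetric] using LIMSEQ_le[OF L R] by blast
qed

text \<open>At almost every time the translates converge in L^2, and
  \<open>2 * nrm L2 (f \<tau>)\<close> dominates. Dominated convergence speaks of sequences, so a
  failure is first turned into a sequence of shifts tending to 0.\<close>

lemma L1_time_translation:
  fixes f :: "real \<Rightarrow> 'a::euclidean_space \<Rightarrow> complex"
  assumes S: "S \<in> sets lebesgue" and f: "f \<in> bochner_Lp 1 S L2" and e: "0 < e"
  shows "\<exists>\<delta>>0. \<forall>h. norm h < \<delta> \<longrightarrow> (\<integral>\<tau>. nrm L2 (\<lambda>x. f \<tau> (x + h) - f \<tau> x) \<partial>lebesgue_on S) < e"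
proof (rule ccontr)
  assume N: "\<not> ?thesis"
  have neg: "\<exists>h. norm h < \<delta> \<and> e \<le> (\<integral>\<tau>. nrm L2 (\<lambda>x. f \<tau> (x + h) - f \<tau> x) \<partial>lebesgue_on S)" if "0 < \<delta>" for \<delta>
  proof (rule ccontr)
    assume "\<not> ?thesis"
    then have "\<forall>h. norm h < \<delta> \<longrightarrow> (\<integral>\<tau>. nrm L2 (\<lambda>x. f \<tau> (x + h) - f \<tau> x) \<partial>lebesgue_on S) < e"
      by (auto simp: not_le)
    then show False using N that by blast
  qed
  have "\<forall>n. \<exists>h. norm h < 1 / real (Suc n) \<and> e \<le> (\<integral>\<tau>. nrm L2 (\<lambda>x. f \<tau> (x + h) - f \<tau> x) \<partial>lebesgue_on S)"
    by (intro allI neg) simp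
  from choice[OF this] obtain h where "\<forall>n. norm (h n) < 1 / real (Suc n) \<and>
      e \<le> (\<integral>\<tau>. nrm L2 (\<lambda>x. f \<tau> (x + h n) - f \<tau> x) \<partial>lebesgue_on S)" by blast
  then have h: "norm (h n) < 1 / real (Suc n)" and he: "e \<le> (\<integral>\<tau>. nrm L2 (\<lambda>x. f \<tau> (x + h n) - f \<tau> x) \<partial>lebesgue_on S)" for n
    by blast+
  have hlim: "h \<longlonglongrightarrow> 0"
  proof (rule Lim_null_comparison)
    show "\<forall>\<^sub>F n in sequentially. norm (h n) \<le> 1 / real (Suc n)" using h by (intro always_eventually allI less_imp_le)
    show "(\<lambda>n. 1 / real (Suc n)) \<longlonglongrightarrow> 0" using LIMSEQ_inverse_real_of_nat by (simp add: inverse_eq_divide)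
  qed
  have fae: "AE \<tau> in lebesgue_on S. f \<tau> \<in> elems L2"
    using f by (intro strongly_measurable_AE) (simp add: bochner_L1_iff)
  have "(\<lambda>n. \<integral>\<tau>. nrm L2 (\<lambda>x. f \<tau> (x + h n) - f \<tau> x) \<partial>lebesgue_on S) \<longlonglongrightarrow> (\<integral>\<tau>. 0 \<partial>lebesgue_on S)"
  proof (rule integral_dominated_convergence)
    show "integrable (lebesgue_on S) (\<lambda>\<tau>. 2 * nrm L2 (f \<tau>))" using f by (simp add: bochner_L1_iff)
    show "(\<lambda>\<tau>. nrm L2 (\<lambda>x. f \<tau> (x + h n) - f \<tau> x)) \<in> borel_measurable (lebesgue_on S)" for n
      using bochner_L1_diff[OF S bochner_L1_shift[OF S f] f] by (auto simp: bochner_L1_iff)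
    show "AE \<tau> in lebesgue_on S. (\<lambda>n. nrm L2 (\<lambda>x. f \<tau> (x + h n) - f \<tau> x)) \<longlonglongrightarrow> 0"
      using fae
    proof eventually_elim
      case (elim \<tau>)
      from filterlim_compose[OF L2_translation[OF elim] hlim] show ?case .
    qed
    show "AE \<tau> in lebesgue_on S. norm (nrm L2 (\<lambda>x. f \<tau> (x + h n) - f \<tau> x)) \<le> 2 * nrm L2 (f \<tau>)" for n
      using fae
    proof eventually_elim
      case (elim \<tau>)
      then show ?case using nrm_L2_triangle_diff[OF L2_shift[OF elim, of "h n"] elim] nrm_L2_shift[OF elim, of "h n"] by simp
    qed
  qed simp
  then have "(\<lambda>n. \<integral>\<tau>. nrm L2 (\<lambda>x. f \<tau> (x + h n) - f \<tau> x) \<partial>lebesgue_on S) \<longlonglongrightarrow> 0" by simp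
  then have "e \<le> 0" using he by (intro LIMSEQ_le_const) auto
  then show False using e by simp
qed

lemma integral_tail_small:
  fixes \<kappa> :: "real \<Rightarrow> real"
  assumes \<kappa>: "integrable (lebesgue_on {0<..}) \<kappa>" "\<And>\<tau>. 0 \<le> \<kappa> \<tau>" and e: "0 < e"
  shows "\<exists>T>0. \<forall>s\<ge>T. \<forall>t. (\<integral>\<tau>. \<kappa> \<tau> \<partial>lebesgue_on {s..t}) < e"
proof -
  have ki: "integrable lebesgue (\<lambda>\<tau>. indicator {0<..} \<tau> * \<kappa> \<tau>)"
    using \<kappa>(1) by (simp add: integrable_restrict_space)
  \<comment> \<open>The successor makes the time found at the end positive.\<close>
  have "(\<lambda>n. \<integral>\<tau>. indicator {real (Suc n)..} \<tau> * (indicator {0<..} \<tau> * \<kappa> \<tau>) \<partial>lebesgue) \<longlonglongrightarrow> (\<integral>\<tau>. 0 \<partial>(lebesgue :: real measure))"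
  proof (rule integral_dominated_convergence[OF _ _ ki])
    show "(\<lambda>\<tau>. indicator {real (Suc n)..} \<tau> * (indicator {0<..} \<tau> * \<kappa> \<tau>)) \<in> borel_measurable lebesgue" for n
      by (rule borel_measurable_times[OF borel_measurable_indicator borel_measurable_integrable[OF ki]]) simp
    show "AE \<tau> in lebesgue. (\<lambda>n. indicator {real (Suc n)..} \<tau> * (indicator {0<..} \<tau> * \<kappa> \<tau>)) \<longlonglongrightarrow> 0"
    proof (rule AE_I2)
      fix \<tau> :: real
      obtain n0 :: nat where n0: "\<tau> < real n0" using reals_Archimedean2 by blast
      have "\<forall>\<^sub>F n in sequentially. indicator {real (Suc n)..} \<tau> * (indicator {0<..} \<tau> * \<kappa> \<tau>) = 0"
        using eventually_ge_at_top[of n0] by eventually_elim (use n0 in \<open>auto simp: indicator_def\<close>)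
      then show "(\<lambda>n. indicator {real (Suc n)..} \<tau> * (indicator {0<..} \<tau> * \<kappa> \<tau>)) \<longlonglongrightarrow> 0" by (rule tendsto_eventually)
    qed
    show "AE \<tau> in lebesgue. norm (indicator {real (Suc n)..} \<tau> * (indicator {0<..} \<tau> * \<kappa> \<tau>)) \<le> indicator {0<..} \<tau> * \<kappa> \<tau>" for n
      by (rule AE_I2) (use \<kappa>(2) in \<open>auto simp: indicator_def\<close>)
  qed simp
  then have "(\<lambda>n. \<integral>\<tau>. indicator {real (Suc n)..} \<tau> * (indicator {0<..} \<tau> * \<kappa> \<tau>) \<partial>lebesgue) \<longlonglongrightarrow> 0" by simp
  from order_tendstoD(2)[OF this e]
  obtain n where n: "(\<integral>\<tau>. indicator {real (Suc n)..} \<tau> * (indicator {0<..} \<tau> * \<kappa> \<tau>) \<partial>lebesgue) < e"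
    unfolding eventually_sequentially by blast
  have "(\<integral>\<tau>. \<kappa> \<tau> \<partial>lebesgue_on {s..t}) < e" if s: "real (Suc n) \<le> s" for s t
  proof -
    have "(\<integral>\<tau>. \<kappa> \<tau> \<partial>lebesgue_on {s..t}) = (\<integral>\<tau>. indicator {s..t} \<tau> * \<kappa> \<tau> \<partial>lebesgue)"
      by (simp add: integral_restrict_space)
    also have "\<dots> \<le> (\<integral>\<tau>. indicator {real (Suc n)..} \<tau> * (indicator {0<..} \<tau> * \<kappa> \<tau>) \<partial>lebesgue)"
    proof (rule integral_mono')
      show "integrable lebesgue (\<lambda>\<tau>. indicator {real (Suc n)..} \<tau> * (indicator {0<..} \<tau> * \<kappa> \<tau>))"
        using integrable_mult_indicator[OF _ ki, of "{real (Suc n)..}"] by simp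
    qed (use s \<kappa>(2) in \<open>auto simp: indicator_def\<close>)
    finally show ?thesis using n by linarith
  qed
  then show ?thesis by (intro exI[of _ "real (Suc n)"]) auto
qed

text \<open>A nonnegative function with bounded integral cannot stay above a positive constant
  forever; this yields late times of small truncated energy. Equicontinuity, uniform in time,
  converts such a time into one of small L^2 norm, and the tail of \<open>f\<close> controls
  everything afterwards.\<close>

lemma weak_solution_decay:
  fixes f u :: "real \<Rightarrow> 'a::euclidean_space \<Rightarrow> complex"
  assumes m: "0 < m" "m < 1" and a: "2 * sqrt m * Im a \<ge> (1 - m) * \<bar>Re a\<bar>" "0 < Im a"
    and W: "weak_solution a m f u0 u" and fl: "f \<in> bochner_Lp_loc 1 L2" and f: "f \<in> bochner_Lp 1 {0<..} L2"
  shows "((\<lambda>t. nrm L2 (u t)) \<longlongrightarrow> 0) at_top"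
  unfolding tendsto_iff
proof (intro allI impI)
  fix e :: real assume e: "0 < e"
  have uc: "u \<in> cont_space L2" using W by (simp add: weak_solution_def)
  have fi: "integrable (lebesgue_on {0<..}) (\<lambda>\<tau>. nrm L2 (f \<tau>))" using f by (simp add: bochner_L1_iff)
  have P: "{0<..} \<in> sets (lebesgue :: real measure)" by simp
  \<comment> \<open>The norm will be at most \<open>2 * \<eta>\<close> at a suitable time and grow
    by less than \<open>2 * \<eta>\<close> later, in total less than e/2.\<close>
  define \<eta> where "\<eta> = e / 8"
  have \<eta>: "0 < \<eta>" using e by (simp add: \<eta>_def)
  have u1: "u 1 \<in> elems L2" by (rule cont_space_L2[OF uc]) simp
  have "\<forall>\<^sub>F h in nhds 0. nrm L2 (\<lambda>x. u 1 (x + h) - u 1 x) < \<eta> / 2"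
    using \<eta> by (intro order_tendstoD(2)[OF L2_translation[OF u1]]) simp
  then obtain \<delta>1 where \<delta>1: "\<delta>1 > 0" "\<And>h. norm h < \<delta>1 \<Longrightarrow> nrm L2 (\<lambda>x. u 1 (x + h) - u 1 x) < \<eta> / 2"
    unfolding eventually_nhds_metric by (auto simp: dist_norm)
  \<comment> \<open>With the factor 2 of \<open>weak_solution_translate\<close> this adds another
    half of \<open>\<eta>\<close>. The integral over the whole half-line makes
    \<open>\<delta>2\<close> independent of \<open>t\<close>.\<close>
  obtain \<delta>2 where \<delta>2: "\<delta>2 > 0" "\<And>h. norm h < \<delta>2 \<Longrightarrow> (\<integral>\<tau>. nrm L2 (\<lambda>x. f \<tau> (x + h) - f \<tau> x) \<partial>lebesgue_on {0<..}) < \<eta> / 4"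
    using L1_time_translation[OF P f, of "\<eta> / 4"] \<eta> by auto
  define \<delta> where "\<delta> = min \<delta>1 \<delta>2"
  have \<delta>: "0 < \<delta>" using \<delta>1 \<delta>2 by (simp add: \<delta>_def)
  have equi: "nrm L2 (\<lambda>x. u t (x + h) - u t x) \<le> \<eta>" if h: "norm h < \<delta>" and t: "1 \<le> t" for h t
  proof -
    have "(\<integral>\<tau>. nrm L2 (\<lambda>x. f \<tau> (x + h) - f \<tau> x) \<partial>lebesgue_on {1..t}) \<le> (\<integral>\<tau>. nrm L2 (\<lambda>x. f \<tau> (x + h) - f \<tau> x) \<partial>lebesgue_on {0<..})"
      using bochner_L1_diff[OF P bochner_L1_shift[OF P f] f, of h]
      by (intro integral_mono_lebesgue_on_AE) (auto simp: bochner_L1_iff)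
    then show ?thesis
      using weak_solution_translate[OF m a(1) W fl zero_less_one t, of h] \<delta>1(2)[of h] \<delta>2(2)[of h] h by (simp add: \<delta>_def)
  qed
  define b where "b = measure lebesgue (ball (0::'a) \<delta>)"
  have b: "0 < b" unfolding b_def using \<delta> by (simp add: content_ball_pos)
  \<comment> \<open>Fixes the level \<open>p0\<close> below which the energy terms of
    \<open>nrm_L2_le_of_equicontinuous\<close> stay under \<open>\<eta>\<^sup>2\<close>; it depends
    on \<open>\<delta>\<close>, so equicontinuity had to come before.\<close>
  have "((\<lambda>p. 4 * p + 2 * p\<^sup>2 / b) \<longlongrightarrow> 4 * 0 + 2 * 0\<^sup>2 / b) (nhds (0::real))"
    by (intro tendsto_intros filterlim_ident) (use b in auto)
  then have "\<forall>\<^sub>F p in nhds (0::real). 4 * p + 2 * p\<^sup>2 / b < \<eta>\<^sup>2"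
    using \<eta> by (intro order_tendstoD(2)) auto
  then obtain p0 where p0: "p0 > 0" "\<And>p. \<bar>p\<bar> < p0 \<Longrightarrow> 4 * p + 2 * p\<^sup>2 / b < \<eta>\<^sup>2"
    unfolding eventually_nhds_metric by (auto simp: dist_real_def)
  obtain T where T: "T > 0" "\<And>s t. T \<le> s \<Longrightarrow> (\<integral>\<tau>. nrm L2 (f \<tau>) \<partial>lebesgue_on {s..t}) < \<eta>"
    using integral_tail_small[OF fi nrm_L2_nonneg \<eta>] by blast
  define K where "K = (\<integral>\<tau>. nrm L2 (f \<tau>) \<partial>lebesgue_on {0<..})"
  define C where "C = 2 * (nrm L2 (u 1) + 2 * K)\<^sup>2"
  have bound: "2 * Im a * (\<integral>\<tau>. trunc_energy (u \<tau>) \<partial>lebesgue_on {1..t}) \<le> C" if t: "1 \<le> t" for t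
  proof -
    have "(\<integral>\<tau>. nrm L2 (f \<tau>) \<partial>lebesgue_on {1..t}) \<le> K"
      unfolding K_def by (rule integral_mono_lebesgue_on_AE[OF fi]) auto
    then have "2 * (nrm L2 (u 1) + 2 * (\<integral>\<tau>. nrm L2 (f \<tau>) \<partial>lebesgue_on {1..t}))\<^sup>2 \<le> C"
      unfolding C_def by (intro mult_left_mono power_mono) (auto intro!: add_nonneg_nonneg integral_nonneg_AE)
    then show ?thesis using weak_solution_trunc_energy[OF m a(1) W fl zero_less_one t a(2)] by linarith
  qed
  define S where "S = max 1 T"
  have "\<exists>s\<ge>S. trunc_energy (u s) < p0"
  proof (rule ccontr)
    assume "\<not> ?thesis"
    then have ge: "p0 \<le> trunc_energy (u s)" if "S \<le> s" for s using that by (auto simp: not_less)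
    \<comment> \<open>Energy at least \<open>p0\<close> on \<open>{S..t}\<close> would give a total
      dissipation of at least \<open>C + 1\<close>, beyond the bound \<open>C\<close>.\<close>
    define t where "t = S + (C + 1) / (2 * Im a * p0)"
    have C0: "0 \<le> C" by (simp add: C_def)
    have t: "S \<le> t" using C0 a(2) p0(1) by (simp add: t_def)
    have "(\<integral>\<tau>. p0 \<partial>lebesgue_on {S..t}) \<le> (\<integral>\<tau>. trunc_energy (u \<tau>) \<partial>lebesgue_on {1..t})"
    proof (rule integral_mono_lebesgue_on_AE)
      show "integrable (lebesgue_on {1..t}) (\<lambda>\<tau>. trunc_energy (u \<tau>))"
        by (rule continuous_interval_measurable(1)[OF cont_space_trunc_energy[OF uc]]) simp
      show "AE \<tau> in lebesgue_on {S..t}. p0 \<le> trunc_energy (u \<tau>)" by (rule AE_I2) (use ge in auto)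
    qed (auto simp: S_def trunc_energy_nonneg)
    also have "(\<integral>\<tau>. p0 \<partial>lebesgue_on {S..t}) = p0 * (t - S)"
      using t by (simp add: measure_restrict_space mult.commute)
    finally have "2 * Im a * (p0 * (t - S)) \<le> 2 * Im a * (\<integral>\<tau>. trunc_energy (u \<tau>) \<partial>lebesgue_on {1..t})"
      using a(2) by (intro mult_left_mono) auto
    also have "\<dots> \<le> C" using t by (intro bound) (simp add: S_def)
    also have "2 * Im a * (p0 * (t - S)) = C + 1" using a(2) p0(1) by (simp add: t_def)
    finally show False by simp
  qed
  then obtain s where s: "1 \<le> s" "T \<le> s" "trunc_energy (u s) < p0" by (auto simp: S_def)
  have us: "u s \<in> elems L2" using s by (intro cont_space_L2[OF uc]) auto
  have "(nrm L2 (u s))\<^sup>2 \<le> \<eta>\<^sup>2 + 4 * trunc_energy (u s) + 2 * (trunc_energy (u s))\<^sup>2 / b"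
    unfolding b_def by (rule nrm_L2_le_of_equicontinuous[OF us \<delta> equi[OF _ s(1)]])
  also have "\<dots> \<le> \<eta>\<^sup>2 + \<eta>\<^sup>2" using p0(2)[of "trunc_energy (u s)"] s(3) trunc_energy_nonneg[of "u s"] by simp
  also have "\<dots> \<le> (2 * \<eta>)\<^sup>2" by (simp add: power2_eq_square)
  finally have small: "nrm L2 (u s) \<le> 2 * \<eta>" by (rule power2_le_imp_le) (use \<eta> in simp)
  have "nrm L2 (u t) < e" if t: "s \<le> t" for t
  proof -
    have "nrm L2 (u t) \<le> nrm L2 (u s) + 2 * (\<integral>\<tau>. nrm L2 (f \<tau>) \<partial>lebesgue_on {s..t})"
      using s by (intro weak_solution_growth[OF m a(1) W fl _ t]) auto
    then show ?thesis using small T(2)[OF s(2), of t] e unfolding \<eta>_def by linarith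
  qed
  then show "\<forall>\<^sub>F t in at_top. dist (nrm L2 (u t)) 0 < e"
    unfolding eventually_at_top_linorder by (intro exI[of _ s]) simp
qed

theorem theorem3p5:
  fixes a :: complex and m :: real
    and f u :: "real \<Rightarrow> real ^ 'n \<Rightarrow> complex" and u0 :: "real ^ 'n \<Rightarrow> complex"
  assumes "0 < m" and "m < 1"
    and "2 * sqrt m * Im a \<ge> (1 - m) * \<bar>Re a\<bar>"
    and "Re a \<ge> 0 \<longrightarrow> 2 * sqrt m * Im a > (1 - m) * Re a"
    and "f \<in> bochner_Lp_loc 1 L2"
    and "u0 \<in> elems L2"
    and "weak_solution a m f u0 u"
    and "f \<in> bochner_Lp 1 {0<..} L2"
  shows "((\<lambda>t. nrm L2 (u t)) \<longlongrightarrow> 0) at_top"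
proof -
  \<comment> \<open>For \<open>Re a \<ge> 0\<close> the strict inequality gives this; for
    \<open>Re a < 0\<close> the other one suffices, its right side being positive because
    \<open>m < 1\<close>.\<close>
  have "0 < 2 * sqrt m * Im a"
  proof (cases "0 \<le> Re a")
    case True
    then have "0 \<le> (1 - m) * Re a" using assms(2) by simp
    then show ?thesis using assms(4) True by linarith
  next
    case False
    then have "0 < (1 - m) * \<bar>Re a\<bar>" using assms(2) by (intro mult_pos_pos) auto
    then show ?thesis using assms(3) by linarith
  qed
  then have "0 < Im a" using assms(1) by (simp add: zero_less_mult_iff)
  then show ?thesis by (rule weak_solution_decay[OF assms(1-3) _ assms(7,5,8)])
qed

end
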